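(* Let $n\ge 1$, let $S^n=\{x\in\mathbb{R}^n:\sum_{i=1}^nx_i<1,\ x_i>0\ \forall i=1,\dots,n\}$ be endowed with the Riemannian metric $g_{S^n}$ represented at $x$ by the matrix $G_{S^n}(x)$ with entries $(G_{S^n}(x))_{ij}=\frac{\delta_{ij}}{x_i}+\frac{1}{1-\sum_{k=1}^nx_k}$ (the Baran metric of the simplex), and let $\Delta$ be the Laplace Beltrami operator of $(S^n,g_{S^n})$ acting on $$\mathscr{C}^2_b(S^n)=\Big\{u\in\mathscr{C}^2(S^n):\max_{|\alpha|\le 2}\sup_{x\in S^n}|\partial^\alpha u(x)|<\infty\Big\},$$ regarded as an operator in $L^2(S^n,g_{S^n})$. Let $\mu_{S^n}=\frac{1}{\sqrt{(1-\sum_{i=1}^nx_i)\prod_{i=1}^nx_i}}\chi_{S^n}\,dx$ (the pluripotential equilibrium measure of the simplex, up to normalization) and let $\{\psi_\alpha\}_{\alpha\in\mathbb{N}^n}$ be the polynomials defined in the context. Then: (1) $\mu_{S^n}$ is the Riemannian volume measure of $(S^n,g_{S^n})$, and the $\psi_\alpha$ are orthonormal polynomials with respect to $\mu_{S^n}$. (2) The operator $-\Delta$ with domain $\mathscr{C}^2_b(S^n)$ is symmetric and unbounded; its set of eigenvalues is $$\sigma=\Big\{\lambda_s:=s\Big(s+\frac{n-1}{2}\Big):s\in\mathbb{N}\Big\},$$ and the eigenspace of $\lambda_s$ is $\operatorname{span}\{\psi_\alpha:|\alpha|=s\}$. (3) The closure of $-\Delta$ (still denoted $-\Delta$) is a self-adjoint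 operator in $L^2(S^n,g_{S^n})$ whose spectrum is the same set $\sigma$, with domain $$\mathcal{D}(\Delta)=\Big\{u\in L^2(S^n,g_{S^n}):\sum_{s=0}^\infty\lambda_s^2\sum_{|\alpha|=s}|\hat u_\alpha|^2<\infty\Big\}\subset H^1(S^n,g_{S^n}),$$ where $\hat u_\alpha=\int_{S^n}u\,\psi_\alpha\,d\mu_{S^n}$. (4) The operator $(-\Delta)^{1/2}$ has domain $$\Big\{u\in L^2(S^n,g_{S^n}):\sum_{s=0}^\infty\lambda_s\sum_{|\alpha|=s}|\hat u_\alpha|^2<\infty\Big\}=H^1(S^n,g_{S^n}).$$
   Context: $\mathbb{N}=\{0,1,2,\dots\}$ and $|\alpha|=\alpha_1+\dots+\alpha_n$ for multi-indices. $S^n$ denotes the open simplex (not the sphere). Laplace Beltrami operator of a metric $g$, in coordinates: $\Delta u=\frac{1}{\sqrt{\det g}}\sum_i\partial_i\big(\sqrt{\det g}\sum_j g^{ij}\partial_j u\big)$, where $(g^{ij})$ is the inverse of the matrix of $g$. $L^2(M,g)$ is $L^2$ with respect to the Riemannian volume $\mathrm{Vol}_g$. Sobolev space: for $u\in\mathscr{C}^\infty(M)$ let $\|u\|_{1,2}=\big(\int|u|^2d\mathrm{Vol}_g\big)^{1/2}+\big(\int|\operatorname{grad}u|_g^2d\mathrm{Vol}_g\big)^{1/2}$, where $(\operatorname{grad}u)^i=\sum_jg^{ij}\partial_ju$, and let $\mathscr{C}^\infty_{1,2}(M)=\{u\in\mathscr{C}^\infty(M):\|u\|_{1,2}<\infty\}$.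 $H^1(M,g)$ is the closure (completion) of $\mathscr{C}^\infty_{1,2}(M)$ with respect to $\|\cdot\|_{1,2}$ within the space of square integrable functions. Polynomials $\psi_\alpha$: for $\alpha\in\mathbb{N}^n$ let $$\tilde\psi_\alpha(x)=\prod_{j=1}^n\Big(1-\sum_{k=1}^{j-1}x_k\Big)^{\alpha_j}J_{\alpha_j}^{a_j,-1/2}\!\left(\frac{2x_j}{1-\sum_{k=1}^{j-1}x_k}-1\right),\qquad a_j=2\sum_{k=j+1}^n\alpha_k+\frac{n-j-1}{2},$$ where $J_m^{a,b}$ is the Jacobi polynomial of degree $m$, orthogonal on $[-1,1]$ for the weight $(1-t)^a(1+t)^b$. Then $\psi_\alpha=\tilde\psi_\alpha/\|\tilde\psi_\alpha\|_{L^2(\mu_{S^n})}$. *)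

theory Defs
  imports "HOL-Analysis.Analysis" "HOL-Computational_Algebra.Polynomial"
begin

definition partial_deriv :: "'n \<Rightarrow> (real^'n \<Rightarrow> 'b::real_normed_vector) \<Rightarrow> real^'n::finite \<Rightarrow> 'b" where
  "partial_deriv i u x = frechet_derivative u (at x) (axis i 1)"

text \<open>Iterated partial derivatives are indexed by the list of directions. For a function of class
  \<open>C\<^sup>k\<close> the order of the directions is irrelevant, so that the lists of length at most \<open>k\<close> give
  exactly the derivatives of multi-index order at most \<open>k\<close>.\<close>

definition partial_derivs :: "'n list \<Rightarrow> (real^'n \<Rightarrow> 'b::real_normed_vector) \<Rightarrow> real^'n::finite \<Rightarrow> 'b" where
  "partial_derivs is u = foldr partial_deriv is u"

definition C_on :: "nat \<Rightarrow> (real^'n::finite) set \<Rightarrow> (real^'n \<Rightarrow> 'b::real_normed_vector) set" where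
  "C_on k S = {u. (\<forall>is. length is < k \<longrightarrow> (\<forall>x\<in>S. partial_derivs is u differentiable (at x)))
                \<and> (\<forall>is. length is \<le> k \<longrightarrow> continuous_on S (partial_derivs is u))}"

definition smooth_on :: "(real^'n::finite) set \<Rightarrow> (real^'n \<Rightarrow> 'b::real_normed_vector) set" where
  "smooth_on S = (\<Inter>k. C_on k S)"

definition C2b_on :: "(real^'n::finite) set \<Rightarrow> (real^'n \<Rightarrow> 'b::real_normed_vector) set" where
  "C2b_on S = {u \<in> C_on 2 S. \<forall>is. length is \<le> 2 \<longrightarrow> bounded (partial_derivs is u ` S)}"

definition riemannian_volume ::
    "(real^'n \<Rightarrow> real^'n^'n) \<Rightarrow> (real^'n::finite) set \<Rightarrow> (real^'n) measure" where
  "riemannian_volume G S = density (restrict_space lborel S) (\<lambda>x. ennreal (sqrt (det (G x))))"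

definition grad :: "(real^'n \<Rightarrow> real^'n^'n) \<Rightarrow> (real^'n \<Rightarrow> complex) \<Rightarrow> real^'n::finite \<Rightarrow> complex^'n" where
  "grad G u x = (\<chi> i. \<Sum>j\<in>UNIV. (matrix_inv (G x) $ i $ j) *\<^sub>R partial_deriv j u x)"

text \<open>The metric is extended to complex tangent vectors as a Hermitian form.\<close>

definition metric_norm :: "real^'n^'n \<Rightarrow> complex^'n::finite \<Rightarrow> real" where
  "metric_norm g v = sqrt (Re (\<Sum>i\<in>UNIV. \<Sum>j\<in>UNIV. (g $ i $ j) *\<^sub>R (v $ i * cnj (v $ j))))"

definition laplace_beltrami ::
    "(real^'n \<Rightarrow> real^'n^'n) \<Rightarrow> (real^'n \<Rightarrow> complex) \<Rightarrow> real^'n::finite \<Rightarrow> complex" where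
  "laplace_beltrami G u x =
     (1 / sqrt (det (G x))) *\<^sub>R
       (\<Sum>i\<in>UNIV. partial_deriv i
          (\<lambda>y. sqrt (det (G y)) *\<^sub>R
             (\<Sum>j\<in>UNIV. (matrix_inv (G y) $ i $ j) *\<^sub>R partial_deriv j u y)) x)"

text \<open>Elements of \<open>L\<^sup>2\<close> are represented by functions; two functions which agree almost everywhere
  represent the same element. Subsets of \<open>L\<^sup>2\<close> and graphs of operators are represented by
  sets which are saturated with respect to equality almost everywhere, and equality of such sets is
  equality of the corresponding sets of classes.\<close>

definition L2 :: "'a measure \<Rightarrow> ('a \<Rightarrow> complex) set" where
  "L2 M = {u \<in> borel_measurable M. integrable M (\<lambda>x. (cmod (u x))\<^sup>2)}"

definition l2_inner :: "'a measure \<Rightarrow> ('a \<Rightarrow> complex) \<Rightarrow> ('a \<Rightarrow> complex) \<Rightarrow> complex" where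
  "l2_inner M u v = (\<integral>x. u x * cnj (v x) \<partial>M)"

definition l2_norm :: "'a measure \<Rightarrow> ('a \<Rightarrow> complex) \<Rightarrow> real" where
  "l2_norm M u = sqrt (\<integral>x. (cmod (u x))\<^sup>2 \<partial>M)"

definition ae_eq :: "'a measure \<Rightarrow> ('a \<Rightarrow> complex) \<Rightarrow> ('a \<Rightarrow> complex) \<Rightarrow> bool" where
  "ae_eq M u v \<longleftrightarrow> (AE x in M. u x = v x)"

definition l2_span :: "'a measure \<Rightarrow> ('a \<Rightarrow> complex) set \<Rightarrow> ('a \<Rightarrow> complex) set" where
  "l2_span M B = {u \<in> L2 M. \<exists>F c. finite F \<and> F \<subseteq> B \<and> ae_eq M u (\<lambda>x. \<Sum>v\<in>F. c v * v x)}"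

type_synonym 'a graph = "(('a \<Rightarrow> complex) \<times> ('a \<Rightarrow> complex)) set"

definition l2_op :: "'a measure \<Rightarrow> ('a \<Rightarrow> complex) set \<Rightarrow> (('a \<Rightarrow> complex) \<Rightarrow> ('a \<Rightarrow> complex)) \<Rightarrow> 'a graph" where
  "l2_op M D T = {(u, f). u \<in> L2 M \<and> f \<in> L2 M \<and> (\<exists>v\<in>D. ae_eq M u v \<and> ae_eq M f (T v))}"

definition is_l2_op :: "'a measure \<Rightarrow> 'a graph \<Rightarrow> bool" where
  "is_l2_op M A \<longleftrightarrow>
     A \<subseteq> L2 M \<times> L2 M \<and>
     (\<forall>(u, f)\<in>A. \<forall>u'\<in>L2 M. \<forall>f'\<in>L2 M. ae_eq M u u' \<longrightarrow> ae_eq M f f' \<longrightarrow> (u', f') \<in> A) \<and>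
     ((\<lambda>x. 0), (\<lambda>x. 0)) \<in> A \<and>
     (\<forall>(u, f)\<in>A. \<forall>(v, g)\<in>A. ((\<lambda>x. u x + v x), (\<lambda>x. f x + g x)) \<in> A) \<and>
     (\<forall>c. \<forall>(u, f)\<in>A. ((\<lambda>x. c * u x), (\<lambda>x. c * f x)) \<in> A) \<and>
     (\<forall>u f g. (u, f) \<in> A \<longrightarrow> (u, g) \<in> A \<longrightarrow> ae_eq M f g)"

definition densely_defined :: "'a measure \<Rightarrow> 'a graph \<Rightarrow> bool" where
  "densely_defined M A \<longleftrightarrow>
     (\<forall>u\<in>L2 M. \<forall>e>0. \<exists>v\<in>Domain A. l2_norm M (\<lambda>x. u x - v x) < e)"

definition symmetric_op :: "'a measure \<Rightarrow> 'a graph \<Rightarrow> bool" where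
  "symmetric_op M A \<longleftrightarrow> is_l2_op M A \<and> densely_defined M A \<and>
     (\<forall>(u, f)\<in>A. \<forall>(v, g)\<in>A. l2_inner M f v = l2_inner M u g)"

definition bounded_op :: "'a measure \<Rightarrow> 'a graph \<Rightarrow> bool" where
  "bounded_op M A \<longleftrightarrow> (\<exists>C. \<forall>(u, f)\<in>A. l2_norm M f \<le> C * l2_norm M u)"

definition adjoint_op :: "'a measure \<Rightarrow> 'a graph \<Rightarrow> 'a graph" where
  "adjoint_op M A = {(v, g). v \<in> L2 M \<and> g \<in> L2 M \<and> (\<forall>(u, f)\<in>A. l2_inner M f v = l2_inner M u g)}"

definition self_adjoint_op :: "'a measure \<Rightarrow> 'a graph \<Rightarrow> bool" where
  "self_adjoint_op M A \<longleftrightarrow> is_l2_op M A \<and> densely_defined M A \<and> adjoint_op M A = A"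

definition closure_op :: "'a measure \<Rightarrow> 'a graph \<Rightarrow> 'a graph" where
  "closure_op M A = {(u, f). u \<in> L2 M \<and> f \<in> L2 M \<and>
     (\<exists>v g. (\<forall>k::nat. (v k, g k) \<in> A) \<and>
        (\<lambda>k. l2_norm M (\<lambda>x. v k x - u x)) \<longlonglongrightarrow> 0 \<and>
        (\<lambda>k. l2_norm M (\<lambda>x. g k x - f x)) \<longlonglongrightarrow> 0)}"

definition eigenspace :: "'a graph \<Rightarrow> complex \<Rightarrow> ('a \<Rightarrow> complex) set" where
  "eigenspace A z = {u. (u, (\<lambda>x. z * u x)) \<in> A}"

definition eigenvalues :: "'a measure \<Rightarrow> 'a graph \<Rightarrow> complex set" where
  "eigenvalues M A = {z. \<exists>u\<in>eigenspace A z. \<not> ae_eq M u (\<lambda>x. 0)}"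

text \<open>\<open>z\<close> is in the resolvent set iff \<open>A - z\<close> is onto and has a bounded inverse; the
  estimate below contains the injectivity.\<close>

definition resolvent_set :: "'a measure \<Rightarrow> 'a graph \<Rightarrow> complex set" where
  "resolvent_set M A = {z.
     (\<forall>h\<in>L2 M. \<exists>(u, f)\<in>A. ae_eq M h (\<lambda>x. f x - z * u x)) \<and>
     (\<exists>C. \<forall>(u, f)\<in>A. l2_norm M u \<le> C * l2_norm M (\<lambda>x. f x - z * u x))}"

definition spectrum_op :: "'a measure \<Rightarrow> 'a graph \<Rightarrow> complex set" where
  "spectrum_op M A = - resolvent_set M A"

text \<open>The square root of a nonnegative self-adjoint operator is the unique nonnegative self-adjoint
  operator whose square (composition with the natural domain) is the given operator.\<close>

definition is_sqrt_op :: "'a measure \<Rightarrow> 'a graph \<Rightarrow> 'a graph \<Rightarrow> bool" where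
  "is_sqrt_op M A B \<longleftrightarrow> self_adjoint_op M B \<and> (\<forall>(u, f)\<in>B. 0 \<le> Re (l2_inner M f u)) \<and> B O B = A"

definition sqrt_op :: "'a measure \<Rightarrow> 'a graph \<Rightarrow> 'a graph" where
  "sqrt_op M A = (THE B. is_sqrt_op M A B)"

definition sobolev_norm ::
    "(real^'n \<Rightarrow> real^'n^'n) \<Rightarrow> (real^'n::finite) set \<Rightarrow> (real^'n \<Rightarrow> complex) \<Rightarrow> real" where
  "sobolev_norm G S u =
     l2_norm (riemannian_volume G S) u
     + sqrt (\<integral>x. (metric_norm (G x) (grad G u x))\<^sup>2 \<partial>riemannian_volume G S)"

text \<open>The Bochner integrals in the norm vanish on nonintegrable functions, so finiteness of the
  norm is expressed by integrability.\<close>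

definition smooth_12 ::
    "(real^'n \<Rightarrow> real^'n^'n) \<Rightarrow> (real^'n::finite) set \<Rightarrow> (real^'n \<Rightarrow> complex) set" where
  "smooth_12 G S = {u \<in> smooth_on S. u \<in> L2 (riemannian_volume G S) \<and>
     integrable (riemannian_volume G S) (\<lambda>x. (metric_norm (G x) (grad G u x))\<^sup>2)}"

text \<open>The completion realised within \<open>L\<^sup>2\<close>: limits in \<open>L\<^sup>2\<close> of sequences that are Cauchy
  for the Sobolev norm.\<close>

definition sobolev_H1 ::
    "(real^'n \<Rightarrow> real^'n^'n) \<Rightarrow> (real^'n::finite) set \<Rightarrow> (real^'n \<Rightarrow> complex) set" where
  "sobolev_H1 G S = {u \<in> L2 (riemannian_volume G S).
     \<exists>w. (\<forall>k::nat. w k \<in> smooth_12 G S) \<and>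
       (\<forall>e>0. \<exists>N. \<forall>k\<ge>N. \<forall>l\<ge>N. sobolev_norm G S (\<lambda>x. w k x - w l x) < e) \<and>
       (\<lambda>k. l2_norm (riemannian_volume G S) (\<lambda>x. w k x - u x)) \<longlonglongrightarrow> 0}"

definition open_simplex :: "(real^'n::finite) set" where
  "open_simplex = {x. (\<Sum>i\<in>UNIV. x $ i) < 1 \<and> (\<forall>i. 0 < x $ i)}"

definition baran_metric :: "real^'n \<Rightarrow> real^'n^'n::finite" where
  "baran_metric x = (\<chi> i j. (if i = j then 1 / x $ i else 0) + 1 / (1 - (\<Sum>k\<in>UNIV. x $ k)))"

definition simplex_measure :: "(real^'n::finite) measure" where
  "simplex_measure = density lborel
     (\<lambda>x. ennreal (indicator open_simplex x / sqrt ((1 - (\<Sum>i\<in>UNIV. x $ i)) * (\<Prod>i\<in>UNIV. x $ i))))"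

text \<open>Jacobi polynomials in the standard normalisation, with value \<open>(m + a) gchoose m\<close> at \<open>1\<close>.\<close>

definition jacobi_poly :: "nat \<Rightarrow> real \<Rightarrow> real \<Rightarrow> real poly" where
  "jacobi_poly m a b =
     (\<Sum>s\<le>m. smult (((real m + a) gchoose (m - s)) * ((real m + b) gchoose s))
        ([:-1/2, 1/2:] ^ s * [:1/2, 1/2:] ^ (m - s)))"

text \<open>The coordinates are indexed by a finite linearly ordered type in place of \<open>{1..n}\<close>; if \<open>j\<close>
  is the index of rank \<open>j\<close>, then \<open>n - j\<close> is the number of indices above \<open>j\<close>.\<close>

definition jacobi_param :: "('n \<Rightarrow> nat) \<Rightarrow> 'n::{finite,linorder} \<Rightarrow> real" where
  "jacobi_param \<alpha> j = 2 * (\<Sum>k\<in>{j<..}. real (\<alpha> k)) + (real (card {j<..}) - 1) / 2"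

definition psi_tilde :: "('n::{finite,linorder} \<Rightarrow> nat) \<Rightarrow> real^('n::{finite,linorder}) \<Rightarrow> real" where
  "psi_tilde \<alpha> x =
     (\<Prod>j\<in>UNIV. (1 - (\<Sum>k\<in>{..<j}. x $ k)) ^ \<alpha> j
        * poly (jacobi_poly (\<alpha> j) (jacobi_param \<alpha> j) (-1/2))
            (2 * x $ j / (1 - (\<Sum>k\<in>{..<j}. x $ k)) - 1))"

definition psi :: "('n::{finite,linorder} \<Rightarrow> nat) \<Rightarrow> real^('n::{finite,linorder}) \<Rightarrow> real" where
  "psi \<alpha> x = psi_tilde \<alpha> x / sqrt (\<integral>y. (psi_tilde \<alpha> y)\<^sup>2 \<partial>simplex_measure)"

definition psi_coeff :: "(real^('n::{finite,linorder}) \<Rightarrow> complex) \<Rightarrow> ('n::{finite,linorder} \<Rightarrow> nat) \<Rightarrow> complex" where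
  "psi_coeff u \<alpha> = (LINT x:open_simplex|simplex_measure. u x * complex_of_real (psi \<alpha> x))"

definition degree_set :: "nat \<Rightarrow> ('n::finite \<Rightarrow> nat) set" where
  "degree_set s = {\<alpha>. (\<Sum>i\<in>UNIV. \<alpha> i) = s}"

definition lambda :: "nat \<Rightarrow> nat \<Rightarrow> real" where
  "lambda n s = real s * (real s + (real n - 1) / 2)"

end

theory Submission
  imports Defs "HOL-Library.Function_Algebras"
begin

text \<open>Write \<open>x\<^sub>0 = 1 - \<Sum>i. x $ i\<close> for the remaining barycentric coordinate (\<open>bary0\<close>). The matrix of
  the Baran metric is a diagonal matrix plus a matrix of rank one. Therefore its inverse is the
  polynomial matrix with entries \<open>\<delta>\<^sub>i\<^sub>j x\<^sub>i - x\<^sub>i x\<^sub>j\<close> (\<open>ginv\<close>) and its determinant is the reciprocal of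
  \<open>x\<^sub>0\<close> times the product of the \<open>x\<^sub>i\<close> (\<open>bary_prod\<close>). So the Riemannian volume has the density
  \<open>weight\<close>, which is integrable, and the Laplace Beltrami operator coincides on functions of class
  \<open>C\<^sup>2\<close> with the operator \<open>lap\<close>, whose coefficients are polynomials.

  All integrations by parts are instances of one divergence theorem
  (\<open>simplex_divergence_weighted\<close>). It has no boundary term if the derivative of
  \<open>ln (bary_prod)\<close> along the vector field is integrable, which is a weak way of saying that the
  field is tangential to the faces. The gradient for the Baran metric of a function with bounded
  derivatives has this property, and so \<open>Green\<close> identifies the quadratic form of the operator with
  the Dirichlet form.

  The polynomials \<open>\<psi>\<^sub>\<alpha>\<close> are orthogonal because their factors solve Jacobi's equation. Let \<open>j\<close> be the
  last index at which \<open>\<alpha>\<close> and \<open>\<beta>\<close> differ. The vector field \<open>cone_field j\<close> differentiates the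
  \<open>j\<close>-th factor, annihilates the factors before it and only rescales those after it. The
  divergence theorem for this field times a Wronskian gives the orthogonality
  (\<open>psi_poly_orthogonal\<close>).

  The operator \<open>-lap\<close> maps a monomial of degree \<open>s\<close> to \<open>\<lambda>\<^sub>s\<close> times this monomial plus terms of
  degree \<open>s - 1\<close> (\<open>lap_monom\<close>). A dimension count shows that the \<open>\<psi>\<^sub>\<alpha>\<close> with \<open>|\<alpha>| < s\<close> span the
  polynomials of degree less than \<open>s\<close>, so that the terms of lower degree are orthogonal to the
  \<open>\<psi>\<^sub>\<beta>\<close> with \<open>|\<beta>| \<ge> s\<close>. With the symmetry of the operator, its matrix in the system of the \<open>\<psi>\<^sub>\<alpha>\<close> is
  diagonal (\<open>l2_inner_lap_epoly\<close>). Polynomials are dense by the theorem of Stone and Weierstrass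
  (\<open>epoly_complete\<close>), so each \<open>\<psi>\<^sub>\<alpha>\<close> is an eigenfunction.

  The rest of the spectral statement holds for every operator that has a complete orthonormal
  system of eigenfunctions in its domain and is symmetric. It is proved in the locale \<open>l2_basis\<close>:
  the closure is the maximal operator which multiplies the coefficients by the eigenvalues
  (\<open>closure_eq_diag\<close>), and such an operator is self-adjoint, with an explicit domain, spectrum and
  square root. The space \<open>H\<^sup>1\<close> is determined by a Bessel inequality for the Dirichlet form
  (\<open>dirichlet_Bessel\<close>) and by the partial sums of the expansion, which are smooth
  (\<open>sobolev_H1_superset\<close>).\<close>

section \<open>Square-integrable functions\<close>

lemma borel_measurable_cnj [measurable (raw)]:
  "f \<in> borel_measurable M \<Longrightarrow> (\<lambda>x. cnj (f x)) \<in> borel_measurable M"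
  by (rule borel_measurable_continuous_on[of cnj]) (auto intro: continuous_intros)

lemma L2_integrable_square: "u \<in> L2 M \<Longrightarrow> integrable M (\<lambda>x. (cmod (u x))\<^sup>2)"
  by (simp add: L2_def)

lemma two_mult_le_sum_squares: "2 * (a * b) \<le> a\<^sup>2 + (b::real)\<^sup>2"
  using zero_le_power2[of "a - b"] by (simp add: power2_diff)

lemma cmod_add_square_le: "(cmod (a + b))\<^sup>2 \<le> 2 * (cmod a)\<^sup>2 + 2 * (cmod b)\<^sup>2"
proof -
  have "(cmod (a + b))\<^sup>2 \<le> (cmod a + cmod b)\<^sup>2"
    by (intro power_mono norm_triangle_ineq) auto
  then show ?thesis
    using two_mult_le_sum_squares[of "cmod a" "cmod b"] by (simp add: power2_sum)
qed

lemma L2_mult_integrable: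
  assumes "u \<in> L2 M" "v \<in> L2 M"
  shows "integrable M (\<lambda>x. u x * cnj (v x))"
proof (rule Bochner_Integration.integrable_bound)
  have [measurable]: "u \<in> borel_measurable M" "v \<in> borel_measurable M"
    using assms by (auto simp: L2_def)
  show "(\<lambda>x. u x * cnj (v x)) \<in> borel_measurable M" by measurable
  show "integrable M (\<lambda>x. (cmod (u x))\<^sup>2 + (cmod (v x))\<^sup>2)"
    using assms by (auto simp: L2_def)
  have "cmod (u x) * cmod (v x) \<le> (cmod (u x))\<^sup>2 + (cmod (v x))\<^sup>2" for x
    using two_mult_le_sum_squares[of "cmod (u x)" "cmod (v x)"]
    by (smt (verit) mult_nonneg_nonneg norm_ge_zero)
  then show "AE x in M. norm (u x * cnj (v x)) \<le> norm ((cmod (u x))\<^sup>2 + (cmod (v x))\<^sup>2)"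
    by (auto simp: norm_mult)
qed

lemma L2_add:
  assumes "u \<in> L2 M" "v \<in> L2 M"
  shows "(\<lambda>x. u x + v x) \<in> L2 M"
proof -
  have [measurable]: "u \<in> borel_measurable M" "v \<in> borel_measurable M"
    using assms by (auto simp: L2_def)
  have "integrable M (\<lambda>x. 2 * (cmod (u x))\<^sup>2 + 2 * (cmod (v x))\<^sup>2)"
    using assms by (auto simp: L2_def)
  then have "integrable M (\<lambda>x. (cmod (u x + v x))\<^sup>2)"
    by (rule Bochner_Integration.integrable_bound) (auto intro!: order_trans[OF cmod_add_square_le])
  then show ?thesis by (simp add: L2_def)
qed

lemma L2_cmult: "u \<in> L2 M \<Longrightarrow> (\<lambda>x. c * u x) \<in> L2 M"
  by (auto simp: L2_def norm_mult power_mult_distrib)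

lemma L2_zero: "(\<lambda>x. 0) \<in> L2 M"
  by (auto simp: L2_def)

lemma L2_diff: "u \<in> L2 M \<Longrightarrow> v \<in> L2 M \<Longrightarrow> (\<lambda>x. u x - v x) \<in> L2 M"
  using L2_add[of u M "\<lambda>x. -1 * v x"] L2_cmult[of v M "-1"] by simp

lemma L2_sum: "(\<And>i. i \<in> I \<Longrightarrow> u i \<in> L2 M) \<Longrightarrow> (\<lambda>x. \<Sum>i\<in>I. u i x) \<in> L2 M"
  by (induction I rule: infinite_finite_induct) (auto intro: L2_add L2_zero)

lemma L2_ae_cong: 
  assumes "u \<in> L2 M" "v \<in> borel_measurable M" "ae_eq M u v"
  shows "v \<in> L2 M"
proof -
  have [measurable]: "u \<in> borel_measurable M" "v \<in> borel_measurable M"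
    and int: "integrable M (\<lambda>x. (cmod (u x))\<^sup>2)" using assms by (auto simp: L2_def)
  have "AE x in M. (cmod (u x))\<^sup>2 = (cmod (v x))\<^sup>2"
    using assms(3) by (auto simp: ae_eq_def elim: eventually_mono)
  then have "integrable M (\<lambda>x. (cmod (v x))\<^sup>2)"
    using integrable_cong_AE_imp[OF int, of "\<lambda>x. (cmod (v x))\<^sup>2"] by simp
  then show ?thesis using assms by (simp add: L2_def)
qed

lemma ae_eq_refl: "ae_eq M u u" by (simp add: ae_eq_def)

lemma ae_eq_sym: "ae_eq M u v \<Longrightarrow> ae_eq M v u"
  unfolding ae_eq_def by (erule eventually_mono) auto

lemma ae_eq_trans: "ae_eq M u v \<Longrightarrow> ae_eq M v w \<Longrightarrow> ae_eq M u w"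
  unfolding ae_eq_def by (erule (1) eventually_elim2) auto

lemma ae_eq_add: "ae_eq M u u' \<Longrightarrow> ae_eq M v v' \<Longrightarrow> ae_eq M (\<lambda>x. u x + v x) (\<lambda>x. u' x + v' x)"
  unfolding ae_eq_def by (erule (1) eventually_elim2) auto

lemma ae_eq_diff: "ae_eq M u u' \<Longrightarrow> ae_eq M v v' \<Longrightarrow> ae_eq M (\<lambda>x. u x - v x) (\<lambda>x. u' x - v' x)"
  unfolding ae_eq_def by (erule (1) eventually_elim2) auto

lemma ae_eq_cmult: "ae_eq M u u' \<Longrightarrow> ae_eq M (\<lambda>x. c * u x) (\<lambda>x. c * u' x)"
  unfolding ae_eq_def by (erule eventually_mono) auto

lemma ae_eq_diff_0: "ae_eq M (\<lambda>x. u x - v x) (\<lambda>x. 0) \<longleftrightarrow> ae_eq M u v"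
  by (simp add: ae_eq_def)

lemma l2_inner_cong_ae:
  assumes "u \<in> L2 M" "v \<in> L2 M" "u' \<in> L2 M" "v' \<in> L2 M" "ae_eq M u u'" "ae_eq M v v'"
  shows "l2_inner M u v = l2_inner M u' v'"
proof -
  have [measurable]: "u \<in> borel_measurable M" "v \<in> borel_measurable M"
     "u' \<in> borel_measurable M" "v' \<in> borel_measurable M" using assms by (auto simp: L2_def)
  show ?thesis unfolding l2_inner_def
    by (rule integral_cong_AE) (use assms in \<open>auto simp: ae_eq_def elim: eventually_elim2\<close>)
qed

lemma l2_norm_cong_ae:
  assumes "u \<in> L2 M" "u' \<in> L2 M" "ae_eq M u u'"
  shows "l2_norm M u = l2_norm M u'"
proof -
  have [measurable]: "u \<in> borel_measurable M" "u' \<in> borel_measurable M"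
    using assms by (auto simp: L2_def)
  have "(\<integral>x. (cmod (u x))\<^sup>2 \<partial>M) = (\<integral>x. (cmod (u' x))\<^sup>2 \<partial>M)"
    by (rule integral_cong_AE) (use assms in \<open>auto simp: ae_eq_def elim: eventually_mono\<close>)
  then show ?thesis by (simp add: l2_norm_def)
qed

lemma l2_inner_add_left:
  assumes "u \<in> L2 M" "v \<in> L2 M" "w \<in> L2 M"
  shows "l2_inner M (\<lambda>x. u x + v x) w = l2_inner M u w + l2_inner M v w"
  using L2_mult_integrable[OF assms(1,3)] L2_mult_integrable[OF assms(2,3)]
  by (simp add: l2_inner_def distrib_right)

lemma l2_inner_cmult_left: "l2_inner M (\<lambda>x. c * u x) w = c * l2_inner M u w"
  by (simp add: l2_inner_def mult.assoc)

lemma l2_inner_commute: "l2_inner M u v = cnj (l2_inner M v u)"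
proof -
  have "cnj (l2_inner M v u) = (\<integral>x. cnj (v x * cnj (u x)) \<partial>M)"
    unfolding l2_inner_def by (rule Bochner_Integration.integral_cnj[symmetric])
  then show ?thesis by (simp add: l2_inner_def mult.commute)
qed

lemma l2_inner_cmult_right: "l2_inner M w (\<lambda>x. c * u x) = cnj c * l2_inner M w u"
  by (simp add: l2_inner_def mult.left_commute)

lemma l2_inner_diff_left:
  assumes "u \<in> L2 M" "v \<in> L2 M" "w \<in> L2 M"
  shows "l2_inner M (\<lambda>x. u x - v x) w = l2_inner M u w - l2_inner M v w"
  using L2_mult_integrable[OF assms(1,3)] L2_mult_integrable[OF assms(2,3)]
  by (simp add: l2_inner_def left_diff_distrib)

lemma l2_inner_diff_right:
  assumes "u \<in> L2 M" "v \<in> L2 M" "w \<in> L2 M"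
  shows "l2_inner M w (\<lambda>x. u x - v x) = l2_inner M w u - l2_inner M w v"
  using L2_mult_integrable[OF assms(3,1)] L2_mult_integrable[OF assms(3,2)]
  by (simp add: l2_inner_def right_diff_distrib)

lemma l2_inner_zero [simp]: "l2_inner M (\<lambda>x. 0) w = 0" "l2_inner M w (\<lambda>x. 0) = 0"
  by (auto simp: l2_inner_def)

lemma l2_inner_sum_left:
  assumes "\<And>i. i \<in> I \<Longrightarrow> u i \<in> L2 M" "w \<in> L2 M"
  shows "l2_inner M (\<lambda>x. \<Sum>i\<in>I. u i x) w = (\<Sum>i\<in>I. l2_inner M (u i) w)"
  using assms(1)
  by (induction I rule: infinite_finite_induct) (auto simp: l2_inner_add_left L2_sum assms(2))

lemma l2_norm_nonneg: "0 \<le> l2_norm M u"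
  by (simp add: l2_norm_def)

lemma l2_norm_square: "(l2_norm M u)\<^sup>2 = (\<integral>x. (cmod (u x))\<^sup>2 \<partial>M)"
  by (simp add: l2_norm_def)

lemma l2_inner_self: "l2_inner M u u = complex_of_real ((l2_norm M u)\<^sup>2)"
  unfolding l2_norm_square l2_inner_def
  by (simp add: complex_norm_square[symmetric] flip: of_real_power)

lemma l2_norm_eq_0_iff: "u \<in> L2 M \<Longrightarrow> l2_norm M u = 0 \<longleftrightarrow> ae_eq M u (\<lambda>x. 0)"
  using integral_nonneg_eq_0_iff_AE[of M "\<lambda>x. (cmod (u x))\<^sup>2"]
  by (auto simp: l2_norm_def ae_eq_def L2_def)

lemma l2_norm_minus_commute: "l2_norm M (\<lambda>x. u x - v x) = l2_norm M (\<lambda>x. v x - u x)"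
  by (simp add: l2_norm_def norm_minus_commute)

lemma l2_norm_cmult: "l2_norm M (\<lambda>x. c * u x) = cmod c * l2_norm M u"
  by (simp add: l2_norm_def norm_mult power_mult_distrib real_sqrt_mult)

lemma l2_Cauchy_Schwarz:
  assumes u: "u \<in> L2 M" and v: "v \<in> L2 M"
  shows "cmod (l2_inner M u v) \<le> l2_norm M u * l2_norm M v"
proof -
  let ?a = "l2_norm M u" and ?b = "l2_norm M v" and ?z = "l2_inner M u v"
  \<comment> \<open>The square of the norm of \<open>u - t \<langle>u, v\<rangle> v\<close> is nonnegative for every real \<open>t\<close>.\<close>
  have *: "2 * t * (cmod ?z)\<^sup>2 \<le> ?a\<^sup>2 + t\<^sup>2 * (cmod ?z)\<^sup>2 * ?b\<^sup>2" for t :: real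
  proof -
    let ?c = "of_real t * ?z"
    have cv: "(\<lambda>x. ?c * v x) \<in> L2 M" by (rule L2_cmult[OF v])
    have "complex_of_real ((l2_norm M (\<lambda>x. u x - ?c * v x))\<^sup>2)
       = l2_inner M (\<lambda>x. u x - ?c * v x) (\<lambda>x. u x - ?c * v x)" by (simp add: l2_inner_self)
    also have "\<dots> = (l2_inner M u u - l2_inner M u (\<lambda>x. ?c * v x))
        - (l2_inner M (\<lambda>x. ?c * v x) u - l2_inner M (\<lambda>x. ?c * v x) (\<lambda>x. ?c * v x))"
      by (simp only: l2_inner_diff_left l2_inner_diff_right u cv L2_diff[OF u cv])
    also have "\<dots> = l2_inner M u u - cnj ?c * ?z - ?c * cnj ?z + ?c * cnj ?c * l2_inner M v v"
      by (simp only: l2_inner_cmult_left l2_inner_cmult_right l2_inner_commute[of M v u])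
         (simp add: algebra_simps)
    also have "\<dots> = of_real (?a\<^sup>2 - 2 * t * (cmod ?z)\<^sup>2 + t\<^sup>2 * (cmod ?z)\<^sup>2 * ?b\<^sup>2)"
    proof -
      have "cnj ?c * ?z = of_real (t * (cmod ?z)\<^sup>2)" "?c * cnj ?z = of_real (t * (cmod ?z)\<^sup>2)"
        "?c * cnj ?c = of_real (t\<^sup>2 * (cmod ?z)\<^sup>2)"
        using complex_norm_square[of ?z] by (auto simp: algebra_simps power2_eq_square)
      then show ?thesis by (simp add: l2_inner_self)
    qed
    finally have "(l2_norm M (\<lambda>x. u x - ?c * v x))\<^sup>2
       = ?a\<^sup>2 - 2 * t * (cmod ?z)\<^sup>2 + t\<^sup>2 * (cmod ?z)\<^sup>2 * ?b\<^sup>2" using of_real_eq_iff by blast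
    then show ?thesis by (smt (verit) zero_le_power2)
  qed
  show ?thesis
  proof (cases "?b = 0")
    case True
    have "cmod ?z = 0"
    proof (rule ccontr)
      \<comment> \<open>If \<open>v\<close> has norm zero, then \<open>2 t |\<langle>u, v\<rangle>|\<^sup>2 \<le> \<parallel>u\<parallel>\<^sup>2\<close> for all \<open>t\<close>, which fails for large \<open>t\<close>.\<close>
      assume nz: "cmod ?z \<noteq> 0"
      have "2 * (?a\<^sup>2 / (cmod ?z)\<^sup>2 + 1) * (cmod ?z)\<^sup>2 \<le> ?a\<^sup>2"
        using *[of "?a\<^sup>2 / (cmod ?z)\<^sup>2 + 1"] True by simp
      moreover have "2 * (?a\<^sup>2 / (cmod ?z)\<^sup>2 + 1) * (cmod ?z)\<^sup>2 = 2 * ?a\<^sup>2 + 2 * (cmod ?z)\<^sup>2"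
        using nz by (simp add: field_simps)
      moreover have "(cmod ?z)\<^sup>2 > 0" using nz by simp
      ultimately show False using zero_le_power2[of ?a] by linarith
    qed
    then show ?thesis using True by simp
  next
    case False
    then have b: "?b\<^sup>2 > 0" by simp
    have "2 * (1 / ?b\<^sup>2) * (cmod ?z)\<^sup>2 \<le> ?a\<^sup>2 + (1 / ?b\<^sup>2)\<^sup>2 * (cmod ?z)\<^sup>2 * ?b\<^sup>2" by (rule *)
    also have "(1 / ?b\<^sup>2)\<^sup>2 * (cmod ?z)\<^sup>2 * ?b\<^sup>2 = (cmod ?z)\<^sup>2 / ?b\<^sup>2"
      using b by (simp add: field_simps power2_eq_square)
    finally have "(cmod ?z)\<^sup>2 / ?b\<^sup>2 \<le> ?a\<^sup>2" by simp
    then have "(cmod ?z)\<^sup>2 \<le> (?a * ?b)\<^sup>2" using b by (simp add: field_simps)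
    then show ?thesis by (rule power2_le_imp_le) (simp add: l2_norm_nonneg)
  qed
qed

lemma l2_norm_triangle:
  assumes u: "u \<in> L2 M" and v: "v \<in> L2 M"
  shows "l2_norm M (\<lambda>x. u x + v x) \<le> l2_norm M u + l2_norm M v"
proof (rule power2_le_imp_le)
  have uv: "(\<lambda>x. u x + v x) \<in> L2 M" by (rule L2_add[OF u v])
  have "complex_of_real ((l2_norm M (\<lambda>x. u x + v x))\<^sup>2)
      = l2_inner M u (\<lambda>x. u x + v x) + l2_inner M v (\<lambda>x. u x + v x)"
    unfolding l2_inner_self[symmetric] by (rule l2_inner_add_left[OF u v uv])
  also have "\<dots> = cnj (l2_inner M (\<lambda>x. u x + v x) u) + cnj (l2_inner M (\<lambda>x. u x + v x) v)"
    by (simp flip: l2_inner_commute)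
  also have "\<dots> = of_real ((l2_norm M u)\<^sup>2) + of_real ((l2_norm M v)\<^sup>2) + (l2_inner M u v + cnj (l2_inner M u v))"
    by (simp add: l2_inner_add_left u v l2_inner_self l2_inner_commute[of M v u])
  also have "\<dots> = of_real ((l2_norm M u)\<^sup>2 + (l2_norm M v)\<^sup>2 + 2 * Re (l2_inner M u v))"
    by (simp add: complex_add_cnj)
  finally have "(l2_norm M (\<lambda>x. u x + v x))\<^sup>2 = (l2_norm M u)\<^sup>2 + (l2_norm M v)\<^sup>2 + 2 * Re (l2_inner M u v)"
    using of_real_eq_iff by blast
  also have "Re (l2_inner M u v) \<le> l2_norm M u * l2_norm M v"
    using l2_Cauchy_Schwarz[OF u v] complex_Re_le_cmod order_trans by blast
  finally show "(l2_norm M (\<lambda>x. u x + v x))\<^sup>2 \<le> (l2_norm M u + l2_norm M v)\<^sup>2"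
    by (simp add: power2_sum)
qed (simp add: l2_norm_nonneg)

lemma l2_norm_triangle_diff:
  assumes "u \<in> L2 M" "v \<in> L2 M" "w \<in> L2 M"
  shows "l2_norm M (\<lambda>x. u x - w x) \<le> l2_norm M (\<lambda>x. u x - v x) + l2_norm M (\<lambda>x. v x - w x)"
  using l2_norm_triangle[of "\<lambda>x. u x - v x" M "\<lambda>x. v x - w x"] assms by (simp add: L2_diff)

lemma tendsto_l2_inner_left:
  assumes "\<And>k. u k \<in> L2 M" "v \<in> L2 M" "w \<in> L2 M" "(\<lambda>k. l2_norm M (\<lambda>x. u k x - v x)) \<longlonglongrightarrow> 0"
  shows "(\<lambda>k. l2_inner M (u k) w) \<longlonglongrightarrow> l2_inner M v w"
proof -
  have "(\<lambda>k. l2_norm M (\<lambda>x. u k x - v x) * l2_norm M w) \<longlonglongrightarrow> 0"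
    using tendsto_mult_right[OF assms(4), of "l2_norm M w"] by simp
  then have "(\<lambda>k. l2_inner M (u k) w - l2_inner M v w) \<longlonglongrightarrow> 0"
  proof (rule Lim_null_comparison[rotated])
    have "cmod (l2_inner M (u k) w - l2_inner M v w) \<le> l2_norm M (\<lambda>x. u k x - v x) * l2_norm M w" for k
      using l2_Cauchy_Schwarz[of "\<lambda>x. u k x - v x" M w] assms by (simp add: l2_inner_diff_left L2_diff)
    then show "\<forall>\<^sub>F k in sequentially. cmod (l2_inner M (u k) w - l2_inner M v w) \<le> l2_norm M (\<lambda>x. u k x - v x) * l2_norm M w"
      by simp
  qed
  then show ?thesis by (simp add: LIM_zero_iff)
qed

lemma tendsto_l2_norm:
  assumes "\<And>k. u k \<in> L2 M" "v \<in> L2 M" "(\<lambda>k. l2_norm M (\<lambda>x. u k x - v x)) \<longlonglongrightarrow> 0"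
  shows "(\<lambda>k. l2_norm M (u k)) \<longlonglongrightarrow> l2_norm M v"
proof -
  have "(\<lambda>k. l2_norm M (u k) - l2_norm M v) \<longlonglongrightarrow> 0"
  proof (rule Lim_null_comparison[OF _ assms(3)])
    have "\<bar>l2_norm M (u k) - l2_norm M v\<bar> \<le> l2_norm M (\<lambda>x. u k x - v x)" for k
      using l2_norm_triangle_diff[of "u k" M v "\<lambda>x. 0"] l2_norm_triangle_diff[of v M "u k" "\<lambda>x. 0"] assms(1)[of k] assms(2)
        l2_norm_minus_commute[of M v "u k"] by (simp add: L2_zero)
    then show "\<forall>\<^sub>F k in sequentially. norm (l2_norm M (u k) - l2_norm M v) \<le> l2_norm M (\<lambda>x. u k x - v x)"
      by simp
  qed
  then show ?thesis by (simp add: LIM_zero_iff)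
qed

text \<open>With \<open>d\<^sub>k\<close> the increments, the series of the integrals of \<open>2\<^sup>k d\<^sub>k\<^sup>2\<close> converges, hence so does
  \<open>\<Sum>k. 2\<^sup>k d\<^sub>k\<^sup>2\<close> almost everywhere, and \<open>d\<^sub>k \<le> 2\<^sup>k d\<^sub>k\<^sup>2 + 2\<^sup>-\<^sup>k\<close> then bounds the telescoping series. The
  weight \<open>2\<^sup>k\<close> avoids an appeal to integrability of \<open>d\<^sub>k\<close> itself, so that the measure may be
  infinite.\<close>

lemma l2_pointwise_subsequence:
  assumes u: "\<And>k. u k \<in> L2 M"
    and d: "\<And>k. (l2_norm M (\<lambda>x. u (Suc k) x - u k x))\<^sup>2 \<le> (1/4)^k"
  shows "AE x in M. convergent (\<lambda>k. u k x)"
proof -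
  let ?d = "\<lambda>k x. cmod (u (Suc k) x - u k x)"
  have meas [measurable]: "u k \<in> borel_measurable M" for k using u[of k] by (simp add: L2_def)
  have int: "integrable M (\<lambda>x. (?d k x)\<^sup>2)" for k
    using L2_diff[OF u u] by (simp add: L2_def)
  have nn: "(\<integral>\<^sup>+x. ennreal (2^k * (?d k x)\<^sup>2) \<partial>M) \<le> ennreal ((1/2)^k)" for k
  proof -
    have "(\<integral>\<^sup>+x. ennreal (2^k * (?d k x)\<^sup>2) \<partial>M) = ennreal (2^k * (l2_norm M (\<lambda>x. u (Suc k) x - u k x))\<^sup>2)"
      unfolding l2_norm_square using int[of k] by (subst nn_integral_eq_integral) auto
    also have "\<dots> \<le> ennreal (2^k * (1/4)^k)"
      using d[of k] by (intro ennreal_leI mult_left_mono) auto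
    also have "(2::real)^k * (1/4)^k = (1/2)^k" by (simp flip: power_mult_distrib)
    finally show ?thesis .
  qed
  have "(\<integral>\<^sup>+x. (\<Sum>k. ennreal (2^k * (?d k x)\<^sup>2)) \<partial>M) = (\<Sum>k. \<integral>\<^sup>+x. ennreal (2^k * (?d k x)\<^sup>2) \<partial>M)"
    by (rule nn_integral_suminf) measurable
  also have "\<dots> \<le> (\<Sum>k. ennreal ((1/2)^k))" by (intro suminf_le nn summableI)
  also have "\<dots> = ennreal (\<Sum>k. (1/2)^k)"
    by (rule suminf_ennreal2) (auto simp: summable_geometric)
  finally have "(\<integral>\<^sup>+x. (\<Sum>k. ennreal (2^k * (?d k x)\<^sup>2)) \<partial>M) < \<infinity>"
    by (rule le_less_trans) simp
  then have "AE x in M. (\<Sum>k. ennreal (2^k * (?d k x)\<^sup>2)) \<noteq> \<infinity>"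
    by (intro nn_integral_PInf_AE) auto
  then show ?thesis
  proof (rule AE_mp, intro AE_I2 impI)
    fix x assume "(\<Sum>k. ennreal (2^k * (?d k x)\<^sup>2)) \<noteq> \<infinity>"
    then have s1: "summable (\<lambda>k. 2^k * (?d k x)\<^sup>2)"
      by (intro summable_suminf_not_top) auto
    have s2: "summable (\<lambda>k. (1/2::real)^k)" by (simp add: summable_geometric)
    have "summable (\<lambda>k. u (Suc k) x - u k x)"
    proof (rule summable_comparison_test'[OF summable_add[OF s1 s2], of 0])
      fix k
      have "2 * (?d k x * 1) \<le> 2^k * (?d k x)\<^sup>2 + (1/2)^k"
      proof -
        have e: "(1/2::real)^k = (sqrt ((1/2)^k))\<^sup>2" "2^k * (?d k x)\<^sup>2 = (sqrt (2^k) * ?d k x)\<^sup>2"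
          by (auto simp: power_mult_distrib)
        have "sqrt (2^k) * sqrt ((1/2::real)^k) = 1"
          by (simp flip: real_sqrt_mult power_mult_distrib)
        then have "2 * (?d k x * 1) = 2 * (?d k x * (sqrt (2^k) * sqrt ((1/2)^k)))"
          by simp
        also have "\<dots> = 2 * ((sqrt (2^k) * ?d k x) * sqrt ((1/2)^k))"
          by (simp only: ac_simps)
        also have "\<dots> \<le> 2^k * (?d k x)\<^sup>2 + (1/2)^k"
          using two_mult_le_sum_squares[of "sqrt (2^k) * ?d k x" "sqrt ((1/2)^k)"] by (simp only: e[symmetric])
        finally show ?thesis .
      qed
      then show "norm (u (Suc k) x - u k x) \<le> 2^k * (?d k x)\<^sup>2 + (1/2)^k"
        using norm_ge_zero[of "u (Suc k) x - u k x"] by linarith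
    qed
    then have "convergent (\<lambda>n. \<Sum>k<n. u (Suc k) x - u k x)"
      by (simp only: summable_iff_convergent)
    then have "convergent (\<lambda>n. u n x - u 0 x)"
      by (simp only: sum_lessThan_telescope[of "\<lambda>k. u k x"])
    then have "convergent (\<lambda>n. (u n x - u 0 x) + u 0 x)"
      by (intro convergent_add convergent_const)
    then show "convergent (\<lambda>k. u k x)" by simp
  qed
qed

text \<open>A subsequence converges almost everywhere, and by Fatou's lemma its pointwise limit is also the
  limit of the whole sequence in the norm.\<close>

lemma Riesz_Fischer:
  assumes u: "\<And>k::nat. u k \<in> L2 M"
    and cau: "\<And>e. e > 0 \<Longrightarrow> \<exists>N. \<forall>k\<ge>N. \<forall>l\<ge>N. l2_norm M (\<lambda>x. u k x - u l x) < e"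
  shows "\<exists>v\<in>L2 M. (\<lambda>k. l2_norm M (\<lambda>x. u k x - v x)) \<longlonglongrightarrow> 0"
proof -
  have "\<forall>j. \<exists>n. \<forall>k\<ge>n. \<forall>l\<ge>n. l2_norm M (\<lambda>x. u k x - u l x) < (1/2)^j"
    using cau by simp
  then obtain N0 where N0: "\<And>j k l. k \<ge> N0 j \<Longrightarrow> l \<ge> N0 j \<Longrightarrow> l2_norm M (\<lambda>x. u k x - u l x) < (1/2)^j"
    by metis
  \<comment> \<open>Summation makes the thresholds strictly increasing.\<close>
  define N where "N j = (\<Sum>i\<le>j. Suc (N0 i))" for j
  have Nlt: "N j < N (Suc j)" for j by (simp add: N_def)
  have "N0 j \<le> N j" for j
    unfolding N_def using member_le_sum[of j "{..j}" "\<lambda>i. Suc (N0 i)"] by simp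
  then have N: "l2_norm M (\<lambda>x. u k x - u l x) < (1/2)^j" if "k \<ge> N j" "l \<ge> N j" for j k l
    using N0[of j k l] that by (meson le_trans)
  have meas [measurable]: "u k \<in> borel_measurable M" for k using u[of k] by (simp add: L2_def)
  define v where "v x = lim (\<lambda>j. u (N j) x)" for x
  have v_meas [measurable]: "v \<in> borel_measurable M"
    unfolding v_def by (rule borel_measurable_lim_metric) measurable
  have conv: "AE x in M. convergent (\<lambda>j. u (N j) x)"
  proof (rule l2_pointwise_subsequence[of "\<lambda>j. u (N j)"])
    show "u (N j) \<in> L2 M" for j by (rule u)
    fix j
    have "l2_norm M (\<lambda>x. u (N (Suc j)) x - u (N j) x) \<le> (1/2)^j"
      using N[of j "N (Suc j)" "N j"] Nlt[of j] by simp
    then have "(l2_norm M (\<lambda>x. u (N (Suc j)) x - u (N j) x))\<^sup>2 \<le> ((1/2)^j)\<^sup>2"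
      by (intro power_mono) (auto simp: l2_norm_nonneg)
    also have "((1/2::real)^j)\<^sup>2 = (1/4)^j"
      by (simp add: power2_eq_square flip: power_mult_distrib)
    finally show "(l2_norm M (\<lambda>x. u (N (Suc j)) x - u (N j) x))\<^sup>2 \<le> (1/4)^j" .
  qed
  have fatou: "(\<integral>\<^sup>+x. ennreal ((cmod (u k x - v x))\<^sup>2) \<partial>M) \<le> ennreal (((1/2)^j)\<^sup>2)" if k: "k \<ge> N j" for j k
  proof -
    have "AE x in M. ennreal ((cmod (u k x - v x))\<^sup>2) = liminf (\<lambda>i. ennreal ((cmod (u k x - u (N i) x))\<^sup>2))"
      using conv
    proof eventually_elim
      case (elim x)
      then have "(\<lambda>j. u (N j) x) \<longlonglongrightarrow> v x" by (simp add: v_def convergent_LIMSEQ_iff)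
      then have "(\<lambda>i. ennreal ((cmod (u k x - u (N i) x))\<^sup>2)) \<longlonglongrightarrow> ennreal ((cmod (u k x - v x))\<^sup>2)"
        by (intro tendsto_ennrealI tendsto_power tendsto_norm tendsto_diff tendsto_const)
      from lim_imp_Liminf[OF _ this] show ?case by simp
    qed
    then have "(\<integral>\<^sup>+x. ennreal ((cmod (u k x - v x))\<^sup>2) \<partial>M)
        = (\<integral>\<^sup>+x. liminf (\<lambda>i. ennreal ((cmod (u k x - u (N i) x))\<^sup>2)) \<partial>M)"
      by (rule nn_integral_cong_AE)
    moreover have "\<dots> \<le> liminf (\<lambda>i. \<integral>\<^sup>+x. ennreal ((cmod (u k x - u (N i) x))\<^sup>2) \<partial>M)"
      by (rule nn_integral_liminf)
        (intro measurable_compose[OF _ measurable_ennreal] borel_measurable_power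
          measurable_compose[OF _ borel_measurable_norm] borel_measurable_diff meas)
    moreover have "liminf (\<lambda>i. \<integral>\<^sup>+x. ennreal ((cmod (u k x - u (N i) x))\<^sup>2) \<partial>M) \<le> ennreal (((1/2)^j)\<^sup>2)"
    proof (rule Liminf_le[OF sequentially_bot], rule eventually_sequentiallyI[of j])
      fix i assume i: "j \<le> i"
      have "N j \<le> N i" by (rule lift_Suc_mono_le[OF _ i]) (use Nlt in \<open>simp add: less_imp_le\<close>)
      then have "l2_norm M (\<lambda>x. u k x - u (N i) x) \<le> (1/2)^j" using N[of j k "N i"] k by simp
      then have "(l2_norm M (\<lambda>x. u k x - u (N i) x))\<^sup>2 \<le> ((1/2)^j)\<^sup>2"
        by (intro power_mono) (auto simp: l2_norm_nonneg)
      then show "(\<integral>\<^sup>+x. ennreal ((cmod (u k x - u (N i) x))\<^sup>2) \<partial>M) \<le> ennreal (((1/2)^j)\<^sup>2)"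
        using L2_integrable_square[OF L2_diff[OF u[of k] u[of "N i"]]]
        by (subst nn_integral_eq_integral) (auto simp: l2_norm_square intro!: ennreal_leI)
    qed
    ultimately show ?thesis by simp
  qed
  have diff_L2: "(\<lambda>x. u k x - v x) \<in> L2 M" if "k \<ge> N j" for k j
  proof -
    have "integrable M (\<lambda>x. (cmod (u k x - v x))\<^sup>2)"
    proof (rule integrableI_bounded)
      show "(\<lambda>x. (cmod (u k x - v x))\<^sup>2) \<in> borel_measurable M" by measurable
      show "(\<integral>\<^sup>+x. ennreal (norm ((cmod (u k x - v x))\<^sup>2)) \<partial>M) < \<infinity>"
        using le_less_trans[OF fatou[OF that] ennreal_less_top] by simp
    qed
    then show ?thesis by (simp add: L2_def)
  qed
  have vL2: "v \<in> L2 M"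
    using L2_diff[OF u[of "N 0"] diff_L2[of 0 "N 0"]] by simp
  have le: "l2_norm M (\<lambda>x. u k x - v x) \<le> (1/2)^j" if "k \<ge> N j" for k j
  proof -
    have "ennreal ((l2_norm M (\<lambda>x. u k x - v x))\<^sup>2) \<le> ennreal (((1/2)^j)\<^sup>2)"
      using fatou[OF that] L2_integrable_square[OF diff_L2[OF that]]
      by (subst (asm) nn_integral_eq_integral) (auto simp: l2_norm_square)
    then have "(l2_norm M (\<lambda>x. u k x - v x))\<^sup>2 \<le> ((1/2)^j)\<^sup>2" by (subst (asm) ennreal_le_iff) auto
    then show ?thesis by (rule power2_le_imp_le) auto
  qed
  have "(\<lambda>k. l2_norm M (\<lambda>x. u k x - v x)) \<longlonglongrightarrow> 0"
  proof (rule LIMSEQ_I)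
    fix r :: real assume "r > 0"
    then obtain j where "(1/2::real)^j < r" using real_arch_pow_inv[of r "1/2"] by auto
    then have "l2_norm M (\<lambda>x. u n x - v x) < r" if "n \<ge> N j" for n
      using le[OF that] by linarith
    then show "\<exists>no. \<forall>n\<ge>no. norm (l2_norm M (\<lambda>x. u n x - v x) - 0) < r"
      by (intro exI[of _ "N j"]) (simp add: l2_norm_nonneg)
  qed
  then show ?thesis using vL2 by blast
qed

section \<open>Operators that are diagonal in an orthonormal basis\<close>

lemma is_l2_opD:
  assumes "is_l2_op M A"
  shows "(u, f) \<in> A \<Longrightarrow> u \<in> L2 M" "(u, f) \<in> A \<Longrightarrow> f \<in> L2 M"
    "(u, f) \<in> A \<Longrightarrow> u' \<in> L2 M \<Longrightarrow> f' \<in> L2 M \<Longrightarrow> ae_eq M u u' \<Longrightarrow> ae_eq M f f' \<Longrightarrow> (u', f') \<in> A"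
    "((\<lambda>x. 0), (\<lambda>x. 0)) \<in> A"
    "(u, f) \<in> A \<Longrightarrow> (v, g) \<in> A \<Longrightarrow> ((\<lambda>x. u x + v x), (\<lambda>x. f x + g x)) \<in> A"
    "(u, f) \<in> A \<Longrightarrow> ((\<lambda>x. c * u x), (\<lambda>x. c * f x)) \<in> A"
    "(u, f) \<in> A \<Longrightarrow> (u, g) \<in> A \<Longrightarrow> ae_eq M f g"
proof -
  note h = assms[unfolded is_l2_op_def]
  note h1 = h[THEN conjunct1] and h2 = h[THEN conjunct2]
  note h3 = h2[THEN conjunct2] note h4 = h3[THEN conjunct2] note h5 = h4[THEN conjunct2]
  show "(u, f) \<in> A \<Longrightarrow> u \<in> L2 M" "(u, f) \<in> A \<Longrightarrow> f \<in> L2 M" using h1 by auto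
  show "(u, f) \<in> A \<Longrightarrow> u' \<in> L2 M \<Longrightarrow> f' \<in> L2 M \<Longrightarrow> ae_eq M u u' \<Longrightarrow> ae_eq M f f' \<Longrightarrow> (u', f') \<in> A"
    using h2[THEN conjunct1] by auto
  show "((\<lambda>x. 0), (\<lambda>x. 0)) \<in> A" by (rule h3[THEN conjunct1])
  show "(u, f) \<in> A \<Longrightarrow> (v, g) \<in> A \<Longrightarrow> ((\<lambda>x. u x + v x), (\<lambda>x. f x + g x)) \<in> A"
    using h4[THEN conjunct1] by auto
  show "(u, f) \<in> A \<Longrightarrow> ((\<lambda>x. c * u x), (\<lambda>x. c * f x)) \<in> A"
    using h5[THEN conjunct1] by auto
  show "(u, f) \<in> A \<Longrightarrow> (u, g) \<in> A \<Longrightarrow> ae_eq M f g"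
    using h5[THEN conjunct2] by auto
qed

lemma is_l2_opI:
  assumes L: "\<And>u f. (u, f) \<in> A \<Longrightarrow> u \<in> L2 M \<and> f \<in> L2 M"
    and cong: "\<And>u f u' f'. \<lbrakk>(u, f) \<in> A; u' \<in> L2 M; f' \<in> L2 M; ae_eq M u u'; ae_eq M f f'\<rbrakk> \<Longrightarrow> (u', f') \<in> A"
    and zero: "((\<lambda>x. 0), (\<lambda>x. 0)) \<in> A"
    and add: "\<And>u f v g. (u, f) \<in> A \<Longrightarrow> (v, g) \<in> A \<Longrightarrow> ((\<lambda>x. u x + v x), (\<lambda>x. f x + g x)) \<in> A"
    and cmult: "\<And>c u f. (u, f) \<in> A \<Longrightarrow> ((\<lambda>x. c * u x), (\<lambda>x. c * f x)) \<in> A"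
    and unique: "\<And>u f g. (u, f) \<in> A \<Longrightarrow> (u, g) \<in> A \<Longrightarrow> ae_eq M f g"
  shows "is_l2_op M A"
  unfolding is_l2_op_def
proof (intro conjI)
  show "A \<subseteq> L2 M \<times> L2 M" using L by auto
  show "\<forall>(u, f)\<in>A. \<forall>u'\<in>L2 M. \<forall>f'\<in>L2 M. ae_eq M u u' \<longrightarrow> ae_eq M f f' \<longrightarrow> (u', f') \<in> A"
  proof clarify
    fix u f u' f' assume "(u, f) \<in> A" "u' \<in> L2 M" "f' \<in> L2 M" "ae_eq M u u'" "ae_eq M f f'"
    then show "(u', f') \<in> A" by (rule cong)
  qed
  show "\<forall>(u, f)\<in>A. \<forall>(v, g)\<in>A. ((\<lambda>x. u x + v x), (\<lambda>x. f x + g x)) \<in> A"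
  proof clarify
    fix u f v g assume "(u, f) \<in> A" "(v, g) \<in> A"
    then show "((\<lambda>x. u x + v x), (\<lambda>x. f x + g x)) \<in> A" by (rule add)
  qed
  show "\<forall>c. \<forall>(u, f)\<in>A. ((\<lambda>x. c * u x), (\<lambda>x. c * f x)) \<in> A"
  proof clarify
    fix c u f assume "(u, f) \<in> A"
    then show "((\<lambda>x. c * u x), (\<lambda>x. c * f x)) \<in> A" by (rule cmult)
  qed
  show "\<forall>u f g. (u, f) \<in> A \<longrightarrow> (u, g) \<in> A \<longrightarrow> ae_eq M f g"
    by (intro allI impI) (rule unique)
qed (rule zero)

lemma is_l2_op_diff:
  assumes "is_l2_op M A" "(u, f) \<in> A" "(v, g) \<in> A"
  shows "((\<lambda>x. u x - v x), (\<lambda>x. f x - g x)) \<in> A"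
  using is_l2_opD(5)[OF assms(1,2) is_l2_opD(6)[OF assms(1,3), of "-1"]] by simp

lemma is_l2_op_sum:
  assumes A: "is_l2_op M A" and "\<And>i. i \<in> I \<Longrightarrow> (u i, f i) \<in> A"
  shows "((\<lambda>x. \<Sum>i\<in>I. c i * u i x), (\<lambda>x. \<Sum>i\<in>I. c i * f i x)) \<in> A"
  using assms(2)
proof (induction I rule: infinite_finite_induct)
  case (insert j I)
  then show ?case
    using is_l2_opD(5)[OF A is_l2_opD(6)[OF A, of "u j" "f j" "c j"], of "\<lambda>x. \<Sum>i\<in>I. c i * u i x"
        "\<lambda>x. \<Sum>i\<in>I. c i * f i x"] by simp
qed (simp_all add: is_l2_opD(4)[OF A])

text \<open>The basis is graded: \<open>deg\<close> has finite fibres, and eigenvalues will depend on the degree only.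
  Completeness is required in the weak form that only the null function is orthogonal to the
  basis; convergence of the expansions follows.\<close>

locale l2_basis =
  fixes M :: "'a measure" and e :: "'i \<Rightarrow> 'a \<Rightarrow> complex" and deg :: "'i \<Rightarrow> nat"
  assumes e_L2: "e i \<in> L2 M"
    and orthonormal: "l2_inner M (e i) (e j) = (if i = j then 1 else 0)"
    and finite_level: "finite {i. deg i = s}"
    and complete: "\<lbrakk>u \<in> L2 M; \<And>i. l2_inner M u (e i) = 0\<rbrakk> \<Longrightarrow> ae_eq M u (\<lambda>x. 0)"
begin

definition coef :: "('a \<Rightarrow> complex) \<Rightarrow> 'i \<Rightarrow> complex" where
  "coef u i = l2_inner M u (e i)"

definition psum :: "('i \<Rightarrow> complex) \<Rightarrow> nat \<Rightarrow> 'a \<Rightarrow> complex" where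
  "psum c k = (\<lambda>x. \<Sum>i\<in>{i. deg i \<le> k}. c i * e i x)"

definition energy :: "('i \<Rightarrow> complex) \<Rightarrow> nat \<Rightarrow> real" where
  "energy c s = (\<Sum>i\<in>{i. deg i = s}. (cmod (c i))\<^sup>2)"

text \<open>The maximal operator that multiplies the coefficients in degree \<open>s\<close> by \<open>l s\<close>.\<close>

definition diag :: "(nat \<Rightarrow> real) \<Rightarrow> 'a graph" where
  "diag l = {(u, f). u \<in> L2 M \<and> f \<in> L2 M \<and> (\<forall>i. coef f i = of_real (l (deg i)) * coef u i)}"

lemma finite_levels: "finite {i. deg i \<le> k}"
proof -
  have "{i. deg i \<le> k} = (\<Union>s\<in>{..k}. {i. deg i = s})" by auto
  then show ?thesis using finite_level by simp
qed

lemma sum_levels: "(\<Sum>i\<in>{i. deg i \<le> k}. f i) = (\<Sum>s\<le>k. \<Sum>i\<in>{i. deg i = s}. f i)"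
proof -
  have "{i. deg i \<le> k} = (\<Union>s\<in>{..k}. {i. deg i = s})" by auto
  then show ?thesis by (simp add: sum.UNION_disjoint finite_level Int_def)
qed

lemma energy_nonneg: "0 \<le> energy c s"
  by (auto simp: energy_def intro: sum_nonneg)

lemma psum_L2: "psum c k \<in> L2 M"
  unfolding psum_def by (intro L2_sum L2_cmult e_L2)

lemma coef_cong: "u \<in> L2 M \<Longrightarrow> v \<in> L2 M \<Longrightarrow> ae_eq M u v \<Longrightarrow> coef u i = coef v i"
  unfolding coef_def by (rule l2_inner_cong_ae) (auto intro: e_L2 ae_eq_refl)

lemma coef_add: "u \<in> L2 M \<Longrightarrow> v \<in> L2 M \<Longrightarrow> coef (\<lambda>x. u x + v x) i = coef u i + coef v i"
  unfolding coef_def by (intro l2_inner_add_left e_L2)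

lemma coef_diff: "u \<in> L2 M \<Longrightarrow> v \<in> L2 M \<Longrightarrow> coef (\<lambda>x. u x - v x) i = coef u i - coef v i"
  unfolding coef_def by (intro l2_inner_diff_left e_L2)

lemma coef_cmult: "coef (\<lambda>x. c * u x) i = c * coef u i"
  unfolding coef_def by (rule l2_inner_cmult_left)

lemma coef_zero [simp]: "coef (\<lambda>x. 0) i = 0"
  unfolding coef_def by simp

lemma coef_basis: "coef (e j) i = (if i = j then 1 else 0)"
  unfolding coef_def by (simp add: orthonormal)

lemma coef_psum: "coef (psum c k) i = (if deg i \<le> k then c i else 0)"
proof -
  have "coef (psum c k) i = (\<Sum>j\<in>{i. deg i \<le> k}. c j * (if i = j then 1 else 0))"
    unfolding coef_def psum_def
    by (subst l2_inner_sum_left) (auto intro: L2_cmult e_L2 simp: l2_inner_cmult_left orthonormal intro!: sum.cong)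
  also have "\<dots> = (\<Sum>j\<in>{i. deg i \<le> k}. if i = j then c j else 0)"
    by (rule sum.cong) auto
  also have "\<dots> = (if deg i \<le> k then c i else 0)"
    by (simp add: finite_levels)
  finally show ?thesis .
qed

lemma inner_psum_left:
  assumes "u \<in> L2 M"
  shows "l2_inner M (psum c k) u = (\<Sum>i\<in>{i. deg i \<le> k}. c i * cnj (coef u i))"
proof -
  have "l2_inner M (psum c k) u = (\<Sum>i\<in>{i. deg i \<le> k}. c i * l2_inner M (e i) u)"
    unfolding psum_def
    by (subst l2_inner_sum_left) (auto intro: L2_cmult e_L2 assms simp: l2_inner_cmult_left)
  then show ?thesis by (simp add: coef_def l2_inner_commute[of M _ u])
qed

lemma norm_psum: "(l2_norm M (psum c k))\<^sup>2 = (\<Sum>s\<le>k. energy c s)"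
proof -
  have "complex_of_real ((l2_norm M (psum c k))\<^sup>2) = (\<Sum>i\<in>{i. deg i \<le> k}. c i * cnj (c i))"
    by (simp add: l2_inner_self[symmetric] inner_psum_left psum_L2 coef_psum del: of_real_power)
  also have "\<dots> = complex_of_real (\<Sum>i\<in>{i. deg i \<le> k}. (cmod (c i))\<^sup>2)"
    by (simp add: complex_norm_square del: of_real_power)
  finally have "(l2_norm M (psum c k))\<^sup>2 = (\<Sum>i\<in>{i. deg i \<le> k}. (cmod (c i))\<^sup>2)"
    using of_real_eq_iff by blast
  then show ?thesis by (simp add: sum_levels energy_def)
qed

text \<open>The coefficients with degree between \<open>k\<close> and \<open>l\<close>, with a sign that makes the partial sums of
  this sequence the differences of partial sums of \<open>c\<close>.\<close>

definition window :: "('i \<Rightarrow> complex) \<Rightarrow> nat \<Rightarrow> nat \<Rightarrow> 'i \<Rightarrow> complex" where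
  "window c k l i = (if deg i \<le> k then c i else 0) - (if deg i \<le> l then c i else 0)"

lemma psum_diff: "(\<lambda>x. psum c k x - psum c l x) = psum (window c k l) (max k l)"
proof
  fix x
  have cut: "psum c m x = (\<Sum>i\<in>{i. deg i \<le> max k l}. (if deg i \<le> m then c i else 0) * e i x)" if "m \<le> max k l" for m
    unfolding psum_def
    by (rule sum.mono_neutral_cong_left) (use that finite_levels in auto)
  show "psum c k x - psum c l x = psum (window c k l) (max k l) x"
    unfolding cut[OF max.cobounded1] cut[OF max.cobounded2]
    by (simp only: psum_def window_def left_diff_distrib sum_subtractf)
qed

text \<open>The weights \<open>t\<close> serve both norms of the Sobolev space: \<open>t = 1\<close> gives the norm of differences of
  partial sums in \<open>L\<^sup>2\<close>, and \<open>t = \<lambda>\<close> gives their Dirichlet energy.\<close>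

lemma sum_energy_window:
  assumes t: "\<And>s. 0 \<le> t s"
  shows "(\<Sum>s\<le>max k l. t s * energy (window c k l) s) = \<bar>(\<Sum>s\<le>k. t s * energy c s) - (\<Sum>s\<le>l. t s * energy c s)\<bar>"
proof -
  have *: "(\<Sum>s\<le>k. t s * energy (window c k l) s) = (\<Sum>s\<le>k. t s * energy c s) - (\<Sum>s\<le>l. t s * energy c s)"
    if "l \<le> k" for k l
  proof -
    have "(\<Sum>s\<le>k. t s * energy (window c k l) s) = (\<Sum>s\<le>k. t s * energy c s - (if s \<le> l then t s * energy c s else 0))"
      using that by (intro sum.cong refl) (auto simp: energy_def window_def)
    moreover have "(\<Sum>s\<le>k. if s \<le> l then t s * energy c s else 0) = (\<Sum>s\<le>l. t s * energy c s)"
      using that by (intro sum.mono_neutral_cong_right) auto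
    ultimately show ?thesis by (simp add: sum_subtractf)
  qed
  have flip: "energy (window c k l) s = energy (window c l k) s" for k l s
    unfolding energy_def window_def by (intro sum.cong refl) (simp add: norm_minus_commute)
  have nn: "0 \<le> (\<Sum>s\<le>k. t s * energy (window c k l) s)" for k l
    by (intro sum_nonneg mult_nonneg_nonneg t energy_nonneg)
  show ?thesis
  proof (cases "l \<le> k")
    case True
    then show ?thesis using *[OF True] nn[of k l] by (simp add: max_def)
  next
    case False
    then have "k \<le> l" by simp
    then show ?thesis using *[OF \<open>k \<le> l\<close>] nn[of l k] by (simp add: max_def flip[of k l] abs_minus_commute)
  qed
qed

lemma norm_psum_diff:
  "(l2_norm M (\<lambda>x. psum c k x - psum c l x))\<^sup>2 = \<bar>(\<Sum>s\<le>k. energy c s) - (\<Sum>s\<le>l. energy c s)\<bar>"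
  unfolding psum_diff norm_psum using sum_energy_window[of "\<lambda>_. 1" c k l] by simp

lemma synthesis:
  assumes s: "summable (energy c)"
  shows "\<exists>u\<in>L2 M. (\<forall>i. coef u i = c i) \<and> (\<lambda>k. l2_norm M (\<lambda>x. psum c k x - u x)) \<longlonglongrightarrow> 0"
proof -
  have "Cauchy (\<lambda>k. \<Sum>s\<le>k. energy c s)"
    using s by (intro convergent_Cauchy) (simp add: summable_iff_convergent')
  have "\<exists>u\<in>L2 M. (\<lambda>k. l2_norm M (\<lambda>x. psum c k x - u x)) \<longlonglongrightarrow> 0"
  proof (rule Riesz_Fischer)
    show "psum c k \<in> L2 M" for k by (rule psum_L2)
    fix \<epsilon> :: real assume "\<epsilon> > 0"
    then have "\<epsilon>\<^sup>2 > 0" by simp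
    then obtain N where N: "\<And>k l. k \<ge> N \<Longrightarrow> l \<ge> N \<Longrightarrow> \<bar>(\<Sum>s\<le>k. energy c s) - (\<Sum>s\<le>l. energy c s)\<bar> < \<epsilon>\<^sup>2"
      using CauchyD[OF \<open>Cauchy (\<lambda>k. \<Sum>s\<le>k. energy c s)\<close>] by force
    have "l2_norm M (\<lambda>x. psum c k x - psum c l x) < \<epsilon>" if "k \<ge> N" "l \<ge> N" for k l
    proof (rule power2_less_imp_less)
      show "(l2_norm M (\<lambda>x. psum c k x - psum c l x))\<^sup>2 < \<epsilon>\<^sup>2"
        unfolding norm_psum_diff by (rule N[OF that])
    qed (use \<open>\<epsilon> > 0\<close> in simp)
    then show "\<exists>N. \<forall>k\<ge>N. \<forall>l\<ge>N. l2_norm M (\<lambda>x. psum c k x - psum c l x) < \<epsilon>" by blast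
  qed
  then obtain u where u: "u \<in> L2 M" and lim: "(\<lambda>k. l2_norm M (\<lambda>x. psum c k x - u x)) \<longlonglongrightarrow> 0" by blast
  have "coef u i = c i" for i
  proof (rule LIMSEQ_unique)
    show "(\<lambda>k. coef (psum c k) i) \<longlonglongrightarrow> coef u i"
      unfolding coef_def by (rule tendsto_l2_inner_left[OF psum_L2 u e_L2 lim])
    show "(\<lambda>k. coef (psum c k) i) \<longlonglongrightarrow> c i"
      by (rule tendsto_eventually, rule eventually_sequentiallyI[of "deg i"]) (simp add: coef_psum)
  qed
  then show ?thesis using u lim by blast
qed

lemma Bessel:
  assumes u: "u \<in> L2 M"
  shows "(\<Sum>s\<le>k. energy (coef u) s) \<le> (l2_norm M u)\<^sup>2"
proof -
  let ?p = "psum (coef u) k" and ?S = "\<Sum>s\<le>k. energy (coef u) s"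
  have p: "?p \<in> L2 M" by (rule psum_L2)
  have pu: "l2_inner M ?p u = of_real ?S"
    by (simp add: inner_psum_left u sum_levels energy_def complex_norm_square del: of_real_power)
  have "complex_of_real ((l2_norm M (\<lambda>x. u x - ?p x))\<^sup>2)
      = (l2_inner M u u - l2_inner M u ?p) - (l2_inner M ?p u - l2_inner M ?p ?p)"
    by (simp only: l2_inner_self[symmetric] l2_inner_diff_left l2_inner_diff_right u p L2_diff[OF u p])
  also have "\<dots> = of_real ((l2_norm M u)\<^sup>2 - ?S)"
    unfolding l2_inner_commute[of M u ?p] pu by (simp add: l2_inner_self norm_psum del: of_real_power)
  finally have "(l2_norm M (\<lambda>x. u x - ?p x))\<^sup>2 = (l2_norm M u)\<^sup>2 - ?S"
    using of_real_eq_iff by blast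
  then show ?thesis using zero_le_power2[of "l2_norm M (\<lambda>x. u x - ?p x)"] by linarith
qed

lemma summable_energy_coef: "u \<in> L2 M \<Longrightarrow> summable (energy (coef u))"
proof (rule summableI_nonneg_bounded)
  assume u: "u \<in> L2 M"
  show "(\<Sum>s<k. energy (coef u) s) \<le> (l2_norm M u)\<^sup>2" for k
  proof -
    have "(\<Sum>s<k. energy (coef u) s) \<le> (\<Sum>s\<le>k. energy (coef u) s)"
      by (rule sum_mono2) (auto simp: energy_nonneg)
    then show ?thesis using Bessel[OF u, of k] by linarith
  qed
qed (rule energy_nonneg)

lemma eq_if_coef_eq:
  assumes "u \<in> L2 M" "v \<in> L2 M" "\<And>i. coef u i = coef v i"
  shows "ae_eq M u v"
proof -
  have "ae_eq M (\<lambda>x. u x - v x) (\<lambda>x. 0)"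
  proof (rule complete)
    show "(\<lambda>x. u x - v x) \<in> L2 M" by (intro L2_diff assms)
    show "l2_inner M (\<lambda>x. u x - v x) (e i) = 0" for i
      using coef_diff[OF assms(1,2), of i] assms(3)[of i] by (simp add: coef_def)
  qed
  then show ?thesis by (simp add: ae_eq_diff_0)
qed

lemma expansion:
  assumes u: "u \<in> L2 M"
  shows "(\<lambda>k. l2_norm M (\<lambda>x. psum (coef u) k x - u x)) \<longlonglongrightarrow> 0"
proof -
  obtain v where v: "v \<in> L2 M" "\<And>i. coef v i = coef u i"
    and lim: "(\<lambda>k. l2_norm M (\<lambda>x. psum (coef u) k x - v x)) \<longlonglongrightarrow> 0"
    using synthesis[OF summable_energy_coef[OF u]] by blast
  have "l2_norm M (\<lambda>x. psum (coef u) k x - v x) = l2_norm M (\<lambda>x. psum (coef u) k x - u x)" for k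
    by (intro l2_norm_cong_ae L2_diff psum_L2 u v(1) ae_eq_diff ae_eq_refl eq_if_coef_eq v(2))
  then show ?thesis using lim by simp
qed

lemma Parseval:
  assumes u: "u \<in> L2 M"
  shows "energy (coef u) sums (l2_norm M u)\<^sup>2"
proof -
  have "(\<lambda>k. (l2_norm M (psum (coef u) k))\<^sup>2) \<longlonglongrightarrow> (l2_norm M u)\<^sup>2"
    by (intro tendsto_power tendsto_l2_norm psum_L2 u expansion)
  then show ?thesis by (simp add: norm_psum sums_def_le)
qed

lemma Parseval_inner:
  assumes u: "u \<in> L2 M" and v: "v \<in> L2 M"
  shows "(\<lambda>k. \<Sum>i\<in>{i. deg i \<le> k}. coef u i * cnj (coef v i)) \<longlonglongrightarrow> l2_inner M u v"
  using tendsto_l2_inner_left[OF psum_L2 u v expansion[OF u]] by (simp add: inner_psum_left v)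

lemma diagD:
  assumes "(u, f) \<in> diag l"
  shows "u \<in> L2 M" "f \<in> L2 M" "coef f i = of_real (l (deg i)) * coef u i"
  using assms by (auto simp: diag_def)

lemma psum_in_diag: "(psum c k, psum (\<lambda>i. of_real (l (deg i)) * c i) k) \<in> diag l"
  by (simp add: diag_def psum_L2 coef_psum)

lemma basis_in_diag: "(e i, \<lambda>x. of_real (l (deg i)) * e i x) \<in> diag l"
  by (auto simp: diag_def e_L2 L2_cmult coef_cmult coef_basis)

lemma is_l2_op_diag: "is_l2_op M (diag l)"
proof (rule is_l2_opI)
  show "u \<in> L2 M \<and> f \<in> L2 M" if "(u, f) \<in> diag l" for u f
    using that by (simp add: diag_def)
  show "((\<lambda>x. 0), (\<lambda>x. 0)) \<in> diag l" by (simp add: diag_def L2_zero)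
  show "(u', f') \<in> diag l"
    if "(u, f) \<in> diag l" "u' \<in> L2 M" "f' \<in> L2 M" "ae_eq M u u'" "ae_eq M f f'" for u f u' f'
    using that coef_cong[of u u'] coef_cong[of f f'] by (simp add: diag_def)
  show "((\<lambda>x. u x + v x), (\<lambda>x. f x + g x)) \<in> diag l"
    if "(u, f) \<in> diag l" "(v, g) \<in> diag l" for u f v g
    using that by (simp add: diag_def L2_add coef_add distrib_left)
  show "((\<lambda>x. c * u x), (\<lambda>x. c * f x)) \<in> diag l" if "(u, f) \<in> diag l" for c u f
    using that by (simp add: diag_def L2_cmult coef_cmult)
  show "ae_eq M f g" if "(u, f) \<in> diag l" "(u, g) \<in> diag l" for u f g
    using that by (intro eq_if_coef_eq) (simp_all add: diag_def)
qed

lemma densely_defined_if: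
  assumes "\<And>c k. psum c k \<in> Domain A"
  shows "densely_defined M A"
  unfolding densely_defined_def
proof (intro ballI allI impI)
  fix u \<epsilon> assume u: "u \<in> L2 M" and "(\<epsilon>::real) > 0"
  then have "eventually (\<lambda>k. l2_norm M (\<lambda>x. psum (coef u) k x - u x) < \<epsilon>) sequentially"
    by (intro order_tendstoD(2)[OF expansion[OF u]])
  then obtain k where "l2_norm M (\<lambda>x. psum (coef u) k x - u x) < \<epsilon>"
    using eventually_happens'[OF sequentially_bot] by blast
  then have "l2_norm M (\<lambda>x. u x - psum (coef u) k x) < \<epsilon>"
    by (subst l2_norm_minus_commute)
  then show "\<exists>v\<in>Domain A. l2_norm M (\<lambda>x. u x - v x) < \<epsilon>"
    using assms[of "coef u" k] by blast
qed

lemma diag_symmetric: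
  assumes uf: "(u, f) \<in> diag l" and vg: "(v, g) \<in> diag l"
  shows "l2_inner M f v = l2_inner M u g"
proof (rule LIMSEQ_unique)
  note uf = diagD[OF uf] and vg = diagD[OF vg]
  show "(\<lambda>k. \<Sum>i\<in>{i. deg i \<le> k}. coef f i * cnj (coef v i)) \<longlonglongrightarrow> l2_inner M f v"
    by (rule Parseval_inner[OF uf(2) vg(1)])
  have "coef f i * cnj (coef v i) = coef u i * cnj (coef g i)" for i
    by (simp add: uf(3) vg(3))
  then show "(\<lambda>k. \<Sum>i\<in>{i. deg i \<le> k}. coef f i * cnj (coef v i)) \<longlonglongrightarrow> l2_inner M u g"
    using Parseval_inner[OF uf(1) vg(2)] by simp
qed

text \<open>Pairing an element of the graph of the adjoint with the basis vectors, which lie in the domain,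
  already determines its coefficients.\<close>

lemma self_adjoint_diag: "self_adjoint_op M (diag l)"
  unfolding self_adjoint_op_def
proof (intro conjI)
  show "is_l2_op M (diag l)" by (rule is_l2_op_diag)
  show "densely_defined M (diag l)"
    by (rule densely_defined_if) (use psum_in_diag in blast)
  show "adjoint_op M (diag l) = diag l"
  proof
    show "diag l \<subseteq> adjoint_op M (diag l)"
    proof clarify
      fix v g assume vg: "(v, g) \<in> diag l"
      show "(v, g) \<in> adjoint_op M (diag l)"
        using diag_symmetric[OF _ vg] diagD[OF vg] by (auto simp: adjoint_op_def)
    qed
    show "adjoint_op M (diag l) \<subseteq> diag l"
    proof clarify
      fix v g assume vg: "(v, g) \<in> adjoint_op M (diag l)"
      then have L: "v \<in> L2 M" "g \<in> L2 M" by (auto simp: adjoint_op_def)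
      have "coef g i = of_real (l (deg i)) * coef v i" for i
      proof -
        have "l2_inner M (\<lambda>x. of_real (l (deg i)) * e i x) v = l2_inner M (e i) g"
          using vg basis_in_diag[of i l] by (auto simp: adjoint_op_def)
        then have "cnj (coef g i) = of_real (l (deg i)) * cnj (coef v i)"
          by (simp add: l2_inner_cmult_left coef_def flip: l2_inner_commute)
        then show ?thesis by (metis complex_cnj_cnj complex_cnj_mult complex_cnj_complex_of_real)
      qed
      then show "(v, g) \<in> diag l" by (simp add: diag_def L)
    qed
  qed
qed

lemma psum_in_op:
  assumes A: "is_l2_op M A" and e: "\<And>i. (e i, \<lambda>x. of_real (l (deg i)) * e i x) \<in> A"
  shows "(psum c k, psum (\<lambda>i. of_real (l (deg i)) * c i) k) \<in> A"
  using is_l2_op_sum[OF A, of "{i. deg i \<le> k}" e "\<lambda>i x. of_real (l (deg i)) * e i x" c] e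
  unfolding psum_def by (simp add: mult_ac)

text \<open>The relation between the coefficients of \<open>u\<close> and \<open>f\<close> survives limits, so the closure cannot be
  larger than the diagonal operator. Conversely, the partial sums of the two expansions approximate
  every element of the graph of the diagonal operator, and they belong to the graph of \<open>A\<close> by
  linearity.\<close>

lemma closure_eq_diag:
  assumes A: "is_l2_op M A" and sub: "A \<subseteq> diag l"
    and e: "\<And>i. (e i, \<lambda>x. of_real (l (deg i)) * e i x) \<in> A"
  shows "closure_op M A = diag l"
proof
  show "closure_op M A \<subseteq> diag l"
  proof clarify
    fix u f assume "(u, f) \<in> closure_op M A"
    then obtain v g where L: "u \<in> L2 M" "f \<in> L2 M" and vg: "\<And>k. (v k, g k) \<in> A"
      and lim: "(\<lambda>k. l2_norm M (\<lambda>x. v k x - u x)) \<longlonglongrightarrow> 0" "(\<lambda>k. l2_norm M (\<lambda>x. g k x - f x)) \<longlonglongrightarrow> 0"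
      unfolding closure_op_def by blast
    note vgD = diagD[OF subsetD[OF sub vg]]
    have "coef f i = of_real (l (deg i)) * coef u i" for i
    proof (rule LIMSEQ_unique)
      show "(\<lambda>k. coef (g k) i) \<longlonglongrightarrow> coef f i"
        unfolding coef_def by (rule tendsto_l2_inner_left[OF vgD(2) L(2) e_L2 lim(2)])
      have "(\<lambda>k. coef (v k) i) \<longlonglongrightarrow> coef u i"
        unfolding coef_def by (rule tendsto_l2_inner_left[OF vgD(1) L(1) e_L2 lim(1)])
      then show "(\<lambda>k. coef (g k) i) \<longlonglongrightarrow> of_real (l (deg i)) * coef u i"
        unfolding vgD(3) by (rule tendsto_mult_left)
    qed
    then show "(u, f) \<in> diag l" by (simp add: diag_def L)
  qed
  show "diag l \<subseteq> closure_op M A"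
  proof clarify
    fix u f assume uf: "(u, f) \<in> diag l"
    note D = diagD[OF uf]
    have "psum (coef f) k = psum (\<lambda>i. of_real (l (deg i)) * coef u i) k" for k
      unfolding D(3) by simp
    then have "(psum (coef u) k, psum (coef f) k) \<in> A" for k
      using psum_in_op[OF A e, of "coef u" k] by simp
    then show "(u, f) \<in> closure_op M A"
      unfolding closure_op_def using D(1,2) expansion[OF D(1)] expansion[OF D(2)] by blast
  qed
qed

lemma symmetric_op_if:
  assumes A: "is_l2_op M A" and sub: "A \<subseteq> diag l"
    and e: "\<And>i. (e i, \<lambda>x. of_real (l (deg i)) * e i x) \<in> A"
  shows "symmetric_op M A"
  unfolding symmetric_op_def
proof (intro conjI A)
  show "densely_defined M A"
    by (rule densely_defined_if) (use psum_in_op[OF A e] in blast)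
  show "\<forall>(u, f)\<in>A. \<forall>(v, g)\<in>A. l2_inner M f v = l2_inner M u g"
    using sub diag_symmetric by blast
qed

lemma norm_basis: "l2_norm M (e i) = 1"
proof -
  have "complex_of_real ((l2_norm M (e i))\<^sup>2) = 1"
    unfolding l2_inner_self[symmetric] by (simp add: orthonormal)
  then have "(l2_norm M (e i))\<^sup>2 = 1\<^sup>2" by (simp del: of_real_power)
  then show ?thesis by (rule power2_eq_imp_eq) (simp_all add: l2_norm_nonneg)
qed

lemma unbounded_if:
  assumes e: "\<And>i. (e i, \<lambda>x. of_real (l (deg i)) * e i x) \<in> A"
    and lim: "filterlim l at_top sequentially" and surj: "surj deg"
  shows "\<not> bounded_op M A"
proof
  assume "bounded_op M A"
  then obtain C where C: "\<And>u f. (u, f) \<in> A \<Longrightarrow> l2_norm M f \<le> C * l2_norm M u"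
    unfolding bounded_op_def by blast
  have "\<bar>l s\<bar> \<le> C" for s
  proof -
    obtain i where "deg i = s" using surj by (metis surjD)
    then show ?thesis using C[OF e[of i]] by (simp add: l2_norm_cmult norm_basis)
  qed
  moreover obtain s where "l s > C"
    using lim unfolding filterlim_at_top_dense by (metis eventually_sequentially order_refl)
  ultimately show False by (metis abs_ge_self linorder_not_less order_trans)
qed

lemma inj_basis: "inj e"
proof
  fix i j assume "e i = e j"
  then have "l2_inner M (e i) (e j) = 1" using orthonormal[of i i] by simp
  then show "i = j" by (simp add: orthonormal split: if_splits)
qed

text \<open>For an eigenvector only the coefficients in degree \<open>s\<close> survive, since \<open>l\<close> is injective; as there
  are finitely many of them, the vector is a finite combination of basis vectors and thus lies in
  the domain of \<open>A\<close> without passing to the closure.\<close>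

lemma eigenspace_eq_span:
  assumes A: "is_l2_op M A" and sub: "A \<subseteq> diag l"
    and e: "\<And>i. (e i, \<lambda>x. of_real (l (deg i)) * e i x) \<in> A" and inj: "inj l"
  shows "eigenspace A (of_real (l s)) = l2_span M (e ` {i. deg i = s})"
proof
  show "eigenspace A (of_real (l s)) \<subseteq> l2_span M (e ` {i. deg i = s})"
  proof
    fix u assume "u \<in> eigenspace A (of_real (l s))"
    then have "(u, \<lambda>x. of_real (l s) * u x) \<in> diag l" using sub by (auto simp: eigenspace_def)
    note D = diagD[OF this]
    have 0: "coef u i = 0" if "deg i \<noteq> s" for i
    proof -
      have "l (deg i) \<noteq> l s" using inj that by (simp add: inj_eq)
      then show ?thesis using D(3)[of i] by (simp add: coef_cmult)
    qed
    have "ae_eq M u (\<lambda>x. \<Sum>i\<in>{i. deg i = s}. coef u i * e i x)"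
    proof (rule eq_if_coef_eq[OF D(1)])
      show L: "(\<lambda>x. \<Sum>i\<in>{i. deg i = s}. coef u i * e i x) \<in> L2 M"
        by (intro L2_sum L2_cmult e_L2)
      fix j
      have "coef (\<lambda>x. \<Sum>i\<in>{i. deg i = s}. coef u i * e i x) j
          = (\<Sum>i\<in>{i. deg i = s}. coef u i * coef (e i) j)"
        unfolding coef_def by (subst l2_inner_sum_left) (auto intro: L2_cmult e_L2 simp: l2_inner_cmult_left)
      also have "\<dots> = (\<Sum>i\<in>{i. deg i = s}. if j = i then coef u i else 0)"
        by (rule sum.cong) (auto simp: coef_basis)
      also have "\<dots> = coef u j" using 0[of j] by (simp add: finite_level)
      finally show "coef u j = coef (\<lambda>x. \<Sum>i\<in>{i. deg i = s}. coef u i * e i x) j" ..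
    qed
    also have "(\<lambda>x. \<Sum>i\<in>{i. deg i = s}. coef u i * e i x)
        = (\<lambda>x. \<Sum>v\<in>e ` {i. deg i = s}. l2_inner M u v * v x)"
      by (subst sum.reindex) (auto intro: inj_on_subset[OF inj_basis] simp: coef_def)
    finally show "u \<in> l2_span M (e ` {i. deg i = s})"
      unfolding l2_span_def using D(1) finite_level[of s] by blast
  qed
  show "l2_span M (e ` {i. deg i = s}) \<subseteq> eigenspace A (of_real (l s))"
  proof
    fix u assume "u \<in> l2_span M (e ` {i. deg i = s})"
    then obtain F c where u: "u \<in> L2 M" and F: "finite F" "F \<subseteq> e ` {i. deg i = s}"
      and eq: "ae_eq M u (\<lambda>x. \<Sum>v\<in>F. c v * v x)" by (auto simp: l2_span_def)
    have "(v, \<lambda>x. of_real (l s) * v x) \<in> A" if "v \<in> F" for v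
      using that F(2) e by blast
    from is_l2_op_sum[OF A this, where I = F and c = c]
    have "((\<lambda>x. \<Sum>v\<in>F. c v * v x), (\<lambda>x. of_real (l s) * (\<Sum>v\<in>F. c v * v x))) \<in> A"
      by (simp add: sum_distrib_left mult.left_commute)
    from is_l2_opD(3)[OF A this u L2_cmult[OF u] ae_eq_sym[OF eq] ae_eq_cmult[OF ae_eq_sym[OF eq]]]
    show "u \<in> eigenspace A (of_real (l s))" by (simp add: eigenspace_def)
  qed
qed

lemma eigenvalues_eq:
  assumes sub: "A \<subseteq> diag l"
    and e: "\<And>i. (e i, \<lambda>x. of_real (l (deg i)) * e i x) \<in> A" and surj: "surj deg"
  shows "eigenvalues M A = (\<lambda>s. complex_of_real (l s)) ` UNIV"
proof
  show "eigenvalues M A \<subseteq> (\<lambda>s. complex_of_real (l s)) ` UNIV"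
  proof
    fix z assume "z \<in> eigenvalues M A"
    then obtain u where "(u, \<lambda>x. z * u x) \<in> A" and nz: "\<not> ae_eq M u (\<lambda>x. 0)"
      by (auto simp: eigenvalues_def eigenspace_def)
    then have "(u, \<lambda>x. z * u x) \<in> diag l" using sub by auto
    note D = diagD[OF this]
    obtain i where "coef u i \<noteq> 0"
      using complete[OF D(1)] nz by (auto simp: coef_def)
    then have "z = of_real (l (deg i))" using D(3)[of i] by (simp add: coef_cmult)
    then show "z \<in> (\<lambda>s. complex_of_real (l s)) ` UNIV" by blast
  qed
  show "(\<lambda>s. complex_of_real (l s)) ` UNIV \<subseteq> eigenvalues M A"
  proof clarify
    fix s
    obtain i where i: "deg i = s" using surj by (metis surjD)
    have "\<not> ae_eq M (e i) (\<lambda>x. 0)"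
      using l2_norm_eq_0_iff[OF e_L2[of i]] norm_basis[of i] by simp
    then show "complex_of_real (l s) \<in> eigenvalues M A"
      using e[of i] i by (auto simp: eigenvalues_def eigenspace_def)
  qed
qed

lemma summable_energy_le:
  assumes "summable (energy c)" "\<And>i. cmod (d i) \<le> K * cmod (c i)"
  shows "summable (energy d)"
proof (rule summable_comparison_test'[OF summable_mult[OF assms(1), of "K\<^sup>2"], of 0])
  fix s
  have "energy d s \<le> (\<Sum>i\<in>{i. deg i = s}. (K * cmod (c i))\<^sup>2)"
    unfolding energy_def by (intro sum_mono power_mono assms(2)) auto
  then show "norm (energy d s) \<le> K\<^sup>2 * energy c s"
    using energy_nonneg[of d s] by (simp add: energy_def power_mult_distrib sum_distrib_left)
qed

text \<open>Since \<open>l\<close> tends to infinity, a number \<open>z\<close> which is not one of the values has positive distance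
  from all of them. Division of the coefficients by \<open>l s - z\<close> is then a bounded inverse.\<close>

lemma spectrum_diag:
  assumes lim: "filterlim l at_top sequentially" and surj: "surj deg"
  shows "spectrum_op M (diag l) = (\<lambda>s. complex_of_real (l s)) ` UNIV"
proof -
  have "z \<in> resolvent_set M (diag l) \<longleftrightarrow> z \<notin> (\<lambda>s. complex_of_real (l s)) ` UNIV" for z
  proof
    assume z: "z \<in> resolvent_set M (diag l)"
    show "z \<notin> (\<lambda>s. complex_of_real (l s)) ` UNIV"
    proof
      assume "z \<in> (\<lambda>s. complex_of_real (l s)) ` UNIV"
      then obtain i where i: "z = of_real (l (deg i))" using surj by (metis imageE surjD)
      obtain C where "\<And>u f. (u, f) \<in> diag l \<Longrightarrow> l2_norm M u \<le> C * l2_norm M (\<lambda>x. f x - z * u x)"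
        using z unfolding resolvent_set_def by blast
      from this[OF basis_in_diag[of i]] have "l2_norm M (e i) \<le> C * l2_norm M (\<lambda>x. 0)" by (simp add: i)
      moreover have "l2_norm M (\<lambda>x. 0) = 0" by (simp add: l2_norm_def)
      ultimately show False by (simp add: norm_basis)
    qed
  next
    assume z: "z \<notin> (\<lambda>s. complex_of_real (l s)) ` UNIV"
    \<comment> \<open>Beyond \<open>S\<close> the distance from \<open>z\<close> is at least one; only finitely many values remain.\<close>
    obtain S where S: "\<And>s. s \<ge> S \<Longrightarrow> l s \<ge> Re z + 1"
      using lim unfolding filterlim_at_top eventually_sequentially by blast
    define \<delta> where "\<delta> = Min (insert 1 ((\<lambda>s. cmod (of_real (l s) - z)) ` {..<S}))"
    have \<delta>: "\<delta> > 0" unfolding \<delta>_def using z by (subst Min_gr_iff) auto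
    have gap: "\<delta> \<le> cmod (of_real (l s) - z)" for s
    proof (cases "s < S")
      case True then show ?thesis unfolding \<delta>_def by (intro Min_le) auto
    next
      case False
      have "\<delta> \<le> 1" unfolding \<delta>_def by (intro Min_le) auto
      also have "1 \<le> Re (of_real (l s) - z)" using S[of s] False by simp
      also have "\<dots> \<le> cmod (of_real (l s) - z)" by (rule complex_Re_le_cmod)
      finally show ?thesis .
    qed
    have onto: "\<exists>(u, f)\<in>diag l. ae_eq M h (\<lambda>x. f x - z * u x)" if h: "h \<in> L2 M" for h
    proof -
      define c where "c i = coef h i / (of_real (l (deg i)) - z)" for i
      have nz: "of_real (l s) - z \<noteq> 0" for s using gap[of s] \<delta> by auto
      have "cmod (c i) \<le> (1 / \<delta>) * cmod (coef h i)" for i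
      proof -
        have "cmod (coef h i) * \<delta> \<le> cmod (coef h i) * cmod (of_real (l (deg i)) - z)"
          by (intro mult_left_mono gap) auto
        then show ?thesis using \<delta> nz[of "deg i"] by (simp add: c_def norm_divide field_simps)
      qed
      from summable_energy_le[OF summable_energy_coef[OF h] this]
      obtain u where u: "u \<in> L2 M" "\<And>i. coef u i = c i" using synthesis by blast
      have "(u, \<lambda>x. h x + z * u x) \<in> diag l"
        using nz by (simp add: diag_def u h L2_add L2_cmult coef_add coef_cmult) (simp add: c_def field_simps)
      then show ?thesis by (force simp: ae_eq_refl)
    qed
    have "l2_norm M u \<le> (1 / \<delta>) * l2_norm M (\<lambda>x. f x - z * u x)" if uf: "(u, f) \<in> diag l" for u f
    proof -
      note D = diagD[OF uf]
      have L: "(\<lambda>x. f x - z * u x) \<in> L2 M" by (intro L2_diff L2_cmult D)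
      have c: "coef (\<lambda>x. f x - z * u x) i = (of_real (l (deg i)) - z) * coef u i" for i
        by (simp add: coef_diff D L2_cmult coef_cmult left_diff_distrib)
      have "\<delta>\<^sup>2 * energy (coef u) s \<le> energy (coef (\<lambda>x. f x - z * u x)) s" for s
        unfolding energy_def c sum_distrib_left norm_mult power_mult_distrib
        using gap \<delta> by (intro sum_mono mult_right_mono power_mono) auto
      then have "\<delta>\<^sup>2 * (l2_norm M u)\<^sup>2 \<le> (l2_norm M (\<lambda>x. f x - z * u x))\<^sup>2"
        using sums_le[OF _ sums_mult[OF Parseval[OF D(1)]] Parseval[OF L]] by blast
      then have "(\<delta> * l2_norm M u)\<^sup>2 \<le> (l2_norm M (\<lambda>x. f x - z * u x))\<^sup>2" by (simp add: power_mult_distrib)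
      then have "\<delta> * l2_norm M u \<le> l2_norm M (\<lambda>x. f x - z * u x)"
        by (rule power2_le_imp_le) (rule l2_norm_nonneg)
      then show ?thesis using \<delta> by (simp add: field_simps)
    qed
    then show "z \<in> resolvent_set M (diag l)"
      unfolding resolvent_set_def using onto by blast
  qed
  then show ?thesis unfolding spectrum_op_def by blast
qed

lemma Domain_diag:
  "Domain (diag l) = {u \<in> L2 M. summable (\<lambda>s. (l s)\<^sup>2 * energy (coef u) s)}"
proof -
  have en: "energy (\<lambda>i. of_real (l (deg i)) * coef u i) = (\<lambda>s. (l s)\<^sup>2 * energy (coef u) s)" for u
    by (auto simp: energy_def sum_distrib_left norm_mult power_mult_distrib intro!: sum.cong)
  show ?thesis
  proof (intro set_eqI iffI)
    fix u assume "u \<in> Domain (diag l)"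
    then obtain f where "(u, f) \<in> diag l" by blast
    note D = diagD[OF this]
    have "coef f = (\<lambda>i. of_real (l (deg i)) * coef u i)" using D(3) by blast
    then show "u \<in> {u \<in> L2 M. summable (\<lambda>s. (l s)\<^sup>2 * energy (coef u) s)}"
      using summable_energy_coef[OF D(2)] D(1) by (simp add: en)
  next
    fix u assume u: "u \<in> {u \<in> L2 M. summable (\<lambda>s. (l s)\<^sup>2 * energy (coef u) s)}"
    then obtain f where "f \<in> L2 M" "\<And>i. coef f i = of_real (l (deg i)) * coef u i"
      using synthesis[of "\<lambda>i. of_real (l (deg i)) * coef u i"] by (auto simp: en)
    then have "(u, f) \<in> diag l" using u by (simp add: diag_def)
    then show "u \<in> Domain (diag l)" by blast
  qed
qed

text \<open>Uniqueness is the substantial direction. If \<open>B\<close> is a nonnegative self-adjoint root, and \<open>h\<close> is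
  the value of \<open>B\<close> at the basis vector \<open>e\<close> with eigenvalue \<open>r\<^sup>2\<close>, then \<open>g = h - r e\<close> satisfies
  \<open>B g = - r g\<close>; nonnegativity forces \<open>g = 0\<close> if \<open>r > 0\<close>, and symmetry gives \<open>h = 0\<close> if \<open>r = 0\<close>. So \<open>B\<close> is diagonal on the basis, and its
  self-adjointness leaves no other choice than the maximal diagonal operator.\<close>

lemma sqrt_op_diag:
  assumes l: "\<And>s. l s \<ge> 0"
  shows "is_sqrt_op M (diag l) B \<longleftrightarrow> B = diag (\<lambda>s. sqrt (l s))"
proof
  let ?R = "diag (\<lambda>s. sqrt (l s))"
  assume "B = ?R"
  moreover have "is_sqrt_op M (diag l) ?R"
    unfolding is_sqrt_op_def
  proof (intro conjI self_adjoint_diag)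
    show "\<forall>(u, f)\<in>?R. 0 \<le> Re (l2_inner M f u)"
    proof clarify
      fix u f assume "(u, f) \<in> ?R"
      note D = diagD[OF this]
      have "(\<lambda>k. Re (\<Sum>i\<in>{i. deg i \<le> k}. coef f i * cnj (coef u i))) \<longlonglongrightarrow> Re (l2_inner M f u)"
        by (intro tendsto_Re Parseval_inner D)
      moreover have "0 \<le> Re (\<Sum>i\<in>{i. deg i \<le> k}. coef f i * cnj (coef u i))" for k
      proof -
        have "coef f i * cnj (coef u i) = of_real (sqrt (l (deg i)) * (cmod (coef u i))\<^sup>2)" for i
          by (simp add: D(3) complex_norm_square mult.assoc del: of_real_power)
        then show ?thesis using l by (auto intro!: sum_nonneg)
      qed
      ultimately show "0 \<le> Re (l2_inner M f u)" by (meson LIMSEQ_le_const)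
    qed
    show "?R O ?R = diag l"
    proof
      show "?R O ?R \<subseteq> diag l"
      proof clarify
        fix u h f assume "(u, h) \<in> ?R" "(h, f) \<in> ?R"
        then show "(u, f) \<in> diag l"
          using l by (auto simp: diag_def mult.assoc[symmetric] simp flip: of_real_mult)
      qed
      show "diag l \<subseteq> ?R O ?R"
      proof clarify
        fix u f assume uf: "(u, f) \<in> diag l"
        note D = diagD[OF uf]
        \<comment> \<open>A vector in the domain of the operator lies in the domain of the root, as \<open>l \<le> 1 + l\<^sup>2\<close>.\<close>
        have en: "(sqrt (l s))\<^sup>2 * energy (coef u) s \<le> energy (coef u) s + (l s)\<^sup>2 * energy (coef u) s" for s
        proof -
          have "l s \<le> 1 + (l s)\<^sup>2"
            using two_mult_le_sum_squares[of 1 "l s"] l[of s] by simp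
          from mult_right_mono[OF this energy_nonneg[of "coef u" s]]
          show ?thesis using l[of s] by (simp add: distrib_right)
        qed
        have "summable (\<lambda>s. energy (coef u) s + (l s)\<^sup>2 * energy (coef u) s)"
          using uf Domain_diag[of l] by (intro summable_add summable_energy_coef D) auto
        then have "summable (\<lambda>s. (sqrt (l s))\<^sup>2 * energy (coef u) s)"
        proof (rule summable_comparison_test'[of _ 0])
          fix s show "norm ((sqrt (l s))\<^sup>2 * energy (coef u) s) \<le> energy (coef u) s + (l s)\<^sup>2 * energy (coef u) s"
            using en[of s] l[of s] energy_nonneg[of "coef u" s] by simp
        qed
        then have "u \<in> Domain ?R" unfolding Domain_diag using D(1) by simp
        then obtain h where h: "(u, h) \<in> ?R" by blast
        then have "(h, f) \<in> ?R"
          using uf l by (auto simp: diag_def mult.assoc[symmetric] simp flip: of_real_mult)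
        then show "(u, f) \<in> ?R O ?R" using h by blast
      qed
    qed
  qed
  ultimately show "is_sqrt_op M (diag l) B" by simp
next
  let ?R = "diag (\<lambda>s. sqrt (l s))"
  assume B: "is_sqrt_op M (diag l) B"
  then have sa: "self_adjoint_op M B" and pos: "\<And>u f. (u, f) \<in> B \<Longrightarrow> 0 \<le> Re (l2_inner M f u)"
    and sq: "B O B = diag l" unfolding is_sqrt_op_def by blast+
  have op: "is_l2_op M B" and adj: "adjoint_op M B = B" using sa unfolding self_adjoint_op_def by blast+
  have sym: "l2_inner M f v = l2_inner M u g" if "(u, f) \<in> B" "(v, g) \<in> B" for u f v g
  proof -
    have "(v, g) \<in> adjoint_op M B" using that adj by simp
    then show ?thesis using that(1) by (auto simp: adjoint_op_def)
  qed
  have e: "(e i, \<lambda>x. of_real (sqrt (l (deg i))) * e i x) \<in> B" for i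
  proof -
    let ?l = "complex_of_real (l (deg i))" and ?r = "complex_of_real (sqrt (l (deg i)))"
    have rr: "?r * ?r = ?l" using l by (simp flip: of_real_mult)
    have "(e i, \<lambda>x. ?l * e i x) \<in> B O B" unfolding sq by (rule basis_in_diag)
    then obtain h where h: "(e i, h) \<in> B" "(h, \<lambda>x. ?l * e i x) \<in> B" by blast
    note hL = is_l2_opD(2)[OF op h(1)]
    have "ae_eq M h (\<lambda>x. ?r * e i x)"
    proof (cases "l (deg i) = 0")
      case True
      have "l2_inner M h h = l2_inner M (e i) (\<lambda>x. ?l * e i x)" by (rule sym[OF h])
      then have "l2_norm M h = 0" using True by (simp add: l2_inner_self)
      then show ?thesis using hL True by (simp add: l2_norm_eq_0_iff)
    next
      case False
      then have r: "sqrt (l (deg i)) > 0" using l[of "deg i"] by simp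
      let ?g = "\<lambda>x. h x - ?r * e i x"
      have gL: "?g \<in> L2 M" by (intro L2_diff hL L2_cmult e_L2)
      have "(?g, \<lambda>x. ?l * e i x - ?r * h x) \<in> B"
        by (rule is_l2_op_diff[OF op h(2) is_l2_opD(6)[OF op h(1)]])
      moreover have "(\<lambda>x. ?l * e i x - ?r * h x) = (\<lambda>x. - ?r * ?g x)"
        by (rule ext) (simp add: algebra_simps flip: rr)
      ultimately have "0 \<le> Re (l2_inner M (\<lambda>x. - ?r * ?g x) ?g)" using pos by metis
      also have "\<dots> = - sqrt (l (deg i)) * (l2_norm M ?g)\<^sup>2"
        by (simp only: l2_inner_cmult_left l2_inner_self) simp
      finally have "sqrt (l (deg i)) * (l2_norm M ?g)\<^sup>2 \<le> 0" by simp
      then have "l2_norm M ?g = 0"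
        using r zero_le_power2[of "l2_norm M ?g"] by (simp add: mult_le_0_iff)
      then have "ae_eq M ?g (\<lambda>x. 0)" using gL by (simp add: l2_norm_eq_0_iff)
      then show ?thesis by (simp only: ae_eq_diff_0)
    qed
    then show ?thesis
      by (intro is_l2_opD(3)[OF op h(1)] e_L2 L2_cmult ae_eq_refl)
  qed
  have BR: "B \<subseteq> ?R"
  proof clarify
    fix u f assume uf: "(u, f) \<in> B"
    have "coef f i = of_real (sqrt (l (deg i))) * coef u i" for i
      using sym[OF uf e[of i]] by (simp add: coef_def l2_inner_cmult_right)
    then show "(u, f) \<in> ?R" using is_l2_opD(1,2)[OF op uf] by (simp add: diag_def)
  qed
  moreover have "?R \<subseteq> B"
  proof -
    have "?R \<subseteq> adjoint_op M B"
    proof clarify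
      fix v g assume vg: "(v, g) \<in> ?R"
      show "(v, g) \<in> adjoint_op M B"
        using diag_symmetric[OF _ vg] BR diagD[OF vg] by (auto simp: adjoint_op_def)
    qed
    then show ?thesis by (simp add: adj)
  qed
  ultimately show "B = ?R" by blast
qed

end

section \<open>The Baran metric and its volume\<close>

definition bary0 :: "real^'n::finite \<Rightarrow> real" where
  "bary0 x = 1 - (\<Sum>k\<in>UNIV. x $ k)"

definition bary_prod :: "real^'n::finite \<Rightarrow> real" where
  "bary_prod x = bary0 x * (\<Prod>i\<in>UNIV. x $ i)"

definition weight :: "real^'n::finite \<Rightarrow> real" where
  "weight x = 1 / sqrt (bary_prod x)"

text \<open>The inverse of the matrix of the Baran metric, see \<open>matrix_inv_baran_metric\<close>.\<close>

definition ginv :: "real^'n::finite \<Rightarrow> 'n \<Rightarrow> 'n \<Rightarrow> real" where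
  "ginv x i j = (if i = j then x $ i else 0) - x $ i * x $ j"

lemma simplexD:
  assumes "x \<in> open_simplex"
  shows "0 < bary0 x" "0 < x $ i" "x $ i < 1" "0 < bary_prod x" "0 < weight x"
proof -
  show *: "0 < bary0 x" "0 < x $ i" using assms by (auto simp: open_simplex_def bary0_def)
  have "x $ i \<le> (\<Sum>k\<in>UNIV. x $ k)"
    using assms by (intro member_le_sum) (auto simp: open_simplex_def intro: less_imp_le)
  then show "x $ i < 1" using *(1) by (simp add: bary0_def)
  show "0 < bary_prod x"
    unfolding bary_prod_def using assms *(1) by (intro mult_pos_pos prod_pos) (auto simp: open_simplex_def)
  then show "0 < weight x" by (simp add: weight_def)
qed

lemma open_simplex_alt: "x \<in> open_simplex \<longleftrightarrow> 0 < bary0 x \<and> (\<forall>i. 0 < x $ i)"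
  by (auto simp: open_simplex_def bary0_def)

lemma open_open_simplex: "open (open_simplex :: (real^'n::finite) set)"
proof -
  have "open_simplex = {x::real^'n. (\<Sum>i\<in>UNIV. x $ i) < 1} \<inter> (\<Inter>i. {x. 0 < x $ i})"
    by (auto simp: open_simplex_def)
  also have "open \<dots>"
    by (intro open_Int open_INT finite open_Collect_less continuous_intros ballI)
  finally show ?thesis .
qed

lemma borel_open_simplex [measurable]: "(open_simplex :: (real^'n::finite) set) \<in> sets borel"
  by (intro borel_open open_open_simplex)

lemma bounded_open_simplex: "bounded (open_simplex :: (real^'n::finite) set)"
proof (rule boundedI)
  fix x :: "real^'n" assume x: "x \<in> open_simplex"
  have "norm x \<le> (\<Sum>i\<in>UNIV. \<bar>x $ i\<bar>)" by (rule norm_le_l1_cart)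
  also have "\<dots> = (\<Sum>i\<in>UNIV. x $ i)" using simplexD(2)[OF x] by (simp add: less_imp_le)
  also have "\<dots> \<le> 1" using simplexD(1)[OF x] by (simp add: bary0_def)
  finally show "norm x \<le> 1" .
qed

lemma sum_if_mult: "(\<Sum>j\<in>UNIV. (if i = j then a j else 0) * f j) = a i * (f i :: 'a::comm_semiring_1)"
  for i :: "'n::finite"
proof -
  have "(\<Sum>j\<in>UNIV. (if i = j then a j else 0) * f j) = (\<Sum>j\<in>UNIV. if i = j then a j * f j else 0)"
    by (rule sum.cong) auto
  then show ?thesis by simp
qed

lemma baran_metric_mult_ginv:
  fixes x :: "real^'n::finite"
  assumes x: "x \<in> open_simplex"
  shows "baran_metric x ** (\<chi> i j. ginv x i j) = mat 1" "(\<chi> i j. ginv x i j) ** baran_metric x = mat 1"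
proof -
  have nz: "bary0 x \<noteq> 0" "x $ i \<noteq> 0" for i using simplexD[OF x] by (auto simp: less_le)
  have sx: "(\<Sum>k\<in>UNIV. x $ k) = 1 - bary0 x" by (simp add: bary0_def)
  have col: "(\<Sum>k\<in>UNIV. ginv x k j) = x $ j * bary0 x" for j
  proof -
    have "(\<Sum>k\<in>UNIV. ginv x k j) = x $ j - (\<Sum>k\<in>UNIV. x $ k) * x $ j"
      by (simp add: ginv_def sum_subtractf sum_distrib_right)
    then show ?thesis by (simp add: sx algebra_simps)
  qed
  have sym: "ginv x i j = ginv x j i" for i j by (auto simp: ginv_def)
  have e: "(\<Sum>k\<in>UNIV. ((if i = k then 1 / x $ i else 0) + 1 / bary0 x) * ginv x k j) = (if i = j then 1 else 0)" for i j
  proof -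
    have "(\<Sum>k\<in>UNIV. ((if i = k then 1 / x $ i else 0) + 1 / bary0 x) * ginv x k j)
        = (\<Sum>k\<in>UNIV. (if i = k then 1 / x $ i else 0) * ginv x k j) + 1 / bary0 x * (\<Sum>k\<in>UNIV. ginv x k j)"
      by (simp add: distrib_right sum.distrib sum_distrib_left)
    also have "\<dots> = 1 / x $ i * ginv x i j + x $ j"
      by (simp add: sum_if_mult col nz)
    also have "\<dots> = (if i = j then 1 else 0)"
      using nz(2)[of i] by (simp add: ginv_def field_simps)
    finally show ?thesis .
  qed
  show 1: "baran_metric x ** (\<chi> i j. ginv x i j) = mat 1"
    using e by (simp add: vec_eq_iff matrix_matrix_mult_def baran_metric_def mat_def flip: bary0_def)
  show "(\<chi> i j. ginv x i j) ** baran_metric x = mat 1"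
    using 1 by (simp add: matrix_left_right_inverse)
qed

lemma matrix_inv_baran_metric:
  assumes "x \<in> open_simplex"
  shows "matrix_inv (baran_metric x) $ i $ j = ginv x i j"
proof -
  let ?G = "baran_metric x" and ?H = "\<chi> i j. ginv x i j"
  note H = baran_metric_mult_ginv[OF assms]
  have inv: "?G ** matrix_inv ?G = mat 1 \<and> matrix_inv ?G ** ?G = mat 1"
    unfolding matrix_inv_def by (rule someI[of _ ?H]) (use H in blast)
  have "matrix_inv ?G = (?H ** ?G) ** matrix_inv ?G"
    by (simp only: H matrix_mul_lid)
  also have "\<dots> = ?H ** (?G ** matrix_inv ?G)"
    by (simp only: matrix_mul_assoc)
  also have "\<dots> = ?H" by (simp only: inv[THEN conjunct1] matrix_mul_rid)
  finally show ?thesis by simp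
qed

text \<open>The constant row is added to one row of the diagonal matrix at a time. By multilinearity each
  step adds a determinant in which one row is constant, and in such a determinant row operations
  remove the constants from all other rows.\<close>

lemma det_diag_plus_const:
  fixes d :: "'n::finite \<Rightarrow> real"
  assumes nz: "\<And>i. d i \<noteq> 0"
  shows "det (\<chi> i j. (if i = j then d i else 0) + c :: real^'n^'n) = (\<Prod>i\<in>UNIV. d i) * (1 + c * (\<Sum>i\<in>UNIV. 1 / d i))"
proof -
  let ?e = "\<lambda>i::'n. (\<chi> j. if i = j then d i else 0) :: real^'n" and ?c = "(\<chi> j. c) :: real^'n"
  have one: "det (\<chi> i. if i = k then ?c else ?e i + (if i \<in> K then ?c else 0)) = c * (\<Prod>i\<in>UNIV - {k}. d i)"
    if "finite K" for K k
    using that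
  proof (induction K rule: finite_induct)
    case empty
    let ?A = "\<chi> i. if i = k then ?c else ?e i"
    \<comment> \<open>This combination of the other rows clears the constant row \<open>k\<close> off its diagonal entry.\<close>
    let ?x = "\<Sum>j\<in>UNIV - {k}. (- c / d j) *s row j ?A"
    have "?x \<in> vec.span {row j ?A |j. j \<noteq> k}"
      by (intro vec.span_sum vec.span_scale vec.span_base) auto
    from det_row_span[OF this] have "det ?A = det (\<chi> i. if i = k then row k ?A + ?x else row i ?A)" by simp
    also have "(\<chi> i. if i = k then row k ?A + ?x else row i ?A) = (\<chi> i j. if i = j then (if i = k then c else d i) else 0)"
    proof -
      have "(row k ?A + ?x) $ l = (if l = k then c else 0)" for l
      proof -
        have "?x $ l = (\<Sum>j\<in>UNIV - {k}. if l = j then - c else 0)"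
          unfolding sum_component using nz
          by (intro sum.cong) (auto simp: row_def)
        also have "\<dots> = (if l = k then 0 else - c)" by simp
        finally show ?thesis by (simp add: row_def)
      qed
      then show ?thesis by (auto simp: vec_eq_iff row_def)
    qed
    also have "det \<dots> = (\<Prod>i\<in>UNIV. if i = k then c else d i)"
      by (subst det_diagonal) auto
    also have "\<dots> = c * (\<Prod>i\<in>UNIV - {k}. d i)"
      by (subst prod.remove[of _ k]) (auto intro!: prod.cong)
    finally show ?case by (simp cong: if_cong)
  next
    case (insert i K)
    show ?case
    proof (cases "i = k")
      case True
      have "(\<chi> i'. if i' = k then ?c else ?e i' + (if i' \<in> insert i K then ?c else 0))
          = (\<chi> i'. if i' = k then ?c else ?e i' + (if i' \<in> K then ?c else 0))"
        using True by (simp add: vec_eq_iff)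
      then show ?thesis using insert.IH by simp
    next
      case False
      let ?A = "\<chi> i'. if i' = k then ?c else ?e i' + (if i' \<in> K then ?c else 0)"
      have "(\<chi> i'. if i' = k then ?c else ?e i' + (if i' \<in> insert i K then ?c else 0))
          = (\<chi> i'. if i' = i then row i ?A + 1 *s row k ?A else row i' ?A)"
        using False insert.hyps(2) by (auto simp: vec_eq_iff row_def)
      then show ?thesis using insert.IH det_row_operation[OF False, of ?A 1] by simp
    qed
  qed
  have "det (\<chi> i. ?e i + (if i \<in> K then ?c else 0)) = (\<Prod>i\<in>UNIV. d i) * (1 + c * (\<Sum>i\<in>K. 1 / d i))" if "finite K" for K
    using that
  proof (induction K rule: finite_induct)
    case empty
    have "(\<chi> i. ?e i) = (\<chi> i j. if i = j then d i else 0)" by (simp add: vec_eq_iff)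
    then show ?case by (simp add: det_diagonal)
  next
    case (insert k K)
    let ?r = "\<lambda>i. ?e i + (if i \<in> K then ?c else 0)"
    have "(\<chi> i. ?e i + (if i \<in> insert k K then ?c else 0)) = (\<chi> i. if i = k then ?e k + ?c else ?r i)"
      using insert.hyps(2) by (auto simp: vec_eq_iff)
    also have "det \<dots> = det (\<chi> i. if i = k then ?e k else ?r i) + det (\<chi> i. if i = k then ?c else ?r i)"
      by (rule det_row_add[of k "\<lambda>_. ?e k" "\<lambda>_. ?c"])
    also have "(\<chi> i. if i = k then ?e k else ?r i) = (\<chi> i. ?r i)"
      using insert.hyps(2) by (auto simp: vec_eq_iff)
    also have "det \<dots> + det (\<chi> i. if i = k then ?c else ?r i)
        = (\<Prod>i\<in>UNIV. d i) * (1 + c * (\<Sum>i\<in>K. 1 / d i)) + c * (\<Prod>i\<in>UNIV - {k}. d i)"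
      using insert.IH one[OF insert.hyps(1), of k] by simp
    also have "(\<Prod>i\<in>UNIV - {k}. d i) = (\<Prod>i\<in>UNIV. d i) / d k"
      using nz[of k] by (simp add: prod.remove[of UNIV k])
    also have "(\<Prod>i\<in>UNIV. d i) * (1 + c * (\<Sum>i\<in>K. 1 / d i)) + c * ((\<Prod>i\<in>UNIV. d i) / d k)
        = (\<Prod>i\<in>UNIV. d i) * (1 + c * (\<Sum>i\<in>insert k K. 1 / d i))"
      using insert.hyps by (simp add: algebra_simps)
    finally show ?case .
  qed
  from this[of UNIV] have "det (\<chi> i. ?e i + ?c) = (\<Prod>i\<in>UNIV. d i) * (1 + c * (\<Sum>i\<in>UNIV. 1 / d i))" by simp
  moreover have "(\<chi> i. ?e i + ?c) = (\<chi> i j. (if i = j then d i else 0) + c)" by (simp add: vec_eq_iff)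
  ultimately show ?thesis by simp
qed

lemma sqrt_det_baran_metric:
  fixes x :: "real^'n::finite"
  assumes x: "x \<in> open_simplex"
  shows "sqrt (det (baran_metric x)) = weight x"
proof -
  have nz: "bary0 x \<noteq> 0" "x $ i \<noteq> 0" for i using simplexD[OF x] by (auto simp: less_le)
  have "det (baran_metric x) = (\<Prod>i\<in>UNIV. 1 / x $ i) * (1 + 1 / bary0 x * (\<Sum>i\<in>UNIV. x $ i))"
    using det_diag_plus_const[of "\<lambda>i. 1 / x $ i" "1 / bary0 x"] nz
    by (simp add: baran_metric_def flip: bary0_def)
  also have "(\<Sum>i\<in>UNIV. x $ i) = 1 - bary0 x" by (simp add: bary0_def)
  also have "1 + 1 / bary0 x * (1 - bary0 x) = 1 / bary0 x" using nz by (simp add: field_simps)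
  finally have "det (baran_metric x) = 1 / bary_prod x"
    by (simp add: bary_prod_def prod_dividef)
  then show ?thesis by (simp add: weight_def real_sqrt_divide)
qed

abbreviation simplex_volume :: "(real^'n::finite) measure" where
  "simplex_volume \<equiv> riemannian_volume baran_metric open_simplex"

lemma borel_measurable_weight [measurable]: "(weight :: real^'n::finite \<Rightarrow> real) \<in> borel_measurable borel"
  unfolding weight_def bary_prod_def bary0_def by measurable

lemma simplex_volume_eq:
  "(simplex_volume :: (real^'n::finite) measure) = density (restrict_space lborel open_simplex) (\<lambda>x. ennreal (weight x))"
proof -
  have "(\<integral>\<^sup>+x. ennreal (sqrt (det (baran_metric x))) * indicator A x \<partial>restrict_space lborel open_simplex)
      = (\<integral>\<^sup>+x. ennreal (weight x) * indicator A x \<partial>restrict_space lborel open_simplex)" for A :: "(real^'n) set"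
    by (rule nn_integral_cong) (simp add: space_restrict_space sqrt_det_baran_metric)
  then show ?thesis unfolding riemannian_volume_def density_def by simp
qed

lemma space_simplex_volume [simp]: "space simplex_volume = open_simplex"
  by (simp add: riemannian_volume_def space_restrict_space)

lemma sets_simplex_volume: "sets simplex_volume = sets (restrict_space borel open_simplex)"
  by (simp add: riemannian_volume_def sets_restrict_space)

lemma borel_measurable_simplex_volume_iff:
  "f \<in> borel_measurable simplex_volume \<longleftrightarrow> f \<in> borel_measurable (restrict_space borel open_simplex)"
  by (intro arg_cong[of _ _ "\<lambda>A. f \<in> A"] measurable_cong_sets sets_simplex_volume refl)

lemma borel_measurable_simplex_volumeI: "f \<in> borel_measurable borel \<Longrightarrow> f \<in> borel_measurable simplex_volume"
  by (simp add: borel_measurable_simplex_volume_iff measurable_restrict_space1)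

lemma nn_integral_powr_minus_half:
  assumes "c \<ge> 0"
  shows "(\<integral>\<^sup>+t. ennreal (indicator {0..c} t * t powr (-1/2)) \<partial>lborel) = ennreal (2 * sqrt c)"
proof -
  have "((\<lambda>t. t powr (-1/2)) has_integral (c powr (-1/2 + 1) / (-1/2 + 1))) {0..c}"
    by (rule has_integral_powr_from_0) (use assms in auto)
  from nn_integral_has_integral_lebesgue[OF _ this]
  have "(\<integral>\<^sup>+t. ennreal (indicator {0..c} t * t powr (-1/2)) \<partial>lborel) = ennreal (c powr (1/2) * 2)"
    by simp
  then show ?thesis using assms by (simp add: powr_half_sqrt mult.commute)
qed

text \<open>The exact value is \<open>\<pi>\<close>. A bound independent of \<open>c\<close> suffices, and it follows from the larger of
  the two factors \<open>t\<close> and \<open>c - t\<close> being at least \<open>c / 2\<close>.\<close>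

lemma nn_integral_arcsine_le:
  assumes c: "c > 0"
  shows "(\<integral>\<^sup>+t. ennreal (indicator {0<..<c} t / sqrt (t * (c - t))) \<partial>lborel) \<le> ennreal (4 * sqrt 2)"
proof -
  let ?h = "\<lambda>t. indicator {0..c} t * t powr (-1/2) :: real"
  have [measurable]: "?h \<in> borel_measurable borel" by measurable
  have le: "indicator {0<..<c} t / sqrt (t * (c - t)) \<le> sqrt (2 / c) * ?h t + sqrt (2 / c) * ?h (c - t)" for t
  proof (cases "t \<in> {0<..<c}")
    case True
    then have t: "0 < t" "t < c" by auto
    have *: "1 / sqrt (a * b) \<le> sqrt (2 / c) * a powr (-1/2)" if "0 < a" "0 < b" "c / 2 \<le> b" for a b
    proof -
      have "1 / sqrt (a * b) \<le> 1 / sqrt (a * (c / 2))"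
        using that c by (intro divide_left_mono real_sqrt_le_mono mult_left_mono mult_pos_pos) auto
      also have "\<dots> = sqrt (2 / c) * a powr (-1/2)"
        using that c by (simp add: powr_minus powr_half_sqrt real_sqrt_mult real_sqrt_divide field_simps)
      finally show ?thesis .
    qed
    have nn: "0 \<le> sqrt (2 / c) * t powr (-1/2)" "0 \<le> sqrt (2 / c) * (c - t) powr (-1/2)" using c by auto
    have "1 / sqrt (t * (c - t)) \<le> sqrt (2 / c) * t powr (-1/2) + sqrt (2 / c) * (c - t) powr (-1/2)"
    proof (cases "c / 2 \<le> c - t")
      case True then show ?thesis using *[of t "c - t"] t nn by linarith
    next
      case False
      then have "1 / sqrt ((c - t) * t) \<le> sqrt (2 / c) * (c - t) powr (-1/2)"
        using t by (intro *) auto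
      then show ?thesis using nn unfolding mult.commute[of "c - t" t] by linarith
    qed
    then show ?thesis using t by simp
  next
    case False
    then show ?thesis using c by simp
  qed
  have "(\<integral>\<^sup>+t. ennreal (indicator {0<..<c} t / sqrt (t * (c - t))) \<partial>lborel)
      \<le> (\<integral>\<^sup>+t. ennreal (sqrt (2 / c)) * ennreal (?h t) + ennreal (sqrt (2 / c)) * ennreal (?h (c - t)) \<partial>lborel)"
  proof (rule nn_integral_mono)
    fix t
    have "ennreal (indicator {0<..<c} t / sqrt (t * (c - t)))
        \<le> ennreal (sqrt (2 / c) * ?h t + sqrt (2 / c) * ?h (c - t))" by (rule ennreal_leI[OF le])
    then show "ennreal (indicator {0<..<c} t / sqrt (t * (c - t)))
       \<le> ennreal (sqrt (2 / c)) * ennreal (?h t) + ennreal (sqrt (2 / c)) * ennreal (?h (c - t))"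
      using c by (simp add: ennreal_plus ennreal_mult)
  qed
  also have "\<dots> = ennreal (sqrt (2 / c)) * (\<integral>\<^sup>+t. ennreal (?h t) \<partial>lborel)
      + ennreal (sqrt (2 / c)) * (\<integral>\<^sup>+t. ennreal (?h (c - t)) \<partial>lborel)"
    by (simp add: nn_integral_add nn_integral_cmult)
  also have "(\<integral>\<^sup>+t. ennreal (?h (c - t)) \<partial>lborel) = (\<integral>\<^sup>+t. ennreal (?h t) \<partial>lborel)"
    using nn_integral_real_affine[of "\<lambda>t. ennreal (?h t)" "-1" c] by simp
  also have "(\<integral>\<^sup>+t. ennreal (?h t) \<partial>lborel) = ennreal (2 * sqrt c)"
    using c by (intro nn_integral_powr_minus_half) simp
  also have "ennreal (sqrt (2 / c)) * ennreal (2 * sqrt c) + ennreal (sqrt (2 / c)) * ennreal (2 * sqrt c) = ennreal (4 * sqrt 2)"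
    using c by (simp flip: ennreal_mult ennreal_plus add: real_sqrt_divide)
  finally show ?thesis .
qed

lemma sqrt_prod: "sqrt (\<Prod>b\<in>B. f b) = (\<Prod>b\<in>B. sqrt (f b))"
  by (induction B rule: infinite_finite_induct) (auto simp: real_sqrt_mult)

text \<open>Integrate first over one coordinate \<open>t\<close>. With the others fixed, the weight is
  \<open>1 / sqrt (t (c - t))\<close> times a function of the others, where \<open>c\<close> is one minus their sum. The inner
  integral is bounded independently of \<open>c\<close>, and the remaining integrand is dominated by a product
  of functions of one variable.\<close>

lemma nn_integral_weight_finite:
  "(\<integral>\<^sup>+x. ennreal (indicator open_simplex x * weight (x :: real^'n::finite)) \<partial>lborel) < \<infinity>"
proof -
  let ?B = "Basis :: (real^'n) set"
  interpret product_sigma_finite "\<lambda>_ :: real^'n. lborel :: real measure" ..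
  obtain i0 :: 'n where True by simp
  define b0 where "b0 = (axis i0 1 :: real^'n)"
  have ax: "axis i 1 \<in> ?B" for i by (auto simp: Basis_vec_def)
  have b0: "b0 \<in> ?B" by (simp add: b0_def ax)
  define B' where "B' = ?B - {b0}"
  have B': "?B = insert b0 B'" "finite B'" "b0 \<notin> B'" using b0 by (auto simp: B'_def)
  \<comment> \<open>Fubini in coordinates: \<open>p\<close> assembles a vector from a function on the standard basis.\<close>
  define p where "p f = (\<Sum>b\<in>?B. f b *\<^sub>R b)" for f :: "real^'n \<Rightarrow> real"
  have comp: "p f $ i = f (axis i 1)" for f i
  proof -
    have "p f $ i = p f \<bullet> axis i 1" by (simp add: inner_axis)
    also have "\<dots> = f (axis i 1)" unfolding p_def
      by (simp add: inner_sum_left inner_Basis ax if_distrib cong: if_cong)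
    finally show ?thesis .
  qed
  have Basis_eq: "?B = (\<lambda>i. axis i 1) ` UNIV" by (auto simp: Basis_vec_def)
  have inj: "inj (\<lambda>i::'n. axis i (1::real))" by (auto simp: inj_def axis_eq_axis)
  have sum_p: "(\<Sum>k\<in>UNIV. p f $ k) = f b0 + (\<Sum>b\<in>B'. f b)" for f
  proof -
    have "(\<Sum>k\<in>UNIV. p f $ k) = (\<Sum>b\<in>?B. f b)" unfolding Basis_eq by (simp add: comp sum.reindex inj)
    then show ?thesis unfolding B'(1) sum.insert[OF B'(2,3)] .
  qed
  have prod_p: "(\<Prod>k\<in>UNIV. p f $ k) = f b0 * (\<Prod>b\<in>B'. f b)" for f
  proof -
    have "(\<Prod>k\<in>UNIV. p f $ k) = (\<Prod>b\<in>?B. f b)" unfolding Basis_eq by (simp add: comp prod.reindex inj)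
    then show ?thesis unfolding B'(1) prod.insert[OF B'(2,3)] .
  qed
  let ?F = "\<lambda>x::real^'n. ennreal (indicator open_simplex x * weight x)"
  let ?h = "\<lambda>t. indicator {0..1} t * t powr (-1/2) :: real"
  have [measurable]: "?F \<in> borel_measurable borel" by measurable
  have [measurable]: "?h \<in> borel_measurable borel" by measurable
  have pm: "p \<in> measurable (Pi\<^sub>M ?B (\<lambda>_. lborel)) borel" unfolding p_def by measurable
  then have pm': "p \<in> measurable (Pi\<^sub>M (insert b0 B') (\<lambda>_. lborel)) borel" using B'(1) by simp
  have "(\<integral>\<^sup>+x. ?F x \<partial>lborel) = (\<integral>\<^sup>+f. ?F (p f) \<partial>Pi\<^sub>M ?B (\<lambda>_. lborel))"
    unfolding lborel_eq[where 'a="real^'n"] p_def[symmetric] by (rule nn_integral_distr[OF pm]) simp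
  also have "\<dots> = (\<integral>\<^sup>+f. (\<integral>\<^sup>+t. ?F (p (f(b0 := t))) \<partial>lborel) \<partial>Pi\<^sub>M B' (\<lambda>_. lborel))"
    unfolding B'(1) by (rule product_nn_integral_insert[OF B'(2,3)]) (use pm' in measurable)
  also have "\<dots> \<le> (\<integral>\<^sup>+f. ennreal (4 * sqrt 2) * (\<Prod>b\<in>B'. ennreal (?h (f b))) \<partial>Pi\<^sub>M B' (\<lambda>_. lborel))"
  proof (rule nn_integral_mono)
    fix f :: "real^'n \<Rightarrow> real"
    define c where "c = 1 - (\<Sum>b\<in>B'. f b)"
    have S: "p (f(b0 := t)) \<in> open_simplex \<longleftrightarrow> (\<forall>b\<in>B'. 0 < f b) \<and> 0 < t \<and> t < c" for t
    proof -
      have "(\<forall>i. 0 < p (f(b0 := t)) $ i) \<longleftrightarrow> (\<forall>b\<in>?B. 0 < (f(b0 := t)) b)"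
        unfolding Basis_eq comp by auto
      also have "\<dots> \<longleftrightarrow> 0 < t \<and> (\<forall>b\<in>B'. 0 < f b)" unfolding B'(1) using B'(3) by auto
      moreover have "(\<Sum>b\<in>B'. (f(b0 := t)) b) = (\<Sum>b\<in>B'. f b)" using B'(3) by (intro sum.cong) auto
      ultimately show ?thesis unfolding open_simplex_def mem_Collect_eq sum_p c_def by auto
    qed
    have W: "weight (p (f(b0 := t))) = 1 / sqrt (t * (c - t)) * (1 / sqrt (\<Prod>b\<in>B'. f b))" for t
    proof -
      have "(\<Sum>b\<in>B'. (f(b0 := t)) b) = (\<Sum>b\<in>B'. f b)" "(\<Prod>b\<in>B'. (f(b0 := t)) b) = (\<Prod>b\<in>B'. f b)"
        using B'(3) by (auto intro!: sum.cong prod.cong)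
      moreover have "1 - (t + (\<Sum>b\<in>B'. f b)) = c - t" by (simp add: c_def)
      ultimately have "bary_prod (p (f(b0 := t))) = (t * (c - t)) * (\<Prod>b\<in>B'. f b)"
        unfolding bary_prod_def bary0_def sum_p prod_p by (simp only: fun_upd_same) (simp only: ac_simps)
      then show ?thesis by (simp add: weight_def real_sqrt_mult)
    qed
    show "(\<integral>\<^sup>+t. ?F (p (f(b0 := t))) \<partial>lborel) \<le> ennreal (4 * sqrt 2) * (\<Prod>b\<in>B'. ennreal (?h (f b)))"
    proof (cases "(\<forall>b\<in>B'. 0 < f b) \<and> c > 0")
      case True
      then have pos: "\<And>b. b \<in> B' \<Longrightarrow> 0 < f b" and c: "c > 0" by auto
      have le1: "f b \<le> 1" if "b \<in> B'" for b
      proof -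
        have "f b \<le> (\<Sum>b\<in>B'. f b)" using pos that B'(2) by (intro member_le_sum) (auto intro: less_imp_le)
        then show ?thesis using c by (simp add: c_def)
      qed
      have prod: "1 / sqrt (\<Prod>b\<in>B'. f b) = (\<Prod>b\<in>B'. ?h (f b))"
      proof -
        have "1 / sqrt (\<Prod>b\<in>B'. f b) = (\<Prod>b\<in>B'. 1 / sqrt (f b))"
          by (simp add: sqrt_prod prod_dividef)
        also have "\<dots> = (\<Prod>b\<in>B'. ?h (f b))"
          using pos le1 by (intro prod.cong) (auto simp: powr_minus powr_half_sqrt field_simps less_imp_le)
        finally show ?thesis .
      qed
      have nnp: "0 \<le> (\<Prod>b\<in>B'. ?h (f b))" by (intro prod_nonneg) auto
      have "(\<integral>\<^sup>+t. ?F (p (f(b0 := t))) \<partial>lborel)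
          = (\<integral>\<^sup>+t. ennreal (indicator {0<..<c} t / sqrt (t * (c - t))) * ennreal (\<Prod>b\<in>B'. ?h (f b)) \<partial>lborel)"
      proof (rule nn_integral_cong)
        fix t
        show "?F (p (f(b0 := t))) = ennreal (indicator {0<..<c} t / sqrt (t * (c - t))) * ennreal (\<Prod>b\<in>B'. ?h (f b))"
        proof (cases "t \<in> {0<..<c}")
          case True
          then show ?thesis using S[of t] pos nnp unfolding W prod
            by (simp flip: ennreal_mult)
        next
          case False
          then show ?thesis using S[of t] by (auto simp: indicator_def)
        qed
      qed
      also have "\<dots> = (\<integral>\<^sup>+t. ennreal (indicator {0<..<c} t / sqrt (t * (c - t))) \<partial>lborel) * ennreal (\<Prod>b\<in>B'. ?h (f b))"
        by (rule nn_integral_multc) measurable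
      also have "\<dots> \<le> ennreal (4 * sqrt 2) * ennreal (\<Prod>b\<in>B'. ?h (f b))"
        by (intro mult_right_mono nn_integral_arcsine_le c) simp
      also have "ennreal (\<Prod>b\<in>B'. ?h (f b)) = (\<Prod>b\<in>B'. ennreal (?h (f b)))"
        by (rule prod_ennreal[symmetric]) auto
      finally show ?thesis .
    next
      case False
      then have "p (f(b0 := t)) \<notin> open_simplex" for t using S[of t] by auto
      then show ?thesis by simp
    qed
  qed
  also have "\<dots> = ennreal (4 * sqrt 2) * (\<integral>\<^sup>+f. (\<Prod>b\<in>B'. ennreal (?h (f b))) \<partial>Pi\<^sub>M B' (\<lambda>_. lborel))"
    by (rule nn_integral_cmult) measurable
  also have "(\<integral>\<^sup>+f. (\<Prod>b\<in>B'. ennreal (?h (f b))) \<partial>Pi\<^sub>M B' (\<lambda>_. lborel))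
      = (\<Prod>b\<in>B'. \<integral>\<^sup>+t. ennreal (?h t) \<partial>lborel)"
    by (rule product_nn_integral_prod[OF B'(2)]) measurable
  also have "\<dots> = ennreal 2 ^ card B'"
    using nn_integral_powr_minus_half[of 1] by simp
  also have "ennreal (4 * sqrt 2) * ennreal 2 ^ card B' < \<infinity>"
    by (simp add: power_less_top_ennreal ennreal_mult_less_top)
  finally show ?thesis .
qed

lemma finite_measure_simplex_volume: "finite_measure (simplex_volume :: (real^'n::finite) measure)"
proof
  have "emeasure simplex_volume (space (simplex_volume :: (real^'n) measure))
      = (\<integral>\<^sup>+x. ennreal (weight x) * indicator open_simplex x \<partial>restrict_space lborel (open_simplex :: (real^'n) set))"
    unfolding simplex_volume_eq
    by (subst emeasure_density) (auto simp: measurable_restrict_space1 space_restrict_space sets_restrict_space)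
  also have "\<dots> = (\<integral>\<^sup>+x. ennreal (weight x) * indicator open_simplex x * indicator open_simplex (x :: real^'n) \<partial>lborel)"
    by (subst nn_integral_restrict_space) auto
  also have "\<dots> = (\<integral>\<^sup>+x. ennreal (indicator open_simplex x * weight (x :: real^'n)) \<partial>lborel)"
    by (intro nn_integral_cong) (auto split: split_indicator)
  also have "\<dots> < \<infinity>" by (rule nn_integral_weight_finite)
  finally show "emeasure simplex_volume (space (simplex_volume :: (real^'n) measure)) \<noteq> \<infinity>" by simp
qed

lemma continuous_on_borel_measurable_simplex_volume:
  "continuous_on open_simplex f \<Longrightarrow> f \<in> borel_measurable simplex_volume"
  by (simp add: borel_measurable_simplex_volume_iff borel_measurable_continuous_on_restrict)

lemma restrict_simplex_measure: "restrict_space simplex_measure open_simplex = simplex_volume"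
proof (rule measure_eqI)
  show "sets (restrict_space simplex_measure open_simplex) = sets simplex_volume"
    by (simp add: simplex_measure_def riemannian_volume_def sets_restrict_space)
  fix A assume A: "A \<in> sets (restrict_space simplex_measure open_simplex)"
  then have A1: "A \<subseteq> open_simplex" "A \<in> sets lborel"
    by (auto simp: sets_restrict_space simplex_measure_def)
  have [measurable]: "A \<in> sets borel" using A1(2) by simp
  have "emeasure (restrict_space simplex_measure open_simplex) A = emeasure simplex_measure A"
    by (rule emeasure_restrict_space) (auto simp: simplex_measure_def A1)
  also have "\<dots> = (\<integral>\<^sup>+x. ennreal (indicator open_simplex x / sqrt (bary_prod x)) * indicator A x \<partial>lborel)"
    unfolding simplex_measure_def bary_prod_def bary0_def by (subst emeasure_density) auto
  also have "\<dots> = (\<integral>\<^sup>+x. ennreal (weight x) * indicator A x * indicator open_simplex x \<partial>lborel)"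
    using A1(1) by (intro nn_integral_cong) (auto simp: weight_def split: split_indicator)
  also have "\<dots> = (\<integral>\<^sup>+x. ennreal (weight x) * indicator A x \<partial>restrict_space lborel open_simplex)"
    by (subst nn_integral_restrict_space) auto
  also have "\<dots> = emeasure simplex_volume A"
    unfolding simplex_volume_eq using A1
    by (subst emeasure_density) (auto simp: sets_restrict_space measurable_restrict_space1)
  finally show "emeasure (restrict_space simplex_measure open_simplex) A = emeasure simplex_volume A" .
qed

lemma simplex_measure_eq_density:
  "simplex_measure = density lborel (\<lambda>x. ennreal (indicator open_simplex x * weight x))"
  unfolding simplex_measure_def weight_def bary_prod_def bary0_def by simp

text \<open>The measure \<open>simplex_measure\<close> lives on the whole space but charges the simplex only, so
  integration with respect to it and to the volume of the simplex agree.\<close>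

lemma integrable_simplex_measure_iff:
  fixes f :: "real^'n::finite \<Rightarrow> 'b::{banach, second_countable_topology}"
  assumes "f \<in> borel_measurable borel"
  shows "integrable simplex_measure f \<longleftrightarrow> integrable simplex_volume f"
    "integral\<^sup>L simplex_measure f = integral\<^sup>L simplex_volume f"
proof -
  have [measurable]: "f \<in> borel_measurable lborel" using assms by simp
  have 1: "AE x in simplex_measure. x \<in> open_simplex"
    unfolding simplex_measure_eq_density by (subst AE_density) (auto simp: indicator_def)
  have s: "open_simplex \<inter> space simplex_measure \<in> sets simplex_measure" by (simp add: simplex_measure_def)
  have m: "f \<in> borel_measurable simplex_measure" "(\<lambda>x. indicator open_simplex x *\<^sub>R f x) \<in> borel_measurable simplex_measure"
    using assms by (auto simp: simplex_measure_def)
  have 2: "AE x in simplex_measure. indicator open_simplex x *\<^sub>R f x = f x"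
    using 1 by (auto elim: eventually_mono)
  show "integrable simplex_measure f \<longleftrightarrow> integrable simplex_volume f"
    unfolding restrict_simplex_measure[symmetric] integrable_restrict_space[OF s]
    by (rule integrable_cong_AE[symmetric, OF m(2,1) 2])
  show "integral\<^sup>L simplex_measure f = integral\<^sup>L simplex_volume f"
    unfolding restrict_simplex_measure[symmetric] integral_restrict_space[OF s]
    by (rule integral_cong_AE[symmetric, OF m(2,1) 2])
qed

lemma integrable_simplex_volume:
  fixes f :: "real^'n::finite \<Rightarrow> 'b::{banach, second_countable_topology}"
  assumes f: "f \<in> borel_measurable simplex_volume"
  shows "integrable simplex_volume f \<longleftrightarrow> set_integrable lborel open_simplex (\<lambda>x. weight x *\<^sub>R f x)"
    and "integral\<^sup>L simplex_volume f = (LINT x:open_simplex|lborel. weight x *\<^sub>R f x)"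
proof -
  have m: "f \<in> borel_measurable (restrict_space lborel open_simplex)"
    using f by (simp add: borel_measurable_simplex_volume_iff cong: measurable_cong_sets)
  have w: "weight \<in> borel_measurable (restrict_space lborel open_simplex)"
    by (simp add: measurable_restrict_space1)
  have nn: "AE x in restrict_space lborel open_simplex. 0 \<le> weight x"
    by (rule AE_I2) (auto simp: space_restrict_space intro: less_imp_le simplexD)
  show "integrable simplex_volume f \<longleftrightarrow> set_integrable lborel open_simplex (\<lambda>x. weight x *\<^sub>R f x)"
    unfolding simplex_volume_eq integrable_density[OF m w nn] set_integrable_def
    by (subst integrable_restrict_space) auto
  show "integral\<^sup>L simplex_volume f = (LINT x:open_simplex|lborel. weight x *\<^sub>R f x)"
    unfolding simplex_volume_eq integral_density[OF m w nn] set_lebesgue_integral_def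
    by (subst integral_restrict_space) auto
qed

section \<open>A divergence theorem without boundary term\<close>

lemma partial_derivI: "(u has_derivative u') (at x) \<Longrightarrow> partial_deriv i u x = u' (axis i 1)"
  unfolding partial_deriv_def using frechet_derivative_at by metis

lemma partial_deriv_cong_open:
  assumes "open S" "x \<in> S" "\<And>y. y \<in> S \<Longrightarrow> u y = v y"
  shows "partial_deriv i u x = partial_deriv i v x"
proof -
  have "(u has_derivative D) (at x) \<longleftrightarrow> (v has_derivative D) (at x)" for D
    using has_derivative_transform_within_open[of u D x UNIV S v] has_derivative_transform_within_open[of v D x UNIV S u] assms
    by auto
  then show ?thesis unfolding partial_deriv_def frechet_derivative_def by simp
qed

lemma differentiable_cong_open:
  assumes "open S" "x \<in> S" "\<And>y. y \<in> S \<Longrightarrow> u y = v y" "u differentiable (at x)"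
  shows "v differentiable (at x)"
  using assms has_derivative_transform_within_open[of u _ x UNIV S v] unfolding differentiable_def by blast

lemma differentiable_has_derivative:
  "u differentiable (at x) \<Longrightarrow> (u has_derivative frechet_derivative u (at x)) (at x)"
  using frechet_derivative_works by blast

lemma partial_deriv_add:
  assumes "u differentiable (at x)" "v differentiable (at x)"
  shows "partial_deriv i (\<lambda>x. u x + v x) x = partial_deriv i u x + partial_deriv i v x"
  unfolding partial_derivI[OF has_derivative_add[OF assms[THEN differentiable_has_derivative]]]
  by (simp add: partial_deriv_def)

lemma partial_deriv_sum:
  assumes "\<And>j. j \<in> J \<Longrightarrow> u j differentiable (at x)"
  shows "partial_deriv i (\<lambda>x. \<Sum>j\<in>J. u j x) x = (\<Sum>j\<in>J. partial_deriv i (u j) x)"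
proof -
  have "((\<lambda>x. \<Sum>j\<in>J. u j x) has_derivative (\<lambda>h. \<Sum>j\<in>J. frechet_derivative (u j) (at x) h)) (at x)"
    by (intro has_derivative_sum differentiable_has_derivative assms)
  from partial_derivI[OF this] show ?thesis by (simp add: partial_deriv_def)
qed

lemma partial_deriv_scaleR:
  fixes f :: "real^'n::finite \<Rightarrow> real"
  assumes "f differentiable (at x)" "u differentiable (at x)"
  shows "partial_deriv i (\<lambda>x. f x *\<^sub>R u x) x = partial_deriv i f x *\<^sub>R u x + f x *\<^sub>R partial_deriv i u x"
  unfolding partial_derivI[OF has_derivative_scaleR[OF assms[THEN differentiable_has_derivative]]]
  by (simp add: partial_deriv_def)

lemma partial_deriv_mult:
  fixes u v :: "real^'n::finite \<Rightarrow> 'b::real_normed_algebra"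
  assumes "u differentiable (at x)" "v differentiable (at x)"
  shows "partial_deriv i (\<lambda>x. u x * v x) x = partial_deriv i u x * v x + u x * partial_deriv i v x"
  unfolding partial_derivI[OF has_derivative_mult[OF assms[THEN differentiable_has_derivative]]]
  by (simp add: partial_deriv_def)

lemma partial_deriv_bounded_linear:
  assumes "bounded_linear T" "u differentiable (at x)"
  shows "partial_deriv i (\<lambda>x. T (u x)) x = T (partial_deriv i u x)"
    and "(\<lambda>x. T (u x)) differentiable (at x)"
  using bounded_linear.has_derivative[OF assms(1) differentiable_has_derivative[OF assms(2)]]
  by (auto simp: partial_deriv_def[of _ u] intro!: partial_derivI differentiableI)

lemma partial_deriv_cmult:
  fixes u :: "real^'n::finite \<Rightarrow> complex"
  assumes "u differentiable (at x)"
  shows "partial_deriv i (\<lambda>x. c * u x) x = c * partial_deriv i u x"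
  by (rule partial_deriv_bounded_linear(1)[OF bounded_linear_mult_right assms])

lemma partial_deriv_const [simp]: "partial_deriv i (\<lambda>x. c) x = 0"
  by (rule partial_derivI) simp

lemma differentiable_component: "(\<lambda>x::real^'n::finite. x $ k) differentiable (at x)"
  by (rule differentiableI[OF bounded_linear.has_derivative[OF bounded_linear_vec_nth has_derivative_ident]])

lemma partial_deriv_component: "partial_deriv i (\<lambda>x::real^'n::finite. x $ k) x = (if i = k then 1 else 0)"
proof -
  have "((\<lambda>x. x $ k) has_derivative (\<lambda>h. h $ k)) (at x)"
    by (intro bounded_linear.has_derivative[OF bounded_linear_vec_nth] has_derivative_ident)
  from partial_derivI[OF this] show ?thesis by (simp add: axis_def)
qed

text \<open>The difference quotients have integral zero by translation invariance. They are dominated by a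
  multiple of the indicator of a ball and converge pointwise to the derivative.\<close>

lemma integral_directional_derivative_eq_0:
  fixes f :: "'a::euclidean_space \<Rightarrow> 'b::{banach, second_countable_topology}"
  assumes deriv: "\<And>x. (f has_derivative f' x) (at x)"
    and K: "compact K" "\<And>x. x \<notin> K \<Longrightarrow> f x = 0"
    and B: "\<And>x. norm (f' x v) \<le> B"
  shows "(\<integral>x. f' x v \<partial>lborel) = 0" "integrable lborel (\<lambda>x. f' x v)"
proof -
  have cont: "continuous_on UNIV f"
    using deriv by (intro continuous_at_imp_continuous_on ballI has_derivative_continuous) blast
  then have meas [measurable]: "f \<in> borel_measurable borel" by (rule borel_measurable_continuous_onI)
  obtain C where C: "\<And>x. x \<in> K \<Longrightarrow> norm (f x) \<le> C"
    using compact_imp_bounded[OF compact_continuous_image[OF continuous_on_subset[OF cont] K(1)]]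
    unfolding bounded_iff by blast
  have Kf: "emeasure lborel K < \<infinity>" using K(1) by (intro emeasure_compact_finite)
  have Ks: "K \<in> sets borel" using K(1) by (simp add: borel_compact)
  have int_f: "integrable lborel f"
  proof (rule Bochner_Integration.integrable_bound)
    show "integrable lborel (\<lambda>x. C * indicator K x)"
      using Kf Ks by (intro integrable_mult_right integrable_real_indicator) auto
    show "AE x in lborel. norm (f x) \<le> norm (C * indicator K x :: real)"
      using C K(2) by (intro AE_I2) (force simp: indicator_def)
  qed simp
  obtain R where R: "\<And>x. x \<in> K \<Longrightarrow> norm x \<le> R" using compact_imp_bounded[OF K(1)] unfolding bounded_iff by blast
  define q where "q n x = real (Suc n) *\<^sub>R (f (v /\<^sub>R real (Suc n) + x) - f x)" for n x
  have q_int: "integral\<^sup>L lborel (q n) = 0" "q n \<in> borel_measurable borel" for n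
  proof -
    let ?h = "v /\<^sub>R real (Suc n)"
    have m: "(\<lambda>x. ?h + x) \<in> measurable lborel borel" by simp
    have "integral\<^sup>L lborel f = integral\<^sup>L (distr lborel borel (\<lambda>x. ?h + x)) f" by (simp add: lborel_distr_plus)
    also have "\<dots> = (\<integral>x. f (?h + x) \<partial>lborel)" by (rule integral_distr[OF m meas])
    finally have 1: "(\<integral>x. f (?h + x) \<partial>lborel) = integral\<^sup>L lborel f" ..
    have 2: "integrable lborel (\<lambda>x. f (?h + x))"
      using int_f integrable_distr_eq[OF m meas] by (simp add: lborel_distr_plus)
    show "integral\<^sup>L lborel (q n) = 0"
      unfolding q_def using 1 2 int_f by simp
    show "q n \<in> borel_measurable borel"
      unfolding q_def by measurable
  qed
  have line: "((\<lambda>t. f (x + t *\<^sub>R v)) has_derivative (\<lambda>s. s *\<^sub>R f' (x + t *\<^sub>R v) v)) (at t)" for x t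
  proof -
    have "((\<lambda>t. x + t *\<^sub>R v) has_derivative (\<lambda>s. s *\<^sub>R v)) (at t)"
      by (auto intro!: derivative_eq_intros)
    from has_derivative_compose[OF this deriv]
    have "((\<lambda>t. f (x + t *\<^sub>R v)) has_derivative (\<lambda>s. f' (x + t *\<^sub>R v) (s *\<^sub>R v))) (at t)" .
    moreover have "f' (x + t *\<^sub>R v) (s *\<^sub>R v) = s *\<^sub>R f' (x + t *\<^sub>R v) v" for s
      by (rule linear_cmul[OF bounded_linear.linear[OF has_derivative_bounded_linear[OF deriv]]])
    ultimately show ?thesis by simp
  qed
  have q_line: "q n x = inverse (inverse (real (Suc n))) *\<^sub>R (f (x + inverse (real (Suc n)) *\<^sub>R v) - f x)" for n x
    by (simp add: q_def add.commute)
  have lim: "(\<lambda>n. q n x) \<longlonglongrightarrow> f' x v" for x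
  proof -
    have "((\<lambda>h. norm (f (x + h *\<^sub>R v) - f x - h *\<^sub>R f' x v) / norm h) \<longlongrightarrow> 0) (at 0)"
      using line[of x 0] by (simp add: has_derivative_at)
    moreover have "filterlim (\<lambda>n. inverse (real (Suc n))) (at 0) sequentially"
      unfolding filterlim_at by (simp add: LIMSEQ_inverse_real_of_nat del: of_nat_Suc)
    ultimately have "(\<lambda>n. norm (f (x + inverse (real (Suc n)) *\<^sub>R v) - f x - inverse (real (Suc n)) *\<^sub>R f' x v)
        / norm (inverse (real (Suc n)))) \<longlonglongrightarrow> 0"
      by (rule filterlim_compose)
    moreover have "norm (f (x + t *\<^sub>R v) - f x - t *\<^sub>R f' x v) / norm t
        = norm (inverse t *\<^sub>R (f (x + t *\<^sub>R v) - f x) - f' x v)" if "t > 0" for t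
    proof -
      have "inverse t *\<^sub>R (f (x + t *\<^sub>R v) - f x) - f' x v = inverse t *\<^sub>R (f (x + t *\<^sub>R v) - f x - t *\<^sub>R f' x v)"
        using that by (simp add: scaleR_diff_right)
      then show ?thesis using that by (simp add: divide_inverse mult.commute)
    qed
    ultimately have "(\<lambda>n. norm (q n x - f' x v)) \<longlonglongrightarrow> 0"
      unfolding q_line by simp
    then show ?thesis by (simp add: LIM_zero_iff tendsto_norm_zero_iff)
  qed
  have bound: "norm (q n x) \<le> B" for n x
  proof -
    let ?t = "inverse (real (Suc n))"
    have "norm (f (x + ?t *\<^sub>R v) - f (x + 0 *\<^sub>R v)) \<le> B * norm (?t - 0)"
    proof (rule differentiable_bound[where S=UNIV and f="\<lambda>t. f (x + t *\<^sub>R v)"])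
      show "((\<lambda>t. f (x + t *\<^sub>R v)) has_derivative (\<lambda>s. s *\<^sub>R f' (x + t *\<^sub>R v) v)) (at t within UNIV)" for t
        using line by simp
      have "B \<ge> 0" using B[of x] norm_ge_zero order_trans by blast
      then show "onorm (\<lambda>s. s *\<^sub>R f' (x + t *\<^sub>R v) v) \<le> B" for t
        by (rule onorm_bound) (use mult_left_mono[OF B abs_ge_zero] in \<open>simp add: mult.commute\<close>)
    qed auto
    then have "norm (f (x + ?t *\<^sub>R v) - f x) \<le> B * ?t" by simp
    then have "inverse ?t * norm (f (x + ?t *\<^sub>R v) - f x) \<le> inverse ?t * (B * ?t)"
      by (rule mult_left_mono) simp
    also have "inverse ?t * (B * ?t) = B" by (simp add: field_simps)
    finally show ?thesis unfolding q_line norm_scaleR by (simp only: abs_inverse abs_of_nat inverse_inverse_eq)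
  qed
  have q_supp: "q n x = 0" if "x \<notin> cball 0 (R + norm v)" for n x
  proof -
    have big: "norm x > R + norm v" using that by simp
    have "x \<notin> K" using R[of x] big norm_ge_zero[of v] by linarith
    moreover have "v /\<^sub>R real (Suc n) + x \<notin> K"
    proof
      assume "v /\<^sub>R real (Suc n) + x \<in> K"
      then have "norm (v /\<^sub>R real (Suc n) + x) \<le> R" by (rule R)
      moreover have "norm (v /\<^sub>R real (Suc n)) \<le> norm v"
        using mult_right_mono[of "inverse (real (Suc n))" 1 "norm v"] by (simp add: inverse_le_1_iff)
      moreover have "norm x \<le> norm (v /\<^sub>R real (Suc n) + x) + norm (v /\<^sub>R real (Suc n))"
        using norm_triangle_ineq4[of "v /\<^sub>R real (Suc n) + x" "v /\<^sub>R real (Suc n)"] by simp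
      ultimately show False using big by linarith
    qed
    ultimately show ?thesis by (simp add: q_def K(2))
  qed
  let ?w = "\<lambda>x. B * indicator (cball 0 (R + norm v)) x :: real"
  have w: "integrable lborel ?w"
    by (intro integrable_mult_right integrable_real_indicator emeasure_bounded_finite) (auto simp: emeasure_lborel_cball_finite)
  have dom: "AE x in lborel. norm (q n x) \<le> ?w x" for n
    by (rule AE_I2) (use bound q_supp in \<open>auto simp: indicator_def\<close>)
  have meas_lim: "(\<lambda>x. f' x v) \<in> borel_measurable lborel"
    by (rule borel_measurable_LIMSEQ_metric[of q]) (use q_int(2) lim in auto)
  have "(\<lambda>n. integral\<^sup>L lborel (q n)) \<longlonglongrightarrow> (\<integral>x. f' x v \<partial>lborel)"
    by (rule integral_dominated_convergence[where w = ?w]) (use q_int(2) lim meas_lim w dom in auto)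
  then show "(\<integral>x. f' x v \<partial>lborel) = 0" by (simp add: q_int(1) LIMSEQ_const_iff)
  show "integrable lborel (\<lambda>x. f' x v)"
    by (rule integrable_dominated_convergence[where w = ?w and s = q]) (use q_int(2) lim meas_lim w dom in auto)
qed

text \<open>A function of class \<open>C\<^sup>1\<close> that vanishes for \<open>t \<le> 1\<close> and tends to one at infinity. Composed with
  \<open>n * bary_prod\<close> it localises to a compact part of the simplex. What makes it work is that
  \<open>t * cutoff' t\<close> is bounded and tends to zero.\<close>

definition cutoff :: "real \<Rightarrow> real" where
  "cutoff t = 1 - 1 / (1 + (max 0 (t - 1))\<^sup>2)"

definition cutoff' :: "real \<Rightarrow> real" where
  "cutoff' t = 2 * max 0 (t - 1) / (1 + (max 0 (t - 1))\<^sup>2)\<^sup>2"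

lemma DERIV_max_0_square: "((\<lambda>t. (max 0 t)\<^sup>2) has_real_derivative 2 * max 0 t) (at (t::real))"
proof (cases t "0::real" rule: linorder_cases)
  case less
  have "((\<lambda>t. 0) has_real_derivative 0) (at t)" by simp
  then have "((\<lambda>t. (max 0 t)\<^sup>2) has_real_derivative 0) (at t)"
    by (rule has_field_derivative_transform_within_open[of _ _ _ "{..<0}"]) (use less in auto)
  then show ?thesis using less by simp
next
  case greater
  have "((\<lambda>t. t\<^sup>2) has_real_derivative 2 * t) (at t)" by (auto intro!: derivative_eq_intros)
  then have "((\<lambda>t. (max 0 t)\<^sup>2) has_real_derivative 2 * t) (at t)"
    by (rule has_field_derivative_transform_within_open[of _ _ _ "{0<..}"]) (use greater in auto)
  then show ?thesis using greater by simp
next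
  case equal
  have "((\<lambda>h. ((max 0 (0 + h))\<^sup>2 - (max 0 0)\<^sup>2) / h) \<longlongrightarrow> 0) (at (0::real))"
  proof (rule Lim_null_comparison)
    show "((\<lambda>h. \<bar>h\<bar>) \<longlongrightarrow> 0) (at (0::real))" by (auto intro!: tendsto_eq_intros)
    have "\<bar>(max 0 h)\<^sup>2 / h\<bar> \<le> \<bar>h\<bar>" for h :: real
      by (cases "h > 0") (auto simp: power2_eq_square max_def)
    then show "\<forall>\<^sub>F h in at 0. norm (((max 0 (0 + h))\<^sup>2 - (max 0 0)\<^sup>2) / h) \<le> \<bar>h :: real\<bar>" by simp
  qed
  then show ?thesis using equal by (simp add: DERIV_def)
qed

lemma DERIV_cutoff: "(cutoff has_real_derivative cutoff' t) (at t)"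
proof -
  have pos: "1 + (max 0 (t - 1))\<^sup>2 \<noteq> (0::real)" for t by (smt (verit) zero_le_power2)
  define q where "q t = (max 0 (t - 1))\<^sup>2" for t :: real
  have "((\<lambda>t. (max 0 (t - 1))\<^sup>2) has_real_derivative 2 * max 0 (t - 1) * 1) (at t)"
    by (rule DERIV_chain2[OF DERIV_max_0_square]) (auto intro!: derivative_eq_intros)
  then have "(q has_real_derivative 2 * max 0 (t - 1)) (at t)" by (simp add: q_def[abs_def])
  then have "((\<lambda>t. 1 - 1 / (1 + q t)) has_real_derivative 2 * max 0 (t - 1) / (1 + q t)\<^sup>2) (at t)"
    using pos[of t, folded q_def] by (auto intro!: derivative_eq_intros simp: power2_eq_square)
  then show ?thesis by (simp add: cutoff_def[abs_def] cutoff'_def q_def)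
qed

text \<open>The bound by \<open>1 - cutoff t\<close>, rather than by a constant alone, yields the limit of
  \<open>t * cutoff' t\<close> in \<open>cutoff_tendsto\<close> as well.\<close>

lemma cutoff_bounds:
  shows "0 \<le> cutoff t" "cutoff t \<le> 1" "\<bar>t * cutoff' t\<bar> \<le> 4 * (1 - cutoff t)" "t \<le> 1 \<Longrightarrow> cutoff t = 0" "t \<le> 1 \<Longrightarrow> cutoff' t = 0"
proof -
  define \<tau> where "\<tau> = max 0 (t - 1)"
  have p: "1 + \<tau>\<^sup>2 \<ge> 1" by simp
  have c: "cutoff t = 1 - 1 / (1 + \<tau>\<^sup>2)" "cutoff' t = 2 * \<tau> / (1 + \<tau>\<^sup>2)\<^sup>2" by (auto simp: cutoff_def cutoff'_def \<tau>_def)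
  have "1 / (1 + \<tau>\<^sup>2) \<le> 1" using p by (subst divide_le_eq_1_pos) linarith+
  then show "0 \<le> cutoff t" by (simp add: c)
  have "0 \<le> 1 / (1 + \<tau>\<^sup>2)" using p by (intro divide_nonneg_nonneg) linarith+
  then show "cutoff t \<le> 1" unfolding c by linarith
  show "t \<le> 1 \<Longrightarrow> cutoff t = 0" "t \<le> 1 \<Longrightarrow> cutoff' t = 0" by (auto simp: cutoff_def cutoff'_def)
  show "\<bar>t * cutoff' t\<bar> \<le> 4 * (1 - cutoff t)"
  proof (cases "t \<le> 1")
    case True then show ?thesis by (simp add: cutoff_def cutoff'_def)
  next
    case False
    then have t: "t = 1 + \<tau>" and \<tau>: "\<tau> \<ge> 0" by (auto simp: \<tau>_def)
    have "2 * \<tau> \<le> 1 + \<tau>\<^sup>2" using two_mult_le_sum_squares[of 1 \<tau>] by simp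
    moreover have "(1 + \<tau>) * (2 * \<tau>) = 2 * \<tau> + 2 * \<tau>\<^sup>2" by (simp add: algebra_simps power2_eq_square)
    moreover have "2 * \<tau> + 2 * \<tau>\<^sup>2 \<le> 4 * (1 + \<tau>\<^sup>2)" using calculation zero_le_power2[of \<tau>] by argo
    ultimately have "(1 + \<tau>) * (2 * \<tau>) \<le> 4 * (1 + \<tau>\<^sup>2)" by (simp only:)
    then have "(1 + \<tau>) * (2 * \<tau>) / (1 + \<tau>\<^sup>2)\<^sup>2 \<le> 4 * (1 + \<tau>\<^sup>2) / (1 + \<tau>\<^sup>2)\<^sup>2"
      by (intro divide_right_mono) auto
    also have "\<dots> = 4 / (1 + \<tau>\<^sup>2)"
    proof -
      have "4 * u / u\<^sup>2 = 4 / u" if "u \<noteq> 0" for u :: real using that by (simp add: power2_eq_square)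
      from this[of "1 + \<tau>\<^sup>2"] show ?thesis using p by linarith
    qed
    also have "\<dots> = 4 * (1 - cutoff t)" by (simp add: c)
    finally have "(1 + \<tau>) * (2 * \<tau>) / (1 + \<tau>\<^sup>2)\<^sup>2 \<le> 4 * (1 - cutoff t)" .
    moreover have "\<bar>t * cutoff' t\<bar> = (1 + \<tau>) * (2 * \<tau>) / (1 + \<tau>\<^sup>2)\<^sup>2"
      unfolding c(2) using \<tau> by (simp add: t)
    ultimately show ?thesis by simp
  qed
qed

lemma continuous_cutoff: "continuous_on A cutoff" "continuous_on A cutoff'"
proof -
  have pos: "1 + (max 0 (t - 1))\<^sup>2 \<noteq> (0::real)" for t by (smt (verit) zero_le_power2)
  show "continuous_on A cutoff" "continuous_on A cutoff'"
    unfolding cutoff_def[abs_def] cutoff'_def[abs_def] by (auto intro!: continuous_intros simp: pos)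
qed

lemma cutoff_tendsto:
  assumes "b > 0"
  shows "(\<lambda>n. cutoff (real n * b)) \<longlonglongrightarrow> 1" "(\<lambda>n. (real n * b) * cutoff' (real n * b)) \<longlonglongrightarrow> 0"
proof -
  have lin: "filterlim (\<lambda>n. real n * b) at_top sequentially"
    using assms by (intro filterlim_at_top_mult_tendsto_pos[OF tendsto_const _ filterlim_real_sequentially])
  have "1 - cutoff t \<le> 1 / t" if "t \<ge> 3" for t
  proof -
    have "3 * t \<le> t * t" using that by (intro mult_right_mono) auto
    moreover have "1 + (t - 1)\<^sup>2 = t * t - 2 * t + 2" by (simp add: power2_eq_square algebra_simps)
    ultimately have "t \<le> 1 + (t - 1)\<^sup>2" by linarith
    then have "1 / (1 + (t - 1)\<^sup>2) \<le> 1 / t" using that by (intro divide_left_mono) auto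
    then show ?thesis using that by (simp add: cutoff_def)
  qed
  then have ev: "\<forall>\<^sub>F n in sequentially. norm (1 - cutoff (real n * b)) \<le> 1 / (real n * b)"
    using filterlim_at_top[THEN iffD1, OF lin, rule_format, of 3] cutoff_bounds(2)
    by (auto elim!: eventually_mono)
  have inv: "(\<lambda>n. 1 / (real n * b)) \<longlonglongrightarrow> 0"
    using tendsto_inverse_0_at_top[OF lin] by (simp add: divide_inverse)
  have 1: "(\<lambda>n. 1 - cutoff (real n * b)) \<longlonglongrightarrow> 0" by (rule Lim_null_comparison[OF ev inv])
  from tendsto_diff[OF tendsto_const[of 1] this] show "(\<lambda>n. cutoff (real n * b)) \<longlonglongrightarrow> 1" by simp
  have 4: "(\<lambda>n. 4 * (1 - cutoff (real n * b))) \<longlonglongrightarrow> 0"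
    using tendsto_mult_left[OF 1, of 4] by simp
  show "(\<lambda>n. (real n * b) * cutoff' (real n * b)) \<longlonglongrightarrow> 0"
    by (rule Lim_null_comparison[OF _ 4]) (use cutoff_bounds(3) in auto)
qed

lemma has_derivative_bary_prod:
  fixes x :: "real^'n::finite"
  assumes x: "x \<in> open_simplex"
  shows "(bary_prod has_derivative (\<lambda>h. bary_prod x * (\<Sum>i\<in>UNIV. (1 / x $ i - 1 / bary0 x) * h $ i))) (at x)"
proof -
  have nz: "bary0 x \<noteq> 0" "x $ i \<noteq> 0" for i using simplexD[OF x] by (auto simp: less_le)
  let ?P = "\<Prod>i\<in>UNIV. x $ i"
  have c: "((\<lambda>x. x $ i) has_derivative (\<lambda>h. h $ i)) (at x)" for i
    by (intro bounded_linear.has_derivative[OF bounded_linear_vec_nth] has_derivative_ident)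
  have 0: "(bary0 has_derivative (\<lambda>h. - (\<Sum>k\<in>UNIV. h $ k))) (at x)"
    unfolding bary0_def[abs_def] by (auto intro!: derivative_eq_intros c)
  have P: "((\<lambda>x. \<Prod>i\<in>UNIV. x $ i) has_derivative (\<lambda>h. \<Sum>i\<in>UNIV. h $ i * (\<Prod>j\<in>UNIV - {i}. x $ j))) (at x)"
    by (rule has_derivative_prod) (rule c)
  have "(bary_prod has_derivative (\<lambda>h. bary0 x * (\<Sum>i\<in>UNIV. h $ i * (\<Prod>j\<in>UNIV - {i}. x $ j)) + - (\<Sum>k\<in>UNIV. h $ k) * ?P)) (at x)"
    unfolding bary_prod_def[abs_def] by (rule has_derivative_mult[OF 0 P])
  moreover have "(\<Prod>j\<in>UNIV - {i}. x $ j) = ?P / x $ i" for i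
    using nz(2)[of i] by (simp add: prod.remove[of UNIV i])
  moreover have "bary0 x * (\<Sum>i\<in>UNIV. h $ i * (?P / x $ i)) + - (\<Sum>k\<in>UNIV. h $ k) * ?P
      = bary_prod x * (\<Sum>i\<in>UNIV. (1 / x $ i - 1 / bary0 x) * h $ i)" for h :: "real^'n"
    using nz(1) unfolding bary_prod_def
    by (simp add: sum_distrib_left sum_distrib_right sum_subtractf left_diff_distrib right_diff_distrib mult_ac)
  ultimately show ?thesis by simp
qed

lemma partial_deriv_bary_prod:
  "x \<in> open_simplex \<Longrightarrow> partial_deriv i bary_prod x = bary_prod x * (1 / x $ i - 1 / bary0 x)"
  by (subst partial_derivI[OF has_derivative_bary_prod]) (auto simp: axis_def if_distrib cong: if_cong)

lemma bary_prod_differentiable: "x \<in> open_simplex \<Longrightarrow> bary_prod differentiable (at x)"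
  using has_derivative_bary_prod differentiableI by blast

lemma weight_deriv:
  assumes x: "x \<in> open_simplex"
  shows "weight differentiable (at x)" "partial_deriv i weight x = - (1/2) * weight x * (1 / x $ i - 1 / bary0 x)"
proof -
  have b: "bary_prod x > 0" by (rule simplexD[OF x])
  have "((\<lambda>b. 1 / sqrt b) has_real_derivative - (1/2) * (1 / sqrt (bary_prod x)) / bary_prod x) (at (bary_prod x))"
    using b by (auto intro!: derivative_eq_intros simp: field_simps)
  then have "((\<lambda>b. 1 / sqrt b) has_derivative (\<lambda>h. - (1/2) * (1 / sqrt (bary_prod x)) / bary_prod x * h)) (at (bary_prod x))"
    by (simp only: has_field_derivative_def)
  from has_derivative_compose[OF differentiable_has_derivative[OF bary_prod_differentiable[OF x]] this]
  have *: "(weight has_derivative (\<lambda>h. - (1/2) * weight x / bary_prod x * frechet_derivative bary_prod (at x) h)) (at x)"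
    by (simp add: weight_def[abs_def])
  then show "weight differentiable (at x)" using differentiableI by blast
  have "partial_deriv i weight x = - (1/2) * weight x / bary_prod x * partial_deriv i bary_prod x"
    using partial_derivI[OF *] by (simp add: partial_deriv_def[of _ bary_prod])
  then show "partial_deriv i weight x = - (1/2) * weight x * (1 / x $ i - 1 / bary0 x)"
    using b by (simp add: partial_deriv_bary_prod[OF x])
qed

lemma continuous_on_simplex_functions:
  "continuous_on open_simplex (bary0 :: real^'n::finite \<Rightarrow> real)"
  "continuous_on open_simplex (bary_prod :: real^'n::finite \<Rightarrow> real)"
  "continuous_on open_simplex (weight :: real^'n::finite \<Rightarrow> real)"
proof -
  show 0: "continuous_on open_simplex (bary0 :: real^'n \<Rightarrow> real)"
    unfolding bary0_def[abs_def] by (intro continuous_intros)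
  show 1: "continuous_on open_simplex (bary_prod :: real^'n \<Rightarrow> real)"
    unfolding bary_prod_def[abs_def] by (intro continuous_intros 0)
  have "sqrt (bary_prod x) \<noteq> 0" if "x \<in> open_simplex" for x :: "real^'n" using simplexD(4)[OF that] by simp
  then show "continuous_on open_simplex (weight :: real^'n \<Rightarrow> real)"
    unfolding weight_def[abs_def] by (intro continuous_intros 1) auto
qed

lemma compact_bary_prod_ge:
  assumes "c > 0"
  shows "compact {x \<in> open_simplex. c \<le> bary_prod (x :: real^'n::finite)}"
proof -
  have eq: "{x \<in> open_simplex. c \<le> bary_prod x} = {x::real^'n. 0 \<le> bary0 x} \<inter> (\<Inter>i. {x. 0 \<le> x $ i}) \<inter> {x. c \<le> bary_prod x}"
  proof (intro set_eqI iffI)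
    fix x :: "real^'n" assume "x \<in> {x \<in> open_simplex. c \<le> bary_prod x}"
    then show "x \<in> {x. 0 \<le> bary0 x} \<inter> (\<Inter>i. {x. 0 \<le> x $ i}) \<inter> {x. c \<le> bary_prod x}"
      by (auto intro: less_imp_le simplexD)
  next
    fix x :: "real^'n" assume x: "x \<in> {x. 0 \<le> bary0 x} \<inter> (\<Inter>i. {x. 0 \<le> x $ i}) \<inter> {x. c \<le> bary_prod x}"
    then have "bary_prod x \<noteq> 0" using assms by auto
    then have "bary0 x \<noteq> 0" "x $ i \<noteq> 0" for i by (auto simp: bary_prod_def)
    then show "x \<in> {x \<in> open_simplex. c \<le> bary_prod x}" using x by (auto simp: open_simplex_alt less_le)
  qed
  have "closed {x \<in> open_simplex. c \<le> bary_prod (x :: real^'n)}"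
    unfolding eq unfolding bary_prod_def bary0_def
    by (intro closed_Int closed_INT ballI closed_Collect_le continuous_intros)
  moreover have "bounded {x \<in> open_simplex. c \<le> bary_prod (x :: real^'n)}"
    by (rule bounded_subset[OF bounded_open_simplex]) auto
  ultimately show ?thesis by (simp add: compact_eq_bounded_closed)
qed

text \<open>For the field \<open>cutoff (n p) F\<close>, with \<open>p = bary_prod\<close>, the integral of the divergence is zero since
  the field has compact support. The derivative of the cutoff contributes \<open>n p cutoff' (n p)\<close> times
  the derivative of \<open>ln p\<close> along \<open>F\<close>. Its first factor is bounded and tends to zero, so by
  dominated convergence this contribution disappears if the second factor is integrable.\<close>

lemma simplex_divergence:
  fixes F :: "'n::finite \<Rightarrow> real^'n \<Rightarrow> 'b::{banach, second_countable_topology}"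
  assumes diff: "\<And>i x. x \<in> open_simplex \<Longrightarrow> F i differentiable (at x)"
    and cont: "\<And>i. continuous_on open_simplex (partial_deriv i (F i))"
    and int_div: "set_integrable lborel open_simplex (\<lambda>x. \<Sum>i\<in>UNIV. partial_deriv i (F i) x)"
    and int_log: "set_integrable lborel open_simplex (\<lambda>x. \<Sum>i\<in>UNIV. (1 / x $ i - 1 / bary0 x) *\<^sub>R F i x)"
  shows "(LINT x:open_simplex|lborel. \<Sum>i\<in>UNIV. partial_deriv i (F i) x) = 0"
proof -
  let ?S = "open_simplex :: (real^'n) set"
  \<comment> \<open>The \<open>i\<close>-th partial derivative of \<open>cutoff (n p) F\<^sub>i\<close>, extended by zero outside of the simplex.\<close>
  define D where "D n i x = (if x \<in> ?S then cutoff (real n * bary_prod x) *\<^sub>R partial_deriv i (F i) x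
      + (real n * bary_prod x * cutoff' (real n * bary_prod x) * (1 / x $ i - 1 / bary0 x)) *\<^sub>R F i x else 0)" for n i x
  have D: "(\<integral>x. D n i x \<partial>lborel) = 0" "integrable lborel (D n i)" if n: "n > 0" for n i
  proof -
    define f where "f x = (if x \<in> ?S then cutoff (real n * bary_prod x) *\<^sub>R F i x else 0)" for x
    define K where "K = {x \<in> ?S. 1 / real n \<le> bary_prod x}"
    have K: "compact K" unfolding K_def using n by (intro compact_bary_prod_ge) simp
    have KS: "K \<subseteq> ?S" by (auto simp: K_def)
    have off: "cutoff (real n * bary_prod x) = 0" "cutoff' (real n * bary_prod x) = 0" if "x \<in> ?S" "x \<notin> K" for x
    proof -
      have "bary_prod x < 1 / real n" using that by (auto simp: K_def)
      then have "real n * bary_prod x \<le> 1" using n by (simp add: field_simps)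
      then show "cutoff (real n * bary_prod x) = 0" "cutoff' (real n * bary_prod x) = 0"
        by (simp_all add: cutoff_bounds)
    qed
    have f_off: "f x = 0" if "x \<notin> K" for x using off[of x] that by (simp add: f_def)
    have "\<exists>f'. (f has_derivative f') (at x) \<and> f' (axis i 1) = D n i x" for x
    proof (cases "x \<in> ?S")
      case True
      have dc: "((\<lambda>x. cutoff (real n * bary_prod x)) has_derivative
          (\<lambda>h. cutoff' (real n * bary_prod x) * (real n * frechet_derivative bary_prod (at x) h))) (at x)"
      proof -
        have "((\<lambda>x. real n * bary_prod x) has_derivative (\<lambda>h. real n * frechet_derivative bary_prod (at x) h)) (at x)"
          by (intro has_derivative_mult_right differentiable_has_derivative bary_prod_differentiable True)
        from has_derivative_compose[OF this DERIV_cutoff[unfolded has_field_derivative_def]]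
        show ?thesis by simp
      qed
      from has_derivative_scaleR[OF dc differentiable_has_derivative[OF diff[OF True, of i]]]
      have "((\<lambda>x. cutoff (real n * bary_prod x) *\<^sub>R F i x) has_derivative
         (\<lambda>h. cutoff (real n * bary_prod x) *\<^sub>R frechet_derivative (F i) (at x) h
          + (cutoff' (real n * bary_prod x) * (real n * frechet_derivative bary_prod (at x) h)) *\<^sub>R F i x)) (at x)" (is "(_ has_derivative ?f') _") .
      then have "(f has_derivative ?f') (at x)"
        by (rule has_derivative_transform_within_open[OF _ open_open_simplex True]) (simp add: f_def)
      moreover have "?f' (axis i 1) = D n i x"
        using True partial_deriv_bary_prod[OF True, of i]
        by (simp add: D_def partial_deriv_def mult_ac)
      ultimately show ?thesis by blast
    next
      case False
      then have "x \<in> - K" using KS by blast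
      have "(f has_derivative (\<lambda>_. 0)) (at x)"
        by (rule has_derivative_transform_within_open[of "\<lambda>_. 0" _ _ _ "- K"])
           (use \<open>x \<in> - K\<close> K f_off in \<open>auto simp: compact_imp_closed open_Compl\<close>)
      then show ?thesis using False by (auto simp: D_def)
    qed
    then obtain f' where f': "\<And>x. (f has_derivative f' x) (at x)" "\<And>x. f' x (axis i 1) = D n i x" by metis
    have nzc: "\<And>x j. x \<in> K \<Longrightarrow> x $ j \<noteq> 0" "\<And>x. x \<in> K \<Longrightarrow> bary0 x \<noteq> 0"
      using KS simplexD by (metis less_irrefl subsetD)+
    have "continuous_on K (\<lambda>x. cutoff (real n * bary_prod x) *\<^sub>R partial_deriv i (F i) x
      + (real n * bary_prod x * cutoff' (real n * bary_prod x) * (1 / x $ i - 1 / bary0 x)) *\<^sub>R F i x)"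
    proof -
      have cF: "continuous_on K (F i)"
        using diff KS by (intro continuous_at_imp_continuous_on ballI differentiable_imp_continuous_within) blast
      note cc = continuous_on_compose2[OF continuous_cutoff(1)[of UNIV]] continuous_on_compose2[OF continuous_cutoff(2)[of UNIV]]
      show ?thesis
        by (intro continuous_intros cc cF continuous_on_subset[OF cont KS]
            continuous_on_subset[OF continuous_on_simplex_functions(1) KS]
            continuous_on_subset[OF continuous_on_simplex_functions(2) KS]) (auto simp: nzc)
    qed
    then have "continuous_on K (D n i)"
      by (rule continuous_on_eq) (use KS in \<open>auto simp: D_def\<close>)
    then have "bounded (D n i ` K)" by (intro compact_imp_bounded compact_continuous_image K)
    then obtain B where B: "\<And>x. x \<in> K \<Longrightarrow> norm (D n i x) \<le> B" unfolding bounded_iff by auto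
    have B': "norm (f' x (axis i 1)) \<le> max B 0" for x
    proof (cases "x \<in> K")
      case True then show ?thesis using B[OF True] by (simp add: f'(2))
    next
      case False
      then have "D n i x = 0" using off[of x] by (simp add: D_def)
      then show ?thesis by (simp add: f'(2))
    qed
    show "(\<integral>x. D n i x \<partial>lborel) = 0" "integrable lborel (D n i)"
      using integral_directional_derivative_eq_0[OF f'(1) K f_off B'] by (simp_all add: f'(2))
  qed
  let ?div = "\<lambda>x. indicator ?S x *\<^sub>R (\<Sum>i\<in>UNIV. partial_deriv i (F i) x)"
  let ?log = "\<lambda>x. indicator ?S x *\<^sub>R (\<Sum>i\<in>UNIV. (1 / x $ i - 1 / bary0 x) *\<^sub>R F i x)"
  have id: "integrable lborel ?div" "integrable lborel ?log"
    using int_div int_log by (simp_all add: set_integrable_def)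
  define T where "T n x = (\<Sum>i\<in>UNIV. D (Suc n) i x)" for n x
  have T: "T n x = cutoff (real (Suc n) * bary_prod x) *\<^sub>R ?div x
      + (real (Suc n) * bary_prod x * cutoff' (real (Suc n) * bary_prod x)) *\<^sub>R ?log x" for n x
    by (cases "x \<in> ?S") (simp_all add: T_def D_def sum.distrib scaleR_sum_right)
  have T0: "(\<integral>x. T n x \<partial>lborel) = 0" "T n \<in> borel_measurable lborel" for n
  proof -
    show "(\<integral>x. T n x \<partial>lborel) = 0" unfolding T_def using D[of "Suc n"] by simp
    have "integrable lborel (T n)" unfolding T_def[abs_def] using D(2)[of "Suc n"] by (intro Bochner_Integration.integrable_sum) simp
    then show "T n \<in> borel_measurable lborel" by simp
  qed
  have "(\<lambda>n. \<integral>x. T n x \<partial>lborel) \<longlonglongrightarrow> (\<integral>x. ?div x \<partial>lborel)"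
  proof (rule integral_dominated_convergence)
    show "?div \<in> borel_measurable lborel" using id by simp
    show "T n \<in> borel_measurable lborel" for n by (rule T0)
    show "integrable lborel (\<lambda>x. norm (?div x) + 4 * norm (?log x))"
      using id by (intro Bochner_Integration.integrable_add integrable_mult_right integrable_norm)
    show "AE x in lborel. norm (T n x) \<le> norm (?div x) + 4 * norm (?log x)" for n
    proof (rule AE_I2)
      fix x :: "real^'n"
      let ?t = "real (Suc n) * bary_prod x"
      have "norm (T n x) \<le> \<bar>cutoff ?t\<bar> * norm (?div x) + \<bar>?t * cutoff' ?t\<bar> * norm (?log x)"
        unfolding T norm_scaleR[symmetric] by (rule norm_triangle_ineq)
      also have "\<dots> \<le> 1 * norm (?div x) + 4 * norm (?log x)"
        using cutoff_bounds(1,2,3)[of ?t] by (intro add_mono mult_right_mono) auto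
      finally show "norm (T n x) \<le> norm (?div x) + 4 * norm (?log x)" by simp
    qed
    show "AE x in lborel. (\<lambda>n. T n x) \<longlonglongrightarrow> ?div x"
    proof (rule AE_I2)
      fix x :: "real^'n"
      show "(\<lambda>n. T n x) \<longlonglongrightarrow> ?div x"
      proof (cases "x \<in> ?S")
        case True
        note b = cutoff_tendsto[OF simplexD(4)[OF True], THEN LIMSEQ_Suc]
        from tendsto_add[OF tendsto_scaleR[OF b(1) tendsto_const[of "?div x"]] tendsto_scaleR[OF b(2) tendsto_const[of "?log x"]]]
        show ?thesis unfolding T by simp
      next
        case False then show ?thesis by (simp add: T)
      qed
    qed
  qed
  then have "(\<integral>x. ?div x \<partial>lborel) = 0" by (simp add: T0 LIMSEQ_const_iff)
  then show ?thesis by (simp add: set_lebesgue_integral_def)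
qed

text \<open>The same for \<open>F = weight * Y\<close>, with the weight moved into the measure. The derivative of
  \<open>ln weight\<close> is minus one half of that of \<open>ln bary_prod\<close>.\<close>

lemma simplex_divergence_weighted:
  fixes Y :: "'n::finite \<Rightarrow> real^'n \<Rightarrow> 'b::{banach, second_countable_topology}"
  assumes diff: "\<And>i x. x \<in> open_simplex \<Longrightarrow> Y i differentiable (at x)"
    and cont: "\<And>i. continuous_on open_simplex (partial_deriv i (Y i))"
    and int_div: "integrable simplex_volume (\<lambda>x. \<Sum>i\<in>UNIV. partial_deriv i (Y i) x)"
    and int_log: "integrable simplex_volume (\<lambda>x. \<Sum>i\<in>UNIV. (1 / x $ i - 1 / bary0 x) *\<^sub>R Y i x)"
  shows "(\<integral>x. (\<Sum>i\<in>UNIV. partial_deriv i (Y i) x)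
      - (1/2) *\<^sub>R (\<Sum>i\<in>UNIV. (1 / x $ i - 1 / bary0 x) *\<^sub>R Y i x) \<partial>simplex_volume) = 0"
proof -
  let ?S = "open_simplex :: (real^'n) set"
  let ?F = "\<lambda>i x. weight x *\<^sub>R Y i x"
  let ?div = "\<lambda>x. \<Sum>i\<in>UNIV. partial_deriv i (Y i) x" and ?log = "\<lambda>x. \<Sum>i\<in>UNIV. (1 / x $ i - 1 / bary0 x) *\<^sub>R Y i x"
  have pd: "partial_deriv i (?F i) x = (- (1/2) * weight x * (1 / x $ i - 1 / bary0 x)) *\<^sub>R Y i x + weight x *\<^sub>R partial_deriv i (Y i) x"
    if "x \<in> ?S" for i x
    using partial_deriv_scaleR[OF weight_deriv(1)[OF that] diff[OF that, of i], of i] weight_deriv(2)[OF that, of i] by simp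
  have div: "(\<Sum>i\<in>UNIV. partial_deriv i (?F i) x) = weight x *\<^sub>R (?div x - (1/2) *\<^sub>R ?log x)" if "x \<in> ?S" for x
    by (simp add: pd[OF that] sum.distrib scaleR_sum_right scaleR_diff_right mult_ac sum_negf sum_subtractf)
  have log: "(\<Sum>i\<in>UNIV. (1 / x $ i - 1 / bary0 x) *\<^sub>R ?F i x) = weight x *\<^sub>R ?log x" for x
    by (simp add: scaleR_sum_right mult.commute)
  have int: "integrable simplex_volume (\<lambda>x. ?div x - (1/2) *\<^sub>R ?log x)"
    using int_div int_log by (intro Bochner_Integration.integrable_diff integrable_scaleR_right)
  have cY: "continuous_on ?S (Y i)" for i
    using diff by (intro continuous_at_imp_continuous_on ballI differentiable_imp_continuous_within) blast
  have "(LINT x:?S|lborel. \<Sum>i\<in>UNIV. partial_deriv i (?F i) x) = 0"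
  proof (rule simplex_divergence)
    show "?F i differentiable (at x)" if "x \<in> ?S" for i x
      by (intro differentiable_scaleR weight_deriv diff that)
    have nz: "x $ i \<noteq> 0" "bary0 x \<noteq> 0" if "x \<in> ?S" for x i using simplexD[OF that] by (auto simp: less_le)
    have "continuous_on ?S (\<lambda>x. (- (1/2) * weight x * (1 / x $ i - 1 / bary0 x)) *\<^sub>R Y i x + weight x *\<^sub>R partial_deriv i (Y i) x)" for i
      by (intro continuous_intros continuous_on_simplex_functions cY cont) (auto simp: nz)
    then show "continuous_on ?S (partial_deriv i (?F i))" for i
      by (rule continuous_on_eq) (simp add: pd)
    show "set_integrable lborel ?S (\<lambda>x. \<Sum>i\<in>UNIV. partial_deriv i (?F i) x)"
      using integrable_simplex_volume(1)[of "\<lambda>x. ?div x - (1/2) *\<^sub>R ?log x"] int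
      by (subst set_integrable_cong[OF refl refl div]) auto
    show "set_integrable lborel ?S (\<lambda>x. \<Sum>i\<in>UNIV. (1 / x $ i - 1 / bary0 x) *\<^sub>R ?F i x)"
      using integrable_simplex_volume(1)[of ?log] int_log by (simp only: log) auto
  qed
  then have "(LINT x:?S|lborel. weight x *\<^sub>R (?div x - (1/2) *\<^sub>R ?log x)) = 0"
    by (subst (asm) set_lebesgue_integral_cong[OF _ allI[OF impI[OF div]]]) auto
  then show ?thesis
    using integrable_simplex_volume(2)[of "\<lambda>x. ?div x - (1/2) *\<^sub>R ?log x"] int by auto
qed

section \<open>Green's formula for the Laplace Beltrami operator\<close>

lemma partial_derivs_simps [simp]:
  "partial_derivs [] u = u" "partial_derivs (i # is) u = partial_deriv i (partial_derivs is u)"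
  by (simp_all add: partial_derivs_def)

lemma C_on_1D:
  assumes "u \<in> C_on k S" "k \<ge> 1"
  shows "x \<in> S \<Longrightarrow> u differentiable (at x)" "continuous_on S u" "continuous_on S (partial_deriv i u)"
proof -
  have d: "\<And>is x. length is < k \<Longrightarrow> x \<in> S \<Longrightarrow> partial_derivs is u differentiable (at x)"
    and c: "\<And>is. length is \<le> k \<Longrightarrow> continuous_on S (partial_derivs is u)"
    using assms(1) by (auto simp: C_on_def)
  show "x \<in> S \<Longrightarrow> u differentiable (at x)" using d[of "[]"] assms(2) by simp
  show "continuous_on S u" "continuous_on S (partial_deriv i u)" using c[of "[]"] c[of "[i]"] assms(2) by simp_all
qed

lemma C_on_2D:
  assumes "u \<in> C_on k S" "k \<ge> 2"
  shows "x \<in> S \<Longrightarrow> partial_deriv j u differentiable (at x)"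
    "continuous_on S (partial_deriv i (partial_deriv j u))"
proof -
  have d: "\<And>is x. length is < k \<Longrightarrow> x \<in> S \<Longrightarrow> partial_derivs is u differentiable (at x)"
    and c: "\<And>is. length is \<le> k \<Longrightarrow> continuous_on S (partial_derivs is u)"
    using assms(1) by (auto simp: C_on_def)
  show "x \<in> S \<Longrightarrow> partial_deriv j u differentiable (at x)" using d[of "[j]"] assms(2) by simp
  show "continuous_on S (partial_deriv i (partial_deriv j u))" using c[of "[i, j]"] assms(2) by simp
qed

lemma C2b_onD:
  assumes "u \<in> C2b_on S"
  shows "u \<in> C_on 2 S" "bounded (u ` S)" "bounded (partial_deriv i u ` S)"
    "bounded (partial_deriv i (partial_deriv j u) ` S)"
proof -
  have b: "\<And>is. length is \<le> 2 \<Longrightarrow> bounded (partial_derivs is u ` S)" and "u \<in> C_on 2 S"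
    using assms by (auto simp: C2b_on_def)
  then show "u \<in> C_on 2 S" by simp
  show "bounded (u ` S)" "bounded (partial_deriv i u ` S)" "bounded (partial_deriv i (partial_deriv j u) ` S)"
    using b[of "[]"] b[of "[i]"] b[of "[i, j]"] by simp_all
qed

lemma ginv_deriv:
  shows "(\<lambda>y. ginv y i j) differentiable (at x)"
    "partial_deriv k (\<lambda>y. ginv y i j) x = (if i = j \<and> i = k then 1 else 0) - ((if k = i then x $ j else 0) + (if k = j then x $ i else 0))"
proof -
  have c: "((\<lambda>x. x $ i) has_derivative (\<lambda>h. h $ i)) (at x)" for i
    by (rule bounded_linear.has_derivative[OF bounded_linear_vec_nth has_derivative_ident])
  have 1: "((\<lambda>y. if i = j then y $ i else 0) has_derivative (\<lambda>h. if i = j then h $ i else 0)) (at x)"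
    by (cases "i = j") (auto intro: c)
  have 2: "((\<lambda>y. y $ i * y $ j) has_derivative (\<lambda>h. x $ i * h $ j + h $ i * x $ j)) (at x)"
    by (rule has_derivative_mult[OF c c])
  have 3: "((\<lambda>y. ginv y i j) has_derivative (\<lambda>h. (if i = j then h $ i else 0) - (x $ i * h $ j + h $ i * x $ j))) (at x)"
    unfolding ginv_def by (rule has_derivative_diff[OF 1 2])
  show "(\<lambda>y. ginv y i j) differentiable (at x)" by (rule differentiableI[OF 3])
  show "partial_deriv k (\<lambda>y. ginv y i j) x = (if i = j \<and> i = k then 1 else 0) - ((if k = i then x $ j else 0) + (if k = j then x $ i else 0))"
    by (subst partial_derivI[OF 3]) (auto simp: axis_def)
qed

text \<open>The derivative of \<open>ln bary_prod\<close> along the columns of the inverse metric is bounded, although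
  \<open>ln bary_prod\<close> has unbounded derivatives: the fields \<open>ginv\<close> are tangential to the faces. By
  \<open>sum_ginv_deriv\<close> the value is also the divergence of the column.\<close>

lemma sum_ginv_log:
  fixes x :: "real^'n::finite"
  assumes x: "x \<in> open_simplex"
  shows "(\<Sum>i\<in>UNIV. (1 / x $ i - 1 / bary0 x) * ginv x i j) = 1 - (real CARD('n) + 1) * x $ j"
proof -
  have nz: "bary0 x \<noteq> 0" "x $ i \<noteq> 0" for i using simplexD[OF x] by (auto simp: less_le)
  have sx: "(\<Sum>k\<in>UNIV. x $ k) = 1 - bary0 x" by (simp add: bary0_def)
  have e: "(1 / x $ i - 1 / bary0 x) * ginv x i j
      = (if i = j then 1 - x $ j / bary0 x else 0) - x $ j + x $ i * x $ j / bary0 x" for i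
  proof -
    have "1 / x $ i * ginv x i j = (if i = j then 1 else 0) - x $ j"
      using nz(2)[of i] nz(2)[of j] by (simp add: ginv_def right_diff_distrib)
    moreover have "1 / bary0 x * ginv x i j = (if i = j then x $ j / bary0 x else 0) - x $ i * x $ j / bary0 x"
      by (simp add: ginv_def diff_divide_distrib)
    ultimately show ?thesis by (simp add: left_diff_distrib)
  qed
  have "(\<Sum>i\<in>UNIV. (1 / x $ i - 1 / bary0 x) * ginv x i j)
      = 1 - x $ j / bary0 x - real CARD('n) * x $ j + (\<Sum>i\<in>UNIV. x $ i) * (x $ j / bary0 x)"
    unfolding e by (simp add: sum.distrib sum_subtractf sum_distrib_right sum_divide_distrib)
  also have "\<dots> = 1 - (real CARD('n) + 1) * x $ j"
    unfolding sx using nz by (simp add: field_simps)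
  finally show ?thesis .
qed

lemma sum_ginv_deriv:
  fixes x :: "real^'n::finite"
  shows "(\<Sum>i\<in>UNIV. partial_deriv i (\<lambda>y. ginv y i j) x) = 1 - (real CARD('n) + 1) * x $ j"
proof -
  have "partial_deriv i (\<lambda>y. ginv y i j) x = (if i = j then 1 - x $ j else 0) - x $ j" for i
    by (simp add: ginv_deriv(2))
  then have "(\<Sum>i\<in>UNIV. partial_deriv i (\<lambda>y. ginv y i j) x) = (\<Sum>i\<in>UNIV. (if i = j then 1 - x $ j else 0) - x $ j)"
    by (simp only:)
  also have "\<dots> = 1 - (real CARD('n) + 1) * x $ j" by (simp add: sum_subtractf algebra_simps)
  finally show ?thesis .
qed

text \<open>The Laplace Beltrami operator written out. The first-order coefficient combines the divergence
  of a column of \<open>ginv\<close> with minus one half of the same quantity from the weight.\<close>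

definition lap :: "(real^'n::finite \<Rightarrow> complex) \<Rightarrow> real^'n \<Rightarrow> complex" where
  "lap u x = (\<Sum>i\<in>UNIV. \<Sum>j\<in>UNIV. ginv x i j *\<^sub>R partial_deriv i (partial_deriv j u) x)
     + (\<Sum>j\<in>UNIV. ((1 - (real CARD('n) + 1) * x $ j) / 2) *\<^sub>R partial_deriv j u x)"

text \<open>The components of the Riemannian gradient on the simplex.\<close>

definition gradv :: "(real^'n::finite \<Rightarrow> complex) \<Rightarrow> 'n \<Rightarrow> real^'n \<Rightarrow> complex" where
  "gradv u i x = (\<Sum>j\<in>UNIV. ginv x i j *\<^sub>R partial_deriv j u x)"

lemma gradv_deriv:
  fixes u :: "real^'n::finite \<Rightarrow> complex"
  assumes u: "u \<in> C_on 2 open_simplex" and x: "x \<in> open_simplex"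
  shows "gradv u i differentiable (at x)"
    "partial_deriv k (gradv u i) x = (\<Sum>j\<in>UNIV. partial_deriv k (\<lambda>y. ginv y i j) x *\<^sub>R partial_deriv j u x
       + ginv x i j *\<^sub>R partial_deriv k (partial_deriv j u) x)"
    "(\<Sum>i\<in>UNIV. partial_deriv i (gradv u i) x) - (1/2) *\<^sub>R (\<Sum>i\<in>UNIV. (1 / x $ i - 1 / bary0 x) *\<^sub>R gradv u i x) = lap u x"
proof -
  have d: "(\<lambda>y. ginv y i j *\<^sub>R partial_deriv j u y) differentiable (at x)" for i j
    by (intro differentiable_scaleR ginv_deriv C_on_2D[OF u] x) simp
  show "gradv u i differentiable (at x)"
    unfolding gradv_def[abs_def] by (rule differentiable_sum) (use d in auto)
  have pd: "partial_deriv k (gradv u i) x = (\<Sum>j\<in>UNIV. partial_deriv k (\<lambda>y. ginv y i j) x *\<^sub>R partial_deriv j u x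
       + ginv x i j *\<^sub>R partial_deriv k (partial_deriv j u) x)" for i k
    unfolding gradv_def[abs_def] partial_deriv_sum[OF d]
    by (intro sum.cong refl partial_deriv_scaleR ginv_deriv C_on_2D[OF u] x) simp
  then show "partial_deriv k (gradv u i) x = (\<Sum>j\<in>UNIV. partial_deriv k (\<lambda>y. ginv y i j) x *\<^sub>R partial_deriv j u x
       + ginv x i j *\<^sub>R partial_deriv k (partial_deriv j u) x)" .
  have 1: "(\<Sum>i\<in>UNIV. partial_deriv i (gradv u i) x)
      = (\<Sum>j\<in>UNIV. (1 - (real CARD('n) + 1) * x $ j) *\<^sub>R partial_deriv j u x)
        + (\<Sum>i\<in>UNIV. \<Sum>j\<in>UNIV. ginv x i j *\<^sub>R partial_deriv i (partial_deriv j u) x)"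
  proof -
    have "(\<Sum>i\<in>UNIV. \<Sum>j\<in>UNIV. partial_deriv i (\<lambda>y. ginv y i j) x *\<^sub>R partial_deriv j u x)
        = (\<Sum>j\<in>UNIV. \<Sum>i\<in>UNIV. partial_deriv i (\<lambda>y. ginv y i j) x *\<^sub>R partial_deriv j u x)"
      by (rule sum.swap)
    also have "\<dots> = (\<Sum>j\<in>UNIV. (1 - (real CARD('n) + 1) * x $ j) *\<^sub>R partial_deriv j u x)"
      by (simp add: scaleR_sum_left[symmetric] sum_ginv_deriv)
    finally show ?thesis unfolding pd by (simp add: sum.distrib)
  qed
  have 2: "(\<Sum>i\<in>UNIV. (1 / x $ i - 1 / bary0 x) *\<^sub>R gradv u i x)
      = (\<Sum>j\<in>UNIV. (1 - (real CARD('n) + 1) * x $ j) *\<^sub>R partial_deriv j u x)"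
  proof -
    have "(\<Sum>i\<in>UNIV. (1 / x $ i - 1 / bary0 x) *\<^sub>R gradv u i x)
        = (\<Sum>i\<in>UNIV. \<Sum>j\<in>UNIV. ((1 / x $ i - 1 / bary0 x) * ginv x i j) *\<^sub>R partial_deriv j u x)"
      by (simp add: gradv_def scaleR_sum_right)
    also have "\<dots> = (\<Sum>j\<in>UNIV. \<Sum>i\<in>UNIV. ((1 / x $ i - 1 / bary0 x) * ginv x i j) *\<^sub>R partial_deriv j u x)"
      by (rule sum.swap)
    also have "\<dots> = (\<Sum>j\<in>UNIV. (1 - (real CARD('n) + 1) * x $ j) *\<^sub>R partial_deriv j u x)"
      by (simp only: scaleR_sum_left[symmetric] sum_ginv_log[OF x])
    finally show ?thesis .
  qed
  have 3: "b - (1/2) *\<^sub>R b = (1/2) *\<^sub>R b" for b :: complex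
    by (metis add_diff_cancel_right' field_sum_of_halves scaleR_left.add scaleR_one)
  have 4: "a + b - h = b + (a - h)" for a b h :: complex by simp
  have "(1/2) *\<^sub>R (\<Sum>j\<in>UNIV. (1 - (real CARD('n) + 1) * x $ j) *\<^sub>R partial_deriv j u x)
      = (\<Sum>j\<in>UNIV. ((1 - (real CARD('n) + 1) * x $ j) / 2) *\<^sub>R partial_deriv j u x)"
    by (simp add: scaleR_sum_right)
  then show "(\<Sum>i\<in>UNIV. partial_deriv i (gradv u i) x) - (1/2) *\<^sub>R (\<Sum>i\<in>UNIV. (1 / x $ i - 1 / bary0 x) *\<^sub>R gradv u i x) = lap u x"
    unfolding 1 2 lap_def 4 3 by (simp only:)
qed

lemma laplace_beltrami_eq_lap:
  fixes u :: "real^'n::finite \<Rightarrow> complex"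
  assumes u: "u \<in> C_on 2 open_simplex" and x: "x \<in> open_simplex"
  shows "laplace_beltrami baran_metric u x = lap u x"
proof -
  have w: "weight x > 0" by (rule simplexD[OF x])
  have "partial_deriv i (\<lambda>y. sqrt (det (baran_metric y)) *\<^sub>R (\<Sum>j\<in>UNIV. (matrix_inv (baran_metric y) $ i $ j) *\<^sub>R partial_deriv j u y)) x
      = partial_deriv i (\<lambda>y. weight y *\<^sub>R gradv u i y) x" for i
    by (rule partial_deriv_cong_open[OF open_open_simplex x])
       (simp add: sqrt_det_baran_metric matrix_inv_baran_metric gradv_def)
  also have "partial_deriv i (\<lambda>y. weight y *\<^sub>R gradv u i y) x
      = weight x *\<^sub>R (partial_deriv i (gradv u i) x - (1/2) *\<^sub>R ((1 / x $ i - 1 / bary0 x) *\<^sub>R gradv u i x))" for i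
    unfolding partial_deriv_scaleR[OF weight_deriv(1)[OF x] gradv_deriv(1)[OF u x]] weight_deriv(2)[OF x]
    by (simp add: scaleR_diff_right)
  finally have "laplace_beltrami baran_metric u x
      = (\<Sum>i\<in>UNIV. partial_deriv i (gradv u i) x - (1/2) *\<^sub>R ((1 / x $ i - 1 / bary0 x) *\<^sub>R gradv u i x))"
    unfolding laplace_beltrami_def using w
    by (simp add: sqrt_det_baran_metric[OF x] scaleR_sum_right[symmetric])
  also have "\<dots> = lap u x"
    by (simp only: sum_subtractf scaleR_sum_right[symmetric] gradv_deriv(3)[OF u x])
  finally show ?thesis .
qed

text \<open>The Hermitian form of the inverse metric on covectors. For a probability vector \<open>x\<close> this would be
  the covariance of \<open>a\<close> and \<open>b\<close>.\<close>

definition gform :: "real^'n::finite \<Rightarrow> ('n \<Rightarrow> complex) \<Rightarrow> ('n \<Rightarrow> complex) \<Rightarrow> complex" where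
  "gform x a b = (\<Sum>i\<in>UNIV. x $ i *\<^sub>R (a i * cnj (b i)))
     - (\<Sum>i\<in>UNIV. x $ i *\<^sub>R a i) * cnj (\<Sum>i\<in>UNIV. x $ i *\<^sub>R b i)"

lemma sum_ginv_gform: "(\<Sum>i\<in>UNIV. (\<Sum>j\<in>UNIV. ginv x i j *\<^sub>R a j) * cnj (b i)) = gform x a b"
proof -
  have "(\<Sum>j\<in>UNIV. ginv x i j *\<^sub>R a j) = x $ i *\<^sub>R a i - x $ i *\<^sub>R (\<Sum>j\<in>UNIV. x $ j *\<^sub>R a j)" for i
  proof -
    have "(\<Sum>j\<in>UNIV. ginv x i j *\<^sub>R a j) = (\<Sum>j\<in>UNIV. (if i = j then x $ i *\<^sub>R a i else 0) - x $ i *\<^sub>R x $ j *\<^sub>R a j)"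
      by (rule sum.cong) (auto simp: ginv_def scaleR_diff_left)
    then show ?thesis by (simp add: sum_subtractf scaleR_sum_right)
  qed
  then have "(\<Sum>i\<in>UNIV. (\<Sum>j\<in>UNIV. ginv x i j *\<^sub>R a j) * cnj (b i))
      = (\<Sum>i\<in>UNIV. x $ i *\<^sub>R (a i * cnj (b i))) - (\<Sum>i\<in>UNIV. (\<Sum>j\<in>UNIV. x $ j *\<^sub>R a j) * cnj (x $ i *\<^sub>R b i))"
    by (simp add: left_diff_distrib sum_subtractf)
  also have "(\<Sum>i\<in>UNIV. (\<Sum>j\<in>UNIV. x $ j *\<^sub>R a j) * cnj (x $ i *\<^sub>R b i))
      = (\<Sum>i\<in>UNIV. x $ i *\<^sub>R a i) * cnj (\<Sum>i\<in>UNIV. x $ i *\<^sub>R b i)"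
    by (simp add: sum_distrib_left)
  finally show ?thesis by (simp add: gform_def)
qed

lemma gform_commute: "gform x b a = cnj (gform x a b)"
  by (simp add: gform_def mult.commute)

lemma gform_diff_left: "gform x (\<lambda>i. a i - b i) c = gform x a c - gform x b c"
  by (simp add: gform_def left_diff_distrib scaleR_diff_right sum_subtractf)

lemma gform_diff_right: "gform x c (\<lambda>i. a i - b i) = gform x c a - gform x c b"
  by (simp add: gform_def right_diff_distrib scaleR_diff_right sum_subtractf)

lemma gform_cmult_left: "gform x (\<lambda>i. z * a i) c = z * gform x a c"
proof -
  have "(\<Sum>i\<in>UNIV. x $ i *\<^sub>R (z * a i)) = z * (\<Sum>i\<in>UNIV. x $ i *\<^sub>R a i)"
    by (simp add: sum_distrib_left)
  moreover have "(\<Sum>i\<in>UNIV. x $ i *\<^sub>R (z * a i * cnj (c i))) = z * (\<Sum>i\<in>UNIV. x $ i *\<^sub>R (a i * cnj (c i)))"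
    by (simp add: sum_distrib_left mult.assoc)
  ultimately show ?thesis by (simp add: gform_def right_diff_distrib mult.assoc)
qed

lemma gform_cmult_right: "gform x c (\<lambda>i. z * a i) = cnj z * gform x c a"
  using arg_cong[OF gform_cmult_left[of x z a c], of cnj] by (simp add: gform_commute[of x c])

text \<open>Positivity as for a variance: with the mean \<open>m = \<Sum>i. x\<^sub>i a\<^sub>i\<close>, the form is the sum of the
  \<open>x\<^sub>i |a\<^sub>i - m|\<^sup>2\<close> and of \<open>x\<^sub>0 |m|\<^sup>2\<close>.\<close>

lemma gform_self:
  assumes x: "x \<in> open_simplex"
  shows "gform x a a = of_real (Re (gform x a a))" "0 \<le> Re (gform x a a)"
proof -
  let ?m = "\<Sum>i\<in>UNIV. x $ i *\<^sub>R a i"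
  have sx: "(\<Sum>i\<in>UNIV. x $ i) = 1 - bary0 x" by (simp add: bary0_def)
  have "(\<Sum>i\<in>UNIV. x $ i *\<^sub>R ((a i - ?m) * cnj (a i - ?m)))
      = (\<Sum>i\<in>UNIV. x $ i *\<^sub>R (a i * cnj (a i)) - (x $ i *\<^sub>R a i) * cnj ?m - ?m * cnj (x $ i *\<^sub>R a i) + x $ i *\<^sub>R (?m * cnj ?m))"
    by (intro sum.cong refl) (simp add: algebra_simps)
  also have "\<dots> = (\<Sum>i\<in>UNIV. x $ i *\<^sub>R (a i * cnj (a i))) - ?m * cnj ?m - ?m * cnj ?m + (1 - bary0 x) *\<^sub>R (?m * cnj ?m)"
    by (simp only: sum.distrib sum_subtractf sum_distrib_right[symmetric] sum_distrib_left[symmetric] cnj_sum[symmetric]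
        scaleR_sum_left[symmetric] sx)
  also have "\<dots> = gform x a a - bary0 x *\<^sub>R (?m * cnj ?m)"
    by (simp add: gform_def scaleR_diff_left)
  finally have "gform x a a = (\<Sum>i\<in>UNIV. x $ i *\<^sub>R ((a i - ?m) * cnj (a i - ?m))) + bary0 x *\<^sub>R (?m * cnj ?m)"
    by simp
  also have "\<dots> = of_real ((\<Sum>i\<in>UNIV. x $ i * (cmod (a i - ?m))\<^sup>2) + bary0 x * (cmod ?m)\<^sup>2)"
    by (simp only: complex_norm_square[symmetric]) (simp add: scaleR_conv_of_real)
  finally have *: "gform x a a = of_real ((\<Sum>i\<in>UNIV. x $ i * (cmod (a i - ?m))\<^sup>2) + bary0 x * (cmod ?m)\<^sup>2)" .
  show "gform x a a = of_real (Re (gform x a a))" unfolding * by (simp only: Re_complex_of_real)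
  have "0 \<le> (\<Sum>i\<in>UNIV. x $ i * (cmod (a i - ?m))\<^sup>2) + bary0 x * (cmod ?m)\<^sup>2"
    using simplexD(1,2)[OF x] by (intro add_nonneg_nonneg sum_nonneg mult_nonneg_nonneg) (auto intro: less_imp_le)
  then show "0 \<le> Re (gform x a a)" unfolding * by (simp only: Re_complex_of_real)
qed

text \<open>Expand the form at \<open>a - z b\<close>, where \<open>z\<close> is the phase of \<open>gform x a b\<close>.\<close>

lemma gform_bound:
  assumes x: "x \<in> open_simplex"
  shows "2 * cmod (gform x a b) \<le> Re (gform x a a) + Re (gform x b b)"
proof -
  let ?z = "sgn (gform x a b)"
  have "gform x (\<lambda>i. a i - ?z * b i) (\<lambda>i. a i - ?z * b i)
      = gform x a a - cnj ?z * gform x a b - ?z * cnj (gform x a b) + ?z * cnj ?z * gform x b b"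
    by (simp only: gform_diff_left gform_diff_right gform_cmult_left gform_cmult_right gform_commute[of x b a])
       (simp add: algebra_simps)
  moreover have "cnj ?z * gform x a b = of_real (cmod (gform x a b))"
    by (cases "gform x a b = 0")
       (simp_all add: sgn_div_norm scaleR_conv_of_real complex_norm_square[symmetric] mult.commute[of "cnj _"] power2_eq_square field_simps del: of_real_power)
  moreover have "?z * cnj (gform x a b) = of_real (cmod (gform x a b))"
    using arg_cong[OF calculation(2), of cnj] by simp
  moreover have "Re (?z * cnj ?z * gform x b b) \<le> Re (gform x b b)"
  proof -
    have "?z * cnj ?z * gform x b b = of_real ((cmod ?z)\<^sup>2 * Re (gform x b b))"
      by (subst gform_self(1)[OF x]) (simp only: complex_norm_square[symmetric] of_real_mult)
    moreover have "(cmod ?z)\<^sup>2 * Re (gform x b b) \<le> 1 * Re (gform x b b)"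
      by (intro mult_right_mono gform_self(2)[OF x]) (simp add: norm_sgn)
    ultimately show ?thesis by simp
  qed
  ultimately show ?thesis
    using gform_self(2)[OF x, of "\<lambda>i. a i - ?z * b i"] by simp
qed

lemma gform_diff_bound:
  assumes x: "x \<in> open_simplex"
  shows "Re (gform x (\<lambda>i. a i - b i) (\<lambda>i. a i - b i)) \<le> 2 * Re (gform x a a) + 2 * Re (gform x b b)"
proof -
  have "Re (gform x (\<lambda>i. a i - b i) (\<lambda>i. a i - b i)) = Re (gform x a a) + Re (gform x b b) - 2 * Re (gform x a b)"
    by (simp add: gform_diff_left gform_diff_right gform_commute[of x b a])
  moreover have "- Re (gform x a b) \<le> cmod (gform x a b)"
    using abs_Re_le_cmod[of "gform x a b"] by linarith
  ultimately show ?thesis using gform_bound[OF x, of a b] by linarith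
qed

abbreviation pgrad :: "(real^'n::finite \<Rightarrow> complex) \<Rightarrow> real^'n \<Rightarrow> 'n \<Rightarrow> complex" where
  "pgrad u x \<equiv> \<lambda>i. partial_deriv i u x"

lemma metric_norm_grad:
  fixes u :: "real^'n::finite \<Rightarrow> complex"
  assumes x: "x \<in> open_simplex"
  shows "(metric_norm (baran_metric x) (grad baran_metric u x))\<^sup>2 = Re (gform x (pgrad u x) (pgrad u x))"
proof -
  let ?G = "baran_metric x" and ?v = "\<lambda>i. gradv u i x"
  have v: "grad baran_metric u x $ i = ?v i" for i
    by (simp add: grad_def gradv_def matrix_inv_baran_metric[OF x])
  have G: "(\<Sum>j\<in>UNIV. ?G $ i $ j * ginv x j k) = (if i = k then 1 else 0)" for i k
    using baran_metric_mult_ginv(1)[OF x] by (simp add: vec_eq_iff matrix_matrix_mult_def mat_def)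
  have Gv: "(\<Sum>j\<in>UNIV. ?G $ i $ j *\<^sub>R ?v j) = partial_deriv i u x" for i
  proof -
    have "(\<Sum>j\<in>UNIV. ?G $ i $ j *\<^sub>R ?v j) = (\<Sum>j\<in>UNIV. \<Sum>k\<in>UNIV. (?G $ i $ j * ginv x j k) *\<^sub>R partial_deriv k u x)"
      by (simp add: gradv_def scaleR_sum_right)
    also have "\<dots> = (\<Sum>k\<in>UNIV. (\<Sum>j\<in>UNIV. ?G $ i $ j * ginv x j k) *\<^sub>R partial_deriv k u x)"
      by (subst sum.swap) (simp add: scaleR_sum_left)
    also have "\<dots> = (\<Sum>k\<in>UNIV. if i = k then partial_deriv k u x else 0)"
      unfolding G by (rule sum.cong) auto
    finally show ?thesis by simp
  qed
  have "(\<Sum>i\<in>UNIV. \<Sum>j\<in>UNIV. (?G $ i $ j) *\<^sub>R (?v i * cnj (?v j))) = (\<Sum>i\<in>UNIV. ?v i * cnj (\<Sum>j\<in>UNIV. ?G $ i $ j *\<^sub>R ?v j))"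
    by (simp add: sum_distrib_left)
  also have "\<dots> = gform x (pgrad u x) (pgrad u x)"
    unfolding Gv using sum_ginv_gform[of x "pgrad u x" "pgrad u x"] by (simp add: gradv_def)
  finally show ?thesis
    using gform_self(2)[OF x, of "pgrad u x"] by (simp add: metric_norm_def v)
qed

lemma L2_simplexI:
  fixes f :: "real^'n::finite \<Rightarrow> complex"
  assumes "f \<in> borel_measurable simplex_volume" "bounded (f ` open_simplex)"
  shows "f \<in> L2 simplex_volume"
proof -
  interpret finite_measure "simplex_volume :: (real^'n) measure" by (rule finite_measure_simplex_volume)
  obtain B where B: "\<And>x. x \<in> open_simplex \<Longrightarrow> cmod (f x) \<le> B" using assms(2) unfolding bounded_iff by auto
  have [measurable]: "f \<in> borel_measurable simplex_volume" by fact
  have "integrable simplex_volume (\<lambda>x. (cmod (f x))\<^sup>2)"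
  proof (rule integrable_const_bound[of _ "B\<^sup>2"])
    show "AE x in simplex_volume. norm ((cmod (f x))\<^sup>2) \<le> B\<^sup>2"
      by (rule AE_I2) (auto intro!: power_mono B)
  qed measurable
  then show ?thesis using assms(1) by (simp add: L2_def)
qed

lemma bounded_image_combine:
  fixes f g :: "'a \<Rightarrow> 'b::real_normed_algebra"
  assumes "bounded (f ` S)" "bounded (g ` S)"
  shows "bounded ((\<lambda>x. f x + g x) ` S)" "bounded ((\<lambda>x. f x * g x) ` S)"
proof -
  obtain A B where A: "\<And>x. x \<in> S \<Longrightarrow> norm (f x) \<le> A" and B: "\<And>x. x \<in> S \<Longrightarrow> norm (g x) \<le> B"
    using assms unfolding bounded_iff by auto
  show "bounded ((\<lambda>x. f x + g x) ` S)"
    by (rule boundedI[of _ "A + B"]) (auto intro!: order_trans[OF norm_triangle_ineq] add_mono A B)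
  have "norm (f x * g x) \<le> A * B" if "x \<in> S" for x
    using norm_mult_ineq[of "f x" "g x"] mult_mono[OF A[OF that] B[OF that]] A[OF that] norm_ge_zero[of "f x"]
    by (meson norm_ge_zero order_trans)
  then show "bounded ((\<lambda>x. f x * g x) ` S)" by (intro boundedI[of _ "A * B"]) auto
qed

lemma bounded_image_sum:
  fixes f :: "'i \<Rightarrow> 'a \<Rightarrow> 'b::real_normed_algebra"
  assumes "\<And>i. i \<in> I \<Longrightarrow> bounded (f i ` S)"
  shows "bounded ((\<lambda>x. \<Sum>i\<in>I. f i x) ` S)"
  using assms by (induction I rule: infinite_finite_induct)
    (auto intro: bounded_image_combine simp: image_constant_conv)

lemma bounded_simplex_polys:
  "bounded ((\<lambda>x. complex_of_real (x $ i)) ` (open_simplex :: (real^'n::finite) set))"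
  "bounded ((\<lambda>x. complex_of_real (ginv x i j)) ` (open_simplex :: (real^'n) set))"
proof -
  have c: "norm (x $ k) \<le> 1" if "x \<in> open_simplex" for x :: "real^'n" and k
    using simplexD(2,3)[OF that, of k] by simp
  then show 1: "bounded ((\<lambda>x. complex_of_real (x $ i)) ` (open_simplex :: (real^'n) set))" for i
    by (intro boundedI[of _ 1]) auto
  have "bounded ((\<lambda>x. complex_of_real (if i = j then x $ i else 0) + complex_of_real (- 1) * (complex_of_real (x $ i) * complex_of_real (x $ j))) ` (open_simplex :: (real^'n) set))"
  proof (intro bounded_image_combine 1)
    show "bounded ((\<lambda>x. complex_of_real (if i = j then x $ i else 0)) ` (open_simplex :: (real^'n) set))"
      using 1 by (cases "i = j") (auto simp: image_constant_conv)
  qed (auto simp: image_constant_conv)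
  then show "bounded ((\<lambda>x. complex_of_real (ginv x i j)) ` (open_simplex :: (real^'n) set))"
    by (rule bounded_subset) (auto simp: ginv_def)
qed

lemma bounded_simplex_affine:
  "bounded ((\<lambda>x. complex_of_real (c * (1 - b * x $ j))) ` (open_simplex :: (real^'n::finite) set))"
proof (rule boundedI[of _ "\<bar>c\<bar> * (1 + \<bar>b\<bar>)"], clarify)
  fix x :: "real^'n" assume x: "x \<in> open_simplex"
  have "\<bar>1 - b * x $ j\<bar> \<le> \<bar>1\<bar> + \<bar>b * x $ j\<bar>" by (rule abs_triangle_ineq4)
  also have "\<bar>b * x $ j\<bar> \<le> \<bar>b\<bar> * 1"
    unfolding abs_mult using simplexD(2,3)[OF x, of j] by (intro mult_left_mono) auto
  finally have "\<bar>1 - b * x $ j\<bar> \<le> 1 + \<bar>b\<bar>" by simp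
  then show "norm (complex_of_real (c * (1 - b * x $ j))) \<le> \<bar>c\<bar> * (1 + \<bar>b\<bar>)"
    unfolding norm_of_real abs_mult by (intro mult_left_mono) auto
qed

lemma C_on_mono: "k \<le> m \<Longrightarrow> u \<in> C_on m S \<Longrightarrow> u \<in> C_on k S"
  unfolding C_on_def mem_Collect_eq by (meson le_trans less_le_trans)

lemma C2b_laplace_L2:
  fixes u :: "real^'n::finite \<Rightarrow> complex"
  assumes u: "u \<in> C2b_on open_simplex"
  shows "lap u \<in> L2 simplex_volume" "u \<in> L2 simplex_volume"
    "(\<lambda>x. - laplace_beltrami baran_metric u x) \<in> L2 simplex_volume"
proof -
  note C2 = C2b_onD(1)[OF u] and b = C2b_onD(2-)[OF u]
  have cg: "continuous_on A (\<lambda>x. ginv x i j)" for A and i j :: 'n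
    unfolding ginv_def by (cases "i = j") (auto intro!: continuous_intros)
  have c: "continuous_on open_simplex (lap u)"
    unfolding lap_def[abs_def] by (intro continuous_intros cg C_on_1D[OF C2] C_on_2D[OF C2]) auto
  have "bounded ((\<lambda>x. (\<Sum>i\<in>UNIV. \<Sum>j\<in>UNIV. complex_of_real (ginv x i j) * partial_deriv i (partial_deriv j u) x)
     + (\<Sum>j\<in>UNIV. complex_of_real (1/2 * (1 - (real CARD('n) + 1) * x $ j)) * partial_deriv j u x)) ` open_simplex)"
    by (intro bounded_image_combine bounded_image_sum bounded_simplex_polys bounded_simplex_affine b)
  moreover have "lap u = (\<lambda>x. (\<Sum>i\<in>UNIV. \<Sum>j\<in>UNIV. complex_of_real (ginv x i j) * partial_deriv i (partial_deriv j u) x)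
     + (\<Sum>j\<in>UNIV. complex_of_real (1/2 * (1 - (real CARD('n) + 1) * x $ j)) * partial_deriv j u x))"
    by (rule ext) (simp add: lap_def scaleR_conv_of_real)
  ultimately have bl: "bounded (lap u ` open_simplex)" by simp
  show L: "lap u \<in> L2 simplex_volume"
    by (intro L2_simplexI continuous_on_borel_measurable_simplex_volume c bl)
  show "u \<in> L2 simplex_volume"
    by (intro L2_simplexI continuous_on_borel_measurable_simplex_volume C_on_1D[OF C2] b) auto
  have "continuous_on open_simplex (\<lambda>x. - lap u x)" by (intro continuous_intros c)
  then have "continuous_on open_simplex (\<lambda>x. - laplace_beltrami baran_metric u x)"
    by (rule continuous_on_eq) (simp add: laplace_beltrami_eq_lap[OF C2])
  then have "(\<lambda>x. - laplace_beltrami baran_metric u x) \<in> borel_measurable simplex_volume"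
    by (rule continuous_on_borel_measurable_simplex_volume)
  moreover have "ae_eq simplex_volume (\<lambda>x. -1 * lap u x) (\<lambda>x. - laplace_beltrami baran_metric u x)"
    unfolding ae_eq_def by (rule AE_I2) (simp add: laplace_beltrami_eq_lap[OF C2])
  ultimately show "(\<lambda>x. - laplace_beltrami baran_metric u x) \<in> L2 simplex_volume"
    using L2_ae_cong[OF L2_cmult[OF L, of "-1"]] by blast
qed

lemma gform_measurable:
  fixes u v :: "real^'n::finite \<Rightarrow> complex"
  assumes "u \<in> C_on k open_simplex" "v \<in> C_on k open_simplex" "k \<ge> 1"
  shows "(\<lambda>x. gform x (pgrad u x) (pgrad v x)) \<in> borel_measurable simplex_volume"
  unfolding gform_def
  by (intro continuous_on_borel_measurable_simplex_volume continuous_intros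
      C_on_1D(3)[OF assms(1,3)] C_on_1D(3)[OF assms(2,3)])

lemma gform_integrable:
  fixes u v :: "real^'n::finite \<Rightarrow> complex"
  assumes uv: "u \<in> C_on k open_simplex" "v \<in> C_on k open_simplex" "k \<ge> 1"
    and "integrable simplex_volume (\<lambda>x. Re (gform x (pgrad u x) (pgrad u x)))"
    and "integrable simplex_volume (\<lambda>x. Re (gform x (pgrad v x) (pgrad v x)))"
  shows "integrable simplex_volume (\<lambda>x. gform x (pgrad u x) (pgrad v x))"
proof (rule Bochner_Integration.integrable_bound[OF Bochner_Integration.integrable_add[OF assms(4,5)] gform_measurable[OF uv]])
  show "AE x in simplex_volume. norm (gform x (pgrad u x) (pgrad v x))
     \<le> norm (Re (gform x (pgrad u x) (pgrad u x)) + Re (gform x (pgrad v x) (pgrad v x)))"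
  proof (rule AE_I2)
    fix x :: "real^'n" assume "x \<in> space simplex_volume"
    then have x: "x \<in> open_simplex" by simp
    show "norm (gform x (pgrad u x) (pgrad v x)) \<le> norm (Re (gform x (pgrad u x) (pgrad u x)) + Re (gform x (pgrad v x) (pgrad v x)))"
      using gform_bound[OF x, of "pgrad u x" "pgrad v x"] gform_self(2)[OF x, of "pgrad u x"]
        gform_self(2)[OF x, of "pgrad v x"] norm_ge_zero[of "gform x (pgrad u x) (pgrad v x)"]
      by (simp only: real_norm_def)
  qed
qed

lemma C2b_energy_integrable:
  fixes u :: "real^'n::finite \<Rightarrow> complex"
  assumes u: "u \<in> C2b_on open_simplex"
  shows "integrable simplex_volume (\<lambda>x. Re (gform x (pgrad u x) (pgrad u x)))"
proof -
  interpret finite_measure "simplex_volume :: (real^'n) measure" by (rule finite_measure_simplex_volume)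
  note C2 = C2b_onD(1)[OF u] and b = C2b_onD(2-)[OF u]
  have bc: "bounded ((\<lambda>x. cnj (partial_deriv i u x)) ` open_simplex)" for i
    using b(2)[of i] unfolding bounded_iff by auto
  have bm: "bounded ((\<lambda>x. \<Sum>i\<in>UNIV. complex_of_real (x $ i) * partial_deriv i u x) ` open_simplex)"
    by (intro bounded_image_sum bounded_image_combine bounded_simplex_polys b)
  then have bmc: "bounded ((\<lambda>x. cnj (\<Sum>i\<in>UNIV. complex_of_real (x $ i) * partial_deriv i u x)) ` open_simplex)"
    unfolding bounded_iff by (simp only: ball_simps complex_mod_cnj)
  have "bounded ((\<lambda>x. (\<Sum>i\<in>UNIV. complex_of_real (x $ i) * (partial_deriv i u x * cnj (partial_deriv i u x)))
     + (-1) * ((\<Sum>i\<in>UNIV. complex_of_real (x $ i) * partial_deriv i u x) * cnj (\<Sum>i\<in>UNIV. complex_of_real (x $ i) * partial_deriv i u x))) ` open_simplex)"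
    by (intro bounded_image_sum bounded_image_combine bounded_simplex_polys b bc bm bmc) (auto simp: image_constant_conv)
  then have "bounded ((\<lambda>x. gform x (pgrad u x) (pgrad u x)) ` open_simplex)"
    by (simp add: gform_def scaleR_conv_of_real)
  then obtain B where B: "\<And>x. x \<in> open_simplex \<Longrightarrow> cmod (gform x (pgrad u x) (pgrad u x)) \<le> B"
    unfolding bounded_iff by auto
  have "integrable simplex_volume (\<lambda>x. gform x (pgrad u x) (pgrad u x))"
    by (rule integrable_const_bound[of _ B]) (use B gform_measurable[OF C2 C2] in \<open>auto intro: AE_I2\<close>)
  then show ?thesis by (rule integrable_Re)
qed

text \<open>The divergence theorem for \<open>Y = cnj v * grad u\<close>. Its derivative along \<open>ln bary_prod\<close> is a bounded
  function times \<open>cnj v\<close> by \<open>sum_ginv_log\<close>, hence integrable. The function \<open>v\<close> is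
  asked for finite energy and not for bounded derivatives, because the formula is applied to the
  functions in the definition of \<open>H\<^sup>1\<close>.\<close>

lemma Green:
  fixes u v :: "real^'n::finite \<Rightarrow> complex"
  assumes u: "u \<in> C2b_on open_simplex" and v: "v \<in> C_on k open_simplex" "k \<ge> 1"
    and vL: "v \<in> L2 simplex_volume"
    and Ev: "integrable simplex_volume (\<lambda>x. Re (gform x (pgrad v x) (pgrad v x)))"
  shows "integrable simplex_volume (\<lambda>x. gform x (pgrad u x) (pgrad v x))"
    "l2_inner simplex_volume (\<lambda>x. - laplace_beltrami baran_metric u x) v
      = (\<integral>x. gform x (pgrad u x) (pgrad v x) \<partial>simplex_volume)"
proof -
  let ?M = "simplex_volume :: (real^'n) measure" and ?S = "open_simplex :: (real^'n) set"
  note C2 = C2b_onD(1)[OF u] and b = C2b_onD(2-)[OF u]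
  have u1: "u \<in> C_on 1 ?S" using C_on_mono[OF _ C2] by simp
  have v1: "v \<in> C_on 1 ?S" using C_on_mono v by blast
  show int: "integrable ?M (\<lambda>x. gform x (pgrad u x) (pgrad v x))"
    by (rule gform_integrable[OF u1 v1 order_refl C2b_energy_integrable[OF u] Ev])
  define Y where "Y i x = gradv u i x * cnj (v x)" for i x
  have dv: "v differentiable (at x)" if "x \<in> ?S" for x by (rule C_on_1D(1)[OF v1 _ that]) simp
  have dcv: "(\<lambda>x. cnj (v x)) differentiable (at x)" "partial_deriv i (\<lambda>x. cnj (v x)) x = cnj (partial_deriv i v x)" if "x \<in> ?S" for i x
    using partial_deriv_bounded_linear[OF bounded_linear_cnj dv[OF that]] by auto
  have pdY: "partial_deriv i (Y i) x = partial_deriv i (gradv u i) x * cnj (v x) + gradv u i x * cnj (partial_deriv i v x)" if "x \<in> ?S" for i x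
    unfolding Y_def[abs_def] partial_deriv_mult[OF gradv_deriv(1)[OF C2 that] dcv(1)[OF that]] dcv(2)[OF that] ..
  have div: "(\<Sum>i\<in>UNIV. partial_deriv i (Y i) x) - (1/2) *\<^sub>R (\<Sum>i\<in>UNIV. (1 / x $ i - 1 / bary0 x) *\<^sub>R Y i x)
      = lap u x * cnj (v x) + gform x (pgrad u x) (pgrad v x)" if "x \<in> ?S" for x
  proof -
    have "(\<Sum>i\<in>UNIV. (1 / x $ i - 1 / bary0 x) *\<^sub>R Y i x) = (\<Sum>i\<in>UNIV. (1 / x $ i - 1 / bary0 x) *\<^sub>R gradv u i x) * cnj (v x)"
      by (simp add: Y_def sum_distrib_right)
    moreover have "(\<Sum>i\<in>UNIV. partial_deriv i (Y i) x) = (\<Sum>i\<in>UNIV. partial_deriv i (gradv u i) x) * cnj (v x) + gform x (pgrad u x) (pgrad v x)"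
      unfolding pdY[OF that] sum_ginv_gform[symmetric] by (simp add: sum.distrib sum_distrib_right gradv_def)
    ultimately show ?thesis
      by (simp add: gradv_deriv(3)[OF C2 that, symmetric] left_diff_distrib)
  qed
  have log: "(\<Sum>i\<in>UNIV. (1 / x $ i - 1 / bary0 x) *\<^sub>R Y i x)
     = (\<Sum>j\<in>UNIV. (1 - (real CARD('n) + 1) * x $ j) *\<^sub>R partial_deriv j u x) * cnj (v x)" if "x \<in> ?S" for x
  proof -
    have "(\<Sum>i\<in>UNIV. (1 / x $ i - 1 / bary0 x) *\<^sub>R gradv u i x)
        = (\<Sum>i\<in>UNIV. \<Sum>j\<in>UNIV. ((1 / x $ i - 1 / bary0 x) * ginv x i j) *\<^sub>R partial_deriv j u x)"
      by (simp add: gradv_def scaleR_sum_right)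
    also have "\<dots> = (\<Sum>j\<in>UNIV. \<Sum>i\<in>UNIV. ((1 / x $ i - 1 / bary0 x) * ginv x i j) *\<^sub>R partial_deriv j u x)"
      by (rule sum.swap)
    also have "\<dots> = (\<Sum>j\<in>UNIV. (1 - (real CARD('n) + 1) * x $ j) *\<^sub>R partial_deriv j u x)"
      by (simp only: scaleR_sum_left[symmetric] sum_ginv_log[OF that])
    finally have "(\<Sum>i\<in>UNIV. (1 / x $ i - 1 / bary0 x) *\<^sub>R gradv u i x) * cnj (v x)
        = (\<Sum>j\<in>UNIV. (1 - (real CARD('n) + 1) * x $ j) *\<^sub>R partial_deriv j u x) * cnj (v x)" by (simp only:)
    moreover have "(\<Sum>i\<in>UNIV. (1 / x $ i - 1 / bary0 x) *\<^sub>R Y i x)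
        = (\<Sum>i\<in>UNIV. (1 / x $ i - 1 / bary0 x) *\<^sub>R gradv u i x) * cnj (v x)"
      by (simp add: Y_def sum_distrib_right)
    ultimately show ?thesis by (simp only:)
  qed
  have bl: "(\<lambda>x. \<Sum>j\<in>UNIV. (1 - (real CARD('n) + 1) * x $ j) *\<^sub>R partial_deriv j u x) \<in> L2 ?M"
  proof (rule L2_simplexI)
    show "(\<lambda>x. \<Sum>j\<in>UNIV. (1 - (real CARD('n) + 1) * x $ j) *\<^sub>R partial_deriv j u x) \<in> borel_measurable ?M"
      by (intro continuous_on_borel_measurable_simplex_volume continuous_intros C_on_1D(3)[OF u1]) simp
    have "bounded ((\<lambda>x. \<Sum>j\<in>UNIV. complex_of_real (1 * (1 - (real CARD('n) + 1) * x $ j)) * partial_deriv j u x) ` ?S)"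
      by (intro bounded_image_combine bounded_image_sum bounded_simplex_affine b)
    then show "bounded ((\<lambda>x. \<Sum>j\<in>UNIV. (1 - (real CARD('n) + 1) * x $ j) *\<^sub>R partial_deriv j u x) ` ?S)"
      by (simp add: scaleR_conv_of_real)
  qed
  have "integrable ?M (\<lambda>x. \<Sum>i\<in>UNIV. (1 / x $ i - 1 / bary0 x) *\<^sub>R Y i x) \<longleftrightarrow>
      integrable ?M (\<lambda>x. (\<Sum>j\<in>UNIV. (1 - (real CARD('n) + 1) * x $ j) *\<^sub>R partial_deriv j u x) * cnj (v x))"
    by (rule Bochner_Integration.integrable_cong[OF refl]) (simp add: log)
  then have int_log: "integrable ?M (\<lambda>x. \<Sum>i\<in>UNIV. (1 / x $ i - 1 / bary0 x) *\<^sub>R Y i x)"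
    using L2_mult_integrable[OF bl vL] by blast
  have int_rhs: "integrable ?M (\<lambda>x. lap u x * cnj (v x) + gform x (pgrad u x) (pgrad v x))"
    by (intro Bochner_Integration.integrable_add L2_mult_integrable C2b_laplace_L2[OF u] vL int)
  have "integrable ?M (\<lambda>x. (lap u x * cnj (v x) + gform x (pgrad u x) (pgrad v x)) + (1/2) *\<^sub>R (\<Sum>i\<in>UNIV. (1 / x $ i - 1 / bary0 x) *\<^sub>R Y i x))"
    by (intro Bochner_Integration.integrable_add integrable_scaleR_right int_rhs int_log)
  moreover have "integrable ?M (\<lambda>x. \<Sum>i\<in>UNIV. partial_deriv i (Y i) x) \<longleftrightarrow>
      integrable ?M (\<lambda>x. (lap u x * cnj (v x) + gform x (pgrad u x) (pgrad v x)) + (1/2) *\<^sub>R (\<Sum>i\<in>UNIV. (1 / x $ i - 1 / bary0 x) *\<^sub>R Y i x))"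
    by (rule Bochner_Integration.integrable_cong[OF refl]) (simp add: div[symmetric])
  ultimately have int_div: "integrable ?M (\<lambda>x. \<Sum>i\<in>UNIV. partial_deriv i (Y i) x)"
    by blast
  have "(\<integral>x. (\<Sum>i\<in>UNIV. partial_deriv i (Y i) x) - (1/2) *\<^sub>R (\<Sum>i\<in>UNIV. (1 / x $ i - 1 / bary0 x) *\<^sub>R Y i x) \<partial>?M) = 0"
  proof (rule simplex_divergence_weighted[OF _ _ int_div int_log])
    show "Y i differentiable (at x)" if "x \<in> ?S" for i x
      unfolding Y_def[abs_def] by (intro differentiable_mult gradv_deriv[OF C2] dcv that)
    have cg: "continuous_on A (\<lambda>x. ginv x i j)" for A and i j :: 'n
      unfolding ginv_def by (cases "i = j") (auto intro!: continuous_intros)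
    have cdg: "continuous_on A (\<lambda>x. partial_deriv k (\<lambda>y. ginv y i j) x)" for A and i j k :: 'n
      unfolding ginv_deriv(2) by (cases "k = i"; cases "k = j") (auto intro!: continuous_intros)
    have "continuous_on ?S (\<lambda>x. (\<Sum>j\<in>UNIV. partial_deriv k (\<lambda>y. ginv y i j) x *\<^sub>R partial_deriv j u x
       + ginv x i j *\<^sub>R partial_deriv k (partial_deriv j u) x))" for i k
      by (intro continuous_intros cg cdg C_on_1D(3)[OF C2] C_on_2D(2)[OF C2]) auto
    then have "continuous_on ?S (partial_deriv k (gradv u i))" for i k
      by (rule continuous_on_eq) (simp add: gradv_deriv(2)[OF C2])
    moreover have "continuous_on ?S (gradv u i)" for i
      unfolding gradv_def[abs_def] by (intro continuous_intros cg C_on_1D(3)[OF C2]) auto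
    ultimately have "continuous_on ?S (\<lambda>x. partial_deriv i (gradv u i) x * cnj (v x) + gradv u i x * cnj (partial_deriv i v x))" for i
      by (intro continuous_intros C_on_1D(2,3)[OF v1]) auto
    then show "continuous_on ?S (partial_deriv i (Y i))" for i
      by (rule continuous_on_eq) (simp add: pdY)
  qed
  then have "(\<integral>x. lap u x * cnj (v x) + gform x (pgrad u x) (pgrad v x) \<partial>?M) = 0"
    by (subst (asm) Bochner_Integration.integral_cong[OF refl div]) auto
  then have "(\<integral>x. lap u x * cnj (v x) \<partial>?M) + (\<integral>x. gform x (pgrad u x) (pgrad v x) \<partial>?M) = 0"
    by (subst (asm) Bochner_Integration.integral_add) (auto intro: L2_mult_integrable C2b_laplace_L2[OF u] vL int)
  moreover have "l2_inner ?M (\<lambda>x. - laplace_beltrami baran_metric u x) v = - (\<integral>x. lap u x * cnj (v x) \<partial>?M)"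
    unfolding l2_inner_def
    by (subst Bochner_Integration.integral_minus[symmetric], rule Bochner_Integration.integral_cong)
       (auto simp: laplace_beltrami_eq_lap[OF C2])
  ultimately show "l2_inner ?M (\<lambda>x. - laplace_beltrami baran_metric u x) v = (\<integral>x. gform x (pgrad u x) (pgrad v x) \<partial>?M)"
    by (simp add: add_eq_0_iff)
qed

lemma laplace_beltrami_symmetric:
  fixes u v :: "real^'n::finite \<Rightarrow> complex"
  assumes u: "u \<in> C2b_on open_simplex" and v: "v \<in> C2b_on open_simplex"
  shows "l2_inner simplex_volume (\<lambda>x. - laplace_beltrami baran_metric u x) v
    = l2_inner simplex_volume u (\<lambda>x. - laplace_beltrami baran_metric v x)"
proof -
  have "l2_inner simplex_volume u (\<lambda>x. - laplace_beltrami baran_metric v x)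
      = cnj (\<integral>x. gform x (pgrad v x) (pgrad u x) \<partial>simplex_volume)"
    by (subst l2_inner_commute, subst Green(2)[OF v C2b_onD(1)[OF u] _ C2b_laplace_L2(2)[OF u] C2b_energy_integrable[OF u]]) auto
  also have "\<dots> = (\<integral>x. cnj (gform x (pgrad v x) (pgrad u x)) \<partial>simplex_volume)"
    by (rule Bochner_Integration.integral_cnj[symmetric])
  also have "\<dots> = (\<integral>x. gform x (pgrad u x) (pgrad v x) \<partial>simplex_volume)"
    by (simp flip: gform_commute)
  also have "\<dots> = l2_inner simplex_volume (\<lambda>x. - laplace_beltrami baran_metric u x) v"
    by (subst Green(2)[OF u C2b_onD(1)[OF v] _ C2b_laplace_L2(2)[OF v] C2b_energy_integrable[OF v]]) auto
  finally show ?thesis ..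
qed

section \<open>Polynomial functions\<close>

inductive polyfun :: "(real^'n::finite \<Rightarrow> 'b::real_normed_field) \<Rightarrow> bool" where
  polyfun_const: "polyfun (\<lambda>x. c)"
| polyfun_coord: "polyfun (\<lambda>x. of_real (x $ i))"
| polyfun_add: "polyfun u \<Longrightarrow> polyfun v \<Longrightarrow> polyfun (\<lambda>x. u x + v x)"
| polyfun_mult: "polyfun u \<Longrightarrow> polyfun v \<Longrightarrow> polyfun (\<lambda>x. u x * v x)"

lemma polyfun_component: "polyfun (\<lambda>x::real^'n::finite. x $ i)"
  using polyfun_coord[of i, where 'b = real] by simp

lemma polyfun_diff: "polyfun u \<Longrightarrow> polyfun v \<Longrightarrow> polyfun (\<lambda>x. u x - v x)"
  using polyfun_add[OF _ polyfun_mult[OF polyfun_const[of "-1"]], of u v] by simp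

lemma polyfun_sum: "(\<And>i. i \<in> I \<Longrightarrow> polyfun (u i)) \<Longrightarrow> polyfun (\<lambda>x. \<Sum>i\<in>I. u i x)"
  by (induction I rule: infinite_finite_induct) (auto intro: polyfun.intros)

lemma polyfun_prod: "(\<And>i. i \<in> I \<Longrightarrow> polyfun (u i)) \<Longrightarrow> polyfun (\<lambda>x. \<Prod>i\<in>I. u i x)"
  by (induction I rule: infinite_finite_induct) (auto intro: polyfun.intros)

lemma polyfun_power: "polyfun u \<Longrightarrow> polyfun (\<lambda>x. u x ^ k)"
  by (induction k) (auto intro: polyfun.intros)

lemma polyfun_of_real: "polyfun u \<Longrightarrow> polyfun (\<lambda>x. of_real (u x) :: complex)"
  by (induction u rule: polyfun.induct) (auto intro: polyfun.intros)

lemma polyfun_differentiable: "polyfun u \<Longrightarrow> u differentiable (at x)"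
proof (induction u rule: polyfun.induct)
  case (polyfun_coord i)
  show ?case
    by (rule differentiableI[OF bounded_linear.has_derivative[OF bounded_linear_of_real
        bounded_linear.has_derivative[OF bounded_linear_vec_nth has_derivative_ident]]])
qed auto

lemma polyfun_partial_deriv: "polyfun u \<Longrightarrow> polyfun (partial_deriv i u)"
proof (induction u rule: polyfun.induct)
  case (polyfun_const c)
  have "partial_deriv i (\<lambda>x. c) = (\<lambda>x. 0)" by (rule ext) simp
  then show ?case by (simp add: polyfun.polyfun_const)
next
  case (polyfun_coord k)
  have "partial_deriv i (\<lambda>x. of_real (x $ k)) = (\<lambda>x. of_real (if i = k then 1 else 0) :: 'b)"
    by (rule ext, subst partial_deriv_bounded_linear(1)[OF bounded_linear_of_real differentiable_component])
       (simp add: partial_deriv_component)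
  then show ?case by (simp only: polyfun.polyfun_const)
next
  case (polyfun_add u v)
  have "partial_deriv i (\<lambda>x. u x + v x) = (\<lambda>x. partial_deriv i u x + partial_deriv i v x)"
    by (intro ext partial_deriv_add polyfun_differentiable polyfun_add.hyps)
  then show ?case by (simp only: polyfun.polyfun_add polyfun_add.IH)
next
  case (polyfun_mult u v)
  have "partial_deriv i (\<lambda>x. u x * v x) = (\<lambda>x. partial_deriv i u x * v x + u x * partial_deriv i v x)"
    by (intro ext partial_deriv_mult polyfun_differentiable polyfun_mult.hyps)
  then show ?case by (simp only: polyfun.intros polyfun_mult.IH polyfun_mult.hyps)
qed

lemma polyfun_continuous: "polyfun u \<Longrightarrow> continuous_on A u"
  by (intro continuous_at_imp_continuous_on ballI differentiable_imp_continuous_within polyfun_differentiable)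

lemma polyfun_partial_derivs: "polyfun u \<Longrightarrow> polyfun (partial_derivs is u)"
  by (induction "is") (auto intro: polyfun_partial_deriv)

lemma polyfun_C_on: "polyfun u \<Longrightarrow> u \<in> C_on k S"
  by (simp add: C_on_def polyfun_differentiable polyfun_continuous polyfun_partial_derivs)

lemma polyfun_bounded: "polyfun u \<Longrightarrow> bounded (u ` open_simplex)"
proof -
  assume u: "polyfun u"
  have "compact (u ` closure open_simplex)"
    by (intro compact_continuous_image polyfun_continuous u) (simp add: bounded_open_simplex)
  then show ?thesis
    by (rule bounded_subset[OF compact_imp_bounded]) (intro image_mono closure_subset)
qed

lemma polyfun_C2b: "polyfun u \<Longrightarrow> u \<in> C2b_on open_simplex"
  by (simp add: C2b_on_def polyfun_C_on polyfun_bounded polyfun_partial_derivs)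

lemma polyfun_integrable:
  fixes u :: "real^'n::finite \<Rightarrow> 'b::{real_normed_field, banach, second_countable_topology}"
  assumes u: "polyfun u"
  shows "integrable simplex_volume u"
proof -
  interpret finite_measure "simplex_volume :: (real^'n) measure" by (rule finite_measure_simplex_volume)
  obtain B where "\<And>x. x \<in> open_simplex \<Longrightarrow> norm (u x) \<le> B"
    using polyfun_bounded[OF u] unfolding bounded_iff by auto
  then show ?thesis
    by (intro integrable_const_bound[of _ B] AE_I2 continuous_on_borel_measurable_simplex_volume polyfun_continuous u) auto
qed

lemma polyfun_real_polynomial_function: "polyfun u \<Longrightarrow> real_polynomial_function u"
  for u :: "real^'n::finite \<Rightarrow> real"
proof (induction u rule: polyfun.induct)
  case (polyfun_coord i)
  show ?case by (simp add: real_polynomial_function.intros(1) bounded_linear_vec_nth)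
qed (auto intro: real_polynomial_function.intros)

section \<open>Derivatives along a vector field\<close>

text \<open>Directional derivatives as a relation, so that the value along a vector field is obtained by
  composing rules, with differentiability carried along.\<close>

definition dderiv :: "(real^'n::finite \<Rightarrow> real) \<Rightarrow> real^'n \<Rightarrow> real^'n \<Rightarrow> real \<Rightarrow> bool" where
  "dderiv f x y d \<longleftrightarrow> (\<exists>D. (f has_derivative D) (at x) \<and> D y = d)"

lemma dderivI: "(f has_derivative D) (at x) \<Longrightarrow> D y = d \<Longrightarrow> dderiv f x y d"
  unfolding dderiv_def by (intro exI[of _ D] conjI)

lemma dderivE:
  assumes "dderiv f x y d"
  obtains D where "(f has_derivative D) (at x)" "D y = d"
  using assms unfolding dderiv_def by (elim exE conjE)

lemma dderiv_const: "dderiv (\<lambda>x. c) x y 0"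
  by (rule dderivI[OF has_derivative_const]) simp

lemma dderiv_component: "dderiv (\<lambda>x. x $ i) x y (y $ i)"
  by (rule dderivI[OF bounded_linear.has_derivative[OF bounded_linear_vec_nth has_derivative_ident]]) simp

lemma dderiv_add: "dderiv f x y d \<Longrightarrow> dderiv g x y e \<Longrightarrow> dderiv (\<lambda>x. f x + g x) x y (d + e)"
  by (elim dderivE) (rule dderivI, rule has_derivative_add, assumption+, simp)

lemma dderiv_diff: "dderiv f x y d \<Longrightarrow> dderiv g x y e \<Longrightarrow> dderiv (\<lambda>x. f x - g x) x y (d - e)"
  by (elim dderivE) (rule dderivI, rule has_derivative_diff, assumption+, simp)

lemma dderiv_mult: "dderiv f x y d \<Longrightarrow> dderiv g x y e \<Longrightarrow> dderiv (\<lambda>x. f x * g x) x y (f x * e + d * g x)"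
  by (elim dderivE) (rule dderivI, rule has_derivative_mult, assumption+, simp)

lemma dderiv_sum:
  "(\<And>i. i \<in> I \<Longrightarrow> dderiv (f i) x y (d i)) \<Longrightarrow> dderiv (\<lambda>x. \<Sum>i\<in>I. f i x) x y (\<Sum>i\<in>I. d i)"
  by (induction I rule: infinite_finite_induct) (auto intro: dderiv_const dderiv_add)

lemma dderiv_power: "dderiv f x y d \<Longrightarrow> dderiv (\<lambda>x. f x ^ n) x y (real n * f x ^ (n - 1) * d)"
proof (induction n)
  case 0 show ?case using dderiv_const[of 1 x y] by simp
next
  case (Suc n)
  from dderiv_mult[OF Suc.prems Suc.IH[OF Suc.prems]] show ?case
    by (cases n) (simp_all add: algebra_simps)
qed

text \<open>If each factor is an eigenvector of the derivation, so is the product, and the eigenvalues add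
  up.\<close>

lemma dderiv_prod_scaling:
  assumes "\<And>i. i \<in> I \<Longrightarrow> dderiv (f i) x y (c i * f i x)"
  shows "dderiv (\<lambda>x. \<Prod>i\<in>I. f i x) x y ((\<Sum>i\<in>I. c i) * (\<Prod>i\<in>I. f i x))"
  using assms
proof (induction I rule: infinite_finite_induct)
  case (insert i I)
  then have "dderiv (\<lambda>x. f i x * (\<Prod>i\<in>I. f i x)) x y (f i x * ((\<Sum>i\<in>I. c i) * (\<Prod>i\<in>I. f i x)) + c i * f i x * (\<Prod>i\<in>I. f i x))"
    by (intro dderiv_mult) auto
  then show ?case using insert.hyps by (simp add: algebra_simps)
qed (auto intro: dderiv_const)

lemma dderiv_partial_deriv:
  assumes "dderiv f x y d"
  shows "(\<Sum>i\<in>UNIV. y $ i * partial_deriv i f x) = d"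
proof -
  obtain D where D: "(f has_derivative D) (at x)" "D y = d" using assms by (auto simp: dderiv_def)
  interpret D: bounded_linear D by (rule has_derivative_bounded_linear[OF D(1)])
  have "y = (\<Sum>i\<in>UNIV. y $ i *\<^sub>R axis i 1)"
    by (simp add: vec_eq_iff axis_def if_distrib cong: if_cong)
  then have "D y = D (\<Sum>i\<in>UNIV. y $ i *\<^sub>R axis i 1)" by (rule arg_cong)
  also have "\<dots> = (\<Sum>i\<in>UNIV. y $ i * D (axis i 1))" by (simp only: D.sum D.scaleR real_scaleR_def)
  finally have "D y = (\<Sum>i\<in>UNIV. y $ i * D (axis i 1))" .
  then show ?thesis using D by (simp add: partial_derivI[OF D(1)])
qed

section \<open>Jacobi polynomials as binary forms\<close>

definition jacobi_coeff :: "nat \<Rightarrow> real \<Rightarrow> real \<Rightarrow> nat \<Rightarrow> real" where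
  "jacobi_coeff m a b s = (- 1) ^ s * ((real m + a) gchoose (m - s)) * ((real m + b) gchoose s)"

text \<open>The Jacobi polynomial as a binary form of degree \<open>m\<close> in \<open>t\<close> and \<open>r\<close>: its value at \<open>2 t / c - 1\<close>,
  multiplied by \<open>c\<^sup>m\<close>, for \<open>c = t + r\<close>. In this form the quotients in \<open>psi_tilde\<close> disappear. The
  functions \<open>jacobi_hom'\<close> and \<open>jacobi_hom''\<close> are its first and second derivatives by \<open>t\<close> with \<open>c\<close>
  held fixed, that is, with \<open>r\<close> decreasing at unit rate.\<close>

definition jacobi_hom :: "nat \<Rightarrow> real \<Rightarrow> real \<Rightarrow> real \<Rightarrow> real \<Rightarrow> real" where
  "jacobi_hom m a b t r = (\<Sum>s\<le>m. jacobi_coeff m a b s * (r ^ s * t ^ (m - s)))"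

definition jacobi_hom' :: "nat \<Rightarrow> real \<Rightarrow> real \<Rightarrow> real \<Rightarrow> real \<Rightarrow> real" where
  "jacobi_hom' m a b t r = (\<Sum>s\<le>m. jacobi_coeff m a b s *
     (r ^ s * (real (m - s) * t ^ (m - s - 1)) - real s * r ^ (s - 1) * t ^ (m - s)))"

definition jacobi_hom'' :: "nat \<Rightarrow> real \<Rightarrow> real \<Rightarrow> real \<Rightarrow> real \<Rightarrow> real" where
  "jacobi_hom'' m a b t r = (\<Sum>s\<le>m. jacobi_coeff m a b s *
     (r ^ s * (real (m - s) * (real (m - s - 1) * t ^ (m - s - 1 - 1)))
      - 2 * (real s * r ^ (s - 1) * (real (m - s) * t ^ (m - s - 1)))
      + real s * (real (s - 1) * r ^ (s - 1 - 1)) * t ^ (m - s)))"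

lemma poly_jacobi_eq_hom:
  assumes "c \<noteq> 0"
  shows "c ^ m * poly (jacobi_poly m a b) (2 * t / c - 1) = jacobi_hom m a b t (c - t)"
proof -
  have 1: "poly [:- 1 / 2, 1 / 2:] (2 * t / c - 1) = - (c - t) / c" "poly [:1 / 2, 1 / 2:] (2 * t / c - 1) = t / c"
    using assms by (auto simp: field_simps)
  have "c ^ m * (((- (c - t)) / c) ^ s * (t / c) ^ (m - s)) = (- 1) ^ s * ((c - t) ^ s * t ^ (m - s))" if "s \<le> m" for s
  proof -
    have "c ^ m = c ^ s * c ^ (m - s)" using that by (simp flip: power_add)
    moreover have "(- (c - t)) ^ s = (- 1) ^ s * (c - t) ^ s" by (rule power_minus)
    ultimately show ?thesis using assms by (simp only: power_divide) simp
  qed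
  then show ?thesis
    unfolding jacobi_poly_def jacobi_hom_def jacobi_coeff_def poly_sum poly_smult poly_mult poly_power 1 sum_distrib_left
    by (intro sum.cong refl) (simp add: mult_ac)
qed

lemma gbinomial_Suc_mult: "(z gchoose Suc p) * real (Suc p) = (z gchoose p) * (z - real p)" for z :: real
proof -
  have "fact p * ((z gchoose Suc p) * real (Suc p)) = fact (Suc p) * (z gchoose Suc p)" by simp
  also have "\<dots> = fact p * (z gchoose p) * (z - real p)"
    by (simp only: gbinomial_mult_fact prod.atLeast0_lessThan_Suc)
  finally show ?thesis by simp
qed

text \<open>The ratio of consecutive coefficients, which is what makes the terms of Jacobi's equation
  cancel.\<close>

lemma jacobi_coeff_rec:
  assumes "s < m"
  shows "jacobi_coeff m a b (Suc s) * (real (Suc s) * (real (Suc s) + a)) = - jacobi_coeff m a b s * (real (m - s) * (real (m - s) + b))"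
proof -
  obtain p where p: "m - s = Suc p" "m - Suc s = p" using assms by (metis Suc_diff_Suc)
  have m: "real m = real p + real s + 1" using assms p by linarith
  have 1: "((real m + a) gchoose Suc p) * real (Suc p) = ((real m + a) gchoose p) * (real (Suc s) + a)"
    unfolding gbinomial_Suc_mult by (simp add: m)
  have 2: "((real m + b) gchoose Suc s) * real (Suc s) = ((real m + b) gchoose s) * (real (Suc p) + b)"
    unfolding gbinomial_Suc_mult by (simp add: m)
  have "jacobi_coeff m a b (Suc s) * (real (Suc s) * (real (Suc s) + a))
      = - ((- 1) ^ s) * (((real m + a) gchoose p) * (real (Suc s) + a)) * (((real m + b) gchoose Suc s) * real (Suc s))"
    by (simp add: jacobi_coeff_def p del: of_nat_Suc)
  also have "\<dots> = - jacobi_coeff m a b s * (real (m - s) * (real (m - s) + b))"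
    unfolding 1[symmetric] 2 by (simp add: jacobi_coeff_def p del: of_nat_Suc)
  finally show ?thesis .
qed

text \<open>Jacobi's differential equation. Each term of the form produces multiples of three monomials;
  after a shift of the index the multiples of each monomial cancel by the recursion of the
  coefficients.\<close>

lemma jacobi_hom_ode:
  "t * r * jacobi_hom'' m a b t r + ((b + 1) * r - (a + 1) * t) * jacobi_hom' m a b t r
     + real m * (real m + a + b + 1) * jacobi_hom m a b t r = 0"
proof -
  let ?c = "jacobi_coeff m a b" and ?M = "\<lambda>k. r ^ k * t ^ (m - k)"
  have pw: "z * (real k * z ^ (k - 1)) = real k * z ^ k" for z :: real and k by (cases k) auto
  have pw2: "z * (real k * (real (k - 1) * z ^ (k - 1 - 1))) = real k * (real (k - 1) * z ^ (k - 1))" for z :: real and k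
    using pw[of z "k - 1"] by (simp add: mult.left_commute)
  have rk: "real k * real (k - 1) = real k * (real k - 1)" for k by (cases k) auto
  have termwise: "t * r * (?c s * (r ^ s * (real (m - s) * (real (m - s - 1) * t ^ (m - s - 1 - 1)))
      - 2 * (real s * r ^ (s - 1) * (real (m - s) * t ^ (m - s - 1)))
      + real s * (real (s - 1) * r ^ (s - 1 - 1)) * t ^ (m - s)))
    + ((b + 1) * r - (a + 1) * t) * (?c s * (r ^ s * (real (m - s) * t ^ (m - s - 1)) - real s * r ^ (s - 1) * t ^ (m - s)))
    + real m * (real m + a + b + 1) * (?c s * ?M s)
    = ?c s * (real (m - s) * (real (m - s) + b)) * (r ^ Suc s * t ^ (m - s - 1))
      + ?c s * (real s * (real s + a)) * (r ^ (s - 1) * t ^ Suc (m - s))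
      + ?c s * (real s * (real s + a) + real (m - s) * (real (m - s) + b)) * ?M s" (is "?L = ?R") if "s \<le> m" for s
  proof -
    \<comment> \<open>Powers are treated as atoms, linked only by the relations \<open>f\<close>, so that both sides become polynomials in them.\<close>
    define q where "q = m - s"
    have m: "real m = real s + real q" using that by (simp add: q_def)
    have e1: "t * (real q * (real (q - 1) * t ^ (q - 1 - 1))) = real q * (real q - 1) * t ^ (q - 1)"
      unfolding pw2 by (simp only: rk mult.assoc[symmetric])
    have e2: "r * (real s * (real (s - 1) * r ^ (s - 1 - 1))) = real s * (real s - 1) * r ^ (s - 1)"
      unfolding pw2 by (simp only: rk mult.assoc[symmetric])
    have e3: "t * (real q * t ^ (q - 1)) = real q * t ^ q" "r * (real s * r ^ (s - 1)) = real s * r ^ s" by (rule pw)+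
    define A B C D where "A = t ^ (q - 1)" and "B = r ^ (s - 1)" and "C = t ^ q" and "D = r ^ s"
    define A2 B2 where "A2 = real q * (real (q - 1) * t ^ (q - 1 - 1))" and "B2 = real s * (real (s - 1) * r ^ (s - 1 - 1))"
    have f: "t * A2 = real q * (real q - 1) * A" "r * B2 = real s * (real s - 1) * B"
      "t * (real q * A) = real q * C" "r * (real s * B) = real s * D"
      using e1 e2 e3 by (auto simp: A_def B_def C_def D_def A2_def B2_def)
    have "?L = ?c s * (r * D * (t * A2) - 2 * (r * (real s * B)) * (t * (real q * A)) + t * C * (r * B2)
      + (b + 1) * (r * D * (real q * A) - (r * (real s * B)) * C)
      - (a + 1) * (D * (t * (real q * A)) - t * C * (real s * B)) + (real s + real q) * (real s + real q + a + b + 1) * (D * C))"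
      unfolding m q_def[symmetric] A_def[symmetric] B_def[symmetric] C_def[symmetric] D_def[symmetric] A2_def[symmetric] B2_def[symmetric]
      by (simp add: algebra_simps)
    also have "\<dots> = ?c s * (real q * (real q + b)) * (r * D * A) + ?c s * (real s * (real s + a)) * (B * (t * C))
      + ?c s * (real s * (real s + a) + real q * (real q + b)) * (D * C)"
      unfolding f by (simp add: algebra_simps)
    also have "\<dots> = ?R"
      unfolding q_def[symmetric] by (simp add: A_def B_def C_def D_def)
    finally show ?thesis .
  qed
  have "t * r * jacobi_hom'' m a b t r + ((b + 1) * r - (a + 1) * t) * jacobi_hom' m a b t r
     + real m * (real m + a + b + 1) * jacobi_hom m a b t r
    = (\<Sum>s\<le>m. ?c s * (real (m - s) * (real (m - s) + b)) * (r ^ Suc s * t ^ (m - s - 1))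
      + ?c s * (real s * (real s + a)) * (r ^ (s - 1) * t ^ Suc (m - s))
      + ?c s * (real s * (real s + a) + real (m - s) * (real (m - s) + b)) * ?M s)"
    unfolding jacobi_hom_def jacobi_hom'_def jacobi_hom''_def sum_distrib_left sum.distrib[symmetric]
    by (rule sum.cong[OF refl], rule termwise) simp
  also have "\<dots> = (\<Sum>s\<le>m. ?c s * (real (m - s) * (real (m - s) + b)) * (r ^ Suc s * t ^ (m - s - 1)))
      + (\<Sum>s\<le>m. ?c s * (real s * (real s + a)) * (r ^ (s - 1) * t ^ Suc (m - s)))
      + (\<Sum>s\<le>m. ?c s * (real s * (real s + a)) * ?M s) + (\<Sum>s\<le>m. ?c s * (real (m - s) * (real (m - s) + b)) * ?M s)"
    by (simp add: sum.distrib distrib_left distrib_right)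
  also have "(\<Sum>s\<le>m. ?c s * (real (m - s) * (real (m - s) + b)) * (r ^ Suc s * t ^ (m - s - 1)))
      = - (\<Sum>s\<le>m. ?c s * (real s * (real s + a)) * ?M s)"
  proof -
    have "(\<Sum>s\<le>m. ?c s * (real (m - s) * (real (m - s) + b)) * (r ^ Suc s * t ^ (m - s - 1)))
        = (\<Sum>s<m. ?c s * (real (m - s) * (real (m - s) + b)) * (r ^ Suc s * t ^ (m - s - 1)))"
      by (simp add: lessThan_Suc_atMost[symmetric])
    also have "\<dots> = (\<Sum>s<m. - (?c (Suc s) * (real (Suc s) * (real (Suc s) + a)) * ?M (Suc s)))"
      by (rule sum.cong[OF refl]) (simp only: jacobi_coeff_rec lessThan_iff, simp)
    also have "\<dots> = - (\<Sum>s\<le>m. ?c s * (real s * (real s + a)) * ?M s)"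
      unfolding sum.atMost_shift by (simp add: sum_negf)
    finally show ?thesis .
  qed
  also have "(\<Sum>s\<le>m. ?c s * (real s * (real s + a)) * (r ^ (s - 1) * t ^ Suc (m - s)))
      = - (\<Sum>s\<le>m. ?c s * (real (m - s) * (real (m - s) + b)) * ?M s)"
  proof -
    have "(\<Sum>s\<le>m. ?c s * (real s * (real s + a)) * (r ^ (s - 1) * t ^ Suc (m - s)))
        = (\<Sum>s<m. ?c (Suc s) * (real (Suc s) * (real (Suc s) + a)) * (r ^ s * t ^ Suc (m - Suc s)))"
      unfolding sum.atMost_shift by simp
    also have "\<dots> = (\<Sum>s<m. - (?c s * (real (m - s) * (real (m - s) + b)) * ?M s))"
      by (rule sum.cong[OF refl]) (simp only: jacobi_coeff_rec lessThan_iff, simp add: Suc_diff_Suc)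
    also have "\<dots> = - (\<Sum>s\<le>m. ?c s * (real (m - s) * (real (m - s) + b)) * ?M s)"
      by (simp add: lessThan_Suc_atMost[symmetric] sum_negf)
    finally show ?thesis .
  qed
  finally show ?thesis by simp
qed

text \<open>Euler's identity for a form of degree \<open>m\<close> along a field that scales both arguments.\<close>

lemma dderiv_jacobi_hom_Euler:
  assumes T: "dderiv T x y (c * T x)" and R: "dderiv R x y (c * R x)"
  shows "dderiv (\<lambda>x. jacobi_hom m a b (T x) (R x)) x y (real m * c * jacobi_hom m a b (T x) (R x))"
proof -
  have pw: "real k * z ^ (k - 1) * (c * z) = real k * c * z ^ k" for z :: real and k by (cases k) auto
  have "dderiv (\<lambda>x. jacobi_coeff m a b s * (R x ^ s * T x ^ (m - s))) x y
      (real m * c * (jacobi_coeff m a b s * (R x ^ s * T x ^ (m - s))))" if "s \<le> m" for s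
  proof -
    have "dderiv (\<lambda>x. jacobi_coeff m a b s * (R x ^ s * T x ^ (m - s))) x y
      (jacobi_coeff m a b s * (R x ^ s * (real (m - s) * T x ^ (m - s - 1) * (c * T x)) + real s * R x ^ (s - 1) * (c * R x) * T x ^ (m - s))
        + 0 * (R x ^ s * T x ^ (m - s)))"
      by (intro dderiv_mult dderiv_const dderiv_power T R)
    then show ?thesis
      unfolding pw using that by (simp add: algebra_simps of_nat_diff)
  qed
  then have "dderiv (\<lambda>x. \<Sum>s\<le>m. jacobi_coeff m a b s * (R x ^ s * T x ^ (m - s))) x y
      (\<Sum>s\<le>m. real m * c * (jacobi_coeff m a b s * (R x ^ s * T x ^ (m - s))))"
    by (intro dderiv_sum) simp
  then show ?thesis by (simp add: jacobi_hom_def sum_distrib_left)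
qed

lemma dderiv_jacobi_hom:
  assumes T: "dderiv T x y q" and R: "dderiv R x y (- q)"
  shows "dderiv (\<lambda>x. jacobi_hom m a b (T x) (R x)) x y (q * jacobi_hom' m a b (T x) (R x))"
    "dderiv (\<lambda>x. jacobi_hom' m a b (T x) (R x)) x y (q * jacobi_hom'' m a b (T x) (R x))"
proof -
  have "dderiv (\<lambda>x. \<Sum>s\<le>m. jacobi_coeff m a b s * (R x ^ s * T x ^ (m - s))) x y
     (\<Sum>s\<le>m. jacobi_coeff m a b s * (R x ^ s * (real (m - s) * T x ^ (m - s - 1) * q) + real s * R x ^ (s - 1) * (- q) * T x ^ (m - s))
        + 0 * (R x ^ s * T x ^ (m - s)))"
    by (intro dderiv_sum dderiv_mult dderiv_const dderiv_power T R)
  moreover have "(\<Sum>s\<le>m. jacobi_coeff m a b s * (R x ^ s * (real (m - s) * T x ^ (m - s - 1) * q) + real s * R x ^ (s - 1) * (- q) * T x ^ (m - s))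
        + 0 * (R x ^ s * T x ^ (m - s))) = q * jacobi_hom' m a b (T x) (R x)"
    unfolding jacobi_hom'_def sum_distrib_left by (rule sum.cong[OF refl]) (simp only: mult_zero_left, simp add: algebra_simps)
  ultimately show "dderiv (\<lambda>x. jacobi_hom m a b (T x) (R x)) x y (q * jacobi_hom' m a b (T x) (R x))"
    by (simp add: jacobi_hom_def)
  have "dderiv (\<lambda>x. \<Sum>s\<le>m. jacobi_coeff m a b s *
       (R x ^ s * (real (m - s) * T x ^ (m - s - 1)) - real s * R x ^ (s - 1) * T x ^ (m - s))) x y
     (\<Sum>s\<le>m. jacobi_coeff m a b s *
       ((R x ^ s * (real (m - s) * (real (m - s - 1) * T x ^ (m - s - 1 - 1) * q) + 0 * T x ^ (m - s - 1))
          + real s * R x ^ (s - 1) * (- q) * (real (m - s) * T x ^ (m - s - 1)))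
        - (real s * R x ^ (s - 1) * (real (m - s) * T x ^ (m - s - 1) * q)
          + (real s * (real (s - 1) * R x ^ (s - 1 - 1) * (- q)) + 0 * R x ^ (s - 1)) * T x ^ (m - s)))
       + 0 * (R x ^ s * (real (m - s) * T x ^ (m - s - 1)) - real s * R x ^ (s - 1) * T x ^ (m - s)))"
    by (intro dderiv_sum dderiv_mult dderiv_diff dderiv_const dderiv_power T R)
  moreover have "(\<Sum>s\<le>m. jacobi_coeff m a b s *
       ((R x ^ s * (real (m - s) * (real (m - s - 1) * T x ^ (m - s - 1 - 1) * q) + 0 * T x ^ (m - s - 1))
          + real s * R x ^ (s - 1) * (- q) * (real (m - s) * T x ^ (m - s - 1)))
        - (real s * R x ^ (s - 1) * (real (m - s) * T x ^ (m - s - 1) * q)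
          + (real s * (real (s - 1) * R x ^ (s - 1 - 1) * (- q)) + 0 * R x ^ (s - 1)) * T x ^ (m - s)))
       + 0 * (R x ^ s * (real (m - s) * T x ^ (m - s - 1)) - real s * R x ^ (s - 1) * T x ^ (m - s)))
     = q * jacobi_hom'' m a b (T x) (R x)"
    unfolding jacobi_hom''_def sum_distrib_left by (rule sum.cong[OF refl]) (simp only: mult_zero_left, simp add: algebra_simps)
  ultimately show "dderiv (\<lambda>x. jacobi_hom' m a b (T x) (R x)) x y (q * jacobi_hom'' m a b (T x) (R x))"
    by (simp add: jacobi_hom'_def)
qed

lemma polyfun_jacobi_hom:
  assumes "polyfun T" "polyfun R"
  shows "polyfun (\<lambda>x. jacobi_hom m a b (T x) (R x))" "polyfun (\<lambda>x. jacobi_hom' m a b (T x) (R x))"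
  unfolding jacobi_hom_def jacobi_hom'_def
  by (intro polyfun_sum polyfun_mult polyfun_diff polyfun_power polyfun_const assms)+

section \<open>Orthogonality of the polynomials\<close>

definition rest :: "'n \<Rightarrow> real^('n::{finite,linorder}) \<Rightarrow> real" where
  "rest j x = 1 - (\<Sum>k\<in>{..j}. x $ k)"

definition jfactor :: "('n::{finite,linorder} \<Rightarrow> nat) \<Rightarrow> 'n \<Rightarrow> real^('n::{finite,linorder}) \<Rightarrow> real" where
  "jfactor \<alpha> k x = jacobi_hom (\<alpha> k) (jacobi_param \<alpha> k) (-1/2) (x $ k) (rest k x)"

text \<open>A polynomial that agrees with \<open>psi_tilde\<close> on the simplex; outside of it \<open>psi_tilde\<close> involves
  divisions by zero.\<close>

definition psi_poly :: "('n::{finite,linorder} \<Rightarrow> nat) \<Rightarrow> real^('n::{finite,linorder}) \<Rightarrow> real" where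
  "psi_poly \<alpha> x = (\<Prod>k\<in>UNIV. jfactor \<alpha> k x)"

lemma psi_tilde_eq_poly:
  fixes x :: "real^('n::{finite,linorder})"
  assumes x: "x \<in> open_simplex"
  shows "psi_tilde \<alpha> x = psi_poly \<alpha> x"
proof -
  have "(1 - (\<Sum>k\<in>{..<j}. x $ k)) ^ \<alpha> j * poly (jacobi_poly (\<alpha> j) (jacobi_param \<alpha> j) (-1/2)) (2 * x $ j / (1 - (\<Sum>k\<in>{..<j}. x $ k)) - 1)
     = jfactor \<alpha> j x" for j
  proof -
    have "(\<Sum>k\<in>{..<j}. x $ k) \<le> (\<Sum>k\<in>UNIV. x $ k)"
      using simplexD(2)[OF x] by (intro sum_mono2) (auto intro: less_imp_le)
    also have "\<dots> < 1" using simplexD(1)[OF x] by (simp add: bary0_def)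
    finally have "1 - (\<Sum>k\<in>{..<j}. x $ k) \<noteq> 0" by simp
    from poly_jacobi_eq_hom[OF this] have "(1 - (\<Sum>k\<in>{..<j}. x $ k)) ^ \<alpha> j * poly (jacobi_poly (\<alpha> j) (jacobi_param \<alpha> j) (-1/2)) (2 * x $ j / (1 - (\<Sum>k\<in>{..<j}. x $ k)) - 1)
      = jacobi_hom (\<alpha> j) (jacobi_param \<alpha> j) (-1/2) (x $ j) (1 - (\<Sum>k\<in>{..<j}. x $ k) - x $ j)" .
    moreover have "{..j} = insert j {..<j}" by auto
    then have "rest j x = 1 - (\<Sum>k\<in>{..<j}. x $ k) - x $ j" by (simp add: rest_def)
    ultimately show ?thesis by (simp add: jfactor_def)
  qed
  then show ?thesis unfolding psi_tilde_def psi_poly_def by simp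
qed

lemma polyfun_rest: "polyfun (rest j)"
  unfolding rest_def[abs_def] by (intro polyfun_diff polyfun_const polyfun_sum polyfun_component)

lemma polyfun_jfactor: "polyfun (jfactor \<alpha> k)"
  unfolding jfactor_def[abs_def] by (intro polyfun_jacobi_hom polyfun_component polyfun_rest)

lemma polyfun_psi_poly: "polyfun (psi_poly \<alpha>)"
  unfolding psi_poly_def[abs_def] by (intro polyfun_prod polyfun_jfactor)

text \<open>The field keeps the coordinates before \<open>j\<close> and moves mass between \<open>x $ j\<close> and all later
  barycentric coordinates, the latter in fixed proportions. The factor \<open>x $ j\<close> makes it
  tangential to the face where \<open>x $ j\<close> vanishes.\<close>

definition cone_field :: "'n \<Rightarrow> real^('n::{finite,linorder}) \<Rightarrow> real^('n::{finite,linorder})" where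
  "cone_field j x = (\<chi> i. if i = j then x $ j * rest j x else if j < i then - x $ j * x $ i else 0)"

lemma dderiv_rest:
  fixes x :: "real^('n::{finite,linorder})"
  shows "dderiv (rest k) x y (- (\<Sum>i\<in>{..k}. y $ i))"
proof -
  have "dderiv (\<lambda>x. 1 - (\<Sum>i\<in>{..k}. x $ i)) x y (0 - (\<Sum>i\<in>{..k}. y $ i))"
    by (intro dderiv_diff dderiv_const dderiv_sum dderiv_component)
  then show ?thesis by (simp add: rest_def[abs_def])
qed

lemma sum_cone_field:
  fixes x :: "real^('n::{finite,linorder})"
  shows "k < j \<Longrightarrow> (\<Sum>i\<in>{..k}. cone_field j x $ i) = 0"
    "j \<le> k \<Longrightarrow> (\<Sum>i\<in>{..k}. cone_field j x $ i) = x $ j * rest k x"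
proof -
  show "k < j \<Longrightarrow> (\<Sum>i\<in>{..k}. cone_field j x $ i) = 0"
    by (rule sum.neutral) (auto simp: cone_field_def)
  assume jk: "j \<le> k"
  have s: "{..k} = {..<j} \<union> insert j {j<..k}" "{..k} = {..j} \<union> {j<..k}" using jk by auto
  have "(\<Sum>i\<in>{..k}. cone_field j x $ i) = (\<Sum>i\<in>{..<j}. cone_field j x $ i) + (\<Sum>i\<in>insert j {j<..k}. cone_field j x $ i)"
    unfolding s(1) by (rule sum.union_disjoint) auto
  also have "(\<Sum>i\<in>{..<j}. cone_field j x $ i) = 0" by (rule sum.neutral) (auto simp: cone_field_def)
  also have "(\<Sum>i\<in>insert j {j<..k}. cone_field j x $ i) = x $ j * rest j x + (\<Sum>i\<in>{j<..k}. - x $ j * x $ i)"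
    by (subst sum.insert) (auto simp: cone_field_def intro!: sum.cong)
  also have "(\<Sum>i\<in>{j<..k}. - x $ j * x $ i) = - x $ j * (\<Sum>i\<in>{j<..k}. x $ i)" by (simp add: sum_distrib_left)
  also have "0 + (x $ j * rest j x + - x $ j * (\<Sum>i\<in>{j<..k}. x $ i)) = x $ j * rest k x"
  proof -
    have "rest k x = rest j x - (\<Sum>i\<in>{j<..k}. x $ i)"
      unfolding rest_def s(2) by (subst sum.union_disjoint) auto
    then show ?thesis by (simp add: right_diff_distrib)
  qed
  finally show "(\<Sum>i\<in>{..k}. cone_field j x $ i) = x $ j * rest k x" .
qed

text \<open>Factors before \<open>j\<close> depend on fixed coordinates only; in factors after \<open>j\<close> both arguments of the
  form are scaled at the rate \<open>- x $ j\<close>.\<close>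

lemma dderiv_jfactor:
  fixes x :: "real^('n::{finite,linorder})"
  shows "k < j \<Longrightarrow> dderiv (jfactor \<alpha> k) x (cone_field j x) 0"
    "j < k \<Longrightarrow> dderiv (jfactor \<alpha> k) x (cone_field j x) (- x $ j * real (\<alpha> k) * jfactor \<alpha> k x)"
proof -
  assume k: "k < j"
  then have y: "cone_field j x $ k = 0" by (auto simp: cone_field_def)
  have "dderiv (\<lambda>x. x $ k) x (cone_field j x) (0 * x $ k)" "dderiv (rest k) x (cone_field j x) (0 * rest k x)"
    using dderiv_component[of k x "cone_field j x"] dderiv_rest[of k x "cone_field j x"] k
    by (simp_all add: sum_cone_field y)
  from dderiv_jacobi_hom_Euler[OF this] show "dderiv (jfactor \<alpha> k) x (cone_field j x) 0"
    by (simp add: jfactor_def[abs_def])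
next
  assume k: "j < k"
  then have y: "cone_field j x $ k = - x $ j * x $ k" by (auto simp: cone_field_def)
  have "dderiv (\<lambda>x. x $ k) x (cone_field j x) ((- x $ j) * x $ k)" "dderiv (rest k) x (cone_field j x) ((- x $ j) * rest k x)"
    using dderiv_component[of k x "cone_field j x"] dderiv_rest[of k x "cone_field j x"] k
    by (simp_all add: sum_cone_field y)
  from dderiv_jacobi_hom_Euler[OF this, of "\<alpha> k" "jacobi_param \<alpha> k" "-1/2", folded jfactor_def]
  show "dderiv (jfactor \<alpha> k) x (cone_field j x) (- x $ j * real (\<alpha> k) * jfactor \<alpha> k x)"
    by (simp only: mult.commute[of "real (\<alpha> k)"])
qed

lemma psi_poly_split:
  "psi_poly \<alpha> x = (\<Prod>k\<in>{..<j}. jfactor \<alpha> k x) * jfactor \<alpha> j x * (\<Prod>k\<in>{j<..}. jfactor \<alpha> k x)"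
proof -
  have U: "UNIV = {..<j} \<union> insert j {j<..}" by auto
  show ?thesis unfolding psi_poly_def by (subst U, subst prod.union_disjoint) (auto simp: mult.assoc)
qed

text \<open>Let \<open>j\<close> be the last index where the multi-indices differ. Then the Jacobi parameter at \<open>j\<close> and all
  later factors agree for \<open>\<alpha>\<close> and \<open>\<beta>\<close>. The proof is the classical one for orthogonality of
  solutions of a Sturm-Liouville equation, along the field \<open>cone_field j\<close>: the weighted divergence
  of the field times \<open>A Q\<^sup>2 (P\<^sub>2 P\<^sub>1' - P\<^sub>1 P\<^sub>2')\<close> is, by Jacobi's equation for the two \<open>j\<close>-th factors
  \<open>P\<^sub>1\<close> and \<open>P\<^sub>2\<close>, the difference of the two eigenvalues times \<open>\<psi>\<^sub>\<alpha> \<psi>\<^sub>\<beta>\<close>. Here \<open>A\<close> collects the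
  earlier factors and \<open>Q\<^sup>2\<close> the later ones. The parameter \<open>a\<close> is exactly the one which accounts for
  the scaling of \<open>Q\<^sup>2\<close> and for the divergence of the field.\<close>

lemma psi_poly_orthogonal:
  fixes \<alpha> \<beta> :: "'n::{finite,linorder} \<Rightarrow> nat"
  assumes ne: "\<alpha> \<noteq> \<beta>"
  shows "(\<integral>x. psi_poly \<alpha> x * psi_poly \<beta> x \<partial>simplex_volume) = 0"
proof -
  define j where "j = Max {j. \<alpha> j \<noteq> \<beta> j}"
  have fin: "finite {j. \<alpha> j \<noteq> \<beta> j}" and nonempty: "{j. \<alpha> j \<noteq> \<beta> j} \<noteq> {}" using ne by auto
  have j: "\<alpha> j \<noteq> \<beta> j" using Max_in[OF fin nonempty] by (simp add: j_def)
  have above: "\<alpha> k = \<beta> k" if "j < k" for k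
  proof (rule ccontr)
    assume "\<alpha> k \<noteq> \<beta> k"
    then have "k \<le> j" unfolding j_def using fin by (intro Max_ge) auto
    then show False using that by simp
  qed
  define N where "N = (\<Sum>k\<in>{j<..}. real (\<alpha> k))"
  define a where "a = jacobi_param \<alpha> j"
  have a: "a = 2 * N + (real (card {j<..}) - 1) / 2" by (simp add: a_def jacobi_param_def N_def)
  have a\<beta>: "jacobi_param \<beta> j = a"
  proof -
    have "(\<Sum>k\<in>{j<..}. real (\<beta> k)) = (\<Sum>k\<in>{j<..}. real (\<alpha> k))" by (rule sum.cong) (auto simp: above)
    then show ?thesis unfolding a_def jacobi_param_def by simp
  qed
  have Q\<beta>: "jfactor \<beta> k = jfactor \<alpha> k" if "j < k" for k
  proof -
    have "jacobi_param \<beta> k = jacobi_param \<alpha> k" unfolding jacobi_param_def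
    proof -
      have "(\<Sum>i\<in>{k<..}. real (\<beta> i)) = (\<Sum>i\<in>{k<..}. real (\<alpha> i))"
        using that above by (intro sum.cong refl) (auto simp: less_trans)
      then show "2 * (\<Sum>i\<in>{k<..}. real (\<beta> i)) + (real (card {k<..}) - 1) / 2 = 2 * (\<Sum>i\<in>{k<..}. real (\<alpha> i)) + (real (card {k<..}) - 1) / 2" by simp
    qed
    then show ?thesis using above[OF that] by (simp add: jfactor_def[abs_def])
  qed
  let ?y = "cone_field j :: real^('n::{finite,linorder}) \<Rightarrow> real^('n::{finite,linorder})"
  define A where "A x = (\<Prod>k\<in>{..<j}. jfactor \<alpha> k x) * (\<Prod>k\<in>{..<j}. jfactor \<beta> k x)" for x
  define Q where "Q x = (\<Prod>k\<in>{j<..}. jfactor \<alpha> k x)" for x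
  define P1 P2 where "P1 x = jfactor \<alpha> j x" and "P2 x = jfactor \<beta> j x" for x
  define D1 D2 where "D1 x = jacobi_hom' (\<alpha> j) a (-1/2) (x $ j) (rest j x)" and "D2 x = jacobi_hom' (\<beta> j) a (-1/2) (x $ j) (rest j x)" for x
  define E1 E2 where "E1 x = jacobi_hom'' (\<alpha> j) a (-1/2) (x $ j) (rest j x)" and "E2 x = jacobi_hom'' (\<beta> j) a (-1/2) (x $ j) (rest j x)" for x
  define g where "g x = P2 x * D1 x - P1 x * D2 x" for x
  define \<Phi> where "\<Phi> x = A x * (Q x * Q x) * g x" for x
  define \<kappa>1 \<kappa>2 where "\<kappa>1 = real (\<alpha> j) * (real (\<alpha> j) + a + 1/2)" and "\<kappa>2 = real (\<beta> j) * (real (\<beta> j) + a + 1/2)"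
  have P: "P1 x = jacobi_hom (\<alpha> j) a (-1/2) (x $ j) (rest j x)" "P2 x = jacobi_hom (\<beta> j) a (-1/2) (x $ j) (rest j x)" for x
    by (simp_all add: P1_def P2_def jfactor_def a_def a\<beta>[unfolded a_def])
  have prod_eq: "psi_poly \<alpha> x * psi_poly \<beta> x = A x * (Q x * Q x) * (P1 x * P2 x)" for x
  proof -
    have "(\<Prod>k\<in>{j<..}. jfactor \<beta> k x) = Q x" unfolding Q_def by (rule prod.cong) (auto simp: Q\<beta>)
    then show ?thesis unfolding psi_poly_split[of _ _ j] by (simp add: A_def P1_def P2_def flip: Q_def)
  qed
  have tr: "dderiv (\<lambda>x. x $ j) x (?y x) (x $ j * rest j x)" "dderiv (rest j) x (?y x) (- (x $ j * rest j x))" for x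
    using dderiv_component[of j x "?y x"] dderiv_rest[of j x "?y x"] sum_cone_field(2)[of j j x] by (simp_all add: cone_field_def)
  have dP: "dderiv P1 x (?y x) (x $ j * rest j x * D1 x)" "dderiv P2 x (?y x) (x $ j * rest j x * D2 x)"
    "dderiv D1 x (?y x) (x $ j * rest j x * E1 x)" "dderiv D2 x (?y x) (x $ j * rest j x * E2 x)" for x
    unfolding P[abs_def] D1_def[abs_def] D2_def[abs_def] E1_def E2_def by (intro dderiv_jacobi_hom tr)+
  have dA: "dderiv A x (?y x) 0" for x
  proof -
    have "dderiv (\<lambda>x. \<Prod>k\<in>{..<j}. jfactor \<gamma> k x) x (?y x) ((\<Sum>k\<in>{..<j}. 0) * (\<Prod>k\<in>{..<j}. jfactor \<gamma> k x))" for \<gamma>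
      by (rule dderiv_prod_scaling) (simp add: dderiv_jfactor(1))
    from dderiv_mult[OF this[of \<alpha>] this[of \<beta>]] show ?thesis by (simp add: A_def[abs_def])
  qed
  have dQ: "dderiv Q x (?y x) (- x $ j * N * Q x)" for x
  proof -
    have "dderiv Q x (?y x) ((\<Sum>k\<in>{j<..}. - x $ j * real (\<alpha> k)) * Q x)"
      unfolding Q_def[abs_def] by (rule dderiv_prod_scaling, rule dderiv_jfactor(2)) simp
    then show ?thesis by (simp add: N_def sum_distrib_left)
  qed
  have d\<Phi>: "dderiv \<Phi> x (?y x) (A x * (Q x * Q x) * (x $ j * rest j x * (P2 x * E1 x - P1 x * E2 x)) - 2 * x $ j * N * \<Phi> x)" for x
  proof -
    have "dderiv \<Phi> x (?y x) (A x * (Q x * Q x) * ((P2 x * (x $ j * rest j x * E1 x) + x $ j * rest j x * D2 x * D1 x)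
         - (P1 x * (x $ j * rest j x * E2 x) + x $ j * rest j x * D1 x * D2 x))
       + (A x * (Q x * (- x $ j * N * Q x) + - x $ j * N * Q x * Q x) + 0 * (Q x * Q x)) * g x)"
      unfolding \<Phi>_def[abs_def] g_def[abs_def] by (intro dderiv_mult dderiv_diff dP dA dQ)
    moreover have "A x * (Q x * Q x) * ((P2 x * (x $ j * rest j x * E1 x) + x $ j * rest j x * D2 x * D1 x)
         - (P1 x * (x $ j * rest j x * E2 x) + x $ j * rest j x * D1 x * D2 x))
       + (A x * (Q x * (- x $ j * N * Q x) + - x $ j * N * Q x * Q x) + 0 * (Q x * Q x)) * g x
       = A x * (Q x * Q x) * (x $ j * rest j x * (P2 x * E1 x - P1 x * E2 x)) - 2 * x $ j * N * \<Phi> x"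
      by (simp add: \<Phi>_def algebra_simps)
    ultimately show ?thesis by simp
  qed
  have poly_y: "polyfun (\<lambda>x. ?y x $ i)" for i
    unfolding cone_field_def
    by (cases "i = j"; cases "j < i") (auto intro!: polyfun_const polyfun_mult polyfun_component polyfun_rest polyfun_diff[OF polyfun_const[of 0], simplified])
  have poly\<Phi>: "polyfun \<Phi>"
    unfolding \<Phi>_def[abs_def] g_def A_def Q_def P1_def P2_def D1_def D2_def
    by (intro polyfun_mult polyfun_diff polyfun_prod polyfun_jfactor polyfun_jacobi_hom polyfun_component polyfun_rest)
  let ?Z = "\<lambda>i x. ?y x $ i * \<Phi> x"
  have polyZ: "polyfun (?Z i)" for i by (intro polyfun_mult poly_y poly\<Phi>)
  have pd_y: "partial_deriv i (\<lambda>x. ?y x $ i) x = (if i = j then rest j x - x $ j else if j < i then - x $ j else 0)" for i x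
  proof -
    consider "i = j" | "j < i" | "i < j" by (rule linorder_cases)
    then show ?thesis
    proof cases
      case 1
      have "partial_deriv j (rest j) x = - 1"
        using dderiv_rest[of j x "axis j 1"] by (auto simp: dderiv_def axis_def dest: partial_derivI[where i=j])
      moreover have "(\<lambda>x. ?y x $ i) = (\<lambda>x. x $ j * rest j x)" using 1 by (simp add: cone_field_def)
      ultimately show ?thesis
        using 1 by (simp add: partial_deriv_mult differentiable_component polyfun_differentiable[OF polyfun_rest] partial_deriv_component)
    next
      case 2
      then have "(\<lambda>x. ?y x $ i) = (\<lambda>x. (- x $ j) * x $ i)" by (auto simp: cone_field_def)
      moreover have "(\<lambda>x::real^('n::{finite,linorder}). - x $ j) differentiable (at x)"
        by (intro differentiable_minus differentiable_component)
      moreover have "partial_deriv i (\<lambda>x. - x $ j) x = - partial_deriv i (\<lambda>x. x $ j) x"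
        by (rule partial_deriv_bounded_linear(1)[OF bounded_linear_minus[OF bounded_linear_ident] differentiable_component])
      ultimately show ?thesis using 2
        by (simp only: partial_deriv_mult differentiable_component) (simp add: partial_deriv_component)
    next
      case 3
      then have "(\<lambda>x. ?y x $ i) = (\<lambda>x. 0)" by (intro ext) (auto simp: cone_field_def)
      then show ?thesis using 3 by auto
    qed
  qed
  have split3: "(\<Sum>i\<in>UNIV. f i) = (\<Sum>i\<in>{..<j}. f i) + (f j + (\<Sum>i\<in>{j<..}. f i))" for f :: "'n \<Rightarrow> real"
  proof -
    have U: "UNIV = {..<j} \<union> insert j {j<..}" by auto
    show ?thesis by (subst U, subst sum.union_disjoint) auto
  qed
  have div_y: "(\<Sum>i\<in>UNIV. partial_deriv i (\<lambda>x. ?y x $ i) x) = rest j x - (real (card {j<..}) + 1) * x $ j" for x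
  proof -
    have "(\<Sum>i\<in>{j<..}. partial_deriv i (\<lambda>x. ?y x $ i) x) = (\<Sum>i\<in>{j<..}. - x $ j)"
      unfolding pd_y by (rule sum.cong) auto
    moreover have "(\<Sum>i\<in>{..<j}. partial_deriv i (\<lambda>x. ?y x $ i) x) = 0"
      unfolding pd_y by (rule sum.neutral) auto
    ultimately show ?thesis unfolding split3 by (simp add: pd_y algebra_simps)
  qed
  have log_y: "(\<Sum>i\<in>UNIV. (1 / x $ i - 1 / bary0 x) * ?y x $ i) = rest j x - (real (card {j<..}) + 1) * x $ j" if "x \<in> open_simplex" for x
  proof -
    have nz: "bary0 x \<noteq> 0" "x $ i \<noteq> 0" for i using simplexD[OF that] by (auto simp: less_le)
    have "(\<Sum>i\<in>UNIV. (1 / x $ i - 1 / bary0 x) * ?y x $ i) = (\<Sum>i\<in>UNIV. ?y x $ i / x $ i) - (\<Sum>i\<in>UNIV. ?y x $ i) / bary0 x"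
      by (simp add: left_diff_distrib sum_subtractf sum_divide_distrib)
    also have "(\<Sum>i\<in>UNIV. ?y x $ i / x $ i) = rest j x - real (card {j<..}) * x $ j"
    proof -
      have "(\<Sum>i\<in>{j<..}. ?y x $ i / x $ i) = (\<Sum>i\<in>{j<..}. - x $ j)"
        using nz by (intro sum.cong) (auto simp: cone_field_def)
      moreover have "(\<Sum>i\<in>{..<j}. ?y x $ i / x $ i) = 0" by (rule sum.neutral) (auto simp: cone_field_def)
      moreover have "?y x $ j / x $ j = rest j x" using nz by (simp add: cone_field_def)
      ultimately show ?thesis unfolding split3 by simp
    qed
    also have "(\<Sum>i\<in>UNIV. ?y x $ i) = x $ j * bary0 x"
    proof -
      have U: "UNIV = {..Max (UNIV :: 'n set)}" by auto
      have "(\<Sum>i\<in>{..Max UNIV}. ?y x $ i) = x $ j * rest (Max UNIV) x"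
        by (rule sum_cone_field(2)) simp
      then show ?thesis by (simp add: rest_def bary0_def flip: U)
    qed
    finally show ?thesis using nz by (simp add: algebra_simps)
  qed
  have pdZ: "(\<Sum>i\<in>UNIV. partial_deriv i (?Z i) x) = (A x * (Q x * Q x) * (x $ j * rest j x * (P2 x * E1 x - P1 x * E2 x)) - 2 * x $ j * N * \<Phi> x)
      + (rest j x - (real (card {j<..}) + 1) * x $ j) * \<Phi> x" for x
  proof -
    have "(\<Sum>i\<in>UNIV. partial_deriv i (?Z i) x) = (\<Sum>i\<in>UNIV. partial_deriv i (\<lambda>x. ?y x $ i) x * \<Phi> x + ?y x $ i * partial_deriv i \<Phi> x)"
      by (intro sum.cong refl partial_deriv_mult polyfun_differentiable poly_y poly\<Phi>)
    also have "\<dots> = (\<Sum>i\<in>UNIV. partial_deriv i (\<lambda>x. ?y x $ i) x) * \<Phi> x + (\<Sum>i\<in>UNIV. ?y x $ i * partial_deriv i \<Phi> x)"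
      by (simp add: sum.distrib sum_distrib_right)
    finally show ?thesis unfolding div_y dderiv_partial_deriv[OF d\<Phi>] by simp
  qed
  have logZ: "(\<Sum>i\<in>UNIV. (1 / x $ i - 1 / bary0 x) *\<^sub>R ?Z i x) = (rest j x - (real (card {j<..}) + 1) * x $ j) * \<Phi> x" if "x \<in> open_simplex" for x
    unfolding log_y[OF that, symmetric] by (simp add: sum_distrib_right mult.assoc)
  have key: "(\<Sum>i\<in>UNIV. partial_deriv i (?Z i) x) - (1/2) *\<^sub>R (\<Sum>i\<in>UNIV. (1 / x $ i - 1 / bary0 x) *\<^sub>R ?Z i x)
      = (\<kappa>2 - \<kappa>1) * (psi_poly \<alpha> x * psi_poly \<beta> x)" if x: "x \<in> open_simplex" for x
  proof -
    define t r where "t = x $ j" and "r = rest j x"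
    have o1: "t * r * E1 x + (1/2 * r - (a + 1) * t) * D1 x + \<kappa>1 * P1 x = 0"
      using jacobi_hom_ode[of t r "\<alpha> j" a "-1/2"] by (simp add: E1_def D1_def P t_def r_def \<kappa>1_def algebra_simps)
    have o2: "t * r * E2 x + (1/2 * r - (a + 1) * t) * D2 x + \<kappa>2 * P2 x = 0"
      using jacobi_hom_ode[of t r "\<beta> j" a "-1/2"] by (simp add: E2_def D2_def P t_def r_def \<kappa>2_def algebra_simps)
    \<comment> \<open>The first-order coefficient of the equation: this identity is the reason for the value of \<open>a\<close>.\<close>
    have c: "(real (card {j<..}) + 1) / 2 + 2 * N = a + 1" by (simp add: a field_simps)
    have "(\<Sum>i\<in>UNIV. partial_deriv i (?Z i) x) - (1/2) *\<^sub>R (\<Sum>i\<in>UNIV. (1 / x $ i - 1 / bary0 x) *\<^sub>R ?Z i x)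
      = A x * (Q x * Q x) * (t * r * (P2 x * E1 x - P1 x * E2 x)) + (1/2 * r - ((real (card {j<..}) + 1) / 2 + 2 * N) * t) * \<Phi> x"
      unfolding pdZ logZ[OF x] by (simp add: t_def r_def algebra_simps)
    also have "\<dots> = A x * (Q x * Q x) * (P2 x * (t * r * E1 x + (1/2 * r - (a + 1) * t) * D1 x)
        - P1 x * (t * r * E2 x + (1/2 * r - (a + 1) * t) * D2 x))"
      unfolding c \<Phi>_def g_def by (simp add: algebra_simps)
    also have "t * r * E1 x + (1/2 * r - (a + 1) * t) * D1 x = - (\<kappa>1 * P1 x)" using o1 by linarith
    also have "t * r * E2 x + (1/2 * r - (a + 1) * t) * D2 x = - (\<kappa>2 * P2 x)" using o2 by linarith
    also have "A x * (Q x * Q x) * (P2 x * - (\<kappa>1 * P1 x) - P1 x * - (\<kappa>2 * P2 x)) = (\<kappa>2 - \<kappa>1) * (psi_poly \<alpha> x * psi_poly \<beta> x)"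
      unfolding prod_eq by (simp add: algebra_simps)
    finally show ?thesis .
  qed
  have int_div: "integrable simplex_volume (\<lambda>x. \<Sum>i\<in>UNIV. partial_deriv i (?Z i) x)"
    by (intro polyfun_integrable polyfun_sum polyfun_partial_deriv polyZ)
  have "integrable simplex_volume (\<lambda>x. (rest j x - (real (card {j<..}) + 1) * x $ j) * \<Phi> x)"
    by (intro polyfun_integrable polyfun_mult polyfun_diff polyfun_rest polyfun_const polyfun_component poly\<Phi>)
  moreover have "integrable simplex_volume (\<lambda>x. \<Sum>i\<in>UNIV. (1 / x $ i - 1 / bary0 x) *\<^sub>R ?Z i x) \<longleftrightarrow>
      integrable simplex_volume (\<lambda>x. (rest j x - (real (card {j<..}) + 1) * x $ j) * \<Phi> x)"
    by (rule Bochner_Integration.integrable_cong[OF refl]) (rule logZ, simp)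
  ultimately have int_log: "integrable simplex_volume (\<lambda>x. \<Sum>i\<in>UNIV. (1 / x $ i - 1 / bary0 x) *\<^sub>R ?Z i x)" by blast
  have "(\<integral>x. (\<Sum>i\<in>UNIV. partial_deriv i (?Z i) x) - (1/2) *\<^sub>R (\<Sum>i\<in>UNIV. (1 / x $ i - 1 / bary0 x) *\<^sub>R ?Z i x) \<partial>simplex_volume) = 0"
    by (rule simplex_divergence_weighted[OF _ _ int_div int_log])
       (intro polyfun_differentiable polyZ, intro polyfun_continuous polyfun_partial_deriv polyZ)
  moreover have "(\<integral>x. (\<Sum>i\<in>UNIV. partial_deriv i (?Z i) x) - (1/2) *\<^sub>R (\<Sum>i\<in>UNIV. (1 / x $ i - 1 / bary0 x) *\<^sub>R ?Z i x) \<partial>simplex_volume)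
      = (\<integral>x. (\<kappa>2 - \<kappa>1) * (psi_poly \<alpha> x * psi_poly \<beta> x) \<partial>simplex_volume)"
    by (rule Bochner_Integration.integral_cong[OF refl]) (rule key, simp)
  ultimately have "(\<kappa>2 - \<kappa>1) * (\<integral>x. psi_poly \<alpha> x * psi_poly \<beta> x \<partial>simplex_volume) = 0" by simp
  moreover have "\<kappa>2 - \<kappa>1 \<noteq> 0"
  proof -
    have "\<kappa>2 - \<kappa>1 = (real (\<beta> j) - real (\<alpha> j)) * (real (\<alpha> j) + real (\<beta> j) + a + 1/2)"
      by (simp add: \<kappa>1_def \<kappa>2_def algebra_simps)
    \<comment> \<open>As \<open>a + 1/2 \<ge> 0\<close>, the eigenvalue is strictly increasing in the degree.\<close>
    moreover have "0 < real (\<alpha> j) + real (\<beta> j) + a + 1/2"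
    proof -
      have "0 \<le> N" unfolding N_def by (intro sum_nonneg) auto
      moreover have "a + 1/2 = 2 * N + real (card {j<..}) / 2" by (simp add: a field_simps)
      ultimately have "0 \<le> a + 1/2" by simp
      then show ?thesis using j by linarith
    qed
    ultimately show ?thesis using j by simp
  qed
  ultimately show ?thesis by simp
qed

text \<open>The set where two continuous functions differ is open, and nonempty open sets are not null.\<close>

lemma ae_eq_continuous:
  fixes u v :: "real^'n::finite \<Rightarrow> complex"
  assumes "continuous_on open_simplex u" "continuous_on open_simplex v" "ae_eq simplex_volume u v" "x \<in> open_simplex"
  shows "u x = v x"
proof (rule ccontr)
  assume ne: "u x \<noteq> v x"
  let ?S = "open_simplex :: (real^'n) set"
  define U where "U = {y \<in> ?S. u y - v y \<noteq> 0}"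
  have "open U"
  proof -
    have "continuous_on ?S (\<lambda>y. u y - v y)" by (intro continuous_intros assms)
    then have "open (?S \<inter> (\<lambda>y. u y - v y) -` (- {0}))"
      by (rule continuous_open_preimage[OF _ open_open_simplex]) (simp add: open_Compl)
    moreover have "?S \<inter> (\<lambda>y. u y - v y) -` (- {0}) = U" by (auto simp: U_def)
    ultimately show ?thesis by simp
  qed
  moreover have "U \<noteq> {}" using ne assms(4) by (auto simp: U_def)
  ultimately have "\<not> negligible U" by (rule open_not_negligible)
  moreover have "negligible U"
  proof -
    have "AE y in restrict_space lborel ?S. 0 < ennreal (weight y) \<longrightarrow> u y = v y"
      using assms(3) unfolding ae_eq_def simplex_volume_eq
      by (subst (asm) AE_density) (auto simp: measurable_restrict_space1)
    then have "AE y in lborel. y \<in> ?S \<longrightarrow> (0 < ennreal (weight y) \<longrightarrow> u y = v y)"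
      by (subst (asm) AE_restrict_space_iff) auto
    then have "AE y in lborel. y \<notin> U"
      by (rule eventually_mono) (auto simp: U_def simplexD)
    then have "AE y in lebesgue. y \<notin> U" by (rule AE_completion)
    then have "U \<in> null_sets lebesgue"
      using \<open>open U\<close> by (subst (asm) AE_iff_null_sets[symmetric]) (auto intro: lebesgue_openin borel_open)
    then show ?thesis by (simp add: negligible_iff_null_sets)
  qed
  ultimately show False by simp
qed

text \<open>At the vertex \<open>0\<close> only the term with \<open>s = m\<close> of each form survives. The vertex lies in the
  closure of the simplex, so the polynomial does not vanish identically on it.\<close>

lemma psi_poly_0: "psi_poly \<alpha> 0 \<noteq> 0"
proof -
  have "jfactor \<alpha> k 0 \<noteq> 0" for k
  proof -
    let ?m = "\<alpha> k"
    have "jfactor \<alpha> k 0 = (\<Sum>s\<le>?m. if s = ?m then jacobi_coeff ?m (jacobi_param \<alpha> k) (-1/2) ?m else 0)"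
      unfolding jfactor_def jacobi_hom_def by (intro sum.cong refl) (auto simp: rest_def power_0_left)
    also have "\<dots> = (- 1) ^ ?m * ((real ?m + (-1/2)) gchoose ?m)" by (simp add: jacobi_coeff_def)
    finally have e: "jfactor \<alpha> k 0 = (- 1) ^ ?m * ((real ?m + (-1/2)) gchoose ?m)" .
    have "(\<Prod>i = 0..<?m. real ?m + (-1/2) - real i) \<noteq> 0"
    proof -
      have "real ?m + (-1/2) - real i \<noteq> 0" if "i \<in> {0..<?m}" for i
        using that by (auto simp: field_simps)
      then show ?thesis by simp
    qed
    then have "(real ?m + (-1/2)) gchoose ?m \<noteq> 0"
      unfolding gbinomial_mult_fact[symmetric] by auto
    then show ?thesis unfolding e by simp
  qed
  then show ?thesis by (simp add: psi_poly_def)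
qed

lemma psi_poly_nonzero_somewhere: "\<exists>x\<in>open_simplex. psi_poly \<alpha> x \<noteq> 0"
  for \<alpha> :: "'n::{finite,linorder} \<Rightarrow> nat"
proof -
  define X where "X k = inverse (real (Suc k)) *\<^sub>R (vec (1 / (real CARD('n) + 1)) :: real^('n::{finite,linorder}))" for k
  have "X k \<in> open_simplex" for k
  proof -
    have "(\<Sum>i\<in>UNIV. X k $ i) = inverse (real (Suc k)) * (real CARD('n) / (real CARD('n) + 1))" by (simp add: X_def)
    also have "\<dots> \<le> 1 * (real CARD('n) / (real CARD('n) + 1))"
      by (intro mult_right_mono) (auto simp: inverse_le_1_iff)
    also have "\<dots> < 1" by simp
    finally show ?thesis by (auto simp: open_simplex_def X_def add_pos_nonneg)
  qed
  moreover have "(\<lambda>k. psi_poly \<alpha> (X k)) \<longlonglongrightarrow> psi_poly \<alpha> 0"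
  proof -
    have "X \<longlonglongrightarrow> 0 *\<^sub>R vec (1 / (real CARD('n) + 1))"
      unfolding X_def[abs_def] by (intro tendsto_scaleR LIMSEQ_inverse_real_of_nat tendsto_const)
    moreover have "isCont (psi_poly \<alpha>) 0"
      using polyfun_continuous[OF polyfun_psi_poly, of UNIV \<alpha>] by (simp add: continuous_on_eq_continuous_at)
    ultimately show ?thesis using isCont_tendsto_compose by fastforce
  qed
  then have "eventually (\<lambda>k. psi_poly \<alpha> (X k) \<noteq> 0) sequentially"
    by (rule tendsto_imp_eventually_ne) (rule psi_poly_0)
  then obtain k where "psi_poly \<alpha> (X k) \<noteq> 0" using eventually_happens'[OF sequentially_bot] by blast
  ultimately show ?thesis by blast
qed

lemma borel_measurable_poly [measurable (raw)]:
  "f \<in> borel_measurable M \<Longrightarrow> (\<lambda>x. poly p (f x :: real)) \<in> borel_measurable M"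
  by (rule borel_measurable_continuous_on[of "poly p"]) (rule continuous_on_poly[OF continuous_on_id])

lemma psi_tilde_measurable: "psi_tilde \<alpha> \<in> borel_measurable borel"
  unfolding psi_tilde_def[abs_def] by measurable

lemma psi_poly_norm_pos:
  fixes \<alpha> :: "'n::{finite,linorder} \<Rightarrow> nat"
  shows "0 < (\<integral>x. (psi_poly \<alpha> x)\<^sup>2 \<partial>simplex_volume)"
proof -
  have int: "integrable simplex_volume (\<lambda>x. (psi_poly \<alpha> x)\<^sup>2)"
    by (intro polyfun_integrable polyfun_power polyfun_psi_poly)
  have "(\<integral>x. (psi_poly \<alpha> x)\<^sup>2 \<partial>simplex_volume) \<noteq> 0"
  proof
    assume "(\<integral>x. (psi_poly \<alpha> x)\<^sup>2 \<partial>simplex_volume) = 0"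
    then have "AE x in simplex_volume. (psi_poly \<alpha> x)\<^sup>2 = 0"
      using integral_nonneg_eq_0_iff_AE[OF int] by simp
    then have "ae_eq simplex_volume (\<lambda>x. complex_of_real (psi_poly \<alpha> x)) (\<lambda>x. 0)"
      unfolding ae_eq_def by (rule eventually_mono) simp
    then have "complex_of_real (psi_poly \<alpha> x) = 0" if "x \<in> open_simplex" for x
      using that by (intro ae_eq_continuous) (auto intro!: polyfun_continuous polyfun_of_real polyfun_psi_poly)
    then show False using psi_poly_nonzero_somewhere[of \<alpha>] by auto
  qed
  moreover have "0 \<le> (\<integral>x. (psi_poly \<alpha> x)\<^sup>2 \<partial>simplex_volume)" by simp
  ultimately show ?thesis by linarith
qed

text \<open>The normalising factor of \<open>psi\<close>, see \<open>psi_eq_poly\<close>.\<close>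

definition psi_scale :: "('n::{finite,linorder} \<Rightarrow> nat) \<Rightarrow> real" where
  "psi_scale \<alpha> = 1 / sqrt (\<integral>x. (psi_poly \<alpha> x)\<^sup>2 \<partial>simplex_volume)"

lemma psi_eq_poly:
  fixes x :: "real^('n::{finite,linorder})"
  assumes "x \<in> open_simplex"
  shows "psi \<alpha> x = psi_scale \<alpha> * psi_poly \<alpha> x"
proof -
  have "(\<integral>y. (psi_tilde \<alpha> y)\<^sup>2 \<partial>simplex_measure) = (\<integral>y. (psi_tilde \<alpha> y)\<^sup>2 \<partial>simplex_volume)"
    using psi_tilde_measurable[of \<alpha>] by (intro integrable_simplex_measure_iff) measurable
  also have "\<dots> = (\<integral>y. (psi_poly \<alpha> y)\<^sup>2 \<partial>simplex_volume)"
    by (rule Bochner_Integration.integral_cong) (auto simp: psi_tilde_eq_poly)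
  finally show ?thesis by (simp add: psi_def psi_scale_def psi_tilde_eq_poly[OF assms])
qed

lemma psi_orthonormal:
  fixes \<alpha> \<beta> :: "'n::{finite,linorder} \<Rightarrow> nat"
  shows "integrable simplex_measure (\<lambda>x. psi \<alpha> x * psi \<beta> x)"
    "(\<integral>x. psi \<alpha> x * psi \<beta> x \<partial>simplex_measure) = (if \<alpha> = \<beta> then 1 else 0)"
    "(\<integral>x. psi \<alpha> x * psi \<beta> x \<partial>simplex_volume) = (if \<alpha> = \<beta> then 1 else 0)"
proof -
  have [measurable]: "psi \<gamma> \<in> borel_measurable borel" for \<gamma> :: "'n \<Rightarrow> nat"
    unfolding psi_def[abs_def] using psi_tilde_measurable[of \<gamma>] by measurable
  have m: "(\<lambda>x. psi \<alpha> x * psi \<beta> x) \<in> borel_measurable borel" by measurable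
  have eq: "psi \<alpha> x * psi \<beta> x = psi_scale \<alpha> * psi_scale \<beta> * (psi_poly \<alpha> x * psi_poly \<beta> x)" if "x \<in> open_simplex" for x
    by (simp add: psi_eq_poly[OF that])
  have int: "integrable simplex_volume (\<lambda>x. psi_scale \<alpha> * psi_scale \<beta> * (psi_poly \<alpha> x * psi_poly \<beta> x))"
    by (intro polyfun_integrable polyfun_mult polyfun_const polyfun_psi_poly)
  have "integrable simplex_volume (\<lambda>x. psi \<alpha> x * psi \<beta> x) \<longleftrightarrow> integrable simplex_volume (\<lambda>x. psi_scale \<alpha> * psi_scale \<beta> * (psi_poly \<alpha> x * psi_poly \<beta> x))"
    by (rule Bochner_Integration.integrable_cong[OF refl]) (rule eq, simp)
  then show "integrable simplex_measure (\<lambda>x. psi \<alpha> x * psi \<beta> x)"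
    using int integrable_simplex_measure_iff(1)[OF m] by blast
  have "(\<integral>x. psi \<alpha> x * psi \<beta> x \<partial>simplex_volume) = (\<integral>x. psi_scale \<alpha> * psi_scale \<beta> * (psi_poly \<alpha> x * psi_poly \<beta> x) \<partial>simplex_volume)"
    by (rule Bochner_Integration.integral_cong[OF refl]) (rule eq, simp)
  also have "\<dots> = psi_scale \<alpha> * psi_scale \<beta> * (\<integral>x. psi_poly \<alpha> x * psi_poly \<beta> x \<partial>simplex_volume)" by simp
  also have "\<dots> = (if \<alpha> = \<beta> then 1 else 0)"
  proof (cases "\<alpha> = \<beta>")
    case True
    then show ?thesis using psi_poly_norm_pos[of \<beta>] by (simp add: psi_scale_def power2_eq_square real_sqrt_mult_self)
  next
    case False then show ?thesis by (simp add: psi_poly_orthogonal)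
  qed
  finally show 1: "(\<integral>x. psi \<alpha> x * psi \<beta> x \<partial>simplex_volume) = (if \<alpha> = \<beta> then 1 else 0)" .
  show "(\<integral>x. psi \<alpha> x * psi \<beta> x \<partial>simplex_measure) = (if \<alpha> = \<beta> then 1 else 0)"
    using 1 integrable_simplex_measure_iff(2)[OF m] by simp
qed

section \<open>The Laplacian on polynomials\<close>

text \<open>Functions with values in the complex numbers form a vector space, for which the notions of span,
  independence and dimension are needed.\<close>

interpretation fvs: vector_space "\<lambda>(c::complex) (f::'a \<Rightarrow> complex). (\<lambda>x. c * f x)"
  by unfold_locales (auto simp: plus_fun_def fun_eq_iff algebra_simps)

lemma fun_sum_apply: "(\<Sum>i\<in>I. f i) x = (\<Sum>i\<in>I. f i x)" for f :: "'i \<Rightarrow> 'a \<Rightarrow> complex"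
  by (induction I rule: infinite_finite_induct) (auto simp: plus_fun_def zero_fun_def)

definition mdegree :: "('n::finite \<Rightarrow> nat) \<Rightarrow> nat" where
  "mdegree \<beta> = (\<Sum>i\<in>UNIV. \<beta> i)"

definition monom_fun :: "('n::finite \<Rightarrow> nat) \<Rightarrow> real^'n \<Rightarrow> complex" where
  "monom_fun \<beta> x = (\<Prod>i\<in>UNIV. complex_of_real (x $ i) ^ \<beta> i)"

text \<open>Polynomials of degree strictly less than \<open>s\<close>; with the strict inequality the case \<open>s = 0\<close> is the
  null space, as the remainder of a constant requires.\<close>

definition polys :: "nat \<Rightarrow> (real^'n::finite \<Rightarrow> complex) set" where
  "polys s = fvs.span (monom_fun ` {\<beta>. mdegree \<beta> < s})"

lemma finite_mdegree: "finite {\<beta> :: 'n::finite \<Rightarrow> nat. mdegree \<beta> < s}"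
proof (rule finite_subset)
  show "{\<beta> :: 'n \<Rightarrow> nat. mdegree \<beta> < s} \<subseteq> PiE UNIV (\<lambda>_. {..s})"
  proof
    fix \<beta> :: "'n \<Rightarrow> nat" assume "\<beta> \<in> {\<beta>. mdegree \<beta> < s}"
    then have "\<beta> i \<le> s" for i
      using member_le_sum[of i UNIV \<beta>] by (simp add: mdegree_def)
    then show "\<beta> \<in> PiE UNIV (\<lambda>_. {..s})" by auto
  qed
  show "finite (PiE (UNIV :: 'n set) (\<lambda>_. {..s}))" by (intro finite_PiE) auto
qed

lemma polys_mono: "s \<le> t \<Longrightarrow> polys s \<subseteq> polys t"
  unfolding polys_def by (intro fvs.span_mono image_mono) auto

lemma monom_in_polys: "mdegree \<beta> < s \<Longrightarrow> monom_fun \<beta> \<in> polys s"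
  unfolding polys_def by (intro fvs.span_base) auto

lemma polys_add: "f \<in> polys s \<Longrightarrow> g \<in> polys s \<Longrightarrow> (\<lambda>x. f x + g x) \<in> polys s"
  unfolding polys_def using fvs.span_add by (force simp: plus_fun_def)

lemma polys_cmult: "f \<in> polys s \<Longrightarrow> (\<lambda>x. c * f x) \<in> polys s"
  unfolding polys_def by (rule fvs.span_scale)

lemma polys_zero: "(\<lambda>x. 0) \<in> polys s"
  unfolding polys_def using fvs.span_zero by (simp add: zero_fun_def)

lemma polys_sum: "(\<And>i. i \<in> I \<Longrightarrow> f i \<in> polys s) \<Longrightarrow> (\<lambda>x. \<Sum>i\<in>I. f i x) \<in> polys s"
  by (induction I rule: infinite_finite_induct) (auto intro: polys_add polys_zero)

lemma polys_induct [consumes 1, case_names zero add cmult monom]: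
  assumes f: "f \<in> polys s"
    and "P (\<lambda>x. 0)" "\<And>f g. P f \<Longrightarrow> P g \<Longrightarrow> P (\<lambda>x. f x + g x)" "\<And>c f. P f \<Longrightarrow> P (\<lambda>x. c * f x)"
    and "\<And>\<beta>. mdegree \<beta> < s \<Longrightarrow> P (monom_fun \<beta>)"
  shows "P f"
proof -
  have "fvs.subspace {f. P f}"
    unfolding fvs.subspace_def using assms(2-4) by (simp add: zero_fun_def plus_fun_def)
  then have "fvs.span (monom_fun ` {\<beta>. mdegree \<beta> < s}) \<subseteq> {f. P f}"
    by (rule fvs.span_minimal[rotated]) (use assms(5) in auto)
  then show ?thesis using f by (auto simp: polys_def)
qed

lemma polys_mult:
  assumes "f \<in> polys (Suc s)" "g \<in> polys (Suc t)"
  shows "(\<lambda>x. f x * g x) \<in> polys (Suc (s + t))"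
  using assms(1)
proof (induction rule: polys_induct)
  case zero then show ?case by (simp add: polys_zero)
next
  case (add f1 f2) then show ?case by (simp add: distrib_right polys_add)
next
  case (cmult c f1) then show ?case by (simp add: mult.assoc polys_cmult)
next
  case (monom \<beta>)
  then have \<beta>: "mdegree \<beta> \<le> s" by simp
  show ?case
    using assms(2)
  proof (induction rule: polys_induct)
    case zero then show ?case by (simp add: polys_zero)
  next
    case (add f1 f2) then show ?case by (simp add: distrib_left polys_add)
  next
    case (cmult c f1)
    then show ?case using polys_cmult[OF cmult, of c] by (simp add: mult.left_commute)
  next
    case (monom \<gamma>)
    have "(\<lambda>x. monom_fun \<beta> x * monom_fun \<gamma> x) = monom_fun (\<lambda>i. \<beta> i + \<gamma> i)"
      by (rule ext) (simp add: monom_fun_def power_add prod.distrib)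
    moreover have "mdegree (\<lambda>i. \<beta> i + \<gamma> i) = mdegree \<beta> + mdegree \<gamma>" by (simp add: mdegree_def sum.distrib)
    ultimately show ?case using \<beta> monom by (simp add: monom_in_polys)
  qed
qed

lemma polys_const: "(\<lambda>x. c) \<in> polys (Suc s)"
proof -
  have "(\<lambda>x. c * monom_fun (\<lambda>_. 0) x) \<in> polys (Suc s)"
    by (intro polys_cmult monom_in_polys) (simp add: mdegree_def)
  then show ?thesis by (simp add: monom_fun_def)
qed

lemma polys_coord: "(\<lambda>x. complex_of_real (x $ i)) \<in> polys (Suc (Suc 0))"
proof -
  have "monom_fun (\<lambda>j. if j = i then 1 else 0) \<in> polys (Suc (Suc 0))"
    by (intro monom_in_polys) (simp add: mdegree_def)
  moreover have "monom_fun (\<lambda>j. if j = i then 1 else 0) = (\<lambda>x. complex_of_real (x $ i))"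
    by (rule ext) (simp add: monom_fun_def if_distrib cong: if_cong)
  ultimately show ?thesis by simp
qed

lemma polys_power: "f \<in> polys (Suc (Suc 0)) \<Longrightarrow> (\<lambda>x. f x ^ k) \<in> polys (Suc k)"
proof (induction k)
  case 0 then show ?case by (simp add: polys_const)
next
  case (Suc k)
  from polys_mult[OF Suc.prems Suc.IH[OF Suc.prems]] show ?case by simp
qed

lemma polys_prod: "finite I \<Longrightarrow> (\<And>i. i \<in> I \<Longrightarrow> f i \<in> polys (Suc (d i))) \<Longrightarrow> (\<lambda>x. \<Prod>i\<in>I. f i x) \<in> polys (Suc (\<Sum>i\<in>I. d i))"
proof (induction I rule: finite_induct)
  case empty show ?case by (simp add: polys_const)
next
  case (insert i I)
  then show ?case using polys_mult[of "f i" "d i" "\<lambda>x. \<Prod>i\<in>I. f i x" "\<Sum>i\<in>I. d i"] by simp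
qed

lemma polyfun_monom: "polyfun (monom_fun \<beta>)"
  unfolding monom_fun_def[abs_def] by (intro polyfun_prod polyfun_power polyfun_coord)

lemma polys_polyfun: "f \<in> polys s \<Longrightarrow> polyfun f"
  by (induction rule: polys_induct) (auto intro: polyfun.intros polyfun_monom)

lemma polyfun_polys: "polyfun f \<Longrightarrow> \<exists>s. f \<in> polys (Suc s)" for f :: "real^'n::finite \<Rightarrow> complex"
proof (induction f rule: polyfun.induct)
  case (polyfun_const c) then show ?case using polys_const by blast
next
  case (polyfun_coord i) then show ?case using polys_coord by blast
next
  case (polyfun_add u v)
  then obtain s t where "u \<in> polys (Suc s)" "v \<in> polys (Suc t)" by blast
  then have "u \<in> polys (Suc (max s t))" "v \<in> polys (Suc (max s t))"
    using polys_mono[of "Suc s" "Suc (max s t)"] polys_mono[of "Suc t" "Suc (max s t)"] by auto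
  then show ?case using polys_add by blast
next
  case (polyfun_mult u v) then show ?case using polys_mult by blast
qed

text \<open>The polynomial which agrees with \<open>psi\<close> on the simplex. It has derivatives of all orders
  everywhere, whereas \<open>psi\<close> need not be continuous outside of the simplex.\<close>

definition epoly :: "('n::{finite,linorder} \<Rightarrow> nat) \<Rightarrow> real^('n::{finite,linorder}) \<Rightarrow> complex" where
  "epoly \<alpha> x = complex_of_real (psi_scale \<alpha> * psi_poly \<alpha> x)"

lemma epoly_eq_psi: "x \<in> open_simplex \<Longrightarrow> epoly \<alpha> x = complex_of_real (psi \<alpha> x)"
  by (simp add: epoly_def psi_eq_poly)

lemma polyfun_epoly: "polyfun (epoly \<alpha>)"
  unfolding epoly_def[abs_def] by (intro polyfun_of_real polyfun_mult polyfun_const polyfun_psi_poly)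

lemma epoly_in_polys: "epoly \<alpha> \<in> polys (Suc (mdegree \<alpha>))"
proof -
  have j: "(\<lambda>x. complex_of_real (jfactor \<alpha> k x)) \<in> polys (Suc (\<alpha> k))" for k
  proof -
    have r: "(\<lambda>x. complex_of_real (rest k x)) \<in> polys (Suc (Suc 0))"
    proof -
      have "(\<lambda>x. 1 + (-1) * (\<Sum>i\<in>{..k}. complex_of_real (x $ i))) \<in> polys (Suc (Suc 0))"
        by (intro polys_add polys_const polys_cmult polys_sum polys_coord)
      then show ?thesis by (simp add: rest_def)
    qed
    have "(\<lambda>x. \<Sum>s\<le>\<alpha> k. complex_of_real (jacobi_coeff (\<alpha> k) (jacobi_param \<alpha> k) (-1/2) s) *
        (complex_of_real (rest k x) ^ s * complex_of_real (x $ k) ^ (\<alpha> k - s))) \<in> polys (Suc (\<alpha> k))"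
    proof (intro polys_sum polys_cmult)
      fix s assume "s \<in> {..\<alpha> k}"
      then show "(\<lambda>x. complex_of_real (rest k x) ^ s * complex_of_real (x $ k) ^ (\<alpha> k - s)) \<in> polys (Suc (\<alpha> k))"
        using polys_mult[OF polys_power[OF r, of s] polys_power[OF polys_coord[of k], of "\<alpha> k - s"]] by simp
    qed
    then show ?thesis by (simp add: jfactor_def jacobi_hom_def)
  qed
  have "(\<lambda>x. complex_of_real (psi_scale \<alpha>) * (\<Prod>k\<in>UNIV. complex_of_real (jfactor \<alpha> k x))) \<in> polys (Suc (mdegree \<alpha>))"
    unfolding mdegree_def by (intro polys_cmult polys_prod j) simp
  then show ?thesis by (simp add: epoly_def[abs_def] psi_poly_def)
qed

lemma polyfun_L2: "polyfun u \<Longrightarrow> u \<in> L2 simplex_volume"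
  by (intro C2b_laplace_L2 polyfun_C2b)

lemma epoly_orthonormal: "l2_inner simplex_volume (epoly \<alpha>) (epoly \<beta>) = (if \<alpha> = \<beta> then 1 else 0)"
proof -
  have "l2_inner simplex_volume (epoly \<alpha>) (epoly \<beta>) = (\<integral>x. complex_of_real (psi \<alpha> x * psi \<beta> x) \<partial>simplex_volume)"
    unfolding l2_inner_def by (rule Bochner_Integration.integral_cong) (auto simp: epoly_eq_psi)
  also have "\<dots> = complex_of_real (\<integral>x. psi \<alpha> x * psi \<beta> x \<partial>simplex_volume)" by (rule integral_complex_of_real)
  finally show ?thesis by (simp add: psi_orthonormal(3))
qed

lemma inj_epoly: "inj epoly"
proof
  fix \<alpha> \<beta> :: "'n::{finite,linorder} \<Rightarrow> nat" assume "epoly \<alpha> = epoly \<beta>"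
  then have "l2_inner simplex_volume (epoly \<alpha>) (epoly \<beta>) = 1" using epoly_orthonormal[of \<alpha> \<alpha>] by simp
  then show "\<alpha> = \<beta>" by (simp add: epoly_orthonormal split: if_splits)
qed

lemma independent_epoly: "fvs.independent (epoly ` I)"
  for I :: "('n::{finite,linorder} \<Rightarrow> nat) set"
proof
  assume "fvs.dependent (epoly ` I)"
  then obtain t u where t: "finite t" "t \<subseteq> epoly ` I" and s: "(\<Sum>v\<in>t. (\<lambda>x. u v * v x)) = 0" and nz: "\<exists>v\<in>t. u v \<noteq> 0"
    unfolding fvs.dependent_explicit by blast
  obtain v0 where v0: "v0 \<in> t" "u v0 \<noteq> 0" using nz by blast
  have L: "v \<in> L2 simplex_volume" if "v \<in> t" for v using t(2) that by (auto intro: polyfun_L2 polyfun_epoly)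
  have "0 = l2_inner simplex_volume (\<Sum>v\<in>t. (\<lambda>x. u v * v x)) v0" unfolding s by (simp add: zero_fun_def)
  also have "(\<Sum>v\<in>t. (\<lambda>x. u v * v x)) = (\<lambda>x. \<Sum>v\<in>t. u v * v x)" by (rule ext) (rule fun_sum_apply)
  also have "l2_inner simplex_volume (\<lambda>x. \<Sum>v\<in>t. u v * v x) v0 = (\<Sum>v\<in>t. u v * l2_inner simplex_volume v v0)"
    by (subst l2_inner_sum_left) (auto simp: l2_inner_cmult_left intro: L2_cmult L v0)
  also have "\<dots> = (\<Sum>v\<in>t. if v = v0 then u v else 0)"
  proof (rule sum.cong[OF refl])
    fix v assume v: "v \<in> t"
    obtain \<alpha> \<alpha>0 where "v = epoly \<alpha>" "v0 = epoly \<alpha>0" using v v0(1) t(2) by blast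
    then show "u v * l2_inner simplex_volume v v0 = (if v = v0 then u v else 0)"
      using inj_eq[OF inj_epoly, of \<alpha> \<alpha>0] by (simp add: epoly_orthonormal)
  qed
  also have "\<dots> = u v0" using t(1) v0(1) by simp
  finally show False using v0(2) by simp
qed

text \<open>The \<open>epoly \<alpha>\<close> with \<open>mdegree \<alpha> < s\<close> are independent, lie in \<open>polys s\<close>, and are as many as the
  monomials that span it. A monomial outside of their span would give an independent set larger
  than a spanning set.\<close>

lemma polys_eq_span_epoly:
  "(polys s :: (real^('n::{finite,linorder}) \<Rightarrow> complex) set) = fvs.span (epoly ` {\<alpha>. mdegree \<alpha> < s})"
proof
  let ?I = "{\<alpha> :: 'n \<Rightarrow> nat. mdegree \<alpha> < s}"
  have e: "epoly ` ?I \<subseteq> polys s"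
  proof clarify
    fix \<alpha> :: "'n \<Rightarrow> nat" assume "mdegree \<alpha> < s"
    then show "epoly \<alpha> \<in> polys s" using epoly_in_polys[of \<alpha>] polys_mono[of "Suc (mdegree \<alpha>)" s] by auto
  qed
  show "fvs.span (epoly ` ?I) \<subseteq> polys s"
    by (rule fvs.span_minimal[OF e]) (simp add: polys_def)
  have "monom_fun ` ?I \<subseteq> fvs.span (epoly ` ?I)"
  proof (rule ccontr)
    assume "\<not> monom_fun ` ?I \<subseteq> fvs.span (epoly ` ?I)"
    then obtain m where m: "m \<in> monom_fun ` ?I" "m \<notin> fvs.span (epoly ` ?I)" by blast
    have ind: "fvs.independent (insert m (epoly ` ?I))"
      by (rule fvs.independent_insertI[OF m(2) independent_epoly])
    have sub: "insert m (epoly ` ?I) \<subseteq> fvs.span (monom_fun ` ?I)"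
      using e fvs.span_base[OF m(1)] by (simp add: polys_def)
    have "card (insert m (epoly ` ?I)) \<le> card (monom_fun ` ?I)"
      using fvs.independent_span_bound[OF finite_imageI[OF finite_mdegree] ind sub] by (rule conjunct2)
    moreover have "card (monom_fun ` ?I) \<le> card ?I" by (rule card_image_le[OF finite_mdegree])
    moreover have "card (insert m (epoly ` ?I)) = Suc (card ?I)"
    proof -
      have "m \<notin> epoly ` ?I" using m(2) by (rule contrapos_nn) (rule fvs.span_base)
      from card_insert_disjoint[OF finite_imageI[OF finite_mdegree] this] show ?thesis
        by (simp only: card_image[OF inj_on_subset[OF inj_epoly subset_UNIV]])
    qed
    ultimately show False by simp
  qed
  then show "polys s \<subseteq> fvs.span (epoly ` ?I)"
    unfolding polys_def by (rule fvs.span_minimal) simp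
qed

lemma polys_induct_epoly [consumes 1, case_names zero add cmult epoly]:
  fixes f :: "real^('n::{finite,linorder}) \<Rightarrow> complex"
  assumes f: "f \<in> polys s"
    and "P (\<lambda>x. 0)" "\<And>f g. P f \<Longrightarrow> P g \<Longrightarrow> P (\<lambda>x. f x + g x)" "\<And>c f. P f \<Longrightarrow> P (\<lambda>x. c * f x)"
    and "\<And>\<alpha>. mdegree \<alpha> < s \<Longrightarrow> P (epoly \<alpha>)"
  shows "P f"
proof -
  have "fvs.subspace {f. P f}"
    unfolding fvs.subspace_def using assms(2-4) by (simp add: zero_fun_def plus_fun_def)
  then have "fvs.span (epoly ` {\<alpha>. mdegree \<alpha> < s}) \<subseteq> {f. P f}"
    by (rule fvs.span_minimal[rotated]) (use assms(5) in auto)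
  then show ?thesis using f by (auto simp: polys_eq_span_epoly)
qed

lemma polys_orthogonal:
  assumes "f \<in> polys s" "s \<le> mdegree \<alpha>"
  shows "l2_inner simplex_volume f (epoly \<alpha>) = 0"
proof -
  have "f \<in> L2 simplex_volume \<and> l2_inner simplex_volume f (epoly \<alpha>) = 0"
    using assms(1)
  proof (induction rule: polys_induct_epoly)
    case (epoly \<beta>)
    then have "\<beta> \<noteq> \<alpha>" using assms(2) by auto
    then show ?case by (simp add: epoly_orthonormal polyfun_L2 polyfun_epoly)
  qed (auto simp: L2_zero L2_add L2_cmult l2_inner_add_left l2_inner_cmult_left polyfun_L2 polyfun_epoly)
  then show ?thesis ..
qed

lemma C_on_2_add:
  assumes u: "u \<in> C_on 2 open_simplex" and v: "v \<in> C_on 2 open_simplex" and x: "x \<in> open_simplex"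
  shows "partial_deriv j (\<lambda>x. u x + v x) x = partial_deriv j u x + partial_deriv j v x"
    "partial_deriv i (partial_deriv j (\<lambda>x. u x + v x)) x = partial_deriv i (partial_deriv j u) x + partial_deriv i (partial_deriv j v) x"
    "lap (\<lambda>x. u x + v x) x = lap u x + lap v x"
proof -
  have 1: "partial_deriv j (\<lambda>x. u x + v x) x = partial_deriv j u x + partial_deriv j v x" if "x \<in> open_simplex" for x j
    by (rule partial_deriv_add) (auto intro: C_on_1D(1)[OF u _ that] C_on_1D(1)[OF v _ that])
  then show "partial_deriv j (\<lambda>x. u x + v x) x = partial_deriv j u x + partial_deriv j v x" using x by blast
  have 2: "partial_deriv i (partial_deriv j (\<lambda>x. u x + v x)) x = partial_deriv i (partial_deriv j u) x + partial_deriv i (partial_deriv j v) x" for i j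
  proof -
    have "partial_deriv i (partial_deriv j (\<lambda>x. u x + v x)) x = partial_deriv i (\<lambda>x. partial_deriv j u x + partial_deriv j v x) x"
      by (rule partial_deriv_cong_open[OF open_open_simplex x]) (rule 1)
    also have "\<dots> = partial_deriv i (partial_deriv j u) x + partial_deriv i (partial_deriv j v) x"
      by (rule partial_deriv_add) (auto intro: C_on_2D(1)[OF u _ x] C_on_2D(1)[OF v _ x])
    finally show ?thesis .
  qed
  then show "partial_deriv i (partial_deriv j (\<lambda>x. u x + v x)) x = partial_deriv i (partial_deriv j u) x + partial_deriv i (partial_deriv j v) x" .
  show "lap (\<lambda>x. u x + v x) x = lap u x + lap v x"
    unfolding lap_def 1[OF x] 2 by (simp add: scaleR_add_right sum.distrib)
qed

lemma C_on_2_cmult: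
  assumes u: "u \<in> C_on 2 open_simplex" and x: "x \<in> open_simplex"
  shows "partial_deriv j (\<lambda>x. c * u x) x = c * partial_deriv j u x"
    "partial_deriv i (partial_deriv j (\<lambda>x. c * u x)) x = c * partial_deriv i (partial_deriv j u) x"
    "lap (\<lambda>x. c * u x) x = c * lap u x"
proof -
  have 1: "partial_deriv j (\<lambda>x. c * u x) x = c * partial_deriv j u x" if "x \<in> open_simplex" for x j
    by (rule partial_deriv_cmult) (auto intro: C_on_1D(1)[OF u _ that])
  then show "partial_deriv j (\<lambda>x. c * u x) x = c * partial_deriv j u x" using x by blast
  have 2: "partial_deriv i (partial_deriv j (\<lambda>x. c * u x)) x = c * partial_deriv i (partial_deriv j u) x" for i j
  proof -
    have "partial_deriv i (partial_deriv j (\<lambda>x. c * u x)) x = partial_deriv i (\<lambda>x. c * partial_deriv j u x) x"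
      by (rule partial_deriv_cong_open[OF open_open_simplex x]) (rule 1)
    also have "\<dots> = c * partial_deriv i (partial_deriv j u) x"
      by (rule partial_deriv_cmult) (auto intro: C_on_2D(1)[OF u _ x])
    finally show ?thesis .
  qed
  then show "partial_deriv i (partial_deriv j (\<lambda>x. c * u x)) x = c * partial_deriv i (partial_deriv j u) x" .
  show "lap (\<lambda>x. c * u x) x = c * lap u x"
    unfolding lap_def 1[OF x] 2 by (simp add: sum_distrib_left distrib_left)
qed

lemma monom_lower: "monom_fun (\<beta>(j := b)) x = complex_of_real (x $ j) ^ b * (\<Prod>k\<in>UNIV - {j}. complex_of_real (x $ k) ^ \<beta> k)"
  unfolding monom_fun_def by (subst prod.remove[of UNIV j]) (auto intro!: prod.cong)

lemma partial_deriv_monom: "partial_deriv j (monom_fun \<beta>) x = of_nat (\<beta> j) * monom_fun (\<beta>(j := \<beta> j - 1)) x"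
proof -
  have c: "((\<lambda>x. complex_of_real (x $ i) ^ \<beta> i) has_derivative (\<lambda>h. of_nat (\<beta> i) * complex_of_real (h $ i) * complex_of_real (x $ i) ^ (\<beta> i - 1))) (at x)" for i
    by (rule has_derivative_power[OF bounded_linear.has_derivative[OF bounded_linear_of_real
        bounded_linear.has_derivative[OF bounded_linear_vec_nth has_derivative_ident]]])
  have "partial_deriv j (monom_fun \<beta>) x
    = (\<Sum>i\<in>UNIV. of_nat (\<beta> i) * complex_of_real (axis j 1 $ i) * complex_of_real (x $ i) ^ (\<beta> i - 1) * (\<Prod>k\<in>UNIV - {i}. complex_of_real (x $ k) ^ \<beta> k))"
    unfolding monom_fun_def[abs_def] by (rule partial_derivI[OF has_derivative_prod]) (rule c)
  also have "\<dots> = (\<Sum>i\<in>UNIV. if i = j then of_nat (\<beta> j) * complex_of_real (x $ j) ^ (\<beta> j - 1) * (\<Prod>k\<in>UNIV - {j}. complex_of_real (x $ k) ^ \<beta> k) else 0)"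
    by (rule sum.cong) (auto simp: axis_def)
  also have "\<dots> = of_nat (\<beta> j) * complex_of_real (x $ j) ^ (\<beta> j - 1) * (\<Prod>k\<in>UNIV - {j}. complex_of_real (x $ k) ^ \<beta> k)" by simp
  also have "\<dots> = of_nat (\<beta> j) * monom_fun (\<beta>(j := \<beta> j - 1)) x"
    by (simp only: monom_lower mult.assoc)
  finally show ?thesis .
qed

lemma monom_times_coord: "\<beta> j \<noteq> 0 \<Longrightarrow> complex_of_real (x $ j) * monom_fun (\<beta>(j := \<beta> j - 1)) x = monom_fun \<beta> x"
proof -
  assume nz: "\<beta> j \<noteq> 0"
  have "complex_of_real (x $ j) * monom_fun (\<beta>(j := \<beta> j - 1)) x
    = complex_of_real (x $ j) * complex_of_real (x $ j) ^ (\<beta> j - 1) * (\<Prod>k\<in>UNIV - {j}. complex_of_real (x $ k) ^ \<beta> k)"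
    by (simp only: monom_lower mult.assoc)
  also have "complex_of_real (x $ j) * complex_of_real (x $ j) ^ (\<beta> j - 1) = complex_of_real (x $ j) ^ \<beta> j"
    using nz by (cases "\<beta> j") auto
  also have "\<dots> * (\<Prod>k\<in>UNIV - {j}. complex_of_real (x $ k) ^ \<beta> k) = monom_fun \<beta> x"
    unfolding monom_fun_def by (subst prod.remove[of UNIV j]) auto
  finally show ?thesis .
qed

lemma coord_partial_deriv_monom: "complex_of_real (x $ j) * partial_deriv j (monom_fun \<beta>) x = of_nat (\<beta> j) * monom_fun \<beta> x"
proof (cases "\<beta> j = 0")
  case True then show ?thesis by (simp add: partial_deriv_monom)
next
  case False
  then show ?thesis using monom_times_coord[of \<beta> j x, OF False] by (simp add: partial_deriv_monom mult.left_commute)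
qed

lemma partial_deriv2_monom:
  "partial_deriv i (partial_deriv j (monom_fun \<beta>)) x = of_nat (\<beta> j) * partial_deriv i (monom_fun (\<beta>(j := \<beta> j - 1))) x"
proof -
  have "partial_deriv j (monom_fun \<beta>) = (\<lambda>x. of_nat (\<beta> j) * monom_fun (\<beta>(j := \<beta> j - 1)) x)"
    by (rule ext) (rule partial_deriv_monom)
  then show ?thesis
    by (simp add: partial_deriv_cmult polyfun_differentiable polyfun_monom)
qed

lemma coord2_partial_deriv2_monom:
  "complex_of_real (x $ i * x $ j) * partial_deriv i (partial_deriv j (monom_fun \<beta>)) x
    = of_nat (\<beta> j) * (of_nat (\<beta> i) - (if i = j then 1 else 0)) * monom_fun \<beta> x"
proof (cases "\<beta> j = 0")
  case True then show ?thesis by (simp add: partial_deriv2_monom)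
next
  case False
  have "complex_of_real (x $ i * x $ j) * partial_deriv i (partial_deriv j (monom_fun \<beta>)) x
     = of_nat (\<beta> j) * (complex_of_real (x $ j) * (complex_of_real (x $ i) * partial_deriv i (monom_fun (\<beta>(j := \<beta> j - 1))) x))"
    by (simp add: partial_deriv2_monom mult_ac)
  also have "\<dots> = of_nat (\<beta> j) * (of_nat ((\<beta>(j := \<beta> j - 1)) i) * (complex_of_real (x $ j) * monom_fun (\<beta>(j := \<beta> j - 1)) x))"
    unfolding coord_partial_deriv_monom by (simp add: mult_ac)
  also have "\<dots> = of_nat (\<beta> j) * of_nat ((\<beta>(j := \<beta> j - 1)) i) * monom_fun \<beta> x"
    unfolding monom_times_coord[of \<beta> j x, OF False] by simp
  also have "of_nat ((\<beta>(j := \<beta> j - 1)) i) = (of_nat (\<beta> i) - (if i = j then 1 else 0) :: complex)"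
    using False by (auto simp: of_nat_diff)
  finally show ?thesis by simp
qed

text \<open>The part \<open>- x\<^sub>i x\<^sub>j\<close> of the inverse metric and the linear part of the first-order coefficient
  preserve the monomial, by Euler's identity, and together give \<open>- \<lambda>\<^sub>s\<close> with \<open>s = |\<beta>|\<close>. The remaining
  parts lower the degree by one. If \<open>\<beta> i = 0\<close>, the truncated subtraction is harmless because the
  coefficient vanishes.\<close>

lemma lap_monom:
  fixes \<beta> :: "'n::finite \<Rightarrow> nat"
  shows "lap (monom_fun \<beta>) x = (\<Sum>i\<in>UNIV. (of_nat (\<beta> i) * (of_nat (\<beta> i) - 1/2)) * monom_fun (\<beta>(i := \<beta> i - 1)) x)
    - of_real (lambda CARD('n) (mdegree \<beta>)) * monom_fun \<beta> x"
proof -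
  let ?m = "monom_fun \<beta> x" and ?l = "\<lambda>i. monom_fun (\<beta>(i := \<beta> i - 1)) x"
  let ?s = "of_nat (mdegree \<beta>) :: complex" and ?N = "of_nat CARD('n) :: complex"
  have s: "(\<Sum>i\<in>UNIV. of_nat (\<beta> i)) = ?s" by (simp add: mdegree_def)
  have diag: "complex_of_real (x $ i) * partial_deriv i (partial_deriv i (monom_fun \<beta>)) x = of_nat (\<beta> i) * (of_nat (\<beta> i) - 1) * ?l i" for i
  proof -
    have "complex_of_real (x $ i) * partial_deriv i (partial_deriv i (monom_fun \<beta>)) x
      = of_nat (\<beta> i) * (complex_of_real (x $ i) * partial_deriv i (monom_fun (\<beta>(i := \<beta> i - 1))) x)"
      by (simp add: partial_deriv2_monom mult.left_commute)
    also have "\<dots> = of_nat (\<beta> i) * (of_nat (\<beta> i - 1) * ?l i)"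
      unfolding coord_partial_deriv_monom by simp
    also have "\<dots> = of_nat (\<beta> i) * (of_nat (\<beta> i) - 1) * ?l i" by (cases "\<beta> i") auto
    finally show ?thesis .
  qed
  have 1: "(\<Sum>j\<in>UNIV. ginv x i j *\<^sub>R partial_deriv i (partial_deriv j (monom_fun \<beta>)) x)
      = of_nat (\<beta> i) * (of_nat (\<beta> i) - 1) * ?l i - of_nat (\<beta> i) * (?s - 1) * ?m" for i
  proof -
    have "(\<Sum>j\<in>UNIV. ginv x i j *\<^sub>R partial_deriv i (partial_deriv j (monom_fun \<beta>)) x)
      = (\<Sum>j\<in>UNIV. (if i = j then complex_of_real (x $ i) * partial_deriv i (partial_deriv i (monom_fun \<beta>)) x else 0)
          - complex_of_real (x $ i * x $ j) * partial_deriv i (partial_deriv j (monom_fun \<beta>)) x)"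
      by (rule sum.cong) (auto simp: ginv_def scaleR_conv_of_real left_diff_distrib)
    also have "\<dots> = of_nat (\<beta> i) * (of_nat (\<beta> i) - 1) * ?l i
        - (\<Sum>j\<in>UNIV. of_nat (\<beta> j) * (of_nat (\<beta> i) - (if i = j then 1 else 0)) * ?m)"
      unfolding coord2_partial_deriv2_monom by (simp add: sum_subtractf diag)
    also have "(\<Sum>j\<in>UNIV. of_nat (\<beta> j) * (of_nat (\<beta> i) - (if i = j then 1 else 0)) * ?m)
       = (\<Sum>j\<in>UNIV. of_nat (\<beta> j) * (of_nat (\<beta> i) * ?m) - (if i = j then of_nat (\<beta> i) * ?m else 0))"
      by (rule sum.cong) (auto simp: algebra_simps)
    also have "\<dots> = ?s * (of_nat (\<beta> i) * ?m) - of_nat (\<beta> i) * ?m"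
      by (simp add: sum_subtractf sum_distrib_right[symmetric] s)
    also have "of_nat (\<beta> i) * (of_nat (\<beta> i) - 1) * ?l i - (?s * (of_nat (\<beta> i) * ?m) - of_nat (\<beta> i) * ?m)
       = of_nat (\<beta> i) * (of_nat (\<beta> i) - 1) * ?l i - of_nat (\<beta> i) * (?s - 1) * ?m"
    proof -
      have "a * l - (s * (b * m) - b * m) = a * l - b * (s - 1) * m" for a b l m s :: complex by algebra
      then show ?thesis .
    qed
    finally show ?thesis .
  qed
  have 2: "((1 - (real CARD('n) + 1) * x $ j) / 2) *\<^sub>R partial_deriv j (monom_fun \<beta>) x
      = 1/2 * (of_nat (\<beta> j) * ?l j) - (?N + 1) / 2 * (of_nat (\<beta> j) * ?m)" for j
  proof -
    have "((1 - (real CARD('n) + 1) * x $ j) / 2) *\<^sub>R partial_deriv j (monom_fun \<beta>) x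
      = 1/2 * partial_deriv j (monom_fun \<beta>) x - (?N + 1) / 2 * (complex_of_real (x $ j) * partial_deriv j (monom_fun \<beta>) x)"
      by (simp add: scaleR_conv_of_real field_simps)
    then show ?thesis unfolding coord_partial_deriv_monom by (simp only: partial_deriv_monom)
  qed
  have "lap (monom_fun \<beta>) x = (\<Sum>i\<in>UNIV. of_nat (\<beta> i) * (of_nat (\<beta> i) - 1) * ?l i) - ?s * ((?s - 1) * ?m)
      + ((\<Sum>j\<in>UNIV. 1/2 * (of_nat (\<beta> j) * ?l j)) - (?N + 1) / 2 * (?s * ?m))"
    unfolding lap_def 1 2 sum_subtractf sum_distrib_left[symmetric]
    by (simp add: s[symmetric] sum_distrib_right mult.assoc)
  also have "\<dots> = (\<Sum>i\<in>UNIV. (of_nat (\<beta> i) * (of_nat (\<beta> i) - 1/2)) * ?l i) - (?s * (?s - 1) + (?N + 1) / 2 * ?s) * ?m"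
    by (simp add: algebra_simps sum.distrib sum_subtractf sum_divide_distrib[symmetric] sum_negf)
  also have "?s * (?s - 1) + (?N + 1) / 2 * ?s = of_real (lambda CARD('n) (mdegree \<beta>))"
    by (simp add: lambda_def field_simps)
  finally show ?thesis .
qed

text \<open>On polynomials of degree at most \<open>s\<close> the operator is triangular with \<open>\<lambda>\<^sub>s\<close> on the leading part.\<close>

lemma lap_polys:
  fixes f :: "real^'n::finite \<Rightarrow> complex"
  assumes "f \<in> polys (Suc s)"
  shows "\<exists>g\<in>polys s. \<forall>x\<in>open_simplex. - lap f x = of_real (lambda CARD('n) s) * f x + g x"
proof -
  let ?lam = "complex_of_real (lambda CARD('n) s)"
  have "polyfun f \<and> (\<exists>g\<in>polys s. \<forall>x\<in>open_simplex. - lap f x = ?lam * f x + g x)"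
    using assms
  proof (induction rule: polys_induct)
    case zero
    have "lap (\<lambda>x. 0) x = 0" for x :: "real^'n"
    proof -
      have "partial_deriv j (\<lambda>x::real^'n. 0::complex) = (\<lambda>x. 0)" for j by (rule ext) simp
      then show ?thesis by (simp add: lap_def)
    qed
    then show ?case by (auto intro!: bexI[OF _ polys_zero] polyfun_const)
  next
    case (add f1 f2)
    then obtain g1 g2 where g: "g1 \<in> polys s" "g2 \<in> polys s"
      "\<And>x. x \<in> open_simplex \<Longrightarrow> - lap f1 x = ?lam * f1 x + g1 x" "\<And>x. x \<in> open_simplex \<Longrightarrow> - lap f2 x = ?lam * f2 x + g2 x" by blast
    have "- lap (\<lambda>x. f1 x + f2 x) x = ?lam * (f1 x + f2 x) + (g1 x + g2 x)" if "x \<in> open_simplex" for x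
      using C_on_2_add(3)[OF polyfun_C_on polyfun_C_on that, of f1 f2] add g(3,4)[OF that] by (simp add: algebra_simps)
    then show ?case
      by (intro conjI polyfun_add conjunct1[OF add(1)] conjunct1[OF add(2)] bexI[OF _ polys_add[OF g(1,2)]] ballI)
  next
    case (cmult c f1)
    then obtain g1 where g: "g1 \<in> polys s" "\<And>x. x \<in> open_simplex \<Longrightarrow> - lap f1 x = ?lam * f1 x + g1 x" by blast
    have "- lap (\<lambda>x. c * f1 x) x = ?lam * (c * f1 x) + (c * g1 x)" if "x \<in> open_simplex" for x
    proof -
      have "- lap (\<lambda>x. c * f1 x) x = c * (- lap f1 x)"
        using C_on_2_cmult(3)[OF polyfun_C_on that, of f1 c] cmult by simp
      then show ?thesis unfolding g(2)[OF that] by (simp add: algebra_simps)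
    qed
    then show ?case
      by (intro conjI polyfun_mult polyfun_const conjunct1[OF cmult] bexI[OF _ polys_cmult[OF g(1)]] ballI)
  next
    case (monom \<beta>)
    define g0 where "g0 x = (\<Sum>i\<in>UNIV. (- of_nat (\<beta> i) * (of_nat (\<beta> i) - 1/2)) * monom_fun (\<beta>(i := \<beta> i - 1)) x)" for x :: "real^'n"
    have g0: "g0 \<in> polys s"
      unfolding g0_def[abs_def]
    proof (rule polys_sum)
      fix i :: 'n
      show "(\<lambda>x. (- of_nat (\<beta> i) * (of_nat (\<beta> i) - 1/2)) * monom_fun (\<beta>(i := \<beta> i - 1)) x) \<in> polys s"
      proof (cases "\<beta> i = 0")
        case True then show ?thesis by (simp add: polys_zero)
      next
        case False
        have "mdegree \<beta> = \<beta> i + (\<Sum>k\<in>UNIV - {i}. \<beta> k)" unfolding mdegree_def by (rule sum.remove) auto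
        moreover have "mdegree (\<beta>(i := \<beta> i - 1)) = (\<beta> i - 1) + (\<Sum>k\<in>UNIV - {i}. \<beta> k)"
          unfolding mdegree_def by (subst sum.remove[of _ i]) auto
        ultimately have "mdegree (\<beta>(i := \<beta> i - 1)) < s" using False monom by simp
        then show ?thesis by (intro polys_cmult monom_in_polys)
      qed
    qed
    have l0: "- lap (monom_fun \<beta>) x = of_real (lambda CARD('n) (mdegree \<beta>)) * monom_fun \<beta> x + g0 x" for x
      unfolding lap_monom g0_def by (simp add: sum_negf)
    show ?case
    proof (cases "mdegree \<beta> = s")
      case True
      then have "- lap (monom_fun \<beta>) x = ?lam * monom_fun \<beta> x + g0 x" for x using l0 by simp
      then show ?thesis by (intro conjI polyfun_monom bexI[OF _ g0] ballI)
    next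
      case False
      then have "monom_fun \<beta> \<in> polys s" using monom by (intro monom_in_polys) simp
      then have h: "(\<lambda>x. (of_real (lambda CARD('n) (mdegree \<beta>)) - ?lam) * monom_fun \<beta> x + g0 x) \<in> polys s"
        by (intro polys_add polys_cmult g0)
      have "- lap (monom_fun \<beta>) x = ?lam * monom_fun \<beta> x + ((of_real (lambda CARD('n) (mdegree \<beta>)) - ?lam) * monom_fun \<beta> x + g0 x)" for x
        unfolding l0 by (simp add: left_diff_distrib)
      then show ?thesis by (intro conjI polyfun_monom bexI[OF _ h] ballI)
    qed
  qed
  then show ?thesis ..
qed

text \<open>If \<open>|\<alpha>| \<le> |\<beta>|\<close>, the remainder of lower degree is orthogonal to \<open>epoly \<beta>\<close>. The other case
  follows from the symmetry of the operator.\<close>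

lemma l2_inner_lap_epoly:
  fixes \<alpha> \<beta> :: "'n::{finite,linorder} \<Rightarrow> nat"
  shows "l2_inner simplex_volume (\<lambda>x. - laplace_beltrami baran_metric (epoly \<alpha>) x) (epoly \<beta>)
    = of_real (lambda CARD('n) (mdegree \<alpha>)) * (if \<alpha> = \<beta> then 1 else 0)"
proof -
  let ?M = "simplex_volume :: (real^('n::{finite,linorder})) measure"
  let ?L = "\<lambda>\<alpha> x. - laplace_beltrami baran_metric (epoly \<alpha>) x"
  have *: "l2_inner ?M (?L \<alpha>) (epoly \<beta>) = of_real (lambda CARD('n) (mdegree \<alpha>)) * l2_inner ?M (epoly \<alpha>) (epoly \<beta>)" if "mdegree \<alpha> \<le> mdegree \<beta>"
    for \<alpha> \<beta> :: "'n \<Rightarrow> nat"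
  proof -
    obtain g where g: "g \<in> polys (mdegree \<alpha>)" "\<And>x. x \<in> open_simplex \<Longrightarrow> - lap (epoly \<alpha>) x = of_real (lambda CARD('n) (mdegree \<alpha>)) * epoly \<alpha> x + g x"
      using lap_polys[OF epoly_in_polys[of \<alpha>]] by blast
    have "l2_inner ?M (?L \<alpha>) (epoly \<beta>) = l2_inner ?M (\<lambda>x. of_real (lambda CARD('n) (mdegree \<alpha>)) * epoly \<alpha> x + g x) (epoly \<beta>)"
      unfolding l2_inner_def
      by (rule Bochner_Integration.integral_cong) (auto simp: laplace_beltrami_eq_lap polyfun_C_on polyfun_epoly g(2))
    also have "\<dots> = of_real (lambda CARD('n) (mdegree \<alpha>)) * l2_inner ?M (epoly \<alpha>) (epoly \<beta>) + l2_inner ?M g (epoly \<beta>)"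
      by (subst l2_inner_add_left) (auto intro: L2_cmult polyfun_L2 polyfun_epoly polys_polyfun[OF g(1)] simp: l2_inner_cmult_left)
    finally show ?thesis using polys_orthogonal[OF g(1) that] by simp
  qed
  show ?thesis
  proof (cases "mdegree \<alpha> \<le> mdegree \<beta>")
    case True then show ?thesis using *[OF True] by (simp add: epoly_orthonormal)
  next
    case False
    have "l2_inner ?M (?L \<alpha>) (epoly \<beta>) = l2_inner ?M (epoly \<alpha>) (?L \<beta>)"
      by (intro laplace_beltrami_symmetric polyfun_C2b polyfun_epoly)
    also have "\<dots> = cnj (l2_inner ?M (?L \<beta>) (epoly \<alpha>))" by (rule l2_inner_commute)
    also have "\<dots> = 0" using *[of \<beta> \<alpha>] False by (auto simp: epoly_orthonormal)
    finally show ?thesis using False by auto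
  qed
qed

section \<open>Completeness of the polynomials\<close>

text \<open>The indicator of a closed set is a bounded limit of continuous functions of the distance. Closed
  sets generate the Borel sets and are stable under intersections, so Dynkin's theorem extends the
  statement to all Borel sets.\<close>

lemma orthogonal_continuous_imp_set_integral_0:
  fixes u :: "real^'n::finite \<Rightarrow> complex"
  assumes int: "integrable simplex_volume u"
    and orth: "\<And>f. continuous_on UNIV f \<Longrightarrow> (\<integral>x. f x *\<^sub>R u x \<partial>simplex_volume) = 0"
    and A: "A \<in> sets borel"
  shows "(\<integral>x. indicator A x *\<^sub>R u x \<partial>simplex_volume) = 0"
proof -
  let ?M = "simplex_volume :: (real^'n) measure"
  have meas: "(\<lambda>x. indicator B x *\<^sub>R u x) \<in> borel_measurable ?M" if "B \<in> sets borel" for B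
    using int borel_measurable_simplex_volumeI[OF borel_measurable_indicator[OF that]]
    by (intro borel_measurable_scaleR) auto
  have intA: "integrable ?M (\<lambda>x. indicator B x *\<^sub>R u x)" if "B \<in> sets borel" for B
    by (rule Bochner_Integration.integrable_bound[OF int meas[OF that]]) (auto simp: indicator_def)
  have closed: "(\<integral>x. indicator C x *\<^sub>R u x \<partial>?M) = 0" if C: "closed C" for C
  proof (cases "C = {}")
    case True then show ?thesis by simp
  next
    case False
    define f where "f n x = max 0 (1 - real n * infdist x C)" for n and x :: "real^'n"
    have cf: "continuous_on UNIV (f n)" for n
      unfolding f_def[abs_def] by (intro continuous_intros)
    have "(\<lambda>n. \<integral>x. f n x *\<^sub>R u x \<partial>?M) \<longlonglongrightarrow> (\<integral>x. indicator C x *\<^sub>R u x \<partial>?M)"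
    proof (rule integral_dominated_convergence[where w = "\<lambda>x. norm (u x)"])
      show "(\<lambda>x. indicator C x *\<^sub>R u x) \<in> borel_measurable ?M" using C by (intro meas borel_closed)
      show "(\<lambda>x. f n x *\<^sub>R u x) \<in> borel_measurable ?M" for n
        using int borel_measurable_simplex_volumeI[OF borel_measurable_continuous_onI[OF cf]]
        by (intro borel_measurable_scaleR) auto
      show "integrable ?M (\<lambda>x. norm (u x))" using int by simp
      have "\<bar>f n x\<bar> \<le> 1" for n x by (simp add: f_def infdist_nonneg)
      then show "AE x in ?M. norm (f n x *\<^sub>R u x) \<le> norm (u x)" for n
        by (intro AE_I2) (simp add: mult_left_le_one_le)
      show "AE x in ?M. (\<lambda>n. f n x *\<^sub>R u x) \<longlonglongrightarrow> indicator C x *\<^sub>R u x"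
      proof (intro AE_I2 tendsto_scaleR tendsto_const)
        fix x :: "real^'n"
        show "(\<lambda>n. f n x) \<longlonglongrightarrow> indicator C x"
        proof (cases "x \<in> C")
          case True then show ?thesis by (simp add: f_def)
        next
          case notin: False
          then have d: "infdist x C > 0"
            using in_closed_iff_infdist_zero[OF C False] infdist_nonneg[of x C] by (auto simp: less_le)
          then obtain N where N: "1 < real N * infdist x C" using reals_Archimedean3 by blast
          have "f n x = 0" if "n \<ge> N" for n
          proof -
            have "real N * infdist x C \<le> real n * infdist x C" using that d by (intro mult_right_mono) auto
            then show ?thesis using N by (simp add: f_def)
          qed
          then show ?thesis using notin
            by (intro tendsto_eventually eventually_sequentiallyI[of N]) auto
        qed
      qed
    qed
    then show ?thesis using orth[OF cf] by (simp add: LIMSEQ_const_iff)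
  qed
  have all: "(\<integral>x. u x \<partial>?M) = 0" using closed[of UNIV] by simp
  have st: "Int_stable (Collect closed :: (real^'n) set set)" by (auto simp: Int_stable_def)
  have pw: "(Collect closed :: (real^'n) set set) \<subseteq> Pow UNIV" by simp
  have "A \<in> sigma_sets UNIV (Collect closed)" using A unfolding borel_eq_closed by simp
  from st pw this show ?thesis
  proof (induction rule: sigma_sets_induct_disjoint)
    case (basic B) then show ?case using closed by simp
  next
    case empty show ?case by simp
  next
    case (compl B)
    then have B: "B \<in> sets borel" unfolding borel_eq_closed by simp
    have "(\<lambda>x. indicator (UNIV - B) x *\<^sub>R u x) = (\<lambda>x. u x - indicator B x *\<^sub>R u x)"
      by (rule ext) (auto simp: indicator_def)
    then show ?case using compl all int intA[OF B] by simp
  next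
    case (union B)
    have B: "B i \<in> sets borel" for i using union(2) unfolding borel_eq_closed by auto
    have "(\<lambda>n. \<integral>x. (\<Sum>i<n. indicator (B i) x *\<^sub>R u x) \<partial>?M) \<longlonglongrightarrow> (\<integral>x. indicator (\<Union>i. B i) x *\<^sub>R u x \<partial>?M)"
    proof (rule integral_dominated_convergence[where w = "\<lambda>x. norm (u x)"])
      show "(\<lambda>x. indicator (\<Union>i. B i) x *\<^sub>R u x) \<in> borel_measurable ?M" using B by (intro meas) auto
      show "(\<lambda>x. \<Sum>i<n. indicator (B i) x *\<^sub>R u x) \<in> borel_measurable ?M" for n
        by (intro borel_measurable_sum meas B)
      show "integrable ?M (\<lambda>x. norm (u x))" using int by simp
      have s: "(\<Sum>i<n. indicator (B i) x *\<^sub>R u x) = indicator (\<Union>i<n. B i) x *\<^sub>R u x" for n x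
        unfolding scaleR_sum_left[symmetric]
        by (subst indicator_UN_disjoint[symmetric]) (use union(1) in \<open>auto simp: disjoint_family_on_def\<close>)
      show "AE x in ?M. norm (\<Sum>i<n. indicator (B i) x *\<^sub>R u x) \<le> norm (u x)" for n
        unfolding s by (rule AE_I2) (auto simp: indicator_def)
      show "AE x in ?M. (\<lambda>n. \<Sum>i<n. indicator (B i) x *\<^sub>R u x) \<longlonglongrightarrow> indicator (\<Union>i. B i) x *\<^sub>R u x"
      proof (rule AE_I2)
        fix x
        show "(\<lambda>n. \<Sum>i<n. indicator (B i) x *\<^sub>R u x) \<longlonglongrightarrow> indicator (\<Union>i. B i) x *\<^sub>R u x"
        proof (cases "x \<in> (\<Union>i. B i)")
          case True
          then obtain k where "x \<in> B k" by blast
          then have "indicator (\<Union>i<n. B i) x = (1::real)" if "n \<ge> Suc k" for n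
            using that by (auto simp: indicator_def intro!: bexI[of _ k])
          then show ?thesis unfolding s using True
            by (intro tendsto_eventually eventually_sequentiallyI[of "Suc k"]) simp
        next
          case False
          then show ?thesis unfolding s by simp
        qed
      qed
    qed
    moreover have "(\<integral>x. (\<Sum>i<n. indicator (B i) x *\<^sub>R u x) \<partial>?M) = 0" for n
      by (subst Bochner_Integration.integral_sum) (rule intA[OF B], simp add: union(3))
    ultimately show ?case by (simp add: LIMSEQ_const_iff)
  qed
qed

text \<open>A function orthogonal to all \<open>epoly \<alpha>\<close> is orthogonal to all polynomials, by the theorem of Stone
  and Weierstrass to all continuous functions, and so to all indicators. The uniform approximation
  takes place on the closure of the simplex, which is compact; since the volume is finite, the
  function is integrable, and the approximation passes to the integral.\<close>

lemma epoly_complete: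
  fixes u :: "real^('n::{finite,linorder}) \<Rightarrow> complex"
  assumes u: "u \<in> L2 simplex_volume" and orth: "\<And>\<alpha>. l2_inner simplex_volume u (epoly \<alpha>) = 0"
  shows "ae_eq simplex_volume u (\<lambda>x. 0)"
proof -
  let ?M = "simplex_volume :: (real^('n::{finite,linorder})) measure"
  interpret finite_measure ?M by (rule finite_measure_simplex_volume)
  have int: "integrable ?M u"
    using L2_mult_integrable[OF u polyfun_L2[OF polyfun_const[of 1]]] by simp
  have um: "u \<in> borel_measurable ?M" using int by simp
  have p0: "l2_inner ?M u f = 0" if "f \<in> polys s" for f s
  proof -
    have "f \<in> L2 ?M \<and> l2_inner ?M f u = 0"
      using that
    proof (induction rule: polys_induct_epoly)
      case (epoly \<beta>)
      have "l2_inner ?M (epoly \<beta>) u = cnj (l2_inner ?M u (epoly \<beta>))" by (rule l2_inner_commute)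
      then show ?case using orth by (simp add: polyfun_L2 polyfun_epoly)
    qed (auto simp: L2_zero L2_add L2_cmult l2_inner_add_left l2_inner_cmult_left u)
    then show ?thesis using l2_inner_commute[of ?M u f] by simp
  qed
  have poly0: "(\<integral>x. p x *\<^sub>R u x \<partial>?M) = 0" if "polyfun p" for p :: "real^('n::{finite,linorder}) \<Rightarrow> real"
  proof -
    obtain s where "(\<lambda>x. complex_of_real (p x)) \<in> polys (Suc s)" using polyfun_polys[OF polyfun_of_real[OF \<open>polyfun p\<close>]] by blast
    from p0[OF this] show ?thesis by (simp add: l2_inner_def scaleR_conv_of_real mult.commute)
  qed
  have rpf: "polyfun p" if "real_polynomial_function p" for p :: "real^('n::{finite,linorder}) \<Rightarrow> real"
    using that
  proof (induction p rule: real_polynomial_function.induct)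
    case (linear f)
    have "f x = (\<Sum>i\<in>UNIV. f (axis i 1) * x $ i)" for x
    proof -
      have "x = (\<Sum>i\<in>UNIV. x $ i *\<^sub>R axis i 1)"
        by (simp add: vec_eq_iff axis_def if_distrib cong: if_cong)
      then have "f x = f (\<Sum>i\<in>UNIV. x $ i *\<^sub>R axis i 1)" by (rule arg_cong)
      also have "\<dots> = (\<Sum>i\<in>UNIV. f (axis i 1) * x $ i)"
        using linear by (simp add: linear_sum[OF bounded_linear.linear] linear_cmul[OF bounded_linear.linear] mult.commute)
      finally show ?thesis .
    qed
    then have "f = (\<lambda>x. \<Sum>i\<in>UNIV. f (axis i 1) * x $ i)" by blast
    moreover have "polyfun (\<lambda>x::real^('n::{finite,linorder}). \<Sum>i\<in>UNIV. f (axis i 1) * x $ i)"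
      by (intro polyfun_sum polyfun_mult polyfun_const polyfun_component)
    ultimately show ?case by simp
  qed (auto intro: polyfun.intros)
  have cont0: "(\<integral>x. f x *\<^sub>R u x \<partial>?M) = 0" if f: "continuous_on UNIV f" for f :: "real^('n::{finite,linorder}) \<Rightarrow> real"
  proof -
    let ?C = "closure open_simplex :: (real^('n::{finite,linorder})) set"
    have C: "compact ?C" using bounded_open_simplex by simp
    have le: "norm (\<integral>x. f x *\<^sub>R u x \<partial>?M) \<le> e * (\<integral>x. norm (u x) \<partial>?M)" if e: "e > 0" for e
    proof -
      obtain p where p: "real_polynomial_function p" "\<And>x. x \<in> ?C \<Longrightarrow> \<bar>f x - p x\<bar> < e"
        using Stone_Weierstrass_real_polynomial_function[OF C continuous_on_subset[OF f] e] by blast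
      have cp: "continuous_on UNIV p" by (intro polyfun_continuous rpf p)
      have bnd: "norm ((f x - p x) *\<^sub>R u x) \<le> e * norm (u x)" if "x \<in> open_simplex" for x
      proof -
        have "\<bar>f x - p x\<bar> \<le> e" using p(2)[OF subsetD[OF closure_subset that]] by (rule less_imp_le)
        then show ?thesis by (simp add: mult_right_mono)
      qed
      have i1: "integrable ?M (\<lambda>x. (f x - p x) *\<^sub>R u x)"
      proof (rule Bochner_Integration.integrable_bound[of _ "\<lambda>x. e * norm (u x)"])
        show "integrable ?M (\<lambda>x. e * norm (u x))" using int by simp
        show "(\<lambda>x. (f x - p x) *\<^sub>R u x) \<in> borel_measurable ?M"
          by (intro borel_measurable_scaleR um borel_measurable_simplex_volumeI borel_measurable_continuous_onI continuous_intros f cp)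
        show "AE x in ?M. norm ((f x - p x) *\<^sub>R u x) \<le> norm (e * norm (u x))"
          using bnd e by (intro AE_I2) (simp add: abs_mult)
      qed
      have i2: "integrable ?M (\<lambda>x. p x *\<^sub>R u x)"
      proof -
        have "integrable ?M (\<lambda>x. u x * cnj (complex_of_real (p x)))"
          by (intro L2_mult_integrable u polyfun_L2 polyfun_of_real rpf p)
        then show ?thesis by (simp add: scaleR_conv_of_real mult.commute)
      qed
      have "(\<integral>x. f x *\<^sub>R u x \<partial>?M) = (\<integral>x. (f x - p x) *\<^sub>R u x + p x *\<^sub>R u x \<partial>?M)"
        by (simp add: scaleR_diff_left)
      also have "\<dots> = (\<integral>x. (f x - p x) *\<^sub>R u x \<partial>?M)"
        using i1 i2 poly0[OF rpf[OF p(1)]] by simp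
      finally have "norm (\<integral>x. f x *\<^sub>R u x \<partial>?M) = norm (\<integral>x. (f x - p x) *\<^sub>R u x \<partial>?M)" by (rule arg_cong)
      also have "\<dots> \<le> (\<integral>x. norm ((f x - p x) *\<^sub>R u x) \<partial>?M)" by (rule integral_norm_bound)
      also have "\<dots> \<le> (\<integral>x. e * norm (u x) \<partial>?M)"
        by (intro integral_mono integrable_norm i1 integrable_mult_right int bnd) simp
      finally show ?thesis by simp
    qed
    show ?thesis
    proof (rule ccontr)
      assume "(\<integral>x. f x *\<^sub>R u x \<partial>?M) \<noteq> 0"
      then have pos: "norm (\<integral>x. f x *\<^sub>R u x \<partial>?M) > 0" by simp
      define I where "I = (\<integral>x. norm (u x) \<partial>?M)"
      have I: "I \<ge> 0" by (simp add: I_def)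
      let ?c = "norm (\<integral>x. f x *\<^sub>R u x \<partial>?M)"
      \<comment> \<open>Any accuracy below \<open>?c / I\<close> gives a contradiction; \<open>I + 1\<close> covers the case \<open>I = 0\<close>.\<close>
      have "0 < ?c / (2 * (I + 1))" using pos I by (intro divide_pos_pos) auto
      from le[OF this] have "?c \<le> ?c / (2 * (I + 1)) * I" unfolding I_def .
      also have "\<dots> \<le> ?c / 2" using I pos by (simp add: field_simps)
      finally show False using pos by simp
    qed
  qed
  have "AE x in ?M. u x = 0"
  proof (rule density_zero[OF int])
    fix A assume "A \<in> sets ?M"
    then obtain B where B: "B \<in> sets borel" "A = open_simplex \<inter> B"
      unfolding sets_simplex_volume sets_restrict_space by auto
    have "set_lebesgue_integral ?M A u = (\<integral>x. indicator B x *\<^sub>R u x \<partial>?M)"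
      unfolding set_lebesgue_integral_def by (rule Bochner_Integration.integral_cong) (auto simp: B indicator_def)
    then show "set_lebesgue_integral ?M A u = 0"
      using orthogonal_continuous_imp_set_integral_0[OF int cont0 B(1)] by simp
  qed
  then show ?thesis by (simp add: ae_eq_def)
qed

section \<open>Diagonalisation of the Laplace Beltrami operator\<close>

lemma C2b_onI:
  fixes u :: "real^'a::finite \<Rightarrow> 'b::real_normed_vector"
  assumes "\<And>x. x \<in> S \<Longrightarrow> u differentiable (at x)" "\<And>j x. x \<in> S \<Longrightarrow> partial_deriv j u differentiable (at x)"
    and "continuous_on S u" "\<And>j. continuous_on S (partial_deriv j u)" "\<And>i j. continuous_on S (partial_deriv i (partial_deriv j u))"
    and "bounded (u ` S)" "\<And>j. bounded (partial_deriv j u ` S)" "\<And>i j. bounded (partial_deriv i (partial_deriv j u) ` S)"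
  shows "u \<in> C2b_on S"
proof -
  have l2: "is = [] \<or> (\<exists>j. is = [j]) \<or> (\<exists>i j. is = [i, j])" if "length is \<le> 2" for "is" :: "'a list"
  proof (cases "is")
    case (Cons i js)
    then show ?thesis using that by (cases js) auto
  qed simp
  have l1: "is = [] \<or> (\<exists>j. is = [j])" if "length is < 2" for "is" :: "'a list"
    using l2[of "is"] that by auto
  show ?thesis
    unfolding C2b_on_def C_on_def
  proof (intro CollectI conjI allI impI ballI)
    fix "is" :: "'a list" and x assume "length is < 2" "x \<in> S"
    then show "partial_derivs is u differentiable (at x)"
      using l1[of "is"] assms(1,2)[of x] by (auto simp: partial_derivs_def)
  next
    fix "is" :: "'a list" assume "length is \<le> 2"
    from l2[OF this] show "continuous_on S (partial_derivs is u)"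
      using assms(3-5) by (auto simp: partial_derivs_def)
  next
    fix "is" :: "'a list" assume "length is \<le> 2"
    from l2[OF this] show "bounded (partial_derivs is u ` S)"
      using assms(6-8) by (auto simp: partial_derivs_def)
  qed
qed

lemma C2b_on_add:
  fixes u v :: "real^'n::finite \<Rightarrow> complex"
  assumes u: "u \<in> C2b_on open_simplex" and v: "v \<in> C2b_on open_simplex"
  shows "(\<lambda>x. u x + v x) \<in> C2b_on open_simplex"
proof -
  note bu = C2b_onD[OF u] and bv = C2b_onD[OF v]
  note p1 = C_on_2_add(1)[OF bu(1) bv(1)] and p2 = C_on_2_add(2)[OF bu(1) bv(1)]
  show ?thesis
  proof (rule C2b_onI)
    show "(\<lambda>x. u x + v x) differentiable (at x)" if "x \<in> open_simplex" for x
      by (intro differentiable_add C_on_1D(1)[OF bu(1) _ that] C_on_1D(1)[OF bv(1) _ that]) auto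
    show "partial_deriv j (\<lambda>x. u x + v x) differentiable (at x)" if x: "x \<in> open_simplex" for j x
    proof (rule differentiable_cong_open[OF open_open_simplex x])
      show "partial_deriv j u y + partial_deriv j v y = partial_deriv j (\<lambda>x. u x + v x) y" if "y \<in> open_simplex" for y
        using p1[OF that] by simp
      show "(\<lambda>y. partial_deriv j u y + partial_deriv j v y) differentiable (at x)"
        by (intro differentiable_add C_on_2D(1)[OF bu(1) _ x] C_on_2D(1)[OF bv(1) _ x]) auto
    qed
    show "continuous_on open_simplex (\<lambda>x. u x + v x)"
      by (intro continuous_on_add C_on_1D(2)[OF bu(1)] C_on_1D(2)[OF bv(1)]) auto
    have "continuous_on open_simplex (\<lambda>x. partial_deriv j u x + partial_deriv j v x)" for j
      by (intro continuous_on_add C_on_1D(3)[OF bu(1)] C_on_1D(3)[OF bv(1)]) auto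
    then show "continuous_on open_simplex (partial_deriv j (\<lambda>x. u x + v x))" for j
      by (rule continuous_on_eq) (simp add: p1)
    have "continuous_on open_simplex (\<lambda>x. partial_deriv i (partial_deriv j u) x + partial_deriv i (partial_deriv j v) x)" for i j
      by (intro continuous_on_add C_on_2D(2)[OF bu(1)] C_on_2D(2)[OF bv(1)]) auto
    then show "continuous_on open_simplex (partial_deriv i (partial_deriv j (\<lambda>x. u x + v x)))" for i j
      by (rule continuous_on_eq) (simp add: p2)
    show "bounded ((\<lambda>x. u x + v x) ` open_simplex)" by (intro bounded_image_combine bu bv)
    have "bounded ((\<lambda>x. partial_deriv j u x + partial_deriv j v x) ` open_simplex)" for j
      by (intro bounded_image_combine bu bv)
    then show "bounded (partial_deriv j (\<lambda>x. u x + v x) ` open_simplex)" for j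
      by (simp add: p1 cong: image_cong)
    have "bounded ((\<lambda>x. partial_deriv i (partial_deriv j u) x + partial_deriv i (partial_deriv j v) x) ` open_simplex)" for i j
      by (intro bounded_image_combine bu bv)
    then show "bounded (partial_deriv i (partial_deriv j (\<lambda>x. u x + v x)) ` open_simplex)" for i j
      by (simp add: p2 cong: image_cong)
  qed
qed

lemma C2b_on_cmult:
  fixes u :: "real^'n::finite \<Rightarrow> complex"
  assumes u: "u \<in> C2b_on open_simplex"
  shows "(\<lambda>x. c * u x) \<in> C2b_on open_simplex"
proof -
  note bu = C2b_onD[OF u]
  note p1 = C_on_2_cmult(1)[OF bu(1)] and p2 = C_on_2_cmult(2)[OF bu(1)]
  have bc: "bounded ((\<lambda>x. c) ` open_simplex)" by (simp add: image_constant_conv)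
  show ?thesis
  proof (rule C2b_onI)
    show "(\<lambda>x. c * u x) differentiable (at x)" if "x \<in> open_simplex" for x
      by (intro differentiable_mult differentiable_const C_on_1D(1)[OF bu(1) _ that]) auto
    show "partial_deriv j (\<lambda>x. c * u x) differentiable (at x)" if x: "x \<in> open_simplex" for j x
    proof (rule differentiable_cong_open[OF open_open_simplex x])
      show "c * partial_deriv j u y = partial_deriv j (\<lambda>x. c * u x) y" if "y \<in> open_simplex" for y
        using p1[OF that] by simp
      show "(\<lambda>y. c * partial_deriv j u y) differentiable (at x)"
        by (intro differentiable_mult differentiable_const C_on_2D(1)[OF bu(1) _ x]) auto
    qed
    show "continuous_on open_simplex (\<lambda>x. c * u x)"
      by (intro continuous_on_mult_left C_on_1D(2)[OF bu(1)]) auto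
    have c1: "continuous_on open_simplex (\<lambda>x. c * partial_deriv j u x)" for j
      by (intro continuous_on_mult_left C_on_1D(3)[OF bu(1)]) auto
    show "continuous_on open_simplex (partial_deriv j (\<lambda>x. c * u x))" for j
      by (rule continuous_on_eq[OF c1[of j]]) (simp add: p1)
    have c2: "continuous_on open_simplex (\<lambda>x. c * partial_deriv i (partial_deriv j u) x)" for i j
      by (intro continuous_on_mult_left C_on_2D(2)[OF bu(1)]) auto
    show "continuous_on open_simplex (partial_deriv i (partial_deriv j (\<lambda>x. c * u x)))" for i j
      by (rule continuous_on_eq[OF c2[of i j]]) (simp add: p2)
    show "bounded ((\<lambda>x. c * u x) ` open_simplex)" by (intro bounded_image_combine bu bc)
    have "bounded ((\<lambda>x. c * partial_deriv j u x) ` open_simplex)" for j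
      by (intro bounded_image_combine bu bc)
    then show "bounded (partial_deriv j (\<lambda>x. c * u x) ` open_simplex)" for j
      by (simp add: p1 cong: image_cong)
    have "bounded ((\<lambda>x. c * partial_deriv i (partial_deriv j u) x) ` open_simplex)" for i j
      by (intro bounded_image_combine bu bc)
    then show "bounded (partial_deriv i (partial_deriv j (\<lambda>x. c * u x)) ` open_simplex)" for i j
      by (simp add: p2 cong: image_cong)
  qed
qed

abbreviation neg_laplace :: "(real^'n::finite \<Rightarrow> complex) \<Rightarrow> real^'n \<Rightarrow> complex" where
  "neg_laplace u \<equiv> (\<lambda>x. - laplace_beltrami baran_metric u x)"

abbreviation laplace_op :: "(real^'n::finite) graph" where
  "laplace_op \<equiv> l2_op simplex_volume (C2b_on open_simplex) (\<lambda>u x. - laplace_beltrami baran_metric u x)"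

lemma ae_eqI: "(\<And>x. x \<in> open_simplex \<Longrightarrow> u x = v x) \<Longrightarrow> ae_eq simplex_volume u v"
  unfolding ae_eq_def by (intro AE_I2) simp

lemma neg_laplace_linear:
  fixes u v :: "real^'n::finite \<Rightarrow> complex"
  assumes u: "u \<in> C2b_on open_simplex" and v: "v \<in> C2b_on open_simplex" and x: "x \<in> open_simplex"
  shows "neg_laplace (\<lambda>x. u x + v x) x = neg_laplace u x + neg_laplace v x"
    "neg_laplace (\<lambda>x. c * u x) x = c * neg_laplace u x"
  using C_on_2_add(3)[OF C2b_onD(1)[OF u] C2b_onD(1)[OF v] x] C_on_2_cmult(3)[OF C2b_onD(1)[OF u] x, of c]
  by (simp_all add: laplace_beltrami_eq_lap[OF C2b_onD(1)] C2b_on_add C2b_on_cmult u v x)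

lemma laplace_opI:
  assumes "v \<in> C2b_on open_simplex"
  shows "(v, neg_laplace v) \<in> laplace_op"
  unfolding l2_op_def using C2b_laplace_L2[OF assms] assms ae_eq_refl by blast

text \<open>Single-valuedness is the point that needs an argument: two representatives of class \<open>C\<^sup>2\<close> of the
  same element are equal everywhere on the simplex by continuity, hence so are their Laplacians.\<close>

lemma is_l2_op_laplace: "is_l2_op simplex_volume (laplace_op :: (real^'n::finite) graph)"
proof (rule is_l2_opI)
  let ?M = "simplex_volume :: (real^'n) measure"
  fix u f :: "real^'n \<Rightarrow> complex" assume uf: "(u, f) \<in> laplace_op"
  then show "u \<in> L2 ?M \<and> f \<in> L2 ?M" by (auto simp: l2_op_def)
  obtain v where uL: "u \<in> L2 ?M" "f \<in> L2 ?M" and v: "v \<in> C2b_on open_simplex" "ae_eq ?M u v" "ae_eq ?M f (neg_laplace v)"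
    using uf by (auto simp: l2_op_def)
  {
    fix u' f' assume "u' \<in> L2 ?M" "f' \<in> L2 ?M" "ae_eq ?M u u'" "ae_eq ?M f f'"
    then show "(u', f') \<in> laplace_op"
      unfolding l2_op_def using v ae_eq_trans[OF ae_eq_sym[of ?M u u'] v(2)] ae_eq_trans[OF ae_eq_sym[of ?M f f'] v(3)] by blast
  }
  {
    fix c :: complex
    have "ae_eq ?M (\<lambda>x. c * f x) (neg_laplace (\<lambda>x. c * v x))"
      by (rule ae_eq_trans[OF ae_eq_cmult[OF v(3)] ae_eqI]) (rule neg_laplace_linear(2)[OF v(1) v(1), symmetric])
    then show "((\<lambda>x. c * u x), (\<lambda>x. c * f x)) \<in> laplace_op"
      unfolding l2_op_def using L2_cmult[OF uL(1)] L2_cmult[OF uL(2)] C2b_on_cmult[OF v(1)] ae_eq_cmult[OF v(2)] by blast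
  }
  fix u2 f2 assume uf2: "(u2, f2) \<in> (laplace_op :: (real^'n) graph)"
  then obtain v2 where uL2: "u2 \<in> L2 ?M" "f2 \<in> L2 ?M" and v2: "v2 \<in> C2b_on open_simplex" "ae_eq ?M u2 v2" "ae_eq ?M f2 (neg_laplace v2)"
    by (auto simp: l2_op_def)
  have "ae_eq ?M (\<lambda>x. f x + f2 x) (neg_laplace (\<lambda>x. v x + v2 x))"
    by (rule ae_eq_trans[OF ae_eq_add[OF v(3) v2(3)] ae_eqI]) (rule neg_laplace_linear(1)[OF v(1) v2(1), symmetric])
  then show "((\<lambda>x. u x + u2 x), (\<lambda>x. f x + f2 x)) \<in> laplace_op"
    unfolding l2_op_def using L2_add[OF uL(1) uL2(1)] L2_add[OF uL(2) uL2(2)] C2b_on_add[OF v(1) v2(1)] ae_eq_add[OF v(2) v2(2)] by blast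
next
  let ?M = "simplex_volume :: (real^'n) measure"
  have "(\<lambda>x::real^'n. 0 :: complex) \<in> C2b_on open_simplex" by (intro polyfun_C2b polyfun_const)
  moreover have "ae_eq ?M (\<lambda>x. 0) (neg_laplace (\<lambda>x. 0))"
    by (rule ae_eqI) (use neg_laplace_linear(2)[OF calculation calculation, of _ 0] in simp)
  ultimately show "((\<lambda>x. 0), (\<lambda>x. 0)) \<in> (laplace_op :: (real^'n) graph)"
    unfolding l2_op_def using L2_zero ae_eq_refl by blast
next
  let ?M = "simplex_volume :: (real^'n) measure"
  fix u f g :: "real^'n \<Rightarrow> complex" assume "(u, f) \<in> laplace_op" "(u, g) \<in> laplace_op"
  then obtain v w where v: "v \<in> C2b_on open_simplex" "ae_eq ?M u v" "ae_eq ?M f (neg_laplace v)"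
    and w: "w \<in> C2b_on open_simplex" "ae_eq ?M u w" "ae_eq ?M g (neg_laplace w)" by (auto simp: l2_op_def)
  note Cv = C2b_onD(1)[OF v(1)] and Cw = C2b_onD(1)[OF w(1)]
  have eq: "v x = w x" if "x \<in> open_simplex" for x
    using ae_eq_continuous[OF C_on_1D(2)[OF Cv] C_on_1D(2)[OF Cw] ae_eq_trans[OF ae_eq_sym[OF v(2)] w(2)] that] by simp
  have pd: "partial_deriv j v x = partial_deriv j w x" if "x \<in> open_simplex" for j x
    by (rule partial_deriv_cong_open[OF open_open_simplex that eq])
  have "partial_deriv i (partial_deriv j v) x = partial_deriv i (partial_deriv j w) x" if "x \<in> open_simplex" for i j x
    by (rule partial_deriv_cong_open[OF open_open_simplex that pd])
  then have "neg_laplace v x = neg_laplace w x" if "x \<in> open_simplex" for x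
    using that by (simp add: laplace_beltrami_eq_lap[OF Cv] laplace_beltrami_eq_lap[OF Cw] lap_def pd)
  then have "ae_eq ?M (neg_laplace v) (neg_laplace w)" by (rule ae_eqI)
  then show "ae_eq ?M f g" using v(3) w(3) ae_eq_trans ae_eq_sym by blast
qed

text \<open>Both \<open>epoly\<close> and \<open>psi\<close> represent the same basis. The first has the regularity required for the
  operator; the second one is used for the eigenspaces, whose description refers to the functions
  \<open>psi\<close> themselves.\<close>

interpretation epoly: l2_basis "simplex_volume :: (real^('n::{finite,linorder})) measure" epoly mdegree
proof
  show "epoly \<alpha> \<in> L2 simplex_volume" for \<alpha> :: "'n \<Rightarrow> nat" by (intro polyfun_L2 polyfun_epoly)
  show "l2_inner simplex_volume (epoly \<alpha>) (epoly \<beta>) = (if \<alpha> = \<beta> then 1 else 0)" for \<alpha> \<beta> :: "'n \<Rightarrow> nat"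
    by (rule epoly_orthonormal)
  show "finite {\<alpha> :: 'n \<Rightarrow> nat. mdegree \<alpha> = s}" for s
    by (rule finite_subset[OF _ finite_mdegree[of "Suc s"]]) auto
  show "ae_eq simplex_volume u (\<lambda>x. 0)" if "u \<in> L2 simplex_volume" "\<And>i. l2_inner simplex_volume u (epoly i) = 0"
    for u :: "real^('n::{finite,linorder}) \<Rightarrow> complex"
    using that by (rule epoly_complete)
qed

lemma l2_inner_psi: "l2_inner simplex_volume u (\<lambda>x. complex_of_real (psi \<alpha> x)) = l2_inner simplex_volume u (epoly \<alpha>)"
  unfolding l2_inner_def by (rule Bochner_Integration.integral_cong) (simp_all add: epoly_eq_psi)

lemma psi_L2: "(\<lambda>x. complex_of_real (psi \<alpha> x)) \<in> L2 simplex_volume"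
proof (rule L2_ae_cong[OF epoly.e_L2])
  have "psi \<alpha> \<in> borel_measurable borel"
    unfolding psi_def[abs_def] using psi_tilde_measurable[of \<alpha>] by measurable
  then show "(\<lambda>x. complex_of_real (psi \<alpha> x)) \<in> borel_measurable simplex_volume"
    by (intro borel_measurable_simplex_volumeI) measurable
  show "ae_eq simplex_volume (epoly \<alpha>) (\<lambda>x. complex_of_real (psi \<alpha> x))"
    by (rule ae_eqI) (rule epoly_eq_psi)
qed

interpretation psi: l2_basis "simplex_volume :: (real^('n::{finite,linorder})) measure" "\<lambda>\<alpha> x. complex_of_real (psi \<alpha> x)" mdegree
proof
  let ?M = "simplex_volume :: (real^('n::{finite,linorder})) measure"
  show "(\<lambda>x. complex_of_real (psi \<alpha> x)) \<in> L2 ?M" for \<alpha> :: "'n \<Rightarrow> nat" by (rule psi_L2)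
  show "l2_inner ?M (\<lambda>x. complex_of_real (psi \<alpha> x)) (\<lambda>x. complex_of_real (psi \<beta> x)) = (if \<alpha> = \<beta> then 1 else 0)" for \<alpha> \<beta> :: "'n \<Rightarrow> nat"
    unfolding l2_inner_psi l2_inner_commute[of ?M _ "epoly \<beta>"] by (simp add: epoly_orthonormal)
  show "finite {\<alpha> :: 'n \<Rightarrow> nat. mdegree \<alpha> = s}" for s by (rule epoly.finite_level)
  show "ae_eq ?M u (\<lambda>x. 0)" if "u \<in> L2 ?M" "\<And>i. l2_inner ?M u (\<lambda>x. complex_of_real (psi i x)) = 0"
    for u :: "real^('n::{finite,linorder}) \<Rightarrow> complex"
    using that(1) by (rule epoly_complete) (use that(2) in \<open>simp add: l2_inner_psi\<close>)
qed

lemma psi_coef_eq: "psi.coef u \<alpha> = epoly.coef u \<alpha>"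
  unfolding psi.coef_def epoly.coef_def by (rule l2_inner_psi)

lemma psi_diag_eq: "psi.diag l = epoly.diag l"
  unfolding psi.diag_def epoly.diag_def psi_coef_eq ..

lemma psi_coeff_eq_coef: "psi_coeff u \<alpha> = epoly.coef u \<alpha>"
proof -
  have s: "open_simplex \<inter> space simplex_measure \<in> sets (simplex_measure :: (real^('n::{finite,linorder})) measure)"
    by (simp add: simplex_measure_def)
  have "psi_coeff u \<alpha> = (\<integral>x. u x * complex_of_real (psi \<alpha> x) \<partial>simplex_volume)"
    unfolding psi_coeff_def set_lebesgue_integral_def restrict_simplex_measure[symmetric]
    by (rule integral_restrict_space[OF s, symmetric])
  also have "\<dots> = l2_inner simplex_volume u (\<lambda>x. complex_of_real (psi \<alpha> x))" by (simp add: l2_inner_def)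
  finally show ?thesis by (simp add: l2_inner_psi epoly.coef_def)
qed

lemma energy_psi_coeff: "(\<Sum>\<alpha>\<in>degree_set s. (cmod (psi_coeff u \<alpha>))\<^sup>2) = epoly.energy (epoly.coef u) s"
  unfolding epoly.energy_def degree_set_def mdegree_def psi_coeff_eq_coef ..

text \<open>The coefficients of both sides agree by \<open>l2_inner_lap_epoly\<close>, and by completeness the functions
  do.\<close>

lemma laplace_epoly: "(epoly \<alpha>, \<lambda>x. of_real (lambda CARD('n) (mdegree \<alpha>)) * epoly \<alpha> x) \<in> laplace_op"
  for \<alpha> :: "'n::{finite,linorder} \<Rightarrow> nat"
proof (rule is_l2_opD(3)[OF is_l2_op_laplace laplace_opI[OF polyfun_C2b[OF polyfun_epoly]]])
  let ?l = "complex_of_real (lambda CARD('n) (mdegree \<alpha>))"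
  note L = C2b_laplace_L2(3)[OF polyfun_C2b[OF polyfun_epoly[of \<alpha>]]]
  show c: "(\<lambda>x. ?l * epoly \<alpha> x) \<in> L2 simplex_volume" by (intro L2_cmult epoly.e_L2)
  show "ae_eq simplex_volume (neg_laplace (epoly \<alpha>)) (\<lambda>x. ?l * epoly \<alpha> x)"
  proof (rule epoly.eq_if_coef_eq[OF L c])
    show "epoly.coef (neg_laplace (epoly \<alpha>)) \<beta> = epoly.coef (\<lambda>x. ?l * epoly \<alpha> x) \<beta>" for \<beta>
      unfolding epoly.coef_cmult epoly.coef_basis unfolding epoly.coef_def l2_inner_lap_epoly by auto
  qed
qed (auto intro: epoly.e_L2 ae_eq_refl)

text \<open>By symmetry, a coefficient of the image is the inner product with the image of a basis vector,
  which is an eigenvector.\<close>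

lemma laplace_sub_diag: "(laplace_op :: (real^('n::{finite,linorder})) graph) \<subseteq> epoly.diag (lambda CARD('n))"
proof clarify
  let ?M = "simplex_volume :: (real^('n::{finite,linorder})) measure"
  fix u f assume "(u, f) \<in> (laplace_op :: (real^('n::{finite,linorder})) graph)"
  then obtain v where L: "u \<in> L2 ?M" "f \<in> L2 ?M" and v: "v \<in> C2b_on open_simplex" "ae_eq ?M u v" "ae_eq ?M f (neg_laplace v)"
    by (auto simp: l2_op_def)
  have "epoly.coef f \<alpha> = of_real (lambda CARD('n) (mdegree \<alpha>)) * epoly.coef u \<alpha>" for \<alpha>
  proof -
    let ?l = "complex_of_real (lambda CARD('n) (mdegree \<alpha>))"
    have ae: "ae_eq ?M (neg_laplace (epoly \<alpha>)) (\<lambda>x. ?l * epoly \<alpha> x)"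
      by (rule is_l2_opD(7)[OF is_l2_op_laplace laplace_opI[OF polyfun_C2b[OF polyfun_epoly]] laplace_epoly])
    have "epoly.coef f \<alpha> = l2_inner ?M (neg_laplace v) (epoly \<alpha>)"
      using epoly.coef_cong[OF L(2) C2b_laplace_L2(3)[OF v(1)] v(3), of \<alpha>] by (simp only: epoly.coef_def)
    also have "\<dots> = l2_inner ?M v (neg_laplace (epoly \<alpha>))"
      by (rule laplace_beltrami_symmetric[OF v(1) polyfun_C2b[OF polyfun_epoly]])
    also have "\<dots> = l2_inner ?M v (\<lambda>x. ?l * epoly \<alpha> x)"
      by (intro l2_inner_cong_ae C2b_laplace_L2 v polyfun_C2b polyfun_epoly L2_cmult epoly.e_L2 ae_eq_refl ae)
    also have "\<dots> = ?l * epoly.coef v \<alpha>" by (simp add: l2_inner_cmult_right epoly.coef_def)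
    also have "epoly.coef v \<alpha> = epoly.coef u \<alpha>"
      by (rule epoly.coef_cong[OF L(1) C2b_laplace_L2(2)[OF v(1)] v(2), symmetric])
    finally show ?thesis .
  qed
  then show "(u, f) \<in> epoly.diag (lambda CARD('n))" by (simp add: epoly.diag_def L)
qed

lemma lambda_nonneg_inj_at_top:
  assumes "n \<ge> 1"
  shows "0 \<le> lambda n s" "inj (lambda n)" "filterlim (lambda n) at_top sequentially"
proof -
  have n: "0 \<le> (real n - 1) / 2" using assms by simp
  then show nn: "0 \<le> lambda n s" for s by (simp add: lambda_def)
  have "lambda n s < lambda n t" if "s < t" for s t
    unfolding lambda_def using that n by (intro mult_strict_mono') auto
  then have "strict_mono (lambda n)" by (rule strict_monoI)
  then show "inj (lambda n)" by (rule strict_mono_imp_inj_on)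
  have "real s \<le> lambda n s" for s
  proof (cases s)
    case (Suc k)
    then have "real s * 1 \<le> real s * (real s + (real n - 1) / 2)" using n by (intro mult_left_mono) auto
    then show ?thesis by (simp add: lambda_def)
  qed (simp add: lambda_def)
  then show "filterlim (lambda n) at_top sequentially"
    by (intro filterlim_at_top_mono[OF filterlim_real_sequentially]) simp
qed

lemma surj_mdegree: "surj (mdegree :: ('n::finite \<Rightarrow> nat) \<Rightarrow> nat)"
proof (rule surjI)
  fix s
  show "mdegree (\<lambda>i::'n. if i = undefined then s else 0) = s" by (simp add: mdegree_def)
qed

lemma card_ge_1: "CARD('n::finite) \<ge> 1"
  by (simp add: Suc_leI)

section \<open>The Dirichlet energy and the Sobolev space\<close>

definition dirichlet :: "(real^'n::finite \<Rightarrow> complex) \<Rightarrow> real" where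
  "dirichlet u = (\<integral>x. Re (gform x (pgrad u x) (pgrad u x)) \<partial>simplex_volume)"

lemma sobolev_norm_eq: "sobolev_norm baran_metric open_simplex u = l2_norm simplex_volume u + sqrt (dirichlet u)"
proof -
  have "dirichlet u = (\<integral>x. (metric_norm (baran_metric x) (grad baran_metric u x))\<^sup>2 \<partial>simplex_volume)"
    unfolding dirichlet_def by (rule Bochner_Integration.integral_cong) (simp_all add: metric_norm_grad)
  then show ?thesis by (simp add: sobolev_norm_def)
qed

lemma smooth_12_iff:
  "u \<in> smooth_12 baran_metric open_simplex \<longleftrightarrow> u \<in> smooth_on open_simplex \<and> u \<in> L2 simplex_volume
     \<and> integrable simplex_volume (\<lambda>x. Re (gform x (pgrad u x) (pgrad u x)))"
proof -
  have "integrable simplex_volume (\<lambda>x. (metric_norm (baran_metric x) (grad baran_metric u x))\<^sup>2) \<longleftrightarrow>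
     integrable simplex_volume (\<lambda>x. Re (gform x (pgrad u x) (pgrad u x)))"
    by (rule Bochner_Integration.integrable_cong) (simp_all add: metric_norm_grad)
  then show ?thesis by (simp add: smooth_12_def)
qed

lemma polyfun_psum: "polyfun (epoly.psum c K)"
  unfolding epoly.psum_def by (intro polyfun_sum polyfun_mult polyfun_const polyfun_epoly)

lemma neg_laplace_psum:
  fixes c :: "('n::{finite,linorder} \<Rightarrow> nat) \<Rightarrow> complex"
  shows "ae_eq simplex_volume (neg_laplace (epoly.psum c K)) (epoly.psum (\<lambda>\<alpha>. of_real (lambda CARD('n) (mdegree \<alpha>)) * c \<alpha>) K)"
  by (rule is_l2_opD(7)[OF is_l2_op_laplace laplace_opI[OF polyfun_C2b[OF polyfun_psum]]
        epoly.psum_in_op[OF is_l2_op_laplace laplace_epoly]])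

text \<open>Green's formula with the Laplacian on the polynomial factor: the operator acts on the
  coefficients of \<open>psum c K\<close>, and the pairing with \<open>v\<close> sees only the coefficients of \<open>v\<close> up to
  degree \<open>K\<close>. In this form the formula applies to smooth functions of finite energy, whose Laplacian
  may fail to be square-integrable.\<close>

lemma psum_energy_pairing:
  fixes c :: "('n::{finite,linorder} \<Rightarrow> nat) \<Rightarrow> complex" and v :: "real^('n::{finite,linorder}) \<Rightarrow> complex"
  assumes v: "v \<in> C_on k open_simplex" "k \<ge> 1" "v \<in> L2 simplex_volume"
    "integrable simplex_volume (\<lambda>x. Re (gform x (pgrad v x) (pgrad v x)))"
    and cv: "\<And>\<alpha>. mdegree \<alpha> \<le> K \<Longrightarrow> epoly.coef v \<alpha> = c \<alpha>"
  shows "integrable simplex_volume (\<lambda>x. gform x (pgrad (epoly.psum c K) x) (pgrad v x))"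
    "(\<integral>x. gform x (pgrad (epoly.psum c K) x) (pgrad v x) \<partial>simplex_volume)
      = of_real (\<Sum>s\<le>K. lambda CARD('n) s * epoly.energy c s)"
proof -
  let ?q = "epoly.psum c K"
  note q = polyfun_C2b[OF polyfun_psum, of c K]
  show "integrable simplex_volume (\<lambda>x. gform x (pgrad ?q x) (pgrad v x))" by (rule Green(1)[OF q v])
  have "(\<integral>x. gform x (pgrad ?q x) (pgrad v x) \<partial>simplex_volume) = l2_inner simplex_volume (neg_laplace ?q) v"
    by (rule Green(2)[OF q v, symmetric])
  also have "\<dots> = l2_inner simplex_volume (epoly.psum (\<lambda>\<alpha>. of_real (lambda CARD('n) (mdegree \<alpha>)) * c \<alpha>) K) v"
    by (intro l2_inner_cong_ae C2b_laplace_L2 q v epoly.psum_L2 neg_laplace_psum ae_eq_refl)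
  also have "\<dots> = (\<Sum>\<alpha>\<in>{\<alpha>. mdegree \<alpha> \<le> K}. of_real (lambda CARD('n) (mdegree \<alpha>)) * c \<alpha> * cnj (epoly.coef v \<alpha>))"
    by (rule epoly.inner_psum_left[OF v(3)])
  also have "\<dots> = (\<Sum>\<alpha>\<in>{\<alpha>. mdegree \<alpha> \<le> K}. of_real (lambda CARD('n) (mdegree \<alpha>) * (cmod (c \<alpha>))\<^sup>2))"
    by (rule sum.cong) (auto simp: cv complex_norm_square mult.assoc simp del: of_real_power)
  also have "\<dots> = of_real (\<Sum>\<alpha>\<in>{\<alpha>. mdegree \<alpha> \<le> K}. lambda CARD('n) (mdegree \<alpha>) * (cmod (c \<alpha>))\<^sup>2)" by simp
  also have "(\<Sum>\<alpha>\<in>{\<alpha>. mdegree \<alpha> \<le> K}. lambda CARD('n) (mdegree \<alpha>) * (cmod (c \<alpha>))\<^sup>2) = (\<Sum>s\<le>K. lambda CARD('n) s * epoly.energy c s)"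
    unfolding epoly.sum_levels epoly.energy_def sum_distrib_left by (intro sum.cong refl) auto
  finally show "(\<integral>x. gform x (pgrad ?q x) (pgrad v x) \<partial>simplex_volume) = of_real (\<Sum>s\<le>K. lambda CARD('n) s * epoly.energy c s)" .
qed

lemma dirichlet_psum:
  fixes c :: "('n::{finite,linorder} \<Rightarrow> nat) \<Rightarrow> complex"
  shows "dirichlet (epoly.psum c K) = (\<Sum>s\<le>K. lambda CARD('n) s * epoly.energy c s)"
proof -
  let ?q = "epoly.psum c K"
  note q = polyfun_C2b[OF polyfun_psum, of c K]
  note p = psum_energy_pairing[OF C2b_onD(1)[OF q] _ epoly.psum_L2 C2b_energy_integrable[OF q], of K c]
  have c: "\<And>\<alpha>. mdegree \<alpha> \<le> K \<Longrightarrow> epoly.coef ?q \<alpha> = c \<alpha>" by (simp add: epoly.coef_psum)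
  have "dirichlet ?q = Re (\<integral>x. gform x (pgrad ?q x) (pgrad ?q x) \<partial>simplex_volume)"
    unfolding dirichlet_def using p(1)[OF _ c] by (intro integral_Re) simp
  then show ?thesis using p(2)[OF _ c] by simp
qed

text \<open>Expand the energy of \<open>v\<close> minus its partial sum, which is nonnegative. The mixed terms and the
  energy of the partial sum have the same value by \<open>psum_energy_pairing\<close>.\<close>

lemma dirichlet_Bessel:
  fixes v :: "real^('n::{finite,linorder}) \<Rightarrow> complex"
  assumes v: "v \<in> C_on k open_simplex" "k \<ge> 1" "v \<in> L2 simplex_volume"
    "integrable simplex_volume (\<lambda>x. Re (gform x (pgrad v x) (pgrad v x)))"
  shows "(\<Sum>s\<le>K. lambda CARD('n) s * epoly.energy (epoly.coef v) s) \<le> dirichlet v"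
proof -
  let ?M = "simplex_volume :: (real^('n::{finite,linorder})) measure"
  let ?q = "epoly.psum (epoly.coef v) K" and ?S = "\<Sum>s\<le>K. lambda CARD('n) s * epoly.energy (epoly.coef v) s"
  note p = psum_energy_pairing[OF v refl]
  note q = polyfun_C2b[OF polyfun_psum, of "epoly.coef v" K]
  note iq = C2b_energy_integrable[OF q]
  have e: "Re (gform x (\<lambda>i. pgrad v x i - pgrad ?q x i) (\<lambda>i. pgrad v x i - pgrad ?q x i))
      = Re (gform x (pgrad v x) (pgrad v x)) - 2 * Re (gform x (pgrad ?q x) (pgrad v x)) + Re (gform x (pgrad ?q x) (pgrad ?q x))" for x
    by (simp add: gform_diff_left gform_diff_right gform_commute[of x "pgrad v x" "pgrad ?q x"])
  have "0 \<le> (\<integral>x. Re (gform x (pgrad v x) (pgrad v x)) - 2 * Re (gform x (pgrad ?q x) (pgrad v x)) + Re (gform x (pgrad ?q x) (pgrad ?q x)) \<partial>?M)"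
    unfolding e[symmetric] by (rule integral_nonneg_AE, rule AE_I2) (simp add: gform_self(2))
  also have "\<dots> = dirichlet v - 2 * (\<integral>x. Re (gform x (pgrad ?q x) (pgrad v x)) \<partial>?M) + dirichlet ?q"
    using v(4) iq integrable_Re[OF p(1)[of K]] by (simp add: dirichlet_def)
  also have "(\<integral>x. Re (gform x (pgrad ?q x) (pgrad v x)) \<partial>?M) = ?S"
    using integral_Re[OF p(1)[of K]] p(2)[of K] by simp
  also have "dirichlet ?q = ?S" by (rule dirichlet_psum)
  finally show ?thesis by simp
qed

lemma C_on_1_diff:
  fixes u v :: "real^'n::finite \<Rightarrow> complex"
  assumes u: "u \<in> C_on 1 open_simplex" and v: "v \<in> C_on 1 open_simplex"
  shows "(\<lambda>x. u x - v x) \<in> C_on 1 open_simplex"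
    "x \<in> open_simplex \<Longrightarrow> partial_deriv i (\<lambda>x. u x - v x) x = partial_deriv i u x - partial_deriv i v x"
proof -
  have pd: "partial_deriv i (\<lambda>x. u x - v x) x = partial_deriv i u x - partial_deriv i v x" if x: "x \<in> open_simplex" for i x
    using C_on_1D(1)[OF u _ x] C_on_1D(1)[OF v _ x]
    by (subst partial_derivI[OF has_derivative_diff[OF differentiable_has_derivative differentiable_has_derivative]])
       (simp_all add: partial_deriv_def)
  then show "x \<in> open_simplex \<Longrightarrow> partial_deriv i (\<lambda>x. u x - v x) x = partial_deriv i u x - partial_deriv i v x" .
  have c: "continuous_on open_simplex (\<lambda>x. u x - v x)"
    by (intro continuous_on_diff C_on_1D(2)[OF u] C_on_1D(2)[OF v]) auto
  have "continuous_on open_simplex (\<lambda>x. partial_deriv i u x - partial_deriv i v x)" for i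
    by (intro continuous_on_diff C_on_1D(3)[OF u] C_on_1D(3)[OF v]) auto
  then have cp: "continuous_on open_simplex (partial_deriv i (\<lambda>x. u x - v x))" for i
    by (rule continuous_on_eq) (simp add: pd)
  have d: "(\<lambda>x. u x - v x) differentiable (at x)" if x: "x \<in> open_simplex" for x
    by (intro differentiable_diff C_on_1D(1)[OF u _ x] C_on_1D(1)[OF v _ x]) auto
  have l: "is = [] \<or> (\<exists>j. is = [j])" if "length is \<le> 1" for "is" :: "'n list"
    using that by (cases "is") auto
  show "(\<lambda>x. u x - v x) \<in> C_on 1 open_simplex"
    unfolding C_on_def
  proof (intro CollectI conjI allI impI ballI)
    fix "is" :: "'n list" and x :: "real^'n" assume "length is < 1" "x \<in> open_simplex"
    then show "partial_derivs is (\<lambda>x. u x - v x) differentiable (at x)"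
      using d[of x] by (simp add: partial_derivs_def)
  next
    fix "is" :: "'n list" assume "length is \<le> 1"
    from l[OF this] show "continuous_on open_simplex (partial_derivs is (\<lambda>x. u x - v x))"
      using c cp by (auto simp: partial_derivs_def)
  qed
qed

text \<open>From an index \<open>N\<close> on, the energy of \<open>w k - w N\<close> is at most one. The Bessel inequality bounds the
  finite sums of its weighted coefficients by one, and these converge as \<open>k\<close> tends to infinity. So
  \<open>u - w N\<close> has a finite weighted sum, and so has \<open>w N\<close>.\<close>

lemma sobolev_H1_subset:
  fixes u :: "real^('n::{finite,linorder}) \<Rightarrow> complex"
  assumes "u \<in> sobolev_H1 baran_metric open_simplex"
  shows "u \<in> L2 simplex_volume" "summable (\<lambda>s. lambda CARD('n) s * epoly.energy (epoly.coef u) s)"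
proof -
  let ?M = "simplex_volume :: (real^('n::{finite,linorder})) measure" and ?l = "lambda CARD('n)"
  have lnn: "0 \<le> ?l s" for s by (rule lambda_nonneg_inj_at_top(1)[OF card_ge_1])
  obtain w where uL: "u \<in> L2 ?M" and w: "\<And>k::nat. w k \<in> smooth_12 baran_metric open_simplex"
    and cau: "\<forall>e>0. \<exists>N. \<forall>k\<ge>N. \<forall>l\<ge>N. sobolev_norm baran_metric open_simplex (\<lambda>x. w k x - w l x) < e"
    and lim: "(\<lambda>k. l2_norm ?M (\<lambda>x. w k x - u x)) \<longlonglongrightarrow> 0"
    using assms unfolding sobolev_H1_def by blast
  show "u \<in> L2 ?M" by (rule uL)
  have w1: "w k \<in> C_on 1 open_simplex" and wL: "w k \<in> L2 ?M"
    and wE: "integrable ?M (\<lambda>x. Re (gform x (pgrad (w k) x) (pgrad (w k) x)))" for k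
    using w[of k] by (auto simp: smooth_12_iff smooth_on_def)
  obtain N where N: "\<And>k. k \<ge> N \<Longrightarrow> sobolev_norm baran_metric open_simplex (\<lambda>x. w k x - w N x) < 1"
    using cau[rule_format, of 1] by auto
  let ?v = "\<lambda>k x. w k x - w N x"
  have v1: "?v k \<in> C_on 1 open_simplex" and dv: "x \<in> open_simplex \<Longrightarrow> pgrad (?v k) x = (\<lambda>i. pgrad (w k) x i - pgrad (w N) x i)" for k x
    using C_on_1_diff[OF w1 w1] by (auto simp: fun_eq_iff)
  have vL: "?v k \<in> L2 ?M" for k by (intro L2_diff wL)
  have vE: "integrable ?M (\<lambda>x. Re (gform x (pgrad (?v k) x) (pgrad (?v k) x)))" for k
  proof (rule Bochner_Integration.integrable_bound)
    show "integrable ?M (\<lambda>x. 2 * Re (gform x (pgrad (w k) x) (pgrad (w k) x)) + 2 * Re (gform x (pgrad (w N) x) (pgrad (w N) x)))"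
      by (intro Bochner_Integration.integrable_add integrable_mult_right wE)
    show "(\<lambda>x. Re (gform x (pgrad (?v k) x) (pgrad (?v k) x))) \<in> borel_measurable ?M"
      using gform_measurable[OF v1[of k] v1[of k] order_refl] by simp
    show "AE x in ?M. norm (Re (gform x (pgrad (?v k) x) (pgrad (?v k) x)))
        \<le> norm (2 * Re (gform x (pgrad (w k) x) (pgrad (w k) x)) + 2 * Re (gform x (pgrad (w N) x) (pgrad (w N) x)))"
    proof (rule AE_I2)
      fix x :: "real^('n::{finite,linorder})" assume "x \<in> space ?M"
      then have x: "x \<in> open_simplex" by simp
      have "Re (gform x (pgrad (?v k) x) (pgrad (?v k) x))
          \<le> 2 * Re (gform x (pgrad (w k) x) (pgrad (w k) x)) + 2 * Re (gform x (pgrad (w N) x) (pgrad (w N) x))"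
        unfolding dv[OF x] by (rule gform_diff_bound[OF x])
      then show "norm (Re (gform x (pgrad (?v k) x) (pgrad (?v k) x)))
          \<le> norm (2 * Re (gform x (pgrad (w k) x) (pgrad (w k) x)) + 2 * Re (gform x (pgrad (w N) x) (pgrad (w N) x)))"
        unfolding real_norm_def using gform_self(2)[OF x, of "pgrad (?v k) x"] by linarith
    qed
  qed
  have le1: "(\<Sum>s\<le>K. ?l s * epoly.energy (epoly.coef (?v k)) s) \<le> 1" if k: "k \<ge> N" for k K
  proof -
    have "sqrt (dirichlet (?v k)) < 1"
      using N[OF k] l2_norm_nonneg[of ?M "?v k"] unfolding sobolev_norm_eq by linarith
    then have "dirichlet (?v k) \<le> 1" by simp
    then show ?thesis using dirichlet_Bessel[OF v1 order_refl vL vE, of k K] by linarith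
  qed
  define d where "d \<alpha> = epoly.coef u \<alpha> - epoly.coef (w N) \<alpha>" for \<alpha>
  have lim_coef: "(\<lambda>k. epoly.coef (?v k) \<alpha>) \<longlonglongrightarrow> d \<alpha>" for \<alpha>
  proof -
    have "(\<lambda>k. epoly.coef (w k) \<alpha>) \<longlonglongrightarrow> epoly.coef u \<alpha>"
      unfolding epoly.coef_def by (rule tendsto_l2_inner_left[OF wL uL epoly.e_L2 lim])
    then show ?thesis unfolding d_def epoly.coef_diff[OF wL wL] by (intro tendsto_diff tendsto_const)
  qed
  have d1: "(\<Sum>s\<le>K. ?l s * epoly.energy d s) \<le> 1" for K
  proof (rule LIMSEQ_le_const2)
    show "(\<lambda>k. \<Sum>s\<le>K. ?l s * epoly.energy (epoly.coef (?v k)) s) \<longlonglongrightarrow> (\<Sum>s\<le>K. ?l s * epoly.energy d s)"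
      unfolding epoly.energy_def by (intro tendsto_sum tendsto_mult tendsto_const tendsto_power tendsto_norm lim_coef)
    show "\<exists>N. \<forall>k\<ge>N. (\<Sum>s\<le>K. ?l s * epoly.energy (epoly.coef (?v k)) s) \<le> 1"
      using le1 by blast
  qed
  have en: "epoly.energy (epoly.coef u) s \<le> 2 * epoly.energy d s + 2 * epoly.energy (epoly.coef (w N)) s" for s
  proof -
    have "(cmod (epoly.coef u \<alpha>))\<^sup>2 \<le> 2 * (cmod (d \<alpha>))\<^sup>2 + 2 * (cmod (epoly.coef (w N) \<alpha>))\<^sup>2" for \<alpha>
      using cmod_add_square_le[of "d \<alpha>" "epoly.coef (w N) \<alpha>"] by (simp add: d_def)
    then show ?thesis unfolding epoly.energy_def sum_distrib_left sum.distrib[symmetric] by (intro sum_mono)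
  qed
  show "summable (\<lambda>s. ?l s * epoly.energy (epoly.coef u) s)"
  proof (rule summableI_nonneg_bounded)
    show "0 \<le> ?l s * epoly.energy (epoly.coef u) s" for s by (intro mult_nonneg_nonneg lnn epoly.energy_nonneg)
    fix K
    have "(\<Sum>s<K. ?l s * epoly.energy (epoly.coef u) s) \<le> (\<Sum>s\<le>K. ?l s * epoly.energy (epoly.coef u) s)"
      by (intro sum_mono2 mult_nonneg_nonneg lnn epoly.energy_nonneg) auto
    also have "\<dots> \<le> (\<Sum>s\<le>K. ?l s * (2 * epoly.energy d s + 2 * epoly.energy (epoly.coef (w N)) s))"
      by (intro sum_mono mult_left_mono en lnn)
    also have "\<dots> = 2 * (\<Sum>s\<le>K. ?l s * epoly.energy d s) + 2 * (\<Sum>s\<le>K. ?l s * epoly.energy (epoly.coef (w N)) s)"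
      by (simp add: distrib_left sum.distrib sum_distrib_left mult.left_commute)
    also have "\<dots> \<le> 2 * 1 + 2 * dirichlet (w N)"
      by (intro add_mono mult_left_mono d1 dirichlet_Bessel[OF w1 order_refl wL wE]) auto
    finally show "(\<Sum>s<K. ?l s * epoly.energy (epoly.coef u) s) \<le> 2 * 1 + 2 * dirichlet (w N)" .
  qed
qed

text \<open>The partial sums of the expansion are polynomials. Their differences have as energy the
  differences of the partial sums of the given series, so they form a Cauchy sequence.\<close>

lemma sobolev_H1_superset:
  fixes u :: "real^('n::{finite,linorder}) \<Rightarrow> complex"
  assumes u: "u \<in> L2 simplex_volume" and s: "summable (\<lambda>s. lambda CARD('n) s * epoly.energy (epoly.coef u) s)"
  shows "u \<in> sobolev_H1 baran_metric open_simplex"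
proof -
  let ?M = "simplex_volume :: (real^('n::{finite,linorder})) measure" and ?l = "lambda CARD('n)"
  let ?c = "epoly.coef u"
  have lnn: "0 \<le> ?l s" for s by (rule lambda_nonneg_inj_at_top(1)[OF card_ge_1])
  define w where "w = epoly.psum ?c"
  have "w k \<in> smooth_12 baran_metric open_simplex" for k
    unfolding smooth_12_iff w_def smooth_on_def
    by (intro conjI INT_I polyfun_C_on polyfun_psum epoly.psum_L2 C2b_energy_integrable polyfun_C2b)
  moreover have "\<exists>N. \<forall>k\<ge>N. \<forall>l\<ge>N. sobolev_norm baran_metric open_simplex (\<lambda>x. w k x - w l x) < \<epsilon>" if \<epsilon>: "\<epsilon> > 0" for \<epsilon> :: real
  proof -
    let ?A = "\<lambda>k. \<Sum>s\<le>k. epoly.energy ?c s" and ?B = "\<lambda>k. \<Sum>s\<le>k. ?l s * epoly.energy ?c s"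
    have "Cauchy ?A" "Cauchy ?B"
      using epoly.summable_energy_coef[OF u] s by (auto intro!: convergent_Cauchy simp: summable_iff_convergent')
    moreover have e2: "(\<epsilon> / 2)\<^sup>2 > 0" using \<epsilon> by simp
    ultimately obtain N1 N2 where N1: "\<forall>k\<ge>N1. \<forall>l\<ge>N1. norm (?A k - ?A l) < (\<epsilon> / 2)\<^sup>2"
      and N2: "\<forall>k\<ge>N2. \<forall>l\<ge>N2. norm (?B k - ?B l) < (\<epsilon> / 2)\<^sup>2"
      using CauchyD[OF \<open>Cauchy ?A\<close> e2] CauchyD[OF \<open>Cauchy ?B\<close> e2] by blast
    have "sobolev_norm baran_metric open_simplex (\<lambda>x. w k x - w l x) < \<epsilon>" if kl: "k \<ge> max N1 N2" "l \<ge> max N1 N2" for k l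
    proof -
      have "(l2_norm ?M (\<lambda>x. w k x - w l x))\<^sup>2 < (\<epsilon> / 2)\<^sup>2"
        unfolding w_def epoly.norm_psum_diff using N1 kl by simp
      then have 1: "l2_norm ?M (\<lambda>x. w k x - w l x) < \<epsilon> / 2"
        by (rule power2_less_imp_less) (use \<epsilon> in simp)
      have "dirichlet (\<lambda>x. w k x - w l x) = \<bar>?B k - ?B l\<bar>"
        unfolding w_def epoly.psum_diff dirichlet_psum by (rule epoly.sum_energy_window) (rule lnn)
      then have "dirichlet (\<lambda>x. w k x - w l x) < (\<epsilon> / 2)\<^sup>2" using N2 kl by simp
      then have 2: "sqrt (dirichlet (\<lambda>x. w k x - w l x)) < \<epsilon> / 2"
        using \<epsilon> by (intro real_less_lsqrt) auto
      show ?thesis unfolding sobolev_norm_eq using 1 2 by linarith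
    qed
    then show ?thesis by blast
  qed
  moreover have "(\<lambda>k. l2_norm ?M (\<lambda>x. w k x - u x)) \<longlonglongrightarrow> 0"
    unfolding w_def by (rule epoly.expansion[OF u])
  ultimately show ?thesis unfolding sobolev_H1_def using u by blast
qed

lemma sobolev_H1_eq:
  "sobolev_H1 baran_metric (open_simplex :: (real^('n::{finite,linorder})) set)
    = {u \<in> L2 simplex_volume. summable (\<lambda>s. lambda CARD('n) s * epoly.energy (epoly.coef u) s)}"
  using sobolev_H1_subset sobolev_H1_superset by blast

theorem theorem2:
  shows "let
      S = (open_simplex :: (real^'n::{finite,linorder}) set);
      G = baran_metric;
      \<mu> = simplex_measure;
      M = riemannian_volume G S;
      L = (\<lambda>u x. - laplace_beltrami G u x);
      A = l2_op M (C2b_on S) L;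
      lam = lambda CARD('n);
      \<sigma> = (\<lambda>s. complex_of_real (lam s)) ` UNIV
    in
      (restrict_space \<mu> S = M
       \<and> (\<forall>\<alpha>. \<exists>p. real_polynomial_function p \<and> (\<forall>x\<in>S. psi \<alpha> x = p x))
       \<and> (\<forall>\<alpha> \<beta>. integrable \<mu> (\<lambda>x. psi \<alpha> x * psi \<beta> x)
            \<and> (\<integral>x. psi \<alpha> x * psi \<beta> x \<partial>\<mu>) = (if \<alpha> = \<beta> then 1 else 0)))
      \<and>
      ((\<forall>u\<in>C2b_on S. u \<in> L2 M \<and> L u \<in> L2 M)
       \<and> symmetric_op M A
       \<and> \<not> bounded_op M A
       \<and> eigenvalues M A = \<sigma>
       \<and> (\<forall>s. eigenspace A (complex_of_real (lam s))
              = l2_span M ((\<lambda>\<alpha> x. complex_of_real (psi \<alpha> x)) ` degree_set s)))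
      \<and>
      (self_adjoint_op M (closure_op M A)
       \<and> spectrum_op M (closure_op M A) = \<sigma>
       \<and> Domain (closure_op M A)
           = {u \<in> L2 M. summable (\<lambda>s. (lam s)\<^sup>2 * (\<Sum>\<alpha>\<in>degree_set s. (cmod (psi_coeff u \<alpha>))\<^sup>2))}
       \<and> Domain (closure_op M A) \<subseteq> sobolev_H1 G S)
      \<and>
      ((\<exists>!B. is_sqrt_op M (closure_op M A) B)
       \<and> Domain (sqrt_op M (closure_op M A))
           = {u \<in> L2 M. summable (\<lambda>s. lam s * (\<Sum>\<alpha>\<in>degree_set s. (cmod (psi_coeff u \<alpha>))\<^sup>2))}
       \<and> Domain (sqrt_op M (closure_op M A)) = sobolev_H1 G S)"
proof -
  let ?S = "open_simplex :: (real^('n::{finite,linorder})) set"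
  let ?M = "simplex_volume :: (real^('n::{finite,linorder})) measure"
  let ?A = "laplace_op :: (real^('n::{finite,linorder})) graph"
  let ?l = "lambda CARD('n)"
  note op = is_l2_op_laplace and sub = laplace_sub_diag and e = laplace_epoly
  note l = lambda_nonneg_inj_at_top[OF card_ge_1[where 'n = 'n]]
  have cl: "closure_op ?M ?A = epoly.diag ?l" by (rule epoly.closure_eq_diag[OF op sub e])
  have root: "is_sqrt_op ?M (closure_op ?M ?A) B \<longleftrightarrow> B = epoly.diag (\<lambda>s. sqrt (?l s))" for B
    unfolding cl by (rule epoly.sqrt_op_diag) (rule l(1))
  have sqrt: "sqrt_op ?M (closure_op ?M ?A) = epoly.diag (\<lambda>s. sqrt (?l s))"
    unfolding sqrt_op_def root by simp
  have dom_sqrt: "Domain (sqrt_op ?M (closure_op ?M ?A)) = {u \<in> L2 ?M. summable (\<lambda>s. ?l s * epoly.energy (epoly.coef u) s)}"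
    unfolding sqrt epoly.Domain_diag using l(1) by simp
  have dom: "Domain (closure_op ?M ?A) = {u \<in> L2 ?M. summable (\<lambda>s. (?l s)\<^sup>2 * epoly.energy (epoly.coef u) s)}"
    unfolding cl epoly.Domain_diag ..
  \<comment> \<open>The square of the root is the operator, so the domain of the root is the larger one.\<close>
  have "Domain (closure_op ?M ?A) \<subseteq> Domain (sqrt_op ?M (closure_op ?M ?A))"
  proof -
    have "sqrt_op ?M (closure_op ?M ?A) O sqrt_op ?M (closure_op ?M ?A) = closure_op ?M ?A"
      using root[of "sqrt_op ?M (closure_op ?M ?A)"] sqrt unfolding is_sqrt_op_def by blast
    then show ?thesis by blast
  qed
  then have sub_H1: "Domain (closure_op ?M ?A) \<subseteq> sobolev_H1 baran_metric ?S"
    unfolding dom_sqrt sobolev_H1_eq .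
  have eig: "eigenspace ?A (complex_of_real (?l s)) = l2_span ?M ((\<lambda>\<alpha> x. complex_of_real (psi \<alpha> x)) ` degree_set s)" for s
  proof -
    have epsi: "(\<lambda>x. complex_of_real (psi \<alpha> x), \<lambda>x. of_real (?l (mdegree \<alpha>)) * complex_of_real (psi \<alpha> x)) \<in> ?A" for \<alpha>
    proof (rule is_l2_opD(3)[OF op e[of \<alpha>]])
      show "ae_eq ?M (epoly \<alpha>) (\<lambda>x. complex_of_real (psi \<alpha> x))" by (rule ae_eqI) (rule epoly_eq_psi)
      then show "ae_eq ?M (\<lambda>x. of_real (?l (mdegree \<alpha>)) * epoly \<alpha> x) (\<lambda>x. of_real (?l (mdegree \<alpha>)) * complex_of_real (psi \<alpha> x))"
        by (rule ae_eq_cmult)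
    qed (intro psi_L2 L2_cmult)+
    have "degree_set s = {\<alpha> :: 'n \<Rightarrow> nat. mdegree \<alpha> = s}" by (simp add: degree_set_def mdegree_def)
    then show ?thesis
      using psi.eigenspace_eq_span[OF op _ epsi l(2), of s] sub by (simp add: psi_diag_eq)
  qed
  have pol: "\<exists>p. real_polynomial_function p \<and> (\<forall>x\<in>?S. psi \<alpha> x = p x)" for \<alpha>
    using polyfun_real_polynomial_function[OF polyfun_mult[OF polyfun_const polyfun_psi_poly]] psi_eq_poly by blast
  have "\<forall>u\<in>C2b_on ?S. u \<in> L2 ?M \<and> neg_laplace u \<in> L2 ?M" using C2b_laplace_L2 by blast
  moreover have "symmetric_op ?M ?A" by (rule epoly.symmetric_op_if[OF op sub e])
  moreover have "\<not> bounded_op ?M ?A" by (rule epoly.unbounded_if[OF e l(3) surj_mdegree])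
  moreover have "eigenvalues ?M ?A = (\<lambda>s. complex_of_real (?l s)) ` UNIV" by (rule epoly.eigenvalues_eq[OF sub e surj_mdegree])
  moreover have "self_adjoint_op ?M (closure_op ?M ?A)" unfolding cl by (rule epoly.self_adjoint_diag)
  moreover have "spectrum_op ?M (closure_op ?M ?A) = (\<lambda>s. complex_of_real (?l s)) ` UNIV"
    unfolding cl by (rule epoly.spectrum_diag[OF l(3) surj_mdegree])
  moreover have "\<exists>!B. is_sqrt_op ?M (closure_op ?M ?A) B" unfolding root by simp
  moreover have "Domain (sqrt_op ?M (closure_op ?M ?A)) = sobolev_H1 baran_metric ?S"
    unfolding dom_sqrt sobolev_H1_eq ..
  ultimately show ?thesis
    unfolding Let_def energy_psi_coeff
    by (intro conjI allI eig pol restrict_simplex_measure psi_orthonormal dom dom_sqrt sub_H1) assumption+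
qed

end
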